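(* Let $n\ge1$, let $\mathfrak g_0\cong\mathfrak{sp}_{2n}$ be the even part of $\mathfrak{osp}(1,2n)$, and let $\mathbf m=(m_1\ge m_2\ge\cdots\ge m_k>m_{k+1}=0)$ be a partition with $|\mathbf m|=m_1+\cdots+m_k$. There is an isomorphism of $\mathbf U(\mathfrak g_0[t])$-modules $$V_{\mathfrak g_0}(m_1\delta_1)*\cdots*V_{\mathfrak g_0}(m_k\delta_1)\;\cong\;W_{\mathfrak g_0}(|\mathbf m|\delta_1)/\mathfrak I(\mathbf m),$$ where $\mathfrak I(\mathbf m)$ is the submodule of $W_{\mathfrak g_0}(|\mathbf m|\delta_1)$ generated by the elements $\mathbf x_\alpha^-(r,s)w_{|\mathbf m|}$ for all $\alpha\in R_0^+$ and all $r,s\in\mathbb N$ such that $$s+r\ge 1+rp+\sum_{j\ge p+1}m_j\,\delta_1(h_\alpha)\quad\text{for some }p\in\mathbb Z_+$$ (with $m_j=0$ for $j>k$).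
   Context: All spaces are over $\mathbb C$; $\mathbb Z_+$ = non-negative integers, $\mathbb N$ = positive integers. $\mathfrak g_0\cong\mathfrak{sp}_{2n}$ has Cartan subalgebra $\mathfrak h_0$ with basis $H'_1,\dots,H'_n$ and dual basis $\delta_1,\dots,\delta_n$; its positive roots are $R_0^+=\{2\delta_p\ (1\le p\le n),\ \delta_i\pm\delta_j\ (1\le i<j\le n)\}$, with coroots $h_{2\delta_p}=H'_p$, $h_{\delta_i\pm\delta_j}=H'_i\pm H'_j$; $x_\alpha^\pm$ ($\alpha\in R_0^+$) are Chevalley generators of the root spaces, $[x_\alpha^+,x_\alpha^-]=h_\alpha$, and $\mathfrak n_0^+=\bigoplus_{\alpha\in R_0^+}\mathbb C x_\alpha^+$. $\mathfrak g_0[t]=\mathfrak g_0\otimes\mathbb C[t]$ is the current algebra, graded by powers of $t$. $V_{\mathfrak g_0}(m\delta_1)$ is the irreducible $\mathfrak g_0$-module of highest weight $m\delta_1$ (of dimension $\binom{m+2n-1}{2n-1}$). Fusion product. Let $V_1,\dots,V_k$ be finite-dimensional cyclic $\mathfrak g_0$-modules with cyclic vectors $v_1,\dots,v_k$ (for irreducible modules, the highest weight vectors), and $z_1,\dots,z_k\in\mathbb C$ pairwise distinct. Let $V_j^{z_j}$ be the $\mathfrak g_0[t]$-module $V_j$ with $(x\otimes f).w=f(z_j)x.w$. The tensor product $V_1^{z_1}\otimes\cdots\otimes V_k^{z_k}$ is a cyclic $\mathbf U(\mathfrak g_0[t])$-module generated by $v_1\otimes\cdots\otimes v_k$. With $\mathbf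 U(\mathfrak g_0[t])[m]$ the degree $m$ component, filter it by $\mathbf V^j=\sum_{m=0}^j\mathbf U(\mathfrak g_0[t])[m](v_1\otimes\cdots\otimes v_k)$; the associated graded $\mathbf U(\mathfrak g_0[t])$-module is the fusion product $V_1*\cdots*V_k$ (parameters omitted from the notation; the statement is for any choice of pairwise distinct parameters). Local Weyl module. For $k\in\mathbb Z_+$, $W_{\mathfrak g_0}(k\delta_1)$ is the $\mathfrak g_0[t]$-module generated by a non-zero element $w_k$ with defining relations $\mathfrak n_0^+[t]w_k=0$; $(h\otimes t^r)w_k=k\delta_1(h)\delta_{r,0}w_k$ for all $r\in\mathbb Z_+$, $h\in\mathfrak h_0$; $(x_\alpha^-\otimes1)^{k\delta_1(h_\alpha)+1}w_k=0$ for all $\alpha\in R_0^+$. For $r,s\in\mathbb Z_+$ let $\mathbf S(r,s)$ be the set of sequences $(b_i)_{i\ge0}$ in $\mathbb Z_+$ with $\sum_i b_i=r$ and $\sum_i i\,b_i=s$. For $\alpha\in R_0^+$, $$\mathbf x_\alpha^-(r,s)=\sum_{(b_i)\in\mathbf S(r,s)}(x_\alpha^-\otimes1)^{(b_0)}(x_\alpha^-\otimes t)^{(b_1)}\cdots(x_\alpha^-\otimes t^s)^{(b_s)},\qquad x^{(b)}=\tfrac1{b!}x^b,$$ which is $0$ if $\mathbf S(r,s)$ is empty. *)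

theory Defs
  imports
    "HOL-Computational_Algebra.Polynomial"
    "HOL-Library.Poly_Mapping"
    "HOL-Library.FuncSet"
    "HOL-Algebra.AbelCoset"
    "Jordan_Normal_Form.VS_Connect"
begin

section \<open>Complex Lie algebras and their modules\<close>

text \<open>
  Complex vector spaces are modules over \<^term>\<open>class_ring :: complex ring\<close> with explicit carriers.
  The fields \<open>mult\<close> and \<open>one\<close> that the record type \<open>module\<close> inherits from \<open>ring\<close> are never used.
\<close>

record 'g lie_algebra = "(complex, 'g) module" +
  bracket :: "'g \<Rightarrow> 'g \<Rightarrow> 'g"

record ('g, 'v) rep = "(complex, 'v) module" +
  act :: "'g \<Rightarrow> 'v \<Rightarrow> 'v"

text \<open>
  Modules over the enveloping algebra \<open>U(L)\<close> are treated as modules over the Lie algebra \<open>L\<close>.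
\<close>

locale lie_module = vectorspace "class_ring :: complex ring" M
  for L :: "'g lie_algebra" and M :: "('g, 'v) rep" +
  assumes act_closed: "x \<in> carrier L \<Longrightarrow> v \<in> carrier M \<Longrightarrow> act M x v \<in> carrier M"
    and act_add_right: "x \<in> carrier L \<Longrightarrow> v \<in> carrier M \<Longrightarrow> w \<in> carrier M \<Longrightarrow>
      act M x (v \<oplus>\<^bsub>M\<^esub> w) = act M x v \<oplus>\<^bsub>M\<^esub> act M x w"
    and act_smult_right: "x \<in> carrier L \<Longrightarrow> v \<in> carrier M \<Longrightarrow>
      act M x (c \<odot>\<^bsub>M\<^esub> v) = c \<odot>\<^bsub>M\<^esub> act M x v"
    and act_add_left: "x \<in> carrier L \<Longrightarrow> y \<in> carrier L \<Longrightarrow> v \<in> carrier M \<Longrightarrow>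
      act M (x \<oplus>\<^bsub>L\<^esub> y) v = act M x v \<oplus>\<^bsub>M\<^esub> act M y v"
    and act_smult_left: "x \<in> carrier L \<Longrightarrow> v \<in> carrier M \<Longrightarrow>
      act M (c \<odot>\<^bsub>L\<^esub> x) v = c \<odot>\<^bsub>M\<^esub> act M x v"
    and act_bracket: "x \<in> carrier L \<Longrightarrow> y \<in> carrier L \<Longrightarrow> v \<in> carrier M \<Longrightarrow>
      act M (bracket L x y) v = act M x (act M y v) \<ominus>\<^bsub>M\<^esub> act M y (act M x v)"

definition act_stable :: "'g lie_algebra \<Rightarrow> 'v set \<Rightarrow> ('g, 'v) rep \<Rightarrow> bool" where
  "act_stable L N M \<longleftrightarrow>
    LinearCombinations.submodule (class_ring :: complex ring) N M \<and> (\<forall>x\<in>carrier L. \<forall>v\<in>N. act M x v \<in> N)"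

definition generated_submodule :: "'g lie_algebra \<Rightarrow> ('g, 'v) rep \<Rightarrow> 'v set \<Rightarrow> 'v set" where
  "generated_submodule L M S = \<Inter> {N. act_stable L N M \<and> S \<subseteq> N}"

definition irreducible_module :: "'g lie_algebra \<Rightarrow> ('g, 'v) rep \<Rightarrow> bool" where
  "irreducible_module L M \<longleftrightarrow> lie_module L M \<and> carrier M \<noteq> {\<zero>\<^bsub>M\<^esub>} \<and>
    (\<forall>N. act_stable L N M \<longrightarrow> N = {\<zero>\<^bsub>M\<^esub>} \<or> N = carrier M)"

text \<open>The quotient consists of cosets; operations are induced by those on representatives.\<close>

definition quotient_module :: "('g, 'v) rep \<Rightarrow> 'v set \<Rightarrow> ('g, 'v set) rep" where
  "quotient_module M N =
    \<lparr>carrier = a_rcosets\<^bsub>M\<^esub> N, mult = undefined, one = undefined,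
     zero = N, add = (<+>\<^bsub>M\<^esub>),
     smult = (\<lambda>c X. \<Union>v\<in>X. N +>\<^bsub>M\<^esub> (c \<odot>\<^bsub>M\<^esub> v)),
     act = (\<lambda>x X. \<Union>v\<in>X. N +>\<^bsub>M\<^esub> act M x v)\<rparr>"

definition lie_module_isomorphic ::
  "'g lie_algebra \<Rightarrow> ('g, 'v) rep \<Rightarrow> ('g, 'w) rep \<Rightarrow> bool" where
  "lie_module_isomorphic L M N \<longleftrightarrow> lie_module L M \<and> lie_module L N \<and>
    (\<exists>\<phi>. mod_hom (class_ring :: complex ring) M N \<phi> \<and> bij_betw \<phi> (carrier M) (carrier N) \<and>
      (\<forall>x\<in>carrier L. \<forall>v\<in>carrier M. \<phi> (act M x v) = act N x (\<phi> v)))"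


section \<open>Elements of the enveloping algebra, generators and relations\<close>

text \<open>
  An element of \<open>U(L)\<close> is represented by a finitely supported function on words over \<open>L\<close>, where the
  word \<open>[x\<^sub>1, \<dots>, x\<^sub>l]\<close> stands for the product \<open>x\<^sub>1 \<cdots> x\<^sub>l\<close>; \<open>word_action M u v\<close> is \<open>u v\<close>.
\<close>

definition word_action :: "('g, 'v) rep \<Rightarrow> ('g list \<Rightarrow>\<^sub>0 complex) \<Rightarrow> 'v \<Rightarrow> 'v" where
  "word_action M u v =
    (\<Oplus>\<^bsub>M\<^esub>ws\<in>Poly_Mapping.keys u. poly_mapping.lookup u ws \<odot>\<^bsub>M\<^esub> foldr (act M) ws v)"

definition scale_pm :: "complex \<Rightarrow> ('a \<Rightarrow>\<^sub>0 complex) \<Rightarrow> ('a \<Rightarrow>\<^sub>0 complex)" where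
  "scale_pm c u = Poly_Mapping.map ((*) c) u"

text \<open>The free module on one generator (the empty word) over the free associative algebra on \<open>L\<close>.\<close>

definition free_word_module :: "'g lie_algebra \<Rightarrow> ('g, 'g list \<Rightarrow>\<^sub>0 complex) rep" where
  "free_word_module L =
    \<lparr>carrier = {u. Poly_Mapping.keys u \<subseteq> lists (carrier L)}, mult = undefined, one = undefined,
     zero = 0, add = (+), smult = scale_pm,
     act = (\<lambda>x u. \<Sum>ws\<in>Poly_Mapping.keys u. Poly_Mapping.single (x # ws) (poly_mapping.lookup u ws))\<rparr>"

definition enveloping_relations :: "'g lie_algebra \<Rightarrow> ('g list \<Rightarrow>\<^sub>0 complex) set" where
  "enveloping_relations L =
    {Poly_Mapping.single ((x \<oplus>\<^bsub>L\<^esub> y) # ws) 1 - Poly_Mapping.single (x # ws) 1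
        - Poly_Mapping.single (y # ws) 1
      | x y ws. x \<in> carrier L \<and> y \<in> carrier L \<and> ws \<in> lists (carrier L)} \<union>
    {Poly_Mapping.single ((c \<odot>\<^bsub>L\<^esub> x) # ws) 1 - Poly_Mapping.single (x # ws) c
      | c x ws. x \<in> carrier L \<and> ws \<in> lists (carrier L)} \<union>
    {Poly_Mapping.single (x # y # ws) 1 - Poly_Mapping.single (y # x # ws) 1
        - Poly_Mapping.single (bracket L x y # ws) 1
      | x y ws. x \<in> carrier L \<and> y \<in> carrier L \<and> ws \<in> lists (carrier L)}"

text \<open>
  The \<open>U(L)\<close>-module with one generator \<open>w\<close> and defining relations \<open>u w = 0\<close> for \<open>u \<in> R\<close>,
  that is \<open>U(L) / U(L) R\<close>.
\<close>

definition relation_submodule ::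
  "'g lie_algebra \<Rightarrow> ('g list \<Rightarrow>\<^sub>0 complex) set \<Rightarrow> ('g list \<Rightarrow>\<^sub>0 complex) set" where
  "relation_submodule L R =
    generated_submodule L (free_word_module L) (enveloping_relations L \<union> R)"

definition presented_module ::
  "'g lie_algebra \<Rightarrow> ('g list \<Rightarrow>\<^sub>0 complex) set \<Rightarrow> ('g, ('g list \<Rightarrow>\<^sub>0 complex) set) rep" where
  "presented_module L R = quotient_module (free_word_module L) (relation_submodule L R)"

definition presented_generator ::
  "'g lie_algebra \<Rightarrow> ('g list \<Rightarrow>\<^sub>0 complex) set \<Rightarrow> ('g list \<Rightarrow>\<^sub>0 complex) set" where
  "presented_generator L R =
    relation_submodule L R +>\<^bsub>free_word_module L\<^esub> Poly_Mapping.single [] 1"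


section \<open>The symplectic Lie algebra\<close>

text \<open>
  Matrix indices start at 0, whereas \<open>H' n p\<close>, \<open>\<delta> p\<close> and the roots are indexed by \<open>1, \<dots>, n\<close>.
\<close>

definition symplectic_form :: "nat \<Rightarrow> complex mat" where
  "symplectic_form n = four_block_mat (0\<^sub>m n n) (1\<^sub>m n) (- 1\<^sub>m n) (0\<^sub>m n n)"

definition sp_carrier :: "nat \<Rightarrow> complex mat set" where
  "sp_carrier n = {X \<in> carrier_mat (2 * n) (2 * n).
     transpose_mat X * symplectic_form n + symplectic_form n * X = 0\<^sub>m (2 * n) (2 * n)}"

definition sp :: "nat \<Rightarrow> complex mat lie_algebra" where
  "sp n = \<lparr>carrier = sp_carrier n, mult = undefined, one = undefined,
     zero = 0\<^sub>m (2 * n) (2 * n), add = (+), smult = (\<cdot>\<^sub>m),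
     bracket = (\<lambda>X Y. X * Y - Y * X)\<rparr>"

definition H' :: "nat \<Rightarrow> nat \<Rightarrow> complex mat" where
  "H' n p = mat_diag (2 * n) (\<lambda>a. if a = p - 1 then 1 else if a = n + p - 1 then - 1 else 0)"

definition cartan :: "nat \<Rightarrow> complex mat set" where
  "cartan n = LinearCombinations.module.span (class_ring :: complex ring) (sp n) (H' n ` {1..n})"

text \<open>On \<^term>\<open>cartan n\<close> these are the functionals dual to \<open>H' n 1, \<dots>, H' n n\<close>.\<close>

definition \<delta> :: "nat \<Rightarrow> complex mat \<Rightarrow> complex" where
  "\<delta> p h = h $$ (p - 1, p - 1)"

text \<open>
  \<open>Long p\<close>, \<open>Plus i j\<close> and \<open>Minus i j\<close> stand for \<open>2\<delta>\<^sub>p\<close>, \<open>\<delta>\<^sub>i + \<delta>\<^sub>j\<close> and \<open>\<delta>\<^sub>i - \<delta>\<^sub>j\<close>.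
\<close>

datatype root_label = Long nat | Plus nat nat | Minus nat nat

definition pos_roots :: "nat \<Rightarrow> root_label set" where
  "pos_roots n = {Long p | p. 1 \<le> p \<and> p \<le> n} \<union>
     {Plus i j | i j. 1 \<le> i \<and> i < j \<and> j \<le> n} \<union>
     {Minus i j | i j. 1 \<le> i \<and> i < j \<and> j \<le> n}"

fun root_functional :: "root_label \<Rightarrow> complex mat \<Rightarrow> complex" where
  "root_functional (Long p) h = 2 * \<delta> p h"
| "root_functional (Plus i j) h = \<delta> i h + \<delta> j h"
| "root_functional (Minus i j) h = \<delta> i h - \<delta> j h"

fun coroot :: "nat \<Rightarrow> root_label \<Rightarrow> complex mat" where
  "coroot n (Long p) = H' n p"
| "coroot n (Plus i j) = H' n i + H' n j"
| "coroot n (Minus i j) = H' n i - H' n j"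

definition weight_space :: "nat \<Rightarrow> (complex mat \<Rightarrow> complex) \<Rightarrow> complex mat set" where
  "weight_space n \<mu> = {x \<in> sp_carrier n. \<forall>h\<in>cartan n. bracket (sp n) h x = \<mu> h \<cdot>\<^sub>m x}"

definition chevalley_generators ::
  "nat \<Rightarrow> (root_label \<Rightarrow> complex mat) \<Rightarrow> (root_label \<Rightarrow> complex mat) \<Rightarrow> bool" where
  "chevalley_generators n xp xm \<longleftrightarrow> (\<forall>\<alpha>\<in>pos_roots n.
     xp \<alpha> \<in> weight_space n (root_functional \<alpha>) \<and>
     xm \<alpha> \<in> weight_space n (\<lambda>h. - root_functional \<alpha> h) \<and>
     bracket (sp n) (xp \<alpha>) (xm \<alpha>) = coroot n \<alpha>)"

definition n_plus :: "nat \<Rightarrow> (root_label \<Rightarrow> complex mat) \<Rightarrow> complex mat set" where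
  "n_plus n xp = LinearCombinations.module.span (class_ring :: complex ring) (sp n) (xp ` pos_roots n)"

text \<open>The value \<open>\<delta>\<^sub>1(h\<^sub>\<alpha>)\<close> as a natural number (it is 1 if \<open>\<delta>\<^sub>1\<close> occurs in \<open>\<alpha>\<close> and 0 otherwise).\<close>

definition \<delta>1_coroot :: "nat \<Rightarrow> root_label \<Rightarrow> nat" where
  "\<delta>1_coroot n \<alpha> = (THE c. of_nat c = \<delta> 1 (coroot n \<alpha>))"

lemma \<delta>1_coroot_eqI: "\<delta> 1 (coroot n \<alpha>) = of_nat c \<Longrightarrow> \<delta>1_coroot n \<alpha> = c"
  unfolding \<delta>1_coroot_def by (rule the_equality) auto

lemma \<delta>_H': "1 \<le> p \<Longrightarrow> p \<le> n \<Longrightarrow> 1 \<le> q \<Longrightarrow> q \<le> n \<Longrightarrow> \<delta> q (H' n p) = (if p = q then 1 else 0)"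
  by (auto simp: \<delta>_def H'_def mat_diag_def)

lemma \<delta>1_coroot_simps:
  "1 \<le> p \<Longrightarrow> p \<le> n \<Longrightarrow> \<delta>1_coroot n (Long p) = (if p = 1 then 1 else 0)"
  "1 \<le> i \<Longrightarrow> i < j \<Longrightarrow> j \<le> n \<Longrightarrow> \<delta>1_coroot n (Plus i j) = (if i = 1 then 1 else 0)"
  "1 \<le> i \<Longrightarrow> i < j \<Longrightarrow> j \<le> n \<Longrightarrow> \<delta>1_coroot n (Minus i j) = (if i = 1 then 1 else 0)"
  by (intro \<delta>1_coroot_eqI; auto simp: \<delta>_def H'_def mat_diag_def)+

definition highest_weight_vector ::
  "nat \<Rightarrow> (root_label \<Rightarrow> complex mat) \<Rightarrow> (complex mat, 'v) rep \<Rightarrow>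
    (complex mat \<Rightarrow> complex) \<Rightarrow> 'v \<Rightarrow> bool" where
  "highest_weight_vector n xp M \<mu> v \<longleftrightarrow> v \<in> carrier M \<and> v \<noteq> \<zero>\<^bsub>M\<^esub> \<and>
    (\<forall>x\<in>n_plus n xp. act M x v = \<zero>\<^bsub>M\<^esub>) \<and>
    (\<forall>h\<in>cartan n. act M h v = \<mu> h \<odot>\<^bsub>M\<^esub> v)"


section \<open>The current algebra\<close>

text \<open>
  \<open>\<gg> \<otimes> \<complex>[t]\<close> is realised inside the matrices with entries in \<open>\<complex>[t]\<close>, as the polynomials in \<open>t\<close> with
  coefficients in \<open>\<gg>\<close>; \<open>x \<otimes> f\<close> becomes the matrix \<open>f x\<close>.
\<close>

definition mat_coeff :: "nat \<Rightarrow> complex poly mat \<Rightarrow> complex mat" where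
  "mat_coeff r X = map_mat (\<lambda>f. coeff f r) X"

definition currents :: "nat \<Rightarrow> complex mat set \<Rightarrow> complex poly mat set" where
  "currents n A = {X \<in> carrier_mat (2 * n) (2 * n). \<forall>r. mat_coeff r X \<in> A}"

definition current_algebra :: "nat \<Rightarrow> complex poly mat lie_algebra" where
  "current_algebra n = \<lparr>carrier = currents n (sp_carrier n), mult = undefined, one = undefined,
     zero = 0\<^sub>m (2 * n) (2 * n), add = (+), smult = (\<lambda>c X. [:c:] \<cdot>\<^sub>m X),
     bracket = (\<lambda>X Y. X * Y - Y * X)\<rparr>"

definition tensor_poly :: "complex mat \<Rightarrow> complex poly \<Rightarrow> complex poly mat" where
  "tensor_poly x f = map_mat (\<lambda>a. Polynomial.smult a f) x"

abbreviation tensor_t :: "complex mat \<Rightarrow> nat \<Rightarrow> complex poly mat" where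
  "tensor_t x r \<equiv> tensor_poly x (monom 1 r)"

text \<open>\<open>x \<otimes> f\<close> acts as \<open>f(z) x\<close>.\<close>

definition evaluation_module ::
  "complex \<Rightarrow> (complex mat, 'v) rep \<Rightarrow> (complex poly mat, 'v) rep" where
  "evaluation_module z M = \<lparr>carrier = carrier M, mult = mult M, one = one M,
     zero = zero M, add = add M, smult = module.smult M,
     act = (\<lambda>X. act M (map_mat (\<lambda>f. poly f z) X))\<rparr>"

text \<open>Representatives of the elements of degree \<open>d\<close> in the enveloping algebra of the current algebra.\<close>

definition enveloping_degree :: "nat \<Rightarrow> nat \<Rightarrow> (complex poly mat list \<Rightarrow>\<^sub>0 complex) set" where
  "enveloping_degree n d = {u. \<forall>ws\<in>Poly_Mapping.keys u. \<exists>xs :: (complex mat \<times> nat) list.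
     ws = map (\<lambda>(x, r). tensor_t x r) xs \<and> fst ` set xs \<subseteq> sp_carrier n \<and>
     sum_list (map snd xs) = d}"


section \<open>Tensor products\<close>

text \<open>
  The tensor product of \<open>V i\<close>, \<open>i \<in> I\<close>: the free vector space on the tuples modulo multilinearity,
  with the Lie algebra acting by the Leibniz rule.
\<close>

definition free_tuple_module :: "'i set \<Rightarrow> ('i \<Rightarrow> ('g, 'v) rep) \<Rightarrow> ('g, ('i \<Rightarrow> 'v) \<Rightarrow>\<^sub>0 complex) rep" where
  "free_tuple_module I V =
    \<lparr>carrier = {u. Poly_Mapping.keys u \<subseteq> (\<Pi>\<^sub>E i\<in>I. carrier (V i))}, mult = undefined, one = undefined,
     zero = 0, add = (+), smult = scale_pm,
     act = (\<lambda>x u. \<Sum>f\<in>Poly_Mapping.keys u. \<Sum>i\<in>I.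
       Poly_Mapping.single (f(i := act (V i) x (f i))) (poly_mapping.lookup u f))\<rparr>"

definition multilinear_relations ::
  "'i set \<Rightarrow> ('i \<Rightarrow> ('g, 'v) rep) \<Rightarrow> (('i \<Rightarrow> 'v) \<Rightarrow>\<^sub>0 complex) set" where
  "multilinear_relations I V =
    {Poly_Mapping.single (f(i := a \<oplus>\<^bsub>V i\<^esub> b)) 1 - Poly_Mapping.single (f(i := a)) 1
        - Poly_Mapping.single (f(i := b)) 1
      | f i a b. f \<in> (\<Pi>\<^sub>E i\<in>I. carrier (V i)) \<and> i \<in> I \<and> a \<in> carrier (V i) \<and> b \<in> carrier (V i)} \<union>
    {Poly_Mapping.single (f(i := c \<odot>\<^bsub>V i\<^esub> a)) 1 - Poly_Mapping.single (f(i := a)) c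
      | f i a c. f \<in> (\<Pi>\<^sub>E i\<in>I. carrier (V i)) \<and> i \<in> I \<and> a \<in> carrier (V i)}"

definition multilinear_subspace ::
  "'i set \<Rightarrow> ('i \<Rightarrow> ('g, 'v) rep) \<Rightarrow> (('i \<Rightarrow> 'v) \<Rightarrow>\<^sub>0 complex) set" where
  "multilinear_subspace I V =
    LinearCombinations.module.span (class_ring :: complex ring) (free_tuple_module I V) (multilinear_relations I V)"

definition tensor_product ::
  "'i set \<Rightarrow> ('i \<Rightarrow> ('g, 'v) rep) \<Rightarrow> ('g, (('i \<Rightarrow> 'v) \<Rightarrow>\<^sub>0 complex) set) rep" where
  "tensor_product I V = quotient_module (free_tuple_module I V) (multilinear_subspace I V)"

definition pure_tensor ::
  "'i set \<Rightarrow> ('i \<Rightarrow> ('g, 'v) rep) \<Rightarrow> ('i \<Rightarrow> 'v) \<Rightarrow> (('i \<Rightarrow> 'v) \<Rightarrow>\<^sub>0 complex) set" where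
  "pure_tensor I V v =
    multilinear_subspace I V +>\<^bsub>free_tuple_module I V\<^esub> Poly_Mapping.single (restrict v I) 1"


section \<open>Fusion products\<close>

definition degree_filtration ::
  "nat \<Rightarrow> (complex poly mat, 'v) rep \<Rightarrow> 'v \<Rightarrow> nat \<Rightarrow> 'v set" where
  "degree_filtration n M v j =
    {\<Oplus>\<^bsub>M\<^esub>d\<in>{..j}. word_action M (u d) v | u. \<forall>d\<le>j. u d \<in> enveloping_degree n d}"

definition filtration_below :: "('g, 'v) rep \<Rightarrow> (nat \<Rightarrow> 'v set) \<Rightarrow> nat \<Rightarrow> 'v set" where
  "filtration_below M F j = (case j of 0 \<Rightarrow> {\<zero>\<^bsub>M\<^esub>} | Suc i \<Rightarrow> F i)"

definition graded_piece ::
  "('g, 'v) rep \<Rightarrow> (nat \<Rightarrow> 'v set) \<Rightarrow> nat \<Rightarrow> ('g, 'v set) rep" where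
  "graded_piece M F j = quotient_module (M\<lparr>carrier := F j\<rparr>) (filtration_below M F j)"

text \<open>
  The direct sum of the quotients \<open>F j / F (j - 1)\<close>. An element \<open>x \<otimes> t^r\<close> maps the class of
  \<open>v \<in> F j\<close> to the class of \<open>(x \<otimes> t^r) v\<close> in degree \<open>j + r\<close>; a general element of the
  current algebra acts by the sum of the actions of its homogeneous components.
\<close>

definition associated_graded ::
  "(complex poly mat, 'v) rep \<Rightarrow> (nat \<Rightarrow> 'v set) \<Rightarrow> (complex poly mat, nat \<Rightarrow> 'v set) rep" where
  "associated_graded M F =
    \<lparr>carrier = {g. (\<forall>j. g j \<in> carrier (graded_piece M F j)) \<and>
        finite {j. g j \<noteq> \<zero>\<^bsub>graded_piece M F j\<^esub>}},
     mult = undefined, one = undefined,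
     zero = (\<lambda>j. \<zero>\<^bsub>graded_piece M F j\<^esub>),
     add = (\<lambda>g h j. g j \<oplus>\<^bsub>graded_piece M F j\<^esub> h j),
     smult = (\<lambda>c g j. c \<odot>\<^bsub>graded_piece M F j\<^esub> g j),
     act = (\<lambda>X g j. \<Oplus>\<^bsub>graded_piece M F j\<^esub>r\<in>{..j}.
       \<Union>v\<in>g (j - r). filtration_below M F j +>\<^bsub>M\<^esub> act M (tensor_t (mat_coeff r X) r) v)\<rparr>"

text \<open>The fusion product of the modules \<open>V i\<close> with cyclic vectors \<open>v i\<close> and parameters \<open>z i\<close>.\<close>

definition fusion_product ::
  "nat \<Rightarrow> 'i set \<Rightarrow> ('i \<Rightarrow> complex) \<Rightarrow> ('i \<Rightarrow> (complex mat, 'v) rep) \<Rightarrow> ('i \<Rightarrow> 'v) \<Rightarrow>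
    (complex poly mat, nat \<Rightarrow> (('i \<Rightarrow> 'v) \<Rightarrow>\<^sub>0 complex) set set) rep" where
  "fusion_product n I z V v =
    (let E = (\<lambda>i. evaluation_module (z i) (V i)); T = tensor_product I E
     in associated_graded T (degree_filtration n T (pure_tensor I E v)))"


section \<open>Local Weyl modules\<close>

definition weyl_relations ::
  "nat \<Rightarrow> (root_label \<Rightarrow> complex mat) \<Rightarrow> (root_label \<Rightarrow> complex mat) \<Rightarrow> nat \<Rightarrow>
    (complex poly mat list \<Rightarrow>\<^sub>0 complex) set" where
  "weyl_relations n xp xm k =
    {Poly_Mapping.single [X] 1 | X. X \<in> currents n (n_plus n xp)} \<union>
    {Poly_Mapping.single [tensor_t h r] 1
        - Poly_Mapping.single [] (of_nat k * \<delta> 1 h * (if r = 0 then 1 else 0))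
      | h r. h \<in> cartan n} \<union>
    {Poly_Mapping.single (replicate (k * \<delta>1_coroot n \<alpha> + 1) (tensor_poly (xm \<alpha>) 1)) 1
      | \<alpha>. \<alpha> \<in> pos_roots n}"

definition local_weyl where
  "local_weyl n xp xm k = presented_module (current_algebra n) (weyl_relations n xp xm k)"

definition weyl_generator where
  "weyl_generator n xp xm k = presented_generator (current_algebra n) (weyl_relations n xp xm k)"

text \<open>Any sequence with the two prescribed sums vanishes beyond index \<open>s\<close>.\<close>

definition S_set :: "nat \<Rightarrow> nat \<Rightarrow> (nat \<Rightarrow> nat) set" where
  "S_set r s = {b. finite {i. b i \<noteq> 0} \<and>
     (\<Sum>i | b i \<noteq> 0. b i) = r \<and> (\<Sum>i | b i \<noteq> 0. i * b i) = s}"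

text \<open>\<open>divided_power_sum x r s\<close> is \<open>\<^bold>x(r, s)\<close> for the element \<open>x\<close> of the Lie algebra.\<close>

definition divided_power_sum ::
  "complex mat \<Rightarrow> nat \<Rightarrow> nat \<Rightarrow> (complex poly mat list \<Rightarrow>\<^sub>0 complex)" where
  "divided_power_sum x r s = (\<Sum>b\<in>S_set r s.
     Poly_Mapping.single (concat (map (\<lambda>i. replicate (b i) (tensor_t x i)) [0..<Suc s]))
       (\<Prod>i\<le>s. 1 / fact (b i)))"

definition fusion_ideal where
  "fusion_ideal n xp xm k m =
    (let N = (\<Sum>j = 1..k. m j) in
     generated_submodule (current_algebra n) (local_weyl n xp xm N)
       {word_action (local_weyl n xp xm N) (divided_power_sum (xm \<alpha>) r s) (weyl_generator n xp xm N)
         | \<alpha> r s. \<alpha> \<in> pos_roots n \<and> 1 \<le> r \<and> 1 \<le> s \<and>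
             (\<exists>p. s + r \<ge> 1 + r * p + (\<Sum>j = p + 1..k. m j * \<delta>1_coroot n \<alpha>))})"

end

theory Submission
 imports Defs "HOL-Library.Function_Algebras" "HOL-Computational_Algebra.Formal_Power_Series" "HOL-Combinatorics.Multiset_Permutations" "HOL-Library.Product_Plus"
begin

text \<open>
  Both modules are quotients of the free module on words over the current algebra, so it suffices to compare
  the two submodules of relations. The Weyl and divided power relations hold in the fusion product: the lowering
  operators act on a tensor of evaluation modules through polynomials that vanish at the admissible points.
  Conversely, the functionals that read off the tensor coordinates of a product of \<open>y\<close>-operators evaluate
  a polynomial at the admissible assignments of its variables to the parameters \<open>z\<close>. A polynomial of bounded
  degree that vanishes at all of them is a combination of complete homogeneous ones (as in the theorem of Garsia
  and Procesi), which are exactly the defining relations. Descending induction on word length then removes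
  the leading terms of any element of the kernel.
\<close>

text \<open>The least value over \<open>p\<close> of \<open>r * p\<close> plus the tail sum of the
  \<open>m j\<close> is the sum of all \<open>min r (m j)\<close>; so read, the defining inequality
  says that a rational generating series becomes a polynomial of degree below \<open>s\<close> at
  every admissible point. The obstacle is that the Weyl quotient is graded whereas the tensor
  product is only filtered: there the relation of degree \<open>s\<close> needs corrections of lower
  degree, with coefficients that are, up to sign, elementary symmetric in the \<open>z j\<close>
  taken with multiplicity. Pairs, made of a word recorded only in its exact degree and of its value
  in the tensor product, let one straightening argument treat both sides; cancelling the second
  entry at the end isolates the graded statement. No dimension formula enters. In this direction the
  only divided power relations used are those of the root \<open>Long 1\<close>, which concern
  letters of one colour; the other colours arise by acting with the stabiliser of the highest weight
  line, at the cost of shorter words. These are harmless because a functional that looks at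
  \<open>r\<close> excited tensor slots cannot see fewer than \<open>r\<close> letters.\<close>

type_synonym cwords = "complex poly mat list \<Rightarrow>\<^sub>0 complex"

abbreviation "spc == sp_carrier"
abbreviation "mats n == carrier_mat (2 * n) (2 * n)"
abbreviation "CA == current_algebra"
abbreviation "ED == enveloping_degree"
abbreviation "env_rel == enveloping_relations"
abbreviation "tt x r == tensor_t x r"
abbreviation "ok_word n ws == fst ` set ws <= sp_carrier n"
abbreviation "degsum ws == sum_list (map snd ws)"

section \<open>Linear extension of functions on a basis\<close>

no_notation fps_nth (infixl \<open>$\<close> 75)

abbreviation lookup where "lookup \<equiv> poly_mapping.lookup"
abbreviation keys where "keys \<equiv> Poly_Mapping.keys"
abbreviation single where "single \<equiv> Poly_Mapping.single"

text \<open>The added basis elements are restricted to the support of \<open>f\<close>, so that side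
  conditions on the support are available in the step.\<close>

lemma single_induct [case_names zero add]:
 fixes f :: "'a \<Rightarrow>\<^sub>0 'b::comm_monoid_add"
 assumes "P 0"
  and "\<And>a c g. a : keys f ==> P g ==> P (single a c + g)"
 shows "P f"
proof -
 have exp: "f = (\<Sum>a\<in>keys f. single a (lookup f a))"
  by (rule poly_mapping_eqI) (auto simp: lookup_sum lookup_single when_def in_keys_iff)
 have "P (\<Sum>a\<in>A. single a (lookup f a))" if "finite A" "A <= keys f" for A
  using that by (induction A rule: finite_induct) (auto intro: assms)
 from this[of "keys f"] show ?thesis using exp by simp
qed

text \<open>Vector spaces that fill a whole type, so that type class arithmetic applies; carriers
  enter afterwards as subspaces. The instances are the scalars, functions of finite support, plain
  functions, and pairs of functions of finite support.\<close>

locale cvs =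
 fixes sc :: "complex => 'm::ab_group_add => 'm"
 assumes sc_add: "sc c (x + y) = sc c x + sc c y"
  and sc_left: "sc (a + b) x = sc a x + sc b x"
  and sc_sc: "sc a (sc b x) = sc (a * b) x"
  and sc_one: "sc 1 x = x"
begin

lemma sc_zero [simp]: "sc c 0 = 0"
 using sc_add[of c 0 0] by simp
lemma sc_0 [simp]: "sc 0 x = 0"
 using sc_left[of 0 0 x] by simp
lemma sc_minus: "sc c (- x) = - sc c x"
 using sc_add[of c x "- x"] by (simp add: eq_neg_iff_add_eq_0 add.commute)
lemma sc_diff: "sc c (x - y) = sc c x - sc c y"
 using sc_add[of c x "- y"] by (simp add: sc_minus)
lemma sc_uminus: "sc (- c) x = - sc c x"
 using sc_left[of c "- c" x] by (simp add: eq_neg_iff_add_eq_0 add.commute)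
lemma sc_m1: "sc (- 1) x = - x"
 by (simp add: sc_uminus sc_one)
lemma sc_sum: "sc c (\<Sum>i\<in>I. f i) = (\<Sum>i\<in>I. sc c (f i))"
 by (induction I rule: infinite_finite_induct) (auto simp: sc_add)
lemma sc_sum_left: "sc (\<Sum>i\<in>I. f i) x = (\<Sum>i\<in>I. sc (f i) x)"
 by (induction I rule: infinite_finite_induct) (auto simp: sc_left)

definition subsp :: "'m set => bool" where
 "subsp N \<longleftrightarrow> 0 : N \<and> (\<forall>x\<in>N. \<forall>y\<in>N. x + y : N) \<and> (\<forall>c. \<forall>x\<in>N. sc c x : N)"

lemma subspI: "0 : N ==> (\<And>x y. x : N ==> y : N ==> x + y : N) ==>
 (\<And>c x. x : N ==> sc c x : N) ==> subsp N" by (simp add: subsp_def)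

lemma subsp_zero: "subsp N ==> 0 : N"
 and subsp_add: "subsp N ==> x : N ==> y : N ==> x + y : N"
 and subsp_sc: "subsp N ==> x : N ==> sc c x : N"
 by (simp_all add: subsp_def)

lemma subsp_minus: "subsp N ==> x : N ==> - x : N"
 using subsp_sc[of N x "- 1"] by (simp add: sc_m1)

lemma subsp_diff: "subsp N ==> x : N ==> y : N ==> x - y : N"
 using subsp_add[of N x "- y"] subsp_minus[of N y] by simp

lemma subsp_sum: "subsp N ==> (\<And>i. i : I ==> f i : N) ==> (\<Sum>i\<in>I. f i) : N"
 by (induction I rule: infinite_finite_induct) (auto intro: subsp_add subsp_zero)

lemma subsp_cong: "subsp N ==> x - y : N ==> x : N \<longleftrightarrow> y : N"
 using subsp_add[of N "x - y" y] subsp_diff[of N x "x - y"] by auto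

inductive_set lspan :: "'m set => 'm set" for S where
 lspan_zero: "0 : lspan S"
| lspan_step: "x : S ==> y : lspan S ==> sc c x + y : lspan S"

lemma lspan_add: "x : lspan S ==> y : lspan S ==> x + y : lspan S"
 by (induction x rule: lspan.induct) (auto simp: add.assoc intro: lspan_step)

lemma lspan_sc: "x : lspan S ==> sc c x : lspan S"
 by (induction x rule: lspan.induct) (auto simp: sc_add sc_sc intro: lspan_step lspan_zero)

lemma subsp_lspan: "subsp (lspan S)"
 by (rule subspI) (auto intro: lspan_add lspan_sc lspan_zero)

lemma lspan_base: "x : S ==> x : lspan S"
 using lspan_step[OF _ lspan_zero, of x S 1] by (simp add: sc_one)

lemma lspan_least: "subsp N ==> S <= N ==> lspan S <= N"
proof
 fix x assume N: "subsp N" "S <= N" and "x : lspan S"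
 from this(3) show "x : N" by induction (use N in \<open>auto intro: subsp_add subsp_sc subsp_zero\<close>)
qed

lemma lspan_mono: "S <= S' ==> lspan S <= lspan S'"
 by (rule lspan_least[OF subsp_lspan]) (auto intro: lspan_base)

definition lin_ext :: "('a => 'm) => ('a \<Rightarrow>\<^sub>0 complex) => 'm" where
 "lin_ext \<phi> f = (\<Sum>a\<in>keys f. sc (lookup f a) (\<phi> a))"

lemma lin_ext_superset: "finite A ==> keys f <= A ==> lin_ext \<phi> f = (\<Sum>a\<in>A. sc (lookup f a) (\<phi> a))"
 unfolding lin_ext_def by (rule sum.mono_neutral_left) (auto simp: in_keys_iff)

lemma lin_ext_zero [simp]: "lin_ext \<phi> 0 = 0"
 by (simp add: lin_ext_def)

lemma lin_ext_single [simp]: "lin_ext \<phi> (single a c) = sc c (\<phi> a)"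
 by (simp add: lin_ext_def)

lemma lin_ext_add: "lin_ext \<phi> (f + g) = lin_ext \<phi> f + lin_ext \<phi> g"
proof -
 let ?A = "keys f \<union> keys g"
 have "lin_ext \<phi> (f + g) = (\<Sum>a\<in>?A. sc (lookup (f + g) a) (\<phi> a))"
  by (rule lin_ext_superset) (auto dest: subsetD[OF Poly_Mapping.keys_add])
 also have "... = lin_ext \<phi> f + lin_ext \<phi> g"
  by (simp add: lookup_add sc_left sum.distrib lin_ext_superset[of ?A f] lin_ext_superset[of ?A g])
 finally show ?thesis .
qed

lemma lin_ext_minus: "lin_ext \<phi> (- f) = - lin_ext \<phi> f"
 using lin_ext_add[of \<phi> f "- f"] by (simp add: eq_neg_iff_add_eq_0 add.commute)

lemma lin_ext_diff: "lin_ext \<phi> (f - g) = lin_ext \<phi> f - lin_ext \<phi> g"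
 using lin_ext_add[of \<phi> f "- g"] by (simp add: lin_ext_minus)

lemma lin_ext_sum: "lin_ext \<phi> (\<Sum>i\<in>I. f i) = (\<Sum>i\<in>I. lin_ext \<phi> (f i))"
 by (induction I rule: infinite_finite_induct) (auto simp: lin_ext_add)

lemma lin_ext_in: "subsp N ==> (\<And>a. a : keys f ==> \<phi> a : N) ==> lin_ext \<phi> f : N"
 unfolding lin_ext_def by (intro subsp_sum subsp_sc)

lemma lin_ext_cong: "(\<And>a. a : keys f ==> \<phi> a = \<psi> a) ==> lin_ext \<phi> f = lin_ext \<psi> f"
 unfolding lin_ext_def by (auto intro: sum.cong)

end

interpretation cplx: cvs "(*) :: complex => complex => complex" by unfold_locales (auto simp: algebra_simps)

lemma lookup_scale_pm [simp]: "lookup (scale_pm c u) a = c * lookup u a"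
 by (simp add: scale_pm_def map.rep_eq when_def)

interpretation pm: cvs scale_pm by unfold_locales (auto intro!: poly_mapping_eqI simp: lookup_add algebra_simps)

lemma scale_pm_single [simp]: "scale_pm c (single a b) = single a (c * b)"
 by (rule poly_mapping_eqI) (auto simp: lookup_single when_def)

lemma keys_scale_pm: "keys (scale_pm c u) <= keys u"
 by (auto simp: in_keys_iff)

lemma (in cvs) lin_ext_scale: "lin_ext \<phi> (scale_pm c f) = sc c (lin_ext \<phi> f)"
proof -
 have "lin_ext \<phi> (scale_pm c f) = (\<Sum>a\<in>keys f. sc (lookup (scale_pm c f) a) (\<phi> a))"
  by (rule lin_ext_superset) (auto dest: subsetD[OF keys_scale_pm])
 also have "... = sc c (lin_ext \<phi> f)" by (simp add: lin_ext_def sc_sum sc_sc)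
 finally show ?thesis .
qed

section \<open>Polynomials vanishing on the deformed orbit\<close>

text \<open>Exponent vectors are functions, with addition and zero taken pointwise.\<close>

type_synonym pol = "(nat => nat) \<Rightarrow>\<^sub>0 complex"

definition pvar :: "nat => pol" where "pvar v = single (\<lambda>i. if i = v then 1 else 0) 1"
definition pconst :: "complex => pol" where "pconst c = single 0 c"

lemma pconst_simps: "pconst 0 = 0" "pconst 1 = 1" "pconst (a + b) = pconst a + pconst b"
 "pconst (a * b) = pconst a * pconst b" "pconst (- a) = - pconst a" "pconst (a - b) = pconst a - pconst b"
 by (simp_all add: pconst_def single_add mult_single single_uminus single_diff)

text \<open>Degree at most \<open>d - e\<close>. The offset stays on the left so that the set
  collapses to 0 when \<open>e > d\<close>; truncated subtraction would still admit
  constants.\<close>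

definition pol_le :: "nat => nat => nat => pol set" where
 "pol_le r e d = {f. \<forall>a\<in>keys f. (\<forall>i\<ge>r. a i = 0) \<and> (\<Sum>i<r. a i) + e <= d}"

lemma pol_le_zero [simp]: "0 : pol_le r e d"
 by (simp add: pol_le_def)
lemma pol_le_add: "f : pol_le r e d ==> g : pol_le r e d ==> f + g : pol_le r e d"
 unfolding pol_le_def using Poly_Mapping.keys_add[of f g] by blast
lemma pol_le_uminus: "f : pol_le r e d ==> - f : pol_le r e d"
 by (simp add: pol_le_def)
lemma pol_le_diff: "f : pol_le r e d ==> g : pol_le r e d ==> f - g : pol_le r e d"
 using pol_le_add[of f r e d "- g"] by (simp add: pol_le_uminus)
lemma pol_le_sum: "(\<And>i. i : I ==> f i : pol_le r e d) ==> (\<Sum>i\<in>I. f i) : pol_le r e d"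
 by (induction I rule: infinite_finite_induct) (auto intro: pol_le_add)
lemma pol_le_single: "(\<And>i. i \<ge> r ==> a i = 0) ==> (\<Sum>i<r. a i) + e <= d ==> single a c : pol_le r e d"
 by (auto simp: pol_le_def split: if_splits)
lemma pol_le_mult:
 assumes "f : pol_le r e d" "g : pol_le r e' d'"
 shows "f * g : pol_le r (e + e') (d + d')"
 unfolding pol_le_def
proof (intro CollectI ballI)
 fix a assume "a : keys (f * g)"
 with keys_mult obtain b c where a: "a = b + c" "b : keys f" "c : keys g" by blast
 have "(\<forall>i\<ge>r. b i = 0)" "(\<Sum>i<r. b i) + e <= d" "(\<forall>i\<ge>r. c i = 0)" "(\<Sum>i<r. c i) + e' <= d'"
  using a(2,3) assms by (auto simp: pol_le_def)
 thus "(\<forall>i\<ge>r. a i = 0) \<and> (\<Sum>i<r. a i) + (e + e') <= d + d'" by (simp add: a(1) sum.distrib)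
qed
lemma pol_le_mono: "f : pol_le r e d ==> r <= r' ==> e' + d <= e + d' ==> f : pol_le r' e' d'"
proof -
 assume f: "f : pol_le r e d" and r: "r <= r'" and e: "e' + d <= e + d'"
 have "(\<forall>i\<ge>r'. a i = 0) \<and> (\<Sum>i<r'. a i) + e' <= d'" if "a : keys f" for a
 proof -
  have a: "\<forall>i\<ge>r. a i = 0" "(\<Sum>i<r. a i) + e <= d" using f that by (auto simp: pol_le_def)
  moreover have "(\<Sum>i<r'. a i) = (\<Sum>i<r. a i)" by (rule sum.mono_neutral_right) (use a r in auto)
  ultimately show ?thesis using r e by auto
 qed
 thus ?thesis by (simp add: pol_le_def)
qed
lemma pol_le_1: "e <= d ==> 1 : pol_le r e d"
 by (simp add: pol_le_def)
lemma pol_le_pconst: "e <= d ==> pconst c : pol_le r e d"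
 unfolding pconst_def by (rule pol_le_single) auto
lemma pol_le_pvar: "v < r ==> e + 1 <= d ==> pvar v : pol_le r e d"
 unfolding pvar_def by (rule pol_le_single) auto
lemma pol_le_prod: "(\<And>i. i : I ==> f i : pol_le r 0 (d i)) ==> (\<Prod>i\<in>I. f i) : pol_le r 0 (\<Sum>i\<in>I. d i)"
proof (induction I rule: infinite_finite_induct)
 case (insert x I)
 thus ?case using pol_le_mult[of "f x" r 0 "d x" "prod f I" 0 "sum d I"] by simp
qed (auto intro: pol_le_1)

definition pol_eval :: "nat => (nat => complex) => pol => complex" where
 "pol_eval r x = cplx.lin_ext (\<lambda>a. \<Prod>i<r. x i ^ a i)"

lemma pol_eval_simps:
 "pol_eval r x 0 = 0" "pol_eval r x (f + g) = pol_eval r x f + pol_eval r x g"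
 "pol_eval r x (- f) = - pol_eval r x f" "pol_eval r x (f - g) = pol_eval r x f - pol_eval r x g"
 "pol_eval r x (single a c) = c * (\<Prod>i<r. x i ^ a i)"
 "pol_eval r x (pconst c) = c" by (simp_all add: pol_eval_def cplx.lin_ext_add cplx.lin_ext_minus cplx.lin_ext_diff pconst_def)

lemma pol_eval_sum: "pol_eval r x (\<Sum>i\<in>I. f i) = (\<Sum>i\<in>I. pol_eval r x (f i))"
 by (simp add: pol_eval_def cplx.lin_ext_sum)

lemma pol_eval_mult: "pol_eval r x (f * g) = pol_eval r x f * pol_eval r x g"
proof (induction f rule: single_induct)
 case (add a c h)
 have "pol_eval r x (single a c * g) = pol_eval r x (single a c) * pol_eval r x g" by (induction g rule: single_induct)
   (auto simp: pol_eval_simps distrib_left mult_single power_add prod.distrib)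
 thus ?case using add by (simp add: distrib_right pol_eval_simps)
qed (simp add: pol_eval_simps)

lemma pol_eval_1: "pol_eval r x 1 = 1"
 using pol_eval_simps(6)[of r x 1] by (simp add: pconst_simps)
lemma pol_eval_prod: "pol_eval r x (\<Prod>i\<in>I. f i) = (\<Prod>i\<in>I. pol_eval r x (f i))"
 by (induction I rule: infinite_finite_induct) (auto simp: pol_eval_mult pol_eval_1)
lemma pol_eval_pvar: "v < r ==> pol_eval r x (pvar v) = x v"
proof -
 assume "v < r"
 have "(\<Prod>i<r. x i ^ (if i = v then 1 else 0)) = (\<Prod>i<r. if i = v then x i else 1)" by (rule prod.cong) auto
 thus ?thesis using \<open>v < r\<close> by (simp add: pol_eval_simps pvar_def)
qed
lemma pol_eval_cong: "(\<And>i. i < r ==> x i = y i) ==> pol_eval r x f = pol_eval r y f"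
 unfolding pol_eval_def by (rule cplx.lin_ext_cong) auto
lemma pol_eval_Suc: "f : pol_le r e d ==> pol_eval (Suc r) x f = pol_eval r x f"
 unfolding pol_eval_def by (rule cplx.lin_ext_cong) (auto simp: pol_le_def)

section \<open>Generating series with linear factors and their inverses\<close>

definition lf :: "'a::comm_ring_1 => 'a fps" where "lf x = 1 - fps_const x * fps_X"
definition geo :: "'a::comm_ring_1 => 'a fps" where "geo x = Abs_fps (\<lambda>n. x ^ n)"

lemma lf_nth: "fps_nth (lf x) n = (if n = 0 then 1 else if n = 1 then - x else 0)"
 by (cases n) (auto simp: lf_def)

lemma lf_geo: "lf x * geo x = 1"
proof (rule fps_ext)
 fix n show "fps_nth (lf x * geo x) n = fps_nth 1 n" by (cases n) (simp_all add: lf_def geo_def algebra_simps mult.assoc)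
qed

text \<open>With \<open>fps_X\<close> counted as degree -1 this says that the total degree is at
  most 0, a condition stable under products.\<close>

definition fdeg_le :: "nat => pol fps => bool" where
 "fdeg_le r F \<longleftrightarrow> (\<forall>t. fps_nth F t : pol_le r 0 t)"

lemma fdeg_le_mult: "fdeg_le r F ==> fdeg_le r G ==> fdeg_le r (F * G)"
 unfolding fdeg_le_def fps_mult_nth
proof (intro allI pol_le_sum)
 fix t i :: nat assume "\<forall>t. fps_nth F t : pol_le r 0 t" "\<forall>t. fps_nth G t : pol_le r 0 t" "i : {0..t}"
 thus "fps_nth F i * fps_nth G (t - i) : pol_le r 0 t"
  using pol_le_mult[of "fps_nth F i" r 0 i "fps_nth G (t - i)" 0 "t - i"] by simp
qed
lemma fdeg_le_1: "fdeg_le r 1"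
 by (auto simp: fdeg_le_def intro: pol_le_1)
lemma fdeg_le_diff: "fdeg_le r F ==> fdeg_le r G ==> fdeg_le r (F - G)"
 by (simp add: fdeg_le_def pol_le_diff)
lemma fdeg_le_prod: "(\<And>i. i : I ==> fdeg_le r (F i)) ==> fdeg_le r (\<Prod>i\<in>I. F i)"
 by (induction I rule: infinite_finite_induct) (auto intro: fdeg_le_mult fdeg_le_1)
lemma fdeg_le_power: "fdeg_le r F ==> fdeg_le r (F ^ n)"
 by (induction n) (auto intro: fdeg_le_mult fdeg_le_1)
lemma fdeg_le_lf: "x : pol_le r 0 1 ==> fdeg_le r (lf x)"
 by (auto simp: fdeg_le_def lf_nth pol_le_1 pol_le_uminus)
lemma fdeg_le_geo: "x : pol_le r 0 1 ==> fdeg_le r (geo x)"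
proof -
 assume x: "x : pol_le r 0 1"
 have "x ^ t : pol_le r 0 t" for t using pol_le_prod[of "{..<t}" "\<lambda>_. x" r "\<lambda>_. 1"] x by simp
 thus ?thesis by (simp add: fdeg_le_def geo_def)
qed

definition trunc :: "nat => 'a::comm_ring_1 fps => bool" where
 "trunc N F \<longleftrightarrow> (\<forall>t>N. fps_nth F t = 0)"

lemma trunc_mult: "trunc N F ==> trunc N' G ==> trunc (N + N') (F * G)"
 unfolding trunc_def fps_mult_nth
proof (intro allI impI sum.neutral ballI)
 fix t i :: nat assume "\<forall>t>N. fps_nth F t = 0" "\<forall>t>N'. fps_nth G t = 0" "N + N' < t" "i : {0..t}"
 thus "fps_nth F i * fps_nth G (t - i) = 0" by (cases "i > N") auto
qed
lemma trunc_1: "trunc 0 1"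
 by (simp add: trunc_def)
lemma trunc_lf: "trunc 1 (lf x)"
 by (simp add: trunc_def lf_nth)
lemma trunc_prod: "(\<And>i. i : I ==> trunc (N i) (F i)) ==> trunc (\<Sum>i\<in>I. N i) (\<Prod>i\<in>I. F i)"
 by (induction I rule: infinite_finite_induct) (auto intro: trunc_mult trunc_1)
lemma trunc_lf_power: "trunc n (lf x ^ n)"
 using trunc_prod[of "{..<n}" "\<lambda>_. 1" "\<lambda>_. lf x"] trunc_lf[of x] by simp

text \<open>The numerator that clears denominators: an admissible assignment of \<open>q\<close>
  variables uses \<open>j\<close> at most \<open>min q (m j)\<close> times, so the powers of
  \<open>geo (z j)\<close> that it produces cancel. With all \<open>z j = 0\<close> the series is
  1.\<close>

definition qser :: "'j set => ('j => 'a::comm_ring_1) => ('j => nat) => nat => 'a fps" where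
 "qser J z m q = (\<Prod>j\<in>J. lf (z j) ^ min q (m j))"

text \<open>After the variables are grouped by value, each \<open>geo (z j)\<close> cancels against
  one \<open>lf (z j)\<close>. What remains is a polynomial in \<open>fps_X\<close> of degree at
  most the sum of the minima minus \<open>card S\<close>, which is below \<open>s\<close>.\<close>

lemma qser_geo_vanish:
 fixes z :: "'j => 'a::comm_ring_1"
 assumes J: "finite J" and S: "finite S" and p: "\<And>i. i : S ==> p i : J"
  and c: "\<And>j. j : J ==> card {i\<in>S. p i = j} <= m j"
  and s: "(\<Sum>j\<in>J. min (card S) (m j)) < card S + s"
 shows "fps_nth (qser J z m (card S) * (\<Prod>i\<in>S. geo (z (p i)))) s = 0"
proof -
 let ?c = "\<lambda>j. card {i\<in>S. p i = j}"
 have c': "?c j <= min (card S) (m j)" if "j : J" for j using c[OF that] S by (auto intro: card_mono)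
 have "(\<Prod>i\<in>S. geo (z (p i))) = (\<Prod>j\<in>J. \<Prod>i\<in>{i\<in>S. p i = j}. geo (z (p i)))"
  by (rule prod.group[symmetric]) (use J S p in auto)
 also have "... = (\<Prod>j\<in>J. geo (z j) ^ ?c j)" by (intro prod.cong refl) simp
 finally have "qser J z m (card S) * (\<Prod>i\<in>S. geo (z (p i))) =
   (\<Prod>j\<in>J. lf (z j) ^ min (card S) (m j) * geo (z j) ^ ?c j)" by (simp add: qser_def prod.distrib)
 also have "... = (\<Prod>j\<in>J. lf (z j) ^ (min (card S) (m j) - ?c j))"
 proof (intro prod.cong refl)
  fix j assume "j : J"
  have "lf (z j) ^ min (card S) (m j) = lf (z j) ^ (min (card S) (m j) - ?c j) * lf (z j) ^ ?c j"
   using c'[OF \<open>j : J\<close>] by (simp flip: power_add)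
  thus "lf (z j) ^ min (card S) (m j) * geo (z j) ^ ?c j = lf (z j) ^ (min (card S) (m j) - ?c j)"
   by (simp add: mult.assoc flip: power_mult_distrib) (simp add: lf_geo)
 qed
 finally have eq: "qser J z m (card S) * (\<Prod>i\<in>S. geo (z (p i))) =
   (\<Prod>j\<in>J. lf (z j) ^ (min (card S) (m j) - ?c j))" .
 have "(\<Sum>j\<in>J. ?c j) = (\<Sum>j\<in>J. \<Sum>i\<in>{i\<in>S. p i = j}. 1)" by simp
 also have "... = (\<Sum>i\<in>S. 1)" by (rule sum.group) (use J S p in auto)
 finally have "(\<Sum>j\<in>J. ?c j) = card S" by simp
 moreover have "(\<Sum>j\<in>J. min (card S) (m j) - ?c j) + (\<Sum>j\<in>J. ?c j) = (\<Sum>j\<in>J. min (card S) (m j))"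
  using c' by (simp flip: sum.distrib)
 ultimately have "s > (\<Sum>j\<in>J. min (card S) (m j) - ?c j)" using s by simp
 moreover have "trunc (\<Sum>j\<in>J. min (card S) (m j) - ?c j) (\<Prod>j\<in>J. lf (z j) ^ (min (card S) (m j) - ?c j))"
  by (intro trunc_prod trunc_lf_power)
 ultimately show ?thesis unfolding eq by (simp add: trunc_def)
qed

text \<open>A deformed complete homogeneous polynomial: the part of degree \<open>s\<close> is the
  complete homogeneous polynomial in the variables \<open>S\<close>, and \<open>qser\<close>
  supplies the lower terms.\<close>

definition hpol :: "'j set => ('j => complex) => ('j => nat) => nat set => nat => pol" where
 "hpol J z m S s = fps_nth (qser J (\<lambda>j. pconst (z j)) m (card S) * (\<Prod>i\<in>S. geo (pvar i))) s"

text \<open>The part of the ideal generated by the \<open>hpol\<close> that is reachable without any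
  summand exceeding degree \<open>d - e\<close>. Plain ideal membership would allow higher terms
  that cancel, whereas later every summand has to become a word of degree at most
  \<open>d\<close>.\<close>

inductive_set hideal :: "'j set => ('j => complex) => ('j => nat) => nat => nat => nat => pol set"
 for J z m r e d where
 hideal_zero: "0 : hideal J z m r e d"
| hideal_add: "f : hideal J z m r e d ==> g : hideal J z m r e d ==> f + g : hideal J z m r e d"
| hideal_gen: "S <= {..<r} ==> S ~= {} ==> (\<Sum>j\<in>J. min (card S) (m j)) < card S + s ==>
  (\<And>i. i \<ge> r ==> a i = 0) ==> (\<Sum>i<r. a i) + s + e <= d ==>
  single a c * hpol J z m S s : hideal J z m r e d"

lemma hideal_single_mult:
 assumes "f : hideal J z m r e d" "\<And>i. i \<ge> r ==> b i = 0" "(\<Sum>i<r. b i) + e' <= d'"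
 shows "single b c * f : hideal J z m r (e + e') (d + d')"
 using assms(1)
proof induction
 case hideal_zero thus ?case by (simp add: hideal.hideal_zero)
next
 case (hideal_add f g) thus ?case by (simp add: distrib_left hideal.hideal_add)
next
 case (hideal_gen S s a c')
 have "single (b + a) (c * c') * hpol J z m S s : hideal J z m r (e + e') (d + d')"
  by (rule hideal.hideal_gen) (use hideal_gen assms(2,3) in \<open>auto simp: sum.distrib\<close>)
 thus ?case by (simp add: mult_single flip: mult.assoc)
qed

lemma hideal_mult:
 assumes f: "f : hideal J z m r e d" and g: "g : pol_le r e' d'"
 shows "g * f : hideal J z m r (e + e') (d + d')"
proof (induction g rule: single_induct)
 case zero thus ?case by (simp add: hideal.hideal_zero)
next
 case (add a c h)
 have "(\<forall>i\<ge>r. a i = 0) \<and> (\<Sum>i<r. a i) + e' <= d'" using g add(1) by (auto simp: pol_le_def)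
 hence "single a c * f : hideal J z m r (e + e') (d + d')" by (intro hideal_single_mult[OF f]) auto
 thus ?case using add(2) by (simp add: distrib_right hideal.hideal_add)
qed

lemma hideal_sum: "(\<And>i. i : I ==> f i : hideal J z m r e d) ==> (\<Sum>i\<in>I. f i) : hideal J z m r e d"
 by (induction I rule: infinite_finite_induct) (auto intro: hideal.intros)

lemma hideal_hpol: "S <= {..<r} ==> S ~= {} ==> (\<Sum>j\<in>J. min (card S) (m j)) < card S + s ==>
  s + e <= d ==> hpol J z m S s : hideal J z m r e d"
 using hideal_gen[where S = S and r = r and J = J and m = m and s = s and a = 0 and e = e and d = d and z = z and c = 1] by simp

lemma fdeg_le_qser: "fdeg_le r (qser J (\<lambda>j. pconst (z j)) m q)"
 unfolding qser_def by (intro fdeg_le_prod fdeg_le_power fdeg_le_lf pol_le_pconst) auto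

lemma fdeg_le_prod_geo: "S <= {..<r} ==> fdeg_le r (\<Prod>i\<in>S. geo (pvar i))"
 by (intro fdeg_le_prod fdeg_le_geo pol_le_pvar) auto

definition fps_eval :: "nat => (nat => complex) => pol fps => complex fps" where
 "fps_eval r x F = Abs_fps (\<lambda>n. pol_eval r x (fps_nth F n))"

lemma fps_eval_mult: "fps_eval r x (F * G) = fps_eval r x F * fps_eval r x G"
 by (rule fps_ext) (simp add: fps_eval_def fps_mult_nth pol_eval_sum pol_eval_mult)
lemma fps_eval_1: "fps_eval r x 1 = 1"
 by (rule fps_ext) (simp add: fps_eval_def pol_eval_1 pol_eval_simps)
lemma fps_eval_prod: "fps_eval r x (\<Prod>i\<in>I. F i) = (\<Prod>i\<in>I. fps_eval r x (F i))"
 by (induction I rule: infinite_finite_induct) (auto simp: fps_eval_mult fps_eval_1)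
lemma fps_eval_power: "fps_eval r x (F ^ n) = fps_eval r x F ^ n"
 by (induction n) (auto simp: fps_eval_mult fps_eval_1)
lemma fps_eval_lf: "fps_eval r x (lf a) = lf (pol_eval r x a)"
 by (rule fps_ext) (simp add: fps_eval_def lf_nth pol_eval_simps pol_eval_1)
lemma pol_eval_power: "pol_eval r x (a ^ n) = pol_eval r x a ^ n"
 by (induction n) (auto simp: pol_eval_mult pol_eval_1)
lemma fps_eval_geo: "fps_eval r x (geo a) = geo (pol_eval r x a)"
 by (rule fps_ext) (simp add: fps_eval_def geo_def pol_eval_power)

lemma pol_eval_hpol:
 assumes "S <= {..<r}"
 shows "pol_eval r x (hpol J z m S s) = fps_nth (qser J z m (card S) * (\<Prod>i\<in>S. geo (x i))) s"
proof -
 have "pol_eval r x (hpol J z m S s) =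
   fps_nth (fps_eval r x (qser J (\<lambda>j. pconst (z j)) m (card S) * (\<Prod>i\<in>S. geo (pvar i)))) s"
  by (simp add: hpol_def fps_eval_def)
 also have "fps_eval r x (\<Prod>i\<in>S. geo (pvar i)) = (\<Prod>i\<in>S. geo (x i))" unfolding fps_eval_prod fps_eval_geo
  by (intro prod.cong refl arg_cong[of _ _ geo]) (use assms in \<open>auto intro: pol_eval_pvar\<close>)
 hence "fps_eval r x (qser J (\<lambda>j. pconst (z j)) m (card S) * (\<Prod>i\<in>S. geo (pvar i))) =
   qser J z m (card S) * (\<Prod>i\<in>S. geo (x i))"
  by (simp add: fps_eval_mult qser_def fps_eval_prod fps_eval_power fps_eval_lf pol_eval_simps)
 finally show ?thesis .
qed

text \<open>Letters \<open>0, ..., r - 1\<close> distributed over the tensor factors, no more on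
  factor \<open>j\<close> than it has slots.\<close>

definition admissible :: "'j set => ('j => nat) => nat => (nat => 'j) => bool" where
 "admissible J m r p \<longleftrightarrow> (\<forall>i<r. p i : J) \<and> (\<forall>j\<in>J. card {i\<in>{..<r}. p i = j} <= m j)"

lemma hideal_vanish:
 assumes "f : hideal J z m r e d" "finite J" "admissible J m r p"
 shows "pol_eval r (\<lambda>i. z (p i)) f = 0"
 using assms(1)
proof induction
 case (hideal_gen S s a c)
 have fin: "finite S" using hideal_gen(1) finite_subset by blast
 have "fps_nth (qser J z m (card S) * (\<Prod>i\<in>S. geo (z (p i)))) s = 0"
 proof (rule qser_geo_vanish)
  fix j assume j: "j : J"
  have "card {i\<in>S. p i = j} <= card {i\<in>{..<r}. p i = j}" by (rule card_mono) (use hideal_gen(1) in auto)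
  also have "... <= m j" using assms(3) j by (simp add: admissible_def)
  finally show "card {i\<in>S. p i = j} <= m j" .
 qed (use assms hideal_gen fin in \<open>auto simp: admissible_def\<close>)
 thus ?case by (simp add: pol_eval_mult pol_eval_hpol[OF hideal_gen(1)])
qed (simp_all add: pol_eval_simps)

text \<open>Division with remainder by a linear polynomial in the last variable: the remainder is
  its value at \<open>c\<close>, and the quotient loses one degree, recorded in the offset.\<close>

lemma pol_split_last:
 assumes "g : pol_le (Suc r) e d"
 shows "\<exists>g0\<in>pol_le r e d. \<exists>g1\<in>pol_le (Suc r) (e + 1) d. g = g0 + (pvar r - pconst c) * g1"
proof (induction g rule: single_induct)
 case zero
 show ?case by (intro bexI[of _ 0]) auto
next
 case (add a b h)
 define u where "u = (\<lambda>i::nat. if i = r then 1::nat else 0)"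
 \<comment> \<open>Induction on the exponent \<open>k\<close> of the last variable \<open>x\<close>,
   through \<open>x^(k+1) = c x^k + (x - c) x^k\<close>.\<close>
 have step: "\<exists>g0\<in>pol_le r e d. \<exists>g1\<in>pol_le (Suc r) (e + 1) d.
   single (a0 + (\<lambda>i. k * u i)) b = g0 + (pvar r - pconst c) * g1"
  if "\<forall>i\<ge>r. a0 i = 0" "(\<Sum>i<r. a0 i) + k + e <= d" for a0 k using that
 proof (induction k)
  case 0
  have "single a0 b : pol_le r e d" using 0 by (auto intro: pol_le_single)
  moreover have "a0 + (\<lambda>i. 0 * u i) = a0" by (simp add: fun_eq_iff)
  ultimately show ?case by (metis (no_types, lifting) add.right_neutral mult_zero_right pol_le_zero)
 next
  case (Suc k)
  have "(\<Sum>i<r. a0 i) + k + e <= d" using Suc.prems(2) by simp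
  from Suc.IH[OF Suc.prems(1) this] obtain g0 g1 where g: "g0 : pol_le r e d"
   "g1 : pol_le (Suc r) (e + 1) d"
   "single (a0 + (\<lambda>i. k * u i)) b = g0 + (pvar r - pconst c) * g1" by blast
  let ?s = "single (a0 + (\<lambda>i. k * u i)) b"
  have "a0 + (\<lambda>i. Suc k * u i) = u + (a0 + (\<lambda>i. k * u i))" by (simp add: fun_eq_iff)
  hence "single (a0 + (\<lambda>i. Suc k * u i)) b = pvar r * ?s" by (simp add: pvar_def mult_single u_def)
  also have "... = pconst c * ?s + (pvar r - pconst c) * ?s" by (simp add: algebra_simps)
  also have "... = pconst c * (g0 + (pvar r - pconst c) * g1) + (pvar r - pconst c) * ?s" by (simp only: g(3))
  also have "... = pconst c * g0 + (pvar r - pconst c) * (pconst c * g1 + ?s)" by (simp add: algebra_simps)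
  finally have eq: "single (a0 + (\<lambda>i. Suc k * u i)) b = ..." .
  have "pconst c * g0 : pol_le r e d" using pol_le_mult[OF pol_le_pconst[of 0 0 c r] g(1)] by simp
  moreover have "pconst c * g1 : pol_le (Suc r) (e + 1) d" using pol_le_mult[OF pol_le_pconst[of 0 0 c "Suc r"] g(2)] by simp
  moreover have "?s : pol_le (Suc r) (e + 1) d" by (rule pol_le_single) (use Suc(2,3) in \<open>auto simp: u_def\<close>)
  ultimately show ?case using eq pol_le_add by blast
 qed
 have a: "\<forall>i\<ge>Suc r. a i = 0" "(\<Sum>i<r. a i) + a r + e <= d" using assms add(1) by (auto simp: pol_le_def)
 have "a = a(r := 0) + (\<lambda>i. a r * u i)" by (auto simp: fun_eq_iff u_def)
 moreover have "\<forall>i\<ge>r. (a(r := 0)) i = 0" using a(1) by auto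
 moreover have "(\<Sum>i<r. (a(r := 0)) i) = (\<Sum>i<r. a i)" by (intro sum.cong) auto
 ultimately obtain g0 g1 where g: "g0 : pol_le r e d" "g1 : pol_le (Suc r) (e + 1) d"
   "single a b = g0 + (pvar r - pconst c) * g1" using step[of "a(r:=0)" "a r"] a(2) by metis
 from add(2) obtain h0 h1 where h: "h0 : pol_le r e d" "h1 : pol_le (Suc r) (e + 1) d"
   "h = h0 + (pvar r - pconst c) * h1" by auto
 show ?case
 proof (intro bexI)
  show "single a b + h = (g0 + h0) + (pvar r - pconst c) * (g1 + h1)" by (simp only: g(3) h(3)) (simp add: algebra_simps)
 qed (use g h in \<open>auto intro: pol_le_add\<close>)
qed

section \<open>Nodal polynomials in the last variable\<close>

abbreviation nodal :: "('j => complex) => 'j set => nat => pol" where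
 "nodal z A v \<equiv> \<Prod>j\<in>A. (pvar v - pconst (z j))"

lemma nodal_le: "v < r ==> nodal z A v : pol_le r 0 (card A)"
 using pol_le_prod[of A "\<lambda>j. pvar v - pconst (z j)" r "\<lambda>_. 1"]
 by (simp add: pol_le_diff pol_le_pvar pol_le_pconst)

text \<open>Since \<open>X (x - c) = lf c - lf x\<close> and \<open>lf x * geo x = 1\<close>, each
  linear factor of the nodal polynomial is traded, together with one power of \<open>X\<close>, for
  a numerator \<open>lf (z j)\<close>, up to a remainder of degree below
  \<open>card A\<close>.\<close>

lemma nodal_geo:
 assumes "finite A" "v < r"
 shows "\<exists>R. fdeg_le r R \<and> (\<forall>t\<ge>card A. fps_nth R t = 0) \<and>
  fps_X ^ card A * fps_const (nodal z A v) * geo (pvar v) =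
   (\<Prod>j\<in>A. lf (pconst (z j))) * geo (pvar v) + R" using assms(1)
proof (induction A rule: finite_induct)
 case empty
 show ?case by (intro exI[of _ 0]) (auto simp: fdeg_le_def)
next
 case (insert j A)
 let ?x = "pvar v" and ?c = "pconst (z j)" and ?P = "\<Prod>j\<in>A. lf (pconst (z j))"
 from insert obtain R where R: "fdeg_le r R" "\<forall>t\<ge>card A. fps_nth R t = 0"
  "fps_X ^ card A * fps_const (nodal z A v) * geo ?x = ?P * geo ?x + R" by auto
 let ?R = "(lf ?c - lf ?x) * R - ?P"
 have xc: "fps_X * fps_const (?x - ?c) = lf ?c - lf ?x" by (simp add: lf_def algebra_simps flip: fps_const_sub)
 have "fps_X ^ card (insert j A) * fps_const (nodal z (insert j A) v) * geo ?x =
   (fps_X * fps_const (?x - ?c)) * (fps_X ^ card A * fps_const (nodal z A v) * geo ?x)"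
  using insert by (simp add: mult_ac flip: fps_const_mult)
 also have "... = (lf ?c - lf ?x) * (?P * geo ?x + R)" by (simp only: xc R(3))
 also have "... = lf ?c * ?P * geo ?x + (lf ?c - lf ?x) * R - ?P * (lf ?x * geo ?x)" by (simp add: algebra_simps)
 also have "... = (\<Prod>j\<in>insert j A. lf (pconst (z j))) * geo ?x + ?R" using insert by (simp add: lf_geo)
 finally have eq: "fps_X ^ card (insert j A) * fps_const (nodal z (insert j A) v) * geo ?x = ..." .
 have "fdeg_le r ?R" by (intro fdeg_le_diff fdeg_le_mult R(1) fdeg_le_prod fdeg_le_lf pol_le_pconst pol_le_pvar)
   (use assms in auto)
 moreover have "fps_nth ?R t = 0" if "t \<ge> card (insert j A)" for t
 proof -
  have t: "t > card A" using that insert by simp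
  have "trunc (card A) ?P" using trunc_prod[of A "\<lambda>_. 1" "\<lambda>j. lf (pconst (z j))"] trunc_lf by auto
  hence "fps_nth ?P t = 0" using t by (simp add: trunc_def)
  moreover have "fps_nth ((lf ?c - lf ?x) * R) t = 0" unfolding xc[symmetric] using t R(2) by (cases t) (auto simp: mult.assoc)
  ultimately show ?thesis by simp
 qed
 ultimately show ?case using eq by blast
qed

text \<open>Placing the last variable at \<open>z i\<close> lowers \<open>m i\<close> by one. A
  generator for the lowered data, multiplied by the nodal polynomial of the values \<open>A\<close>
  already treated, is a combination of generators for \<open>m\<close> up to a multiple of the next
  nodal polynomial. Treating large multiplicities early is essential: once \<open>card S\<close> is
  at least \<open>m i\<close>, every \<open>j\<close> with \<open>m j > card S\<close> must lie in
  \<open>A\<close>.\<close>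

lemma nodal_hpol_step:
 assumes J: "finite J" "A <= J" "i : J" "i \<notin> A" "m i > 0"
  and up: "\<And>j. j : J ==> j \<notin> A ==> m j <= m i"
  and S: "S <= {..<r}" "S ~= {}"
  and s: "(\<Sum>j\<in>J. min (card S) ((m(i := m i - 1)) j)) < card S + s"
 shows "\<exists>g\<in>pol_le (Suc r) 1 s. nodal z A r * hpol J z (m(i := m i - 1)) S s
   - nodal z (insert i A) r * g : hideal J z m (Suc r) 0 (s + card A)"
proof -
 let ?m = "m(i := m i - 1)" and ?q = "card S" and ?x = "pvar r"
 have finS: "finite S" using S(1) finite_subset by blast
 have finA: "finite A" using J finite_subset by blast
 have S': "S <= {..<Suc r}" using S by auto
 show ?thesis
 proof (cases "?q < m i")
  case True
  \<comment> \<open>Truncation at \<open>card S\<close> hides the lowering of \<open>m i\<close>, so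
    both data have the same generator.\<close>
  hence eq: "min ?q (?m j) = min ?q (m j)" for j by (auto simp: min_def)
  hence "hpol J z ?m S s = hpol J z m S s" by (simp add: hpol_def qser_def)
  moreover have "nodal z A r * hpol J z m S s : hideal J z m (Suc r) (0 + 0) (s + card A)"
   by (intro hideal_mult nodal_le hideal_hpol) (use S S' s eq in auto)
  ultimately show ?thesis by (intro bexI[of _ 0]) auto
 next
  case False
  let ?zc = "\<lambda>j. pconst (z j)"
  let ?Q' = "qser J ?zc ?m ?q" and ?Q = "qser J ?zc m ?q" and ?H = "\<Prod>i\<in>S. geo (pvar i)"
  have sumQ: "(\<Sum>j\<in>J. min ?q (m j)) = (\<Sum>j\<in>J. min ?q (?m j)) + 1"
  proof -
   have "(\<Sum>j\<in>J. min ?q (m j)) = min ?q (m i) + (\<Sum>j\<in>J-{i}. min ?q (m j))" using J by (simp add: sum.remove)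
   moreover have "(\<Sum>j\<in>J. min ?q (?m j)) = min ?q (?m i) + (\<Sum>j\<in>J-{i}. min ?q (?m j))"
    using J by (simp add: sum.remove)
   moreover have "(\<Sum>j\<in>J-{i}. min ?q (?m j)) = (\<Sum>j\<in>J-{i}. min ?q (m j))" by (rule sum.cong) auto
   ultimately show ?thesis using False J by simp
  qed
  have QQ': "?Q = lf (?zc i) * ?Q'"
  proof -
   have "?Q = lf (?zc i) ^ min ?q (m i) * (\<Prod>j\<in>J-{i}. lf (?zc j) ^ min ?q (m j))"
    unfolding qser_def using J by (simp add: prod.remove)
   moreover have "?Q' = lf (?zc i) ^ min ?q (?m i) * (\<Prod>j\<in>J-{i}. lf (?zc j) ^ min ?q (?m j))"
    unfolding qser_def using J by (simp add: prod.remove)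
   moreover have "(\<Prod>j\<in>J-{i}. lf (?zc j) ^ min ?q (?m j)) = (\<Prod>j\<in>J-{i}. lf (?zc j) ^ min ?q (m j))"
    by (rule prod.cong) auto
   moreover have "lf (?zc i) ^ min ?q (m i) = lf (?zc i) * lf (?zc i) ^ min ?q (?m i)"
   proof -
    have "min ?q (m i) = Suc (min ?q (?m i))" using False J by simp
    thus ?thesis by (simp only: power_Suc)
   qed
   ultimately show ?thesis by (simp add: mult.assoc)
  qed
  \<comment> \<open>The new variable enters by inserting \<open>1 = lf x * geo x\<close> and writing
    \<open>lf x = lf (z i) - X (x - z i)\<close>; the factor \<open>x - z i\<close> completes the
    next nodal polynomial.\<close>
  let ?E = "fps_X * (?Q' * ?H * geo ?x)"
  have "?Q' * ?H = ?Q' * ?H * (lf ?x * geo ?x)" by (simp add: lf_geo)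
  also have "... = ?Q * ?H * geo ?x + ?Q' * ?H * geo ?x * (lf ?x - lf (?zc i))" by (simp add: QQ' algebra_simps)
  also have "lf ?x - lf (?zc i) = - (fps_X * fps_const (?x - ?zc i))" by (simp add: lf_def algebra_simps flip: fps_const_sub)
  finally have e0: "?Q' * ?H = ?Q * ?H * geo ?x + ?Q' * ?H * geo ?x * - (fps_X * fps_const (?x - ?zc i))" .
  have alg: "a + b * - (X * c) = a - c * (X * b)" for a b c X :: "pol fps" by (simp add: algebra_simps)
  have e1: "?Q' * ?H = ?Q * ?H * geo ?x - fps_const (?x - ?zc i) * ?E" by (rule trans[OF e0 alg])
  let ?g = "- fps_nth ?E s"
  have "hpol J z ?m S s = fps_nth (?Q * ?H * geo ?x - fps_const (?x - ?zc i) * ?E) s" unfolding hpol_def by (rule arg_cong[OF e1])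
  hence h0: "hpol J z ?m S s = fps_nth (?Q * ?H * geo ?x) s - (?x - ?zc i) * fps_nth ?E s"
   by (simp only: fps_sub_nth fps_mult_left_const_nth)
  have nI: "nodal z (insert i A) r = (?x - ?zc i) * nodal z A r" using finA J by simp
  have alg2: "N * (a - c * E) - c * N * - E = N * a" for N a c E :: pol by (simp add: algebra_simps)
  have degE: "fdeg_le (Suc r) (?Q' * ?H * geo ?x)"
   by (intro fdeg_le_mult fdeg_le_qser fdeg_le_prod_geo fdeg_le_geo pol_le_pvar S') auto
  have g: "?g : pol_le (Suc r) 1 s"
  proof (cases s)
   case (Suc s')
   have "fps_nth (?Q' * ?H * geo ?x) s' : pol_le (Suc r) 0 s'" using degE by (simp add: fdeg_le_def)
   hence "fps_nth (?Q' * ?H * geo ?x) s' : pol_le (Suc r) 1 s" by (rule pol_le_mono) (use Suc in auto)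
   thus ?thesis by (simp add: Suc pol_le_uminus)
  qed simp
  have "nodal z A r * hpol J z ?m S s - nodal z (insert i A) r * ?g =
    nodal z A r * fps_nth (?Q * ?H * geo ?x) s" unfolding h0 nI by (rule alg2)
  also have "... = fps_nth (fps_X ^ card A * fps_const (nodal z A r) * geo ?x * (?Q * ?H)) (s + card A)"
  proof -
   have "fps_X ^ card A * fps_const (nodal z A r) * geo ?x * (?Q * ?H) =
    fps_X ^ card A * (fps_const (nodal z A r) * (?Q * ?H * geo ?x))" by (simp add: mult_ac)
   thus ?thesis by (simp only: fps_X_power_mult_nth) simp
  qed
  finally have e2: "nodal z A r * hpol J z ?m S s - nodal z (insert i A) r * ?g = ..." .
  obtain R where R: "fdeg_le (Suc r) R" "\<forall>t\<ge>card A. fps_nth R t = 0"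
   "fps_X ^ card A * fps_const (nodal z A r) * geo ?x = (\<Prod>j\<in>A. lf (?zc j)) * geo ?x + R"
   using nodal_geo[OF finA, of r "Suc r" z] by auto
  \<comment> \<open>These are the \<open>j\<close> whose exponent in \<open>qser\<close> grows when
    one more variable joins \<open>S\<close>.\<close>
  define B where "B = {j\<in>J. m j > ?q}"
  have BA: "B <= A" unfolding B_def using up False by force
  have finB: "finite B" using BA finA finite_subset by blast
  have "(\<Prod>j\<in>A. lf (?zc j)) = (\<Prod>j\<in>A - B. lf (?zc j)) * (\<Prod>j\<in>B. lf (?zc j))"
   using BA finA by (rule prod.subset_diff)
  moreover have "qser J ?zc m (Suc ?q) = ?Q * (\<Prod>j\<in>B. lf (?zc j))"
  proof -
   have "(\<Prod>j\<in>B. lf (?zc j)) = (\<Prod>j\<in>J. if m j > ?q then lf (?zc j) else 1)"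
    unfolding B_def using J by (simp add: prod.inter_filter)
   hence "?Q * (\<Prod>j\<in>B. lf (?zc j)) =
     (\<Prod>j\<in>J. lf (?zc j) ^ min ?q (m j) * (if m j > ?q then lf (?zc j) else 1))" by (simp only: qser_def prod.distrib)
   also have "... = qser J ?zc m (Suc ?q)"
    unfolding qser_def by (rule prod.cong) (auto simp: min_def mult.commute not_less_eq_eq dest: antisym)
   finally show ?thesis by simp
  qed
  moreover have cI: "card (insert r S) = Suc ?q" using S finS by (subst card_insert_disjoint) auto
  moreover have "(\<Prod>i\<in>insert r S. geo (pvar i)) = geo ?x * ?H" using S finS by (subst prod.insert) auto
  ultimately have e3: "(\<Prod>j\<in>A. lf (?zc j)) * geo ?x * (?Q * ?H) = (\<Prod>j\<in>A - B. lf (?zc j)) *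
    (qser J ?zc m (card (insert r S)) * (\<Prod>i\<in>insert r S. geo (pvar i)))" by (simp add: mult_ac)
  have sumB: "(\<Sum>j\<in>J. min (Suc ?q) (m j)) = (\<Sum>j\<in>J. min ?q (m j)) + card B"
  proof -
   have "card B = (\<Sum>j\<in>J. if m j > ?q then 1 else 0)" unfolding B_def using J by (simp add: sum.inter_filter[symmetric])
   hence "(\<Sum>j\<in>J. min ?q (m j)) + card B = (\<Sum>j\<in>J. min ?q (m j) + (if m j > ?q then 1 else 0))"
    by (simp only: sum.distrib)
   also have "... = (\<Sum>j\<in>J. min (Suc ?q) (m j))" by (rule sum.cong) (auto simp: min_def)
   finally show ?thesis by simp
  qed
  have trAB: "trunc (card (A - B)) (\<Prod>j\<in>A - B. lf (?zc j))"
   using trunc_prod[of "A - B" "\<lambda>_. 1" "\<lambda>j. lf (?zc j)"] trunc_lf by auto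
  have cAB: "card A = card (A - B) + card B" using BA finA finB by (metis card_Diff_subset card_mono le_add_diff_inverse2)
  \<comment> \<open>The numerator left over from \<open>A - B\<close> has degree at most
    \<open>card (A - B)\<close>, so the generators of \<open>insert r S\<close> that occur still
    have a degree above their bound.\<close>
  have h1: "fps_nth ((\<Prod>j\<in>A. lf (?zc j)) * geo ?x * (?Q * ?H)) (s + card A)
    : hideal J z m (Suc r) 0 (s + card A)" unfolding e3 fps_mult_nth[of "\<Prod>j\<in>A - B. lf (?zc j)"] hpol_def[symmetric]
  proof (rule hideal_sum)
   fix t assume t: "t : {0..s + card A}"
   show "fps_nth (\<Prod>j\<in>A - B. lf (?zc j)) t * hpol J z m (insert r S) (s + card A - t)
     : hideal J z m (Suc r) 0 (s + card A)"
   proof (cases "t > card (A - B)")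
    case True
    thus ?thesis using trAB by (simp add: trunc_def hideal.hideal_zero)
   next
    case f: False
    have "fdeg_le (Suc r) (\<Prod>j\<in>A - B. lf (?zc j))" by (intro fdeg_le_prod fdeg_le_lf pol_le_pconst) auto
    hence "fps_nth (\<Prod>j\<in>A - B. lf (?zc j)) t : pol_le (Suc r) 0 t" by (simp add: fdeg_le_def)
    moreover have "hpol J z m (insert r S) (s + card A - t) : hideal J z m (Suc r) 0 (s + card A - t)"
     by (rule hideal_hpol) (use S s sumQ sumB cAB f cI in auto)
    ultimately have "fps_nth (\<Prod>j\<in>A - B. lf (?zc j)) t * hpol J z m (insert r S) (s + card A - t)
     : hideal J z m (Suc r) (0 + 0) ((s + card A - t) + t)" by (intro hideal_mult)
    thus ?thesis using t by simp
   qed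
  qed
  \<comment> \<open>As \<open>R\<close> has degree below \<open>card A\<close>, only generators of
    \<open>S\<close> of degree greater than \<open>s\<close> occur; this one unit pays for the extra
    numerator factor counted in \<open>sumQ\<close>.\<close>
  have h2: "fps_nth (R * (?Q * ?H)) (s + card A) : hideal J z m (Suc r) 0 (s + card A)"
   unfolding fps_mult_nth[of R] hpol_def[symmetric]
  proof (rule hideal_sum)
   fix t assume t: "t : {0..s + card A}"
   show "fps_nth R t * hpol J z m S (s + card A - t) : hideal J z m (Suc r) 0 (s + card A)"
   proof (cases "t \<ge> card A")
    case True
    thus ?thesis using R(2) by (simp add: hideal.hideal_zero)
   next
    case f: False
    have "fps_nth R t : pol_le (Suc r) 0 t" using R(1) by (simp add: fdeg_le_def)
    moreover have "hpol J z m S (s + card A - t) : hideal J z m (Suc r) 0 (s + card A - t)"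
     by (rule hideal_hpol) (use S S' s sumQ f in auto)
    ultimately have "fps_nth R t * hpol J z m S (s + card A - t)
     : hideal J z m (Suc r) (0 + 0) ((s + card A - t) + t)" by (intro hideal_mult)
    thus ?thesis using t by simp
   qed
  qed
  have "nodal z A r * hpol J z ?m S s - nodal z (insert i A) r * ?g : hideal J z m (Suc r) 0 (s + card A)"
   unfolding e2 R(3) using hideal_add[OF h1 h2] by (simp add: algebra_simps)
  thus ?thesis using g by blast
 qed
qed

text \<open>Linear extension of the step for one generator. The offset \<open>card A\<close> in the
  hypothesis pays for the degree of the nodal factor.\<close>

lemma nodal_hideal_step:
 assumes "finite J" "A <= J" "i : J" "i \<notin> A" "m i > 0"
  and "\<And>j. j : J ==> j \<notin> A ==> m j <= m i"
  and "t : hideal J z (m(i := m i - 1)) r (card A + e) d"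
 shows "\<exists>g\<in>pol_le (Suc r) (card A + e + 1) d. nodal z A r * t - nodal z (insert i A) r * g
  : hideal J z m (Suc r) e d" using assms(7)
proof induction
 case hideal_zero
 show ?case by (intro bexI[of _ 0]) (auto intro: hideal.hideal_zero)
next
 case (hideal_add f h)
 then obtain a b where ab: "a : pol_le (Suc r) (card A + e + 1) d" "b : pol_le (Suc r) (card A + e + 1) d"
  "nodal z A r * f - nodal z (insert i A) r * a : hideal J z m (Suc r) e d"
  "nodal z A r * h - nodal z (insert i A) r * b : hideal J z m (Suc r) e d" by blast
 from hideal.hideal_add[OF ab(3,4)]
 have "nodal z A r * (f + h) - nodal z (insert i A) r * (a + b) : hideal J z m (Suc r) e d" by (simp add: algebra_simps)
 thus ?case using pol_le_add[OF ab(1,2)] by blast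
next
 case (hideal_gen S s a c)
 from nodal_hpol_step[OF assms(1-6) hideal_gen(1,2,3)] obtain g where
  g: "g : pol_le (Suc r) 1 s" "nodal z A r * hpol J z (m(i := m i - 1)) S s
   - nodal z (insert i A) r * g : hideal J z m (Suc r) 0 (s + card A)" by blast
 have sa: "single a c : pol_le (Suc r) 0 (\<Sum>i<r. a i)" by (rule pol_le_single) (use hideal_gen(4) in auto)
 have "single a c * (nodal z A r * hpol J z (m(i := m i - 1)) S s - nodal z (insert i A) r * g)
   : hideal J z m (Suc r) (0 + e) (s + card A + (d - (s + card A)))"
  by (rule hideal_single_mult[OF g(2)]) (use hideal_gen(4,5) in auto)
 moreover have "s + card A + (d - (s + card A)) = d" using hideal_gen(5) by simp
 ultimately have "nodal z A r * (single a c * hpol J z (m(i := m i - 1)) S s)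
   - nodal z (insert i A) r * (single a c * g) : hideal J z m (Suc r) e d" by (simp only: add_0) (simp add: algebra_simps)
 moreover have "single a c * g : pol_le (Suc r) (card A + e + 1) d"
  using pol_le_mult[OF sa g(1)] by (rule pol_le_mono) (use hideal_gen(5) in auto)
 ultimately show ?case by blast
qed

text \<open>Induction on the number of variables. The values of the last variable are removed one at
  a time in decreasing order of \<open>m\<close>: at stage \<open>A\<close>, \<open>f\<close> is the
  nodal polynomial of \<open>A\<close> times some \<open>g\<close> up to \<open>hideal\<close>. The
  remainder of \<open>g\<close> modulo \<open>x_r - z i\<close> vanishes at the points of the
  lowered data, so the induction hypothesis covers it. Once all values are removed, the nodal
  polynomial is itself a generator.\<close>

theorem vanishing_in_hideal:
 fixes z :: "'j => complex"
 assumes J: "finite J" "inj_on z J"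
  and "\<And>p. admissible J m r p ==> pol_eval r (\<lambda>i. z (p i)) f = 0"
  and "f : pol_le r e d"
 shows "f : hideal J z m r e d"
 using assms(3,4)
proof (induction r arbitrary: m e f)
 case 0
 have "a = 0" if "a : keys f" for a using 0(2) that by (auto simp: pol_le_def fun_eq_iff)
 hence k: "keys f <= {0}" by auto
 have "pol_eval 0 (\<lambda>i. z (undefined i)) f = 0" by (rule 0(1)) (auto simp: admissible_def)
 hence "lookup f 0 = 0" unfolding pol_eval_def using cplx.lin_ext_superset[OF _ k, of "\<lambda>a. \<Prod>i<0. _ i ^ a i"] by simp
 hence "f = 0" using k by (metis in_keys_iff keys_eq_empty subset_singletonD singletonI)
 thus ?case by (simp add: hideal_zero)
next
 case (Suc r)
 note outer_IH = Suc.IH and outer_prems = Suc.prems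
 define Jp where "Jp = {j\<in>J. m j > 0}"
 have fJp: "finite Jp" using J by (simp add: Jp_def)
 have "\<exists>A g. A <= Jp \<and> card A = l \<and> (\<forall>j\<in>A. \<forall>j'\<in>J - A. m j' <= m j) \<and>
   g : pol_le (Suc r) (card A + e) d \<and> f - nodal z A r * g : hideal J z m (Suc r) e d"
  if "l <= card Jp" for l using that
 proof (induction l)
  case 0
  thus ?case using Suc.prems(2) by (intro exI[of _ "{}"] exI[of _ f]) (auto intro: hideal_zero)
 next
  case (Suc l)
  then obtain A g where A: "A <= Jp" "card A = l" "\<forall>j\<in>A. \<forall>j'\<in>J - A. m j' <= m j"
   and g: "g : pol_le (Suc r) (card A + e) d" "f - nodal z A r * g : hideal J z m (Suc r) e d"
   by auto
  have finA: "finite A" using A fJp finite_subset by blast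
  have "Jp - A ~= {}" using Suc(2) A fJp by (metis Diff_eq_empty_iff card_mono finA not_less_eq_eq)
  then obtain i where i: "i : Jp - A" "\<And>j. j : Jp - A ==> m j <= m i"
  proof -
   have fin: "finite (m ` (Jp - A))" using fJp by simp
   have "Max (m ` (Jp - A)) : m ` (Jp - A)" by (rule Max_in[OF fin]) (use \<open>Jp - A ~= {}\<close> in simp)
   then obtain i where "i : Jp - A" "Max (m ` (Jp - A)) = m i" by auto
   thus ?thesis using Max_ge[OF fin] that[of i] by force
  qed
  have iJ: "i : J" "i \<notin> A" "m i > 0" using i by (auto simp: Jp_def)
  have up: "m j <= m i" if "j : J" "j \<notin> A" for j using i(2)[of j] that by (cases "m j > 0") (auto simp: Jp_def)
  let ?m = "m(i := m i - 1)"
  from pol_split_last[OF g(1), of "z i"] obtain g0 g1 where s: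
   "g0 : pol_le r (card A + e) d" "g1 : pol_le (Suc r) (card A + e + 1) d"
   "g = g0 + (pvar r - pconst (z i)) * g1" by blast
  have g0: "g0 : hideal J z ?m r (card A + e) d"
  proof (rule outer_IH)
   fix p assume p: "admissible J ?m r p"
   \<comment> \<open>An admissible point of the lowered data extends to one for \<open>m\<close> by
     sending the last variable to \<open>i\<close>.\<close>
   define p' where "p' = p(r := i)"
   have p': "admissible J m (Suc r) p'" unfolding admissible_def
   proof safe
    fix j assume j: "j : J"
    have "{a : {..<Suc r}. p' a = j} = {a : {..<r}. p a = j} \<union> (if j = i then {r} else {})"
     by (auto simp: p'_def less_Suc_eq)
    hence "card {a : {..<Suc r}. p' a = j} <= card {a : {..<r}. p a = j} + (if j = i then 1 else 0)"
     by (auto intro: order_trans[OF card_Un_le])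
    also have "... <= ?m j + (if j = i then 1 else 0)" using p j by (simp only: admissible_def) auto
    also have "... = m j" using iJ by auto
    finally show "card {a : {..<Suc r}. p' a = j} <= m j" .
   qed (use p iJ in \<open>auto simp: admissible_def p'_def less_Suc_eq\<close>)
   let ?x = "\<lambda>i. z (p' i)"
   have "pol_eval (Suc r) ?x f = 0" using outer_prems(1)[OF p'] .
   moreover have "pol_eval (Suc r) ?x (f - nodal z A r * g) = 0" by (rule hideal_vanish[OF g(2) J(1) p'])
   ultimately have "pol_eval (Suc r) ?x (nodal z A r * g) = 0" by (simp add: pol_eval_simps)
   moreover have "pol_eval (Suc r) ?x (nodal z A r) = (\<Prod>j\<in>A. z i - z j)"
    by (simp add: pol_eval_prod pol_eval_simps pol_eval_pvar p'_def)
   \<comment> \<open>The distinctness of the parameters enters here: it permits division by the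
     nodal value.\<close>
   moreover have "(\<Prod>j\<in>A. z i - z j) ~= 0" using finA iJ A(1) J(2) by (auto simp: Jp_def inj_on_def prod_zero_iff)
   ultimately have "pol_eval (Suc r) ?x g = 0" by (simp add: pol_eval_mult)
   hence "pol_eval (Suc r) ?x g0 = 0" unfolding s(3) by (simp add: pol_eval_simps pol_eval_mult pol_eval_pvar p'_def)
   hence "pol_eval r ?x g0 = 0" using pol_eval_Suc[OF s(1)] by simp
   thus "pol_eval r (\<lambda>i. z (p i)) g0 = 0" using pol_eval_cong[of r ?x "\<lambda>i. z (p i)" g0] by (simp add: p'_def)
  qed (rule s(1))
  have AJ: "A <= J" using A(1) by (auto simp: Jp_def)
  have "\<exists>g2\<in>pol_le (Suc r) (card A + e + 1) d.
    nodal z A r * g0 - nodal z (insert i A) r * g2 : hideal J z m (Suc r) e d" by (rule nodal_hideal_step[OF J(1) AJ iJ up g0])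
  then obtain g2 where g2: "g2 : pol_le (Suc r) (card A + e + 1) d"
   "nodal z A r * g0 - nodal z (insert i A) r * g2 : hideal J z m (Suc r) e d" by blast
  have nI: "nodal z (insert i A) r = (pvar r - pconst (z i)) * nodal z A r" using finA iJ by simp
  have eq1: "f - nodal z (insert i A) r * (g1 + g2) =
    (f - nodal z A r * g) + (nodal z A r * g0 - nodal z (insert i A) r * g2)" unfolding nI s(3) by (simp add: algebra_simps)
  have "f - nodal z (insert i A) r * (g1 + g2) : hideal J z m (Suc r) e d" unfolding eq1 by (rule hideal_add[OF g(2) g2(2)])
  moreover have "g1 + g2 : pol_le (Suc r) (card (insert i A) + e) d" using pol_le_add[OF s(2) g2(1)] finA iJ by simp
  moreover have "\<forall>j\<in>insert i A. \<forall>j'\<in>J - insert i A. m j' <= m j" using A(3) up by auto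
  ultimately show ?case using A finA iJ i by (intro exI[of _ "insert i A"] exI[of _ "g1 + g2"]) auto
 qed
 from this[OF order_refl] obtain A g where A: "A <= Jp" "card A = card Jp"
  and g: "g : pol_le (Suc r) (card A + e) d" "f - nodal z A r * g : hideal J z m (Suc r) e d" by blast
 have AJ: "A = Jp" using A fJp by (rule card_subset_eq[rotated])
 obtain R where R: "\<forall>t\<ge>card A. fps_nth R t = 0"
   "fps_X ^ card A * fps_const (nodal z A r) * geo (pvar r) = (\<Prod>j\<in>A. lf (pconst (z j))) * geo (pvar r) + R"
  using nodal_geo[of A r "Suc r" z] fJp AJ by auto
 have "fps_nth (fps_X ^ card A * (fps_const (nodal z A r) * geo (pvar r))) (card A) = nodal z A r"
  by (simp add: geo_def fps_X_power_mult_nth)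
 hence "fps_nth ((\<Prod>j\<in>A. lf (pconst (z j))) * geo (pvar r)) (card A) = nodal z A r" using R by (simp add: mult.assoc)
 moreover have "qser J (\<lambda>j. pconst (z j)) m 1 = (\<Prod>j\<in>A. lf (pconst (z j)))"
  unfolding qser_def AJ Jp_def using J by (auto simp: prod.inter_filter intro!: prod.cong)
 \<comment> \<open>For one variable, \<open>qser\<close> runs over the \<open>j\<close> with
   \<open>m j > 0\<close>, and by \<open>nodal_geo\<close> the coefficient at \<open>card A\<close>
   is the nodal polynomial.\<close>
 ultimately have "hpol J z m {r} (card A) = nodal z A r" by (simp add: hpol_def)
 moreover have "hpol J z m {r} (card A) : hideal J z m (Suc r) 0 (card A)"
 proof (rule hideal_hpol)
  have "card Jp = (\<Sum>j\<in>J. if m j > 0 then 1 else 0)"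
   unfolding Jp_def using J(1) by (simp add: sum.inter_filter[symmetric])
  also have "... = (\<Sum>j\<in>J. min (card {r}) (m j))" by (rule sum.cong) auto
  finally have "(\<Sum>j\<in>J. min (card {r}) (m j)) = card Jp" by simp
  thus "(\<Sum>j\<in>J. min (card {r}) (m j)) < card {r} + card A" using A by simp
 qed auto
 ultimately have "g * nodal z A r : hideal J z m (Suc r) (0 + (card A + e)) (card A + d)" using hideal_mult[OF _ g(1)] by metis
 moreover have "h : hideal J z m r' e d" if "h : hideal J z m r' (l + e) (l + d)" for h l r'
  using that by induction (auto intro: hideal.intros)
 ultimately have "nodal z A r * g : hideal J z m (Suc r) e d" by (simp add: mult.commute)
 from hideal_add[OF g(2) this] show ?case by simp
qed



section \<open>Matrices of the symplectic Lie algebra\<close>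

lemma vectorspaceI:
 fixes M :: "(complex, 'a, 'b) module_scheme"
 assumes "\<And>x y. x : carrier M ==> y : carrier M ==> x \<oplus>\<^bsub>M\<^esub> y : carrier M"
  and "\<zero>\<^bsub>M\<^esub> : carrier M"
  and "\<And>x y z. x : carrier M ==> y : carrier M ==> z : carrier M ==>
   (x \<oplus>\<^bsub>M\<^esub> y) \<oplus>\<^bsub>M\<^esub> z = x \<oplus>\<^bsub>M\<^esub> (y \<oplus>\<^bsub>M\<^esub> z)"
  and "\<And>x y. x : carrier M ==> y : carrier M ==> x \<oplus>\<^bsub>M\<^esub> y = y \<oplus>\<^bsub>M\<^esub> x"
  and "\<And>x. x : carrier M ==> \<zero>\<^bsub>M\<^esub> \<oplus>\<^bsub>M\<^esub> x = x"
  and "\<And>x. x : carrier M ==> \<exists>y\<in>carrier M. y \<oplus>\<^bsub>M\<^esub> x = \<zero>\<^bsub>M\<^esub>"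
  and "\<And>c x. x : carrier M ==> c \<odot>\<^bsub>M\<^esub> x : carrier M"
  and "\<And>a b x. x : carrier M ==> (a + b) \<odot>\<^bsub>M\<^esub> x = a \<odot>\<^bsub>M\<^esub> x \<oplus>\<^bsub>M\<^esub> b \<odot>\<^bsub>M\<^esub> x"
  and "\<And>c x y. x : carrier M ==> y : carrier M ==>
   c \<odot>\<^bsub>M\<^esub> (x \<oplus>\<^bsub>M\<^esub> y) = c \<odot>\<^bsub>M\<^esub> x \<oplus>\<^bsub>M\<^esub> c \<odot>\<^bsub>M\<^esub> y"
  and "\<And>a b x. x : carrier M ==> (a * b) \<odot>\<^bsub>M\<^esub> x = a \<odot>\<^bsub>M\<^esub> (b \<odot>\<^bsub>M\<^esub> x)"
  and "\<And>x. x : carrier M ==> 1 \<odot>\<^bsub>M\<^esub> x = x"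
 shows "vectorspace (class_ring :: complex ring) M"
proof -
 have f: "field (class_ring :: complex ring)" by (rule class_field)
 hence c: "cring (class_ring :: complex ring)" using field.axioms(1) domain.axioms(1) by blast
 have "abelian_group M" by (rule abelian_groupI) (use assms in auto)
 hence "Module.module (class_ring :: complex ring) M" using c by (intro moduleI) (use assms in auto)
 thus ?thesis using f by (simp add: vectorspace_def)
qed

text \<open>The index that the symplectic form pairs with \<open>a\<close>; \<open>sg\<close> is the
  sign of this pairing.\<close>

definition cj :: "nat => nat => nat" where "cj n a = (if a < n then a + n else a - n)"
definition sg :: "nat => nat => complex" where "sg n a = (if a < n then 1 else - 1)"

lemma cj_less: "a < 2 * n ==> cj n a < 2 * n"
 and cj_cj: "a < 2 * n ==> cj n (cj n a) = a"
 and sg_cj: "a < 2 * n ==> sg n (cj n a) = - sg n a"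
 and sg_sg: "sg n a * sg n a = 1"
 and cj_eq: "a < 2 * n ==> b < 2 * n ==> cj n a = b \<longleftrightarrow> a = cj n b"
 and cj_neq: "a < 2 * n ==> cj n a ~= a"
 by (auto simp: cj_def sg_def split: if_splits)

lemma symplectic_form_index:
 assumes "a < 2 * n" "b < 2 * n"
 shows "symplectic_form n $$ (a, b) = (if b = cj n a then sg n a else 0)"
 using assms by (auto simp: symplectic_form_def cj_def sg_def)

lemma symplectic_form_carrier: "symplectic_form n : mats n"
 using four_block_carrier_mat[of "0\<^sub>m n n" n n "0\<^sub>m n n" n n "1\<^sub>m n" "- 1\<^sub>m n"]
 by (simp add: symplectic_form_def mult_2)

lemma mat_mult_entry:
 assumes "A : carrier_mat k l" "B : carrier_mat l m" "a < k" "b < m"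
 shows "(A * B) $$ (a, b) = (\<Sum>i<l. A $$ (a, i) * B $$ (i, b))"
 using assms by (auto simp: scalar_prod_def atLeast0LessThan intro!: sum.cong)

text \<open>\<open>sp\<close> is the eigenspace for -1 of the involution that reflects position
  \<open>(a, b)\<close> to \<open>(cj n b, cj n a)\<close> with a sign.\<close>

lemma sp_iff:
 "X : spc n \<longleftrightarrow> X : mats n \<and>
  (\<forall>a<2 * n. \<forall>b<2 * n. X $$ (a, b) = - (sg n a * sg n b * X $$ (cj n b, cj n a)))"
proof (cases "X : mats n")
 case X: True
 let ?J = "symplectic_form n"
 have ent: "(transpose_mat X * ?J + ?J * X) $$ (a, b) = sg n a * X $$ (cj n a, b) - sg n b * X $$ (cj n b, a)"
  if a: "a < 2 * n" and b: "b < 2 * n" for a b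
 proof -
  have "(transpose_mat X * ?J) $$ (a, b) = (\<Sum>i<2*n. transpose_mat X $$ (a, i) * ?J $$ (i, b))"
   by (rule mat_mult_entry) (use X a b symplectic_form_carrier in auto)
  also have "... = (\<Sum>i<2*n. if i = cj n b then - (sg n b * X $$ (cj n b, a)) else 0)" using X a b by (intro sum.cong)
    (auto simp: symplectic_form_index cj_cj sg_cj cj_eq cj_less)
  finally have 1: "(transpose_mat X * ?J) $$ (a, b) = - (sg n b * X $$ (cj n b, a))" using b cj_less by simp
  have "(?J * X) $$ (a, b) = (\<Sum>i<2*n. ?J $$ (a, i) * X $$ (i, b))"
   by (rule mat_mult_entry) (use X a b symplectic_form_carrier in auto)
  also have "... = (\<Sum>i<2*n. if i = cj n a then sg n a * X $$ (cj n a, b) else 0)"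
   using a by (intro sum.cong) (auto simp: symplectic_form_index)
  finally have 2: "(?J * X) $$ (a, b) = sg n a * X $$ (cj n a, b)" using a cj_less by simp
  have "(transpose_mat X * ?J + ?J * X) $$ (a, b) = (transpose_mat X * ?J) $$ (a, b) + (?J * X) $$ (a, b)"
   by (rule index_add_mat(1)) (use X a b symplectic_form_carrier[of n] in auto)
  thus ?thesis using 1 2 by simp
 qed
 have "X : spc n \<longleftrightarrow> (\<forall>a<2 * n. \<forall>b<2 * n. sg n a * X $$ (cj n a, b) = sg n b * X $$ (cj n b, a))"
 proof
  assume "X : spc n"
  hence "transpose_mat X * ?J + ?J * X = 0\<^sub>m (2 * n) (2 * n)" by (simp add: sp_carrier_def)
  thus "\<forall>a<2 * n. \<forall>b<2 * n. sg n a * X $$ (cj n a, b) = sg n b * X $$ (cj n b, a)"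
   using ent by (metis diff_eq_diff_eq diff_self index_zero_mat(1) right_minus_eq)
 next
  assume *: "\<forall>a<2 * n. \<forall>b<2 * n. sg n a * X $$ (cj n a, b) = sg n b * X $$ (cj n b, a)"
  have "transpose_mat X * ?J + ?J * X = 0\<^sub>m (2 * n) (2 * n)"
   by (rule eq_matI) (use ent * X symplectic_form_carrier[of n] in auto)
  thus "X : spc n" using X by (simp add: sp_carrier_def)
 qed
 also have "... \<longleftrightarrow> (\<forall>a<2 * n. \<forall>b<2 * n. X $$ (a, b) = - (sg n a * sg n b * X $$ (cj n b, cj n a)))"
 proof (intro iffI allI impI)
  fix a b assume *: "\<forall>a<2 * n. \<forall>b<2 * n. sg n a * X $$ (cj n a, b) = sg n b * X $$ (cj n b, a)"
   and ab: "a < 2 * n" "b < 2 * n"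
  have "sg n (cj n a) * X $$ (cj n (cj n a), b) = sg n b * X $$ (cj n b, cj n a)"
   using *[rule_format, of "cj n a" b] ab cj_less by blast
  hence "- sg n a * X $$ (a, b) = sg n b * X $$ (cj n b, cj n a)" unfolding sg_cj[OF ab(1)] cj_cj[OF ab(1)] .
  moreover have "- (sg n a * (- sg n a * x)) = x" for x using sg_sg[of n a] by (simp flip: mult.assoc)
  ultimately show "X $$ (a, b) = - (sg n a * sg n b * X $$ (cj n b, cj n a))" by (metis mult.assoc)
 next
  fix a b assume *: "\<forall>a<2 * n. \<forall>b<2 * n. X $$ (a, b) = - (sg n a * sg n b * X $$ (cj n b, cj n a))"
   and ab: "a < 2 * n" "b < 2 * n"
  have "X $$ (cj n a, b) = - (sg n (cj n a) * sg n b * X $$ (cj n b, cj n (cj n a)))"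
   using *[rule_format, of "cj n a" b] ab cj_less by blast
  hence "X $$ (cj n a, b) = sg n a * sg n b * X $$ (cj n b, a)" using ab by (simp add: cj_cj sg_cj)
  thus "sg n a * X $$ (cj n a, b) = sg n b * X $$ (cj n b, a)" using sg_sg[of n a] by (metis mult.assoc mult_1)
 qed
 finally show ?thesis using X by simp
qed (simp add: sp_carrier_def)

lemma sp_carrierD: "X : spc n ==> X : mats n"
 by (simp add: sp_carrier_def)

lemma sp_dims: "X : spc n ==> dim_row X = 2 * n" "X : spc n ==> dim_col X = 2 * n"
 using sp_carrierD by auto

lemma sp_sym: "X : spc n ==> a < 2 * n ==> b < 2 * n ==>
  X $$ (a, b) = - (sg n a * sg n b * X $$ (cj n b, cj n a))" using sp_iff by blast

lemma sp_zero: "0\<^sub>m (2 * n) (2 * n) : spc n"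
 by (auto simp: sp_iff cj_less)

lemma sp_add:
 assumes "X : spc n" "Y : spc n"
 shows "X + Y : spc n"
proof -
 have c: "X : carrier_mat (2*n) (2*n)" "Y : carrier_mat (2*n) (2*n)" using assms sp_carrierD by auto
 have "(X + Y) $$ (a, b) = - (sg n a * sg n b * (X + Y) $$ (cj n b, cj n a))"
  if "a < 2 * n" "b < 2 * n" for a b
 proof -
  have "(X + Y) $$ (a, b) = X $$ (a, b) + Y $$ (a, b)" using c that by simp
  also have "... = - (sg n a * sg n b * (X $$ (cj n b, cj n a) + Y $$ (cj n b, cj n a)))"
   unfolding sp_sym[OF assms(1) that] sp_sym[OF assms(2) that] by (simp add: algebra_simps)
  finally show ?thesis using c that cj_less by simp
 qed
 thus ?thesis using c by (simp add: sp_iff)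
qed

lemma sp_smult:
 assumes "X : spc n"
 shows "c \<cdot>\<^sub>m X : spc n"
proof -
 have cc: "X : carrier_mat (2*n) (2*n)" using assms sp_carrierD by auto
 have "(c \<cdot>\<^sub>m X) $$ (a, b) = - (sg n a * sg n b * (c \<cdot>\<^sub>m X) $$ (cj n b, cj n a))"
  if "a < 2 * n" "b < 2 * n" for a b
 proof -
  have "(c \<cdot>\<^sub>m X) $$ (a, b) = c * X $$ (a, b)" using cc that by simp
  also have "... = - (sg n a * sg n b * (c * X $$ (cj n b, cj n a)))"
   unfolding sp_sym[OF assms(1) that] by (simp add: algebra_simps)
  finally show ?thesis using cc that cj_less by simp
 qed
 thus ?thesis using cc by (simp add: sp_iff)
qed

text \<open>The reflection reverses products and the two minus signs cancel; hence commutators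
  remain in \<open>sp\<close>.\<close>

lemma sp_mult_entry:
 assumes "X : spc n" "Y : spc n" "a < 2 * n" "b < 2 * n"
 shows "(X * Y) $$ (a, b) = sg n a * sg n b * (Y * X) $$ (cj n b, cj n a)"
proof -
 have c: "X : carrier_mat (2*n) (2*n)" "Y : carrier_mat (2*n) (2*n)" using assms sp_carrierD by auto
 have "(X * Y) $$ (a, b) = (\<Sum>k<2*n. X $$ (a, k) * Y $$ (k, b))" by (rule mat_mult_entry) (use c assms in auto)
 also have "... = (\<Sum>k<2*n. sg n a * sg n b * (Y $$ (cj n b, cj n k) * X $$ (cj n k, cj n a)))"
 proof (rule sum.cong)
  fix k assume k: "k : {..<2*n}"
  have "X $$ (a, k) * Y $$ (k, b) = sg n a * sg n b * (sg n k * sg n k) * (Y $$ (cj n b, cj n k) * X $$ (cj n k, cj n a))"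
   using k unfolding sp_sym[OF assms(1), of a k, OF assms(3) k[simplified]]
    sp_sym[OF assms(2), of k b, OF k[simplified] assms(4)] by simp
  thus "X $$ (a, k) * Y $$ (k, b) = sg n a * sg n b * (Y $$ (cj n b, cj n k) * X $$ (cj n k, cj n a))" by (simp add: sg_sg)
 qed simp
 also have "... = (\<Sum>k<2*n. sg n a * sg n b * (Y $$ (cj n b, k) * X $$ (k, cj n a)))"
  by (rule sum.reindex_bij_witness[of _ "cj n" "cj n"]) (auto simp: cj_less cj_cj)
 also have "... = sg n a * sg n b * (\<Sum>k<2*n. Y $$ (cj n b, k) * X $$ (k, cj n a))" by (simp add: sum_distrib_left)
 also have "(\<Sum>k<2*n. Y $$ (cj n b, k) * X $$ (k, cj n a)) = (Y * X) $$ (cj n b, cj n a)"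
  by (rule mat_mult_entry[symmetric]) (use c assms cj_less in auto)
 finally show ?thesis .
qed

abbreviation br :: "complex mat => complex mat => complex mat" where "br X Y \<equiv> X * Y - Y * X"

lemma sp_bracket:
 assumes "X : spc n" "Y : spc n"
 shows "br X Y : spc n"
proof -
 have c: "X : carrier_mat (2*n) (2*n)" "Y : carrier_mat (2*n) (2*n)" using assms sp_carrierD by auto
 have "br X Y $$ (a, b) = - (sg n a * sg n b * br X Y $$ (cj n b, cj n a))"
  if "a < 2 * n" "b < 2 * n" for a b
 proof -
  have "br X Y $$ (a, b) = (X * Y) $$ (a, b) - (Y * X) $$ (a, b)" by (rule index_minus_mat(1)) (use c that in auto)
  also have "... = - (sg n a * sg n b * ((X * Y) $$ (cj n b, cj n a) - (Y * X) $$ (cj n b, cj n a)))"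
   unfolding sp_mult_entry[OF assms that] sp_mult_entry[OF assms(2,1) that] by (simp add: algebra_simps)
  also have "(X * Y) $$ (cj n b, cj n a) - (Y * X) $$ (cj n b, cj n a) = br X Y $$ (cj n b, cj n a)"
   by (rule index_minus_mat(1)[symmetric]) (use c that cj_less in auto)
  finally show ?thesis .
 qed
 moreover have "br X Y : carrier_mat (2*n) (2*n)" using c by auto
 ultimately show ?thesis by (simp add: sp_iff)
qed

lemma sp_record [simp]: "carrier (sp n) = spc n" "\<zero>\<^bsub>sp n\<^esub> = 0\<^sub>m (2 * n) (2 * n)"
  "X \<oplus>\<^bsub>sp n\<^esub> Y = X + Y" "c \<odot>\<^bsub>sp n\<^esub> X = c \<cdot>\<^sub>m X" "bracket (sp n) X Y = br X Y"
 by (simp_all add: sp_def)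

lemma sp_vectorspace: "vectorspace (class_ring :: complex ring) (sp n)"
proof (rule vectorspaceI)
 show "\<exists>Y\<in>carrier (sp n). Y \<oplus>\<^bsub>sp n\<^esub> X = \<zero>\<^bsub>sp n\<^esub>" if "X : carrier (sp n)" for X
  by (rule bexI[of _ "(- 1) \<cdot>\<^sub>m X"]) (use that sp_carrierD[of X n] in \<open>auto intro: sp_smult\<close>)
qed (auto simp: sp_add sp_smult sp_zero distrib_left distrib_right mult.assoc add_ac
  sp_dims intro!: eq_matI)

lemma sp_module: "Module.module (class_ring :: complex ring) (sp n)"
 using sp_vectorspace vectorspace.axioms(1) by blast

lemma span_sp_closed:
 assumes "S <= spc n" "T = LinearCombinations.module.span (class_ring :: complex ring) (sp n) S"
 shows "T <= spc n" "0\<^sub>m (2 * n) (2 * n) : T" "X : T ==> Y : T ==> X + Y : T"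
  "X : T ==> c \<cdot>\<^sub>m X : T" "S <= T"
proof -
 have s: "LinearCombinations.submodule (class_ring :: complex ring) T (sp n)"
  unfolding assms(2) by (rule module.span_is_submodule[OF sp_module]) (use assms in simp)
 show "T <= spc n" "0\<^sub>m (2 * n) (2 * n) : T" "X : T ==> Y : T ==> X + Y : T"
   "X : T ==> c \<cdot>\<^sub>m X : T" using submodule.subset[OF s] submodule.zero_closed[OF s] submodule.m_closed[OF s, of X Y]
   submodule.smult_closed[OF s, of c X] by (auto simp: class_ring_simps)
 show "S <= T" unfolding assms(2) by (rule module.in_own_span[OF sp_module]) (use assms in simp)
qed

text \<open>An elementary matrix antisymmetrised under the reflection. For \<open>a = cj n b\<close>
  both terms agree and the result is twice an elementary matrix, which is the origin of the factor
  1/2 in \<open>ym\<close>.\<close>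

definition gm :: "nat => nat => nat => complex mat" where
 "gm n a b = mat (2 * n) (2 * n) (\<lambda>(i, j). (if i = a \<and> j = b then 1 else 0)
  - sg n a * sg n b * (if i = cj n b \<and> j = cj n a then 1 else 0))"

lemma gm_index: "i < 2 * n ==> j < 2 * n ==> gm n a b $$ (i, j) =
  (if i = a \<and> j = b then 1 else 0) - sg n a * sg n b * (if i = cj n b \<and> j = cj n a then 1 else 0)" by (simp add: gm_def)

lemma gm_carrier [simp]: "gm n a b : mats n"
 by (simp add: gm_def)

lemma gm_sp:
 assumes "a < 2 * n" "b < 2 * n"
 shows "gm n a b : spc n"
proof -
 have "gm n a b $$ (i, j) = - (sg n i * sg n j * gm n a b $$ (cj n j, cj n i))"
  if ij: "i < 2 * n" "j < 2 * n" for i j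
 proof -
  have e: "cj n j = a \<longleftrightarrow> j = cj n a" "cj n i = b \<longleftrightarrow> i = cj n b" "cj n j = cj n b \<longleftrightarrow> j = b"
    "cj n i = cj n a \<longleftrightarrow> i = a" using assms ij cj_cj by metis+
  have alg: "(if P then 1 else 0) - y * (if Q then 1 else 0) =
    - (x * ((if Q then 1 else 0) - y * (if P then 1 else 0)))"
   if "P ==> x * y = 1" "Q ==> x = y" for P Q and x y :: complex using that by (cases P; cases Q) (auto simp: algebra_simps)
  have P: "sg n i * sg n j * (sg n a * sg n b) = 1" if "i = a \<and> j = b"
   using that sg_sg[of n a] sg_sg[of n b] by (simp add: mult_ac)
  have Q: "sg n i * sg n j = sg n a * sg n b" if "i = cj n b \<and> j = cj n a" using that sg_cj assms by simp
  show ?thesis unfolding gm_index[OF ij] gm_index[OF cj_less[OF ij(2)] cj_less[OF ij(1)]] e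
   using alg[OF P Q] by (simp only: conj_commute)
 qed
 thus ?thesis by (simp add: sp_iff)
qed

lemma gm_swap:
 assumes "a < 2 * n" "b < 2 * n"
 shows "gm n a b = (- (sg n a * sg n b)) \<cdot>\<^sub>m gm n (cj n b) (cj n a)"
 by (rule eq_matI) (use assms in \<open>auto simp: gm_index cj_cj sg_cj gm_def algebra_simps\<close>,
  auto simp: sg_def)

text \<open>Antisymmetrising doubles an element of \<open>sp\<close>, so \<open>X\<close> is half
  the sum of its entries times the \<open>gm n a b\<close>. Only positions with a nonzero entry
  occur, which makes shape conditions on \<open>X\<close> usable in the step.\<close>

lemma sp_gm_induct [consumes 1, case_names zero add]:
 assumes X: "X : spc n"
  and zero: "P (0\<^sub>m (2 * n) (2 * n))"
  and add: "\<And>a b c Y. a < 2 * n ==> b < 2 * n ==> X $$ (a, b) ~= 0 ==> Y : spc n ==> P Y ==>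
   P (c \<cdot>\<^sub>m gm n a b + Y)"
 shows "P X"
proof -
 let ?I = "{..<2 * n} \<times> {..<2 * n}"
 define Z where "Z A = mat (2 * n) (2 * n) (\<lambda>ij. \<Sum>(a, b)\<in>A. X $$ (a, b) / 2 * gm n a b $$ ij)" for A
 have Z0: "Z {} = 0\<^sub>m (2 * n) (2 * n)" by (rule eq_matI) (auto simp: Z_def)
 have ZI: "Z (insert (a, b) A) = (X $$ (a, b) / 2) \<cdot>\<^sub>m gm n a b + Z A" if "finite A" "(a, b) \<notin> A" for a b A
  by (rule eq_matI) (use that in \<open>auto simp: Z_def gm_def\<close>)
 have "Z A : spc n \<and> P (Z A)" if "finite A" "A <= ?I" for A using that
 proof (induction A rule: finite_induct)
  case empty thus ?case using zero sp_zero by (simp add: Z0)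
 next
  case (insert x A)
  obtain a b where x: "x = (a, b)" by force
  have ZA: "Z A : spc n" "P (Z A)" using insert by auto
  have eq: "Z (insert x A) = (X $$ (a, b) / 2) \<cdot>\<^sub>m gm n a b + Z A" using insert ZI x by simp
  show ?case
  proof (cases "X $$ (a, b) = 0")
   case True
   hence "Z (insert x A) = Z A" unfolding eq by (intro eq_matI) (auto simp: Z_def gm_def)
   thus ?thesis using ZA by simp
  next
   case False
   thus ?thesis using insert x ZA unfolding eq by (auto intro!: add sp_add sp_smult gm_sp)
  qed
 qed
 from this[of ?I] have "P (Z ?I)" by simp
 moreover have "Z ?I = X"
 proof (rule eq_matI)
  fix i j assume "i < dim_row X" "j < dim_col X"
  hence ij: "i < 2 * n" "j < 2 * n" using sp_carrierD[OF X] by auto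
  have ij': "cj n i < 2 * n" "cj n j < 2 * n" using ij cj_less by auto
  have "Z ?I $$ (i, j) = (\<Sum>(a, b)\<in>?I. X $$ (a, b) / 2 * gm n a b $$ (i, j))" using ij by (simp add: Z_def)
  have alg: "c / 2 * ((if P then 1 else 0) - y * (if Q then 1 else 0)) =
    (if P then d / 2 else 0) + (if Q then - w / 2 else 0)"
   if "P ==> c = d" "Q ==> c * y = w" for P Q and c d w y :: complex using that by (cases P; cases Q) (auto simp: field_simps)
  note \<open>Z ?I $$ (i, j) = (\<Sum>(a, b)\<in>?I. X $$ (a, b) / 2 * gm n a b $$ (i, j))\<close>
  also have "(\<Sum>(a, b)\<in>?I. X $$ (a, b) / 2 * gm n a b $$ (i, j)) = (\<Sum>p\<in>?I. (if p = (i, j) then X $$ (i, j) / 2 else 0)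
    + (if p = (cj n j, cj n i) then - (sg n i * sg n j * X $$ (cj n j, cj n i)) / 2 else 0))"
  proof (rule sum.cong[OF refl], clarify)
   fix a b assume ab: "a < 2 * n" "b < 2 * n"
   have e: "i = cj n b \<longleftrightarrow> b = cj n i" "j = cj n a \<longleftrightarrow> a = cj n j" using ij ab cj_cj by metis+
   show "X $$ (a, b) / 2 * gm n a b $$ (i, j) = (if (a, b) = (i, j) then X $$ (i, j) / 2 else 0)
    + (if (a, b) = (cj n j, cj n i) then - (sg n i * sg n j * X $$ (cj n j, cj n i)) / 2 else 0)" unfolding gm_index[OF ij] e
    unfolding prod.inject
   proof (subst alg[where d = "X $$ (i, j)" and w = "sg n i * sg n j * X $$ (cj n j, cj n i)"])
    show "X $$ (a, b) = X $$ (i, j)" if "i = a \<and> j = b" using that by simp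
    show "X $$ (a, b) * (sg n a * sg n b) = sg n i * sg n j * X $$ (cj n j, cj n i)"
     if "b = cj n i \<and> a = cj n j" using that sg_cj ij by simp
   qed (auto simp: conj_commute)
  qed
  also have "... = X $$ (i, j) / 2 + - (sg n i * sg n j * X $$ (cj n j, cj n i)) / 2" using ij ij' by (simp add: sum.distrib)
  also have "... = X $$ (i, j)" using sp_sym[OF X ij] by simp
  finally show "Z ?I $$ (i, j) = X $$ (i, j)" .
 qed (use sp_carrierD[OF X] in \<open>auto simp: Z_def\<close>)
 ultimately show ?thesis by simp
qed



section \<open>Root vectors\<close>

text \<open>A matrix position of the raising root vector; the lowering root vector occupies the
  transposed position.\<close>

fun root_pair :: "nat => root_label => nat \<times> nat" where
 "root_pair n (Long p) = (p - 1, n + p - 1)"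
| "root_pair n (Plus i j) = (i - 1, n + j - 1)"
| "root_pair n (Minus i j) = (i - 1, j - 1)"

lemma root_pair_less:
 assumes "\<alpha> : pos_roots n" "root_pair n \<alpha> = (a, b)"
 shows "a < n" "b < 2 * n" "a ~= b"
 using assms by (auto simp: pos_roots_def)

lemma H'_index: "i < 2 * n ==> j < 2 * n ==> H' n p $$ (i, j) =
  (if i = j then (if i = p - 1 then 1 else if i = n + p - 1 then - 1 else 0) else 0)" by (auto simp: H'_def mat_diag_def)

lemma H'_carrier: "H' n p : mats n"
 by (auto simp: H'_def mat_diag_def)

lemma H'_dims [simp]: "dim_row (H' n p) = 2 * n" "dim_col (H' n p) = 2 * n"
 using H'_carrier[of n p] by auto

lemma H'_sp: "1 <= p ==> p <= n ==> H' n p : spc n"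
 unfolding sp_iff
proof (intro conjI allI impI H'_carrier)
 fix a b assume p: "1 <= p" "p <= n" and ab: "a < 2 * n" "b < 2 * n"
 have c: "cj n a < 2 * n" "cj n b < 2 * n" using ab cj_less by auto
 have h: "(if cj n a = p - 1 then 1 else if cj n a = n + p - 1 then - 1 else 0) =
   - (if a = p - 1 then 1 else if a = n + p - 1 then - 1 else (0::complex))"
  using p ab by (cases "a < n") (simp_all add: cj_def, arith+)
 show "H' n p $$ (a, b) = - (sg n a * sg n b * H' n p $$ (cj n b, cj n a))"
 proof (cases "a = b")
  case True
  show ?thesis unfolding True[symmetric] sg_sg H'_index[OF ab(1) ab(1)] H'_index[OF c(1) c(1)]
   by (simp only: h if_True simp_thms mult_1 minus_minus)
 next
  case False
  hence "cj n b ~= cj n a" using ab cj_cj by metis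
  thus ?thesis unfolding H'_index[OF ab] H'_index[OF c(2,1)] using False by simp
 qed
qed

lemma cartan_closed:
 "H' n ` {1..n} <= spc n" "cartan n <= spc n" "0\<^sub>m (2 * n) (2 * n) : cartan n"
 "X : cartan n ==> Y : cartan n ==> X + Y : cartan n" "X : cartan n ==> c \<cdot>\<^sub>m X : cartan n"
 "1 <= p ==> p <= n ==> H' n p : cartan n"
proof -
 show s: "H' n ` {1..n} <= spc n" using H'_sp by auto
 note c = span_sp_closed[OF s cartan_def]
 show "cartan n <= spc n" "0\<^sub>m (2 * n) (2 * n) : cartan n"
  "X : cartan n ==> Y : cartan n ==> X + Y : cartan n" "X : cartan n ==> c \<cdot>\<^sub>m X : cartan n" by (rule c; assumption)+
 show "1 <= p ==> p <= n ==> H' n p : cartan n" using c(5) by auto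
qed

lemma diagonal_in_cartan:
 assumes X: "X : spc n" and d: "\<And>a b. a < 2 * n ==> b < 2 * n ==> a ~= b ==> X $$ (a, b) = 0"
 shows "X : cartan n"
 using X
proof (induction X rule: sp_gm_induct)
 case zero show ?case by (rule cartan_closed)
next
 case (add a b c Y)
 have ab: "a = b" using d add(1,2,3) by blast
 have "gm n a b = (if a < n then 1 else - 1) \<cdot>\<^sub>m H' n (if a < n then a + 1 else a - n + 1)"
 proof (rule eq_matI)
  fix i j assume "i < dim_row ((if a < n then 1 else - 1) \<cdot>\<^sub>m H' n (if a < n then a + 1 else a - n + 1))"
   "j < dim_col ((if a < n then 1 else - 1) \<cdot>\<^sub>m H' n (if a < n then a + 1 else a - n + 1))"
  hence ij: "i < 2 * n" "j < 2 * n" by auto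
  show "gm n a b $$ (i, j) = ((if a < n then 1 else - 1) \<cdot>\<^sub>m H' n (if a < n then a + 1 else a - n + 1)) $$ (i, j)"
   using ij add(1) unfolding ab gm_index[OF ij] by (auto simp: index_smult_mat H'_index cj_def sg_def carrier_matD[OF H'_carrier])
 qed (auto simp: gm_def)
 hence "gm n a b : cartan n" using add(1) by (auto intro!: cartan_closed)
 thus ?case using add by (auto intro!: cartan_closed)
qed

lemma mat_diag_bracket_entry:
 assumes "D : carrier_mat m m" "X : carrier_mat m m" "a < m" "b < m"
  and d: "\<And>i j. i < m ==> j < m ==> i ~= j ==> D $$ (i, j) = 0"
 shows "br D X $$ (a, b) = (D $$ (a, a) - D $$ (b, b)) * X $$ (a, b)"
proof -
 have "(D * X) $$ (a, b) = (\<Sum>i<m. D $$ (a, i) * X $$ (i, b))" by (rule mat_mult_entry) (use assms in auto)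
 also have "... = (\<Sum>i<m. if i = a then D $$ (a, a) * X $$ (a, b) else 0)" by (rule sum.cong) (use d assms in auto)
 finally have 1: "(D * X) $$ (a, b) = D $$ (a, a) * X $$ (a, b)" using assms by simp
 have "(X * D) $$ (a, b) = (\<Sum>i<m. X $$ (a, i) * D $$ (i, b))" by (rule mat_mult_entry) (use assms in auto)
 also have "... = (\<Sum>i<m. if i = b then X $$ (a, b) * D $$ (b, b) else 0)" by (rule sum.cong) (use d assms in auto)
 finally have 2: "(X * D) $$ (a, b) = X $$ (a, b) * D $$ (b, b)" using assms by simp
 have "br D X $$ (a, b) = (D * X) $$ (a, b) - (X * D) $$ (a, b)" by (rule index_minus_mat(1)) (use assms in auto)
 thus ?thesis using 1 2 by (simp add: algebra_simps)
qed

text \<open>The weight of basis vector \<open>a\<close> at \<open>H' n (q + 1)\<close>; the matrix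
  position \<open>(a, b)\<close> has weight \<open>wt n q a - wt n q b\<close>.\<close>

definition wt :: "nat => nat => nat => int" where
 "wt n q a = (if a = q then 1 else if a = n + q then - 1 else 0)"

text \<open>A nonzero difference of two signed unit vectors determines the two vectors up to
  exchanging them with reversed signs. Testing at the four indices involved is enough.\<close>

lemma sign_pair_unique:
 fixes sa sb s0 s1 :: int and qa qb q0 q1 :: nat
 assumes e: "\<And>q. q : {qa, qb, q0, q1} ==> (if q = qa then sa else 0) - (if q = qb then sb else 0) =
   (if q = q0 then s0 else 0) - (if q = q1 then s1 else 0)"
  and s: "sa : {1, - 1}" "sb : {1, - 1}" "s0 : {1, - 1}" "s1 : {1, - 1}"
  and ne: "\<not> (q0 = q1 \<and> s0 = s1)"
 shows "(qa = q0 \<and> sa = s0 \<and> qb = q1 \<and> sb = s1) \<or> (qa = q1 \<and> sa = - s1 \<and> qb = q0 \<and> sb = - s0)"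
proof (cases "qa = qb")
 case t: True
 have "q0 = qa" using e[of qa] e[of q0] e[of q1] s ne t by (cases "q0 = qa"; cases "q1 = qa"; cases "q0 = q1") auto
 moreover have "q1 = qa" using e[of qa] e[of q0] e[of q1] s ne t calculation by (cases "q1 = qa") auto
 ultimately show ?thesis using e[of qa] s ne t by auto
next
 case f: False
 have "qa = q0 \<or> qa = q1" using e[of qa] s f by (auto split: if_splits)
 moreover have "qb = q0 \<or> qb = q1" using e[of qb] s f by (auto split: if_splits)
 ultimately consider "qa = q0" "qb = q1" | "qa = q1" "qb = q0" using f by auto
 thus ?thesis
 proof cases
  case 1 thus ?thesis using e[of qa] e[of qb] f by simp
 next
  case 2 thus ?thesis using e[of qa] e[of qb] f by simp
 qed
qed

text \<open>A nonzero weight occurs at one position and its reflection only; this is why root spaces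
  are one-dimensional.\<close>

lemma wt_pair_unique:
 assumes e: "\<And>q. q < n ==> wt n q a - wt n q b = wt n q a0 - wt n q b0"
  and lt: "a < 2 * n" "b < 2 * n" "a0 < 2 * n" "b0 < 2 * n" and ne: "a0 ~= b0"
 shows "(a = a0 \<and> b = b0) \<or> (a = cj n b0 \<and> b = cj n a0)"
proof -
 define bs where "bs x = (if x < n then x else x - n)" for x
 define s where "s x = (if x < n then 1 else - 1 :: int)" for x
 have bs: "bs x < n" if "x < 2 * n" for x using that by (auto simp: bs_def)
 have w: "wt n q x = (if q = bs x then s x else 0)" if "x < 2 * n" "q < n" for x q using that by (auto simp: wt_def bs_def s_def)
 have inj: "x = y" if "x < 2 * n" "y < 2 * n" "bs x = bs y" "s x = s y" for x y
  using that by (auto simp: bs_def s_def split: if_splits)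
 have c: "bs (cj n x) = bs x" "s (cj n x) = - s x" if "x < 2 * n" for x using that by (auto simp: bs_def s_def cj_def)
 have "(bs a = bs a0 \<and> s a = s a0 \<and> bs b = bs b0 \<and> s b = s b0) \<or>
   (bs a = bs b0 \<and> s a = - s b0 \<and> bs b = bs a0 \<and> s b = - s a0)"
 proof (rule sign_pair_unique)
  fix q assume "q : {bs a, bs b, bs a0, bs b0}"
  hence "q < n" using bs lt by auto
  thus "(if q = bs a then s a else 0) - (if q = bs b then s b else 0) =
    (if q = bs a0 then s a0 else 0) - (if q = bs b0 then s b0 else 0)" using e[of q] w lt by simp
 next
  show "\<not> (bs a0 = bs b0 \<and> s a0 = s b0)" using inj lt ne by blast
 qed (auto simp: s_def)
 thus ?thesis
 proof
  assume "bs a = bs a0 \<and> s a = s a0 \<and> bs b = bs b0 \<and> s b = s b0"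
  thus ?thesis using inj lt by blast
 next
  assume "bs a = bs b0 \<and> s a = - s b0 \<and> bs b = bs a0 \<and> s b = - s a0"
  hence "a = cj n b0" "b = cj n a0" using inj[of a "cj n b0"] inj[of b "cj n a0"] c[OF lt(3)] c[OF lt(4)] lt cj_less by auto
  thus ?thesis by blast
 qed
qed

lemma weight_space_support:
 assumes X: "X : weight_space n \<mu>" and a: "a < 2 * n" and b: "b < 2 * n" and ne: "X $$ (a, b) ~= 0"
  and q: "q < n"
 shows "\<mu> (H' n (q + 1)) = of_int (wt n q a - wt n q b)"
proof -
 have XC: "X : mats n" using X sp_carrierD by (auto simp: weight_space_def)
 have "br (H' n (q + 1)) X = \<mu> (H' n (q + 1)) \<cdot>\<^sub>m X"
  using X q cartan_closed(6)[of "q + 1" n] by (auto simp: weight_space_def)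
 hence "br (H' n (q + 1)) X $$ (a, b) = \<mu> (H' n (q + 1)) * X $$ (a, b)" using XC a b by simp
 moreover have "br (H' n (q + 1)) X $$ (a, b) =
   (H' n (q + 1) $$ (a, a) - H' n (q + 1) $$ (b, b)) * X $$ (a, b)"
  by (rule mat_diag_bracket_entry[OF H'_carrier XC a b]) (simp add: H'_index)
 moreover have "H' n (q + 1) $$ (a, a) = of_int (wt n q a)" "H' n (q + 1) $$ (b, b) = of_int (wt n q b)"
  by (simp_all add: H'_index[OF a a] H'_index[OF b b] wt_def)
 ultimately show ?thesis using ne by simp
qed

lemma root_functional_H':
 assumes \<alpha>: "\<alpha> : pos_roots n" and rp: "root_pair n \<alpha> = (a, b)" and q: "q < n"
 shows "root_functional \<alpha> (H' n (q + 1)) = of_int (wt n q a - wt n q b)"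
proof -
 have d: "\<delta> (Suc p) (H' n (q + 1)) = (if q = p then 1 else 0)" if "p < n" for p
  using \<delta>_H'[of "q + 1" n "Suc p"] that q by auto
 have w: "wt n q p = (if q = p then 1 else 0)" "wt n q (n + p) = (if q = p then - 1 else 0)" if "p < n" for p
  using that q by (auto simp: wt_def)
 show ?thesis
 proof (cases \<alpha>)
  case (Long p)
  then obtain p' where "p = Suc p'" "p' < n" using \<alpha> by (cases p) (auto simp: pos_roots_def)
  thus ?thesis using Long rp d[of p'] w[of p'] by auto
 next
  case (Plus i j)
  then obtain i' j' where "i = Suc i'" "j = Suc j'" "i' < n" "j' < n"
   using \<alpha> by (cases i; cases j) (auto simp: pos_roots_def)
  thus ?thesis using Plus rp d[of i'] w[of i'] d[of j'] w[of j'] by auto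
 next
  case (Minus i j)
  then obtain i' j' where "i = Suc i'" "j = Suc j'" "i' < n" "j' < n"
   using \<alpha> by (cases i; cases j) (auto simp: pos_roots_def)
  thus ?thesis using Minus rp d[of i'] w[of i'] d[of j'] w[of j'] by auto
 qed
qed

lemma weight_vector_gm:
 assumes X: "X : weight_space n \<mu>"
  and \<mu>: "\<And>q. q < n ==> \<mu> (H' n (q + 1)) = of_int (wt n q a - wt n q b)"
  and ab: "a < 2 * n" "b < 2 * n" "a ~= b"
 shows "\<exists>c. X = c \<cdot>\<^sub>m gm n a b"
proof -
 have XS: "X : spc n" using X by (simp add: weight_space_def)
 have sup: "(i = a \<and> j = b) \<or> (i = cj n b \<and> j = cj n a)"
  if ij: "i < 2 * n" "j < 2 * n" "X $$ (i, j) ~= 0" for i j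
 proof (rule wt_pair_unique[OF _ ij(1,2) ab])
  fix q assume q: "q < n"
  have "(of_int (wt n q i - wt n q j) :: complex) = of_int (wt n q a - wt n q b)"
   using weight_space_support[OF X ij q] \<mu>[OF q] by simp
  thus "wt n q i - wt n q j = wt n q a - wt n q b" by (simp only: of_int_eq_iff)
 qed
 let ?g = "gm n a b $$ (a, b)"
 have g: "?g ~= 0"
 proof (cases "a = cj n b")
  case True
  hence "sg n a * sg n b = - 1" using sg_cj[OF ab(2)] sg_sg[of n b] by simp
  thus ?thesis unfolding gm_index[OF ab(1,2)] by simp
 next
  case False
  thus ?thesis unfolding gm_index[OF ab(1,2)] by simp
 qed
 have Xs: "X $$ (cj n b, cj n a) = - (sg n a * sg n b * X $$ (a, b))" using sp_sym[OF XS cj_less[OF ab(2)] cj_less[OF ab(1)]]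
  unfolding cj_cj[OF ab(1)] cj_cj[OF ab(2)] sg_cj[OF ab(1)] sg_cj[OF ab(2)] by (simp add: mult_ac)
 have gs: "gm n a b $$ (cj n b, cj n a) = - (sg n a * sg n b * ?g)"
  using sp_sym[OF gm_sp[OF ab(1,2)] cj_less[OF ab(2)] cj_less[OF ab(1)]]
  unfolding cj_cj[OF ab(1)] cj_cj[OF ab(2)] sg_cj[OF ab(1)] sg_cj[OF ab(2)] by (simp add: mult_ac)
 have "X = (X $$ (a, b) / ?g) \<cdot>\<^sub>m gm n a b"
 proof (rule eq_matI)
  fix i j assume "i < dim_row ((X $$ (a, b) / ?g) \<cdot>\<^sub>m gm n a b)" "j < dim_col ((X $$ (a, b) / ?g) \<cdot>\<^sub>m gm n a b)"
  hence ij: "i < 2 * n" "j < 2 * n" by (auto simp: gm_def)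
  have R: "((X $$ (a, b) / ?g) \<cdot>\<^sub>m gm n a b) $$ (i, j) = X $$ (a, b) / ?g * gm n a b $$ (i, j)"
   using ij by (simp add: gm_def)
  consider "i = a \<and> j = b" | "i = cj n b \<and> j = cj n a"
   | "\<not> (i = a \<and> j = b)" "\<not> (i = cj n b \<and> j = cj n a)" by blast
  thus "X $$ (i, j) = ((X $$ (a, b) / ?g) \<cdot>\<^sub>m gm n a b) $$ (i, j)"
  proof cases
   case 1 thus ?thesis unfolding R using g by simp
  next
   case 2 hence "i = cj n b" "j = cj n a" by auto
   thus ?thesis unfolding R using g by (simp only: Xs gs) simp
  next
   case 3
   hence "X $$ (i, j) = 0" using sup ij by blast
   moreover have "gm n a b $$ (i, j) = 0" using 3 by (simp only: gm_index[OF ij] if_False) simp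
   ultimately show ?thesis unfolding R by simp
  qed
 qed (use sp_dims[OF XS] in \<open>auto simp: gm_def\<close>)
 thus ?thesis by blast
qed

lemma coroot_entry:
 assumes "\<alpha> : pos_roots n"
 shows "coroot n \<alpha> $$ (fst (root_pair n \<alpha>), fst (root_pair n \<alpha>)) = 1"
 using assms by (auto simp: pos_roots_def H'_def mat_diag_def)

text \<open>The weight forces multiples of \<open>gm\<close>, and neither scalar vanishes because
  the bracket is a coroot, which has a diagonal entry 1.\<close>

lemma chevalley_gm:
 assumes ch: "chevalley_generators n xp xm" and \<alpha>: "\<alpha> : pos_roots n" and rp: "root_pair n \<alpha> = (a, b)"
 shows "\<exists>c. c ~= 0 \<and> xp \<alpha> = c \<cdot>\<^sub>m gm n a b" "\<exists>c. c ~= 0 \<and> xm \<alpha> = c \<cdot>\<^sub>m gm n b a"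
proof -
 have ab: "a < 2 * n" "b < 2 * n" "a ~= b" "b ~= a" using root_pair_less[OF \<alpha> rp] by auto
 have c: "xp \<alpha> : weight_space n (root_functional \<alpha>)" "xm \<alpha> : weight_space n (\<lambda>h. - root_functional \<alpha> h)"
  "br (xp \<alpha>) (xm \<alpha>) = coroot n \<alpha>" using ch \<alpha> by (auto simp: chevalley_generators_def)
 obtain u where u: "xp \<alpha> = u \<cdot>\<^sub>m gm n a b"
  using weight_vector_gm[OF c(1) root_functional_H'[OF \<alpha> rp] ab(1,2,3)] by blast
 have "- root_functional \<alpha> (H' n (q + 1)) = of_int (wt n q b - wt n q a)" if "q < n" for q
  using root_functional_H'[OF \<alpha> rp that] by simp
 then obtain v where v: "xm \<alpha> = v \<cdot>\<^sub>m gm n b a" using weight_vector_gm[OF c(2) _ ab(2,1,4)] by blast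
 have e: "br (xp \<alpha>) (xm \<alpha>) $$ (a, a) = 1" using coroot_entry[OF \<alpha>] rp c(3) by simp
 have z: "0 \<cdot>\<^sub>m A = 0\<^sub>m (2 * n) (2 * n)" if "A : mats n" for A :: "complex mat"
  using that by (intro eq_matI) auto
 have "u ~= 0"
 proof
  assume "u = 0"
  hence "xp \<alpha> = 0\<^sub>m (2 * n) (2 * n)" using u z by simp
  moreover have "xm \<alpha> : mats n" using v by simp
  ultimately have "br (xp \<alpha>) (xm \<alpha>) = 0\<^sub>m (2 * n) (2 * n)" by (auto intro!: eq_matI)
  thus False using e ab by simp
 qed
 moreover have "v ~= 0"
 proof
  assume "v = 0"
  hence "xm \<alpha> = 0\<^sub>m (2 * n) (2 * n)" using v z by simp
  moreover have "xp \<alpha> : mats n" using u by simp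
  ultimately have "br (xp \<alpha>) (xm \<alpha>) = 0\<^sub>m (2 * n) (2 * n)" by (auto intro!: eq_matI)
  thus False using e ab by simp
 qed
 ultimately show "\<exists>c. c ~= 0 \<and> xp \<alpha> = c \<cdot>\<^sub>m gm n a b" "\<exists>c. c ~= 0 \<and> xm \<alpha> = c \<cdot>\<^sub>m gm n b a"
  using u v by blast+
qed

text \<open>Eigenvalues of a regular Cartan element on the natural representation: they decrease
  along \<open>0, ..., n - 1, 2n - 1, ..., n\<close> and skip 0. Position \<open>(a, b)\<close>
  belongs to a positive root exactly when \<open>hgt n a > hgt n b\<close>.\<close>

definition hgt :: "nat => nat => int" where
 "hgt n a = (if a < n then int n - int a else int a - int (2 * n))"

lemma hgt_cj: "a < 2 * n ==> hgt n (cj n a) = - hgt n a"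
 by (auto simp: hgt_def cj_def)

text \<open>Positions in the lower right block, and half of the upper right block, are not values of
  \<open>root_pair\<close>; their reflections are.\<close>

lemma root_of_pair:
 assumes "a < 2 * n" "b < 2 * n" "hgt n a > hgt n b"
 shows "\<exists>\<alpha>\<in>pos_roots n. root_pair n \<alpha> = (a, b) \<or> root_pair n \<alpha> = (cj n b, cj n a)"
proof -
 consider "a < n" "b < n" | "a < n" "b \<ge> n" | "a \<ge> n" "b < n" | "a \<ge> n" "b \<ge> n" by linarith
 thus ?thesis
 proof cases
  case 1
  hence "Minus (a + 1) (b + 1) : pos_roots n" using assms by (auto simp: pos_roots_def hgt_def)
  thus ?thesis by (intro bexI[of _ "Minus (a + 1) (b + 1)"]) auto
 next
  case 2
  consider "a = b - n" | "a < b - n" | "a > b - n" by linarith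
  thus ?thesis
  proof cases
   case l: 1
   hence "Long (a + 1) : pos_roots n" using 2 assms by (auto simp: pos_roots_def)
   thus ?thesis using l 2 by (intro bexI[of _ "Long (a + 1)"]) auto
  next
   case l: 2
   hence "Plus (a + 1) (b - n + 1) : pos_roots n" using 2 assms by (auto simp: pos_roots_def)
   thus ?thesis using l 2 by (intro bexI[of _ "Plus (a + 1) (b - n + 1)"]) auto
  next
   case l: 3
   hence "Plus (b - n + 1) (a + 1) : pos_roots n" using 2 assms by (auto simp: pos_roots_def)
   thus ?thesis using l 2 by (intro bexI[of _ "Plus (b - n + 1) (a + 1)"]) (auto simp: cj_def)
  qed
 next
  case 3 thus ?thesis using assms by (auto simp: hgt_def)
 next
  case 4
  hence "Minus (b - n + 1) (a - n + 1) : pos_roots n" using assms by (auto simp: pos_roots_def hgt_def)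
  thus ?thesis using 4 by (intro bexI[of _ "Minus (b - n + 1) (a - n + 1)"]) (auto simp: cj_def)
 qed
qed

lemma gm_upper_chevalley:
 assumes ch: "chevalley_generators n xp xm" and ab: "a < 2 * n" "b < 2 * n" "hgt n a > hgt n b"
 shows "\<exists>\<alpha>\<in>pos_roots n. \<exists>c. gm n a b = c \<cdot>\<^sub>m xp \<alpha>" "\<exists>\<alpha>\<in>pos_roots n. \<exists>c. gm n b a = c \<cdot>\<^sub>m xm \<alpha> \<and>
  (root_pair n \<alpha> = (a, b) \<or> root_pair n \<alpha> = (cj n b, cj n a))"
proof -
 obtain \<alpha> where \<alpha>: "\<alpha> : pos_roots n" "root_pair n \<alpha> = (a, b) \<or> root_pair n \<alpha> = (cj n b, cj n a)"
  using root_of_pair[OF ab] by blast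
 obtain a' b' where rp: "root_pair n \<alpha> = (a', b')" by force
 obtain u where u: "u ~= 0" "xp \<alpha> = u \<cdot>\<^sub>m gm n a' b'" using chevalley_gm(1)[OF ch \<alpha>(1) rp] by blast
 obtain v where v: "v ~= 0" "xm \<alpha> = v \<cdot>\<^sub>m gm n b' a'" using chevalley_gm(2)[OF ch \<alpha>(1) rp] by blast
 have one: "1 \<cdot>\<^sub>m A = A" for A :: "complex mat" by (rule eq_matI) auto
 have sm: "x \<cdot>\<^sub>m (y \<cdot>\<^sub>m A) = (x * y) \<cdot>\<^sub>m A" for x y and A :: "complex mat" by (rule eq_matI) auto
 have iu: "gm n a' b' = (1 / u) \<cdot>\<^sub>m xp \<alpha>" unfolding u(2) sm using u(1) one by simp
 have iv: "gm n b' a' = (1 / v) \<cdot>\<^sub>m xm \<alpha>" unfolding v(2) sm using v(1) one by simp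
 have "\<exists>c. gm n a b = c \<cdot>\<^sub>m gm n a' b'" "\<exists>c. gm n b a = c \<cdot>\<^sub>m gm n b' a'"
  using \<alpha>(2) rp one[of "gm n a b", symmetric] one[of "gm n b a", symmetric]
   gm_swap[OF ab(1,2)] gm_swap[OF ab(2,1)] by auto
 then obtain s s' where "gm n a b = s \<cdot>\<^sub>m gm n a' b'" "gm n b a = s' \<cdot>\<^sub>m gm n b' a'" by blast
 hence "gm n a b = (s * (1 / u)) \<cdot>\<^sub>m xp \<alpha>" "gm n b a = (s' * (1 / v)) \<cdot>\<^sub>m xm \<alpha>"
  by (simp_all only: iu iv sm)
 thus "\<exists>\<alpha>\<in>pos_roots n. \<exists>c. gm n a b = c \<cdot>\<^sub>m xp \<alpha>" "\<exists>\<alpha>\<in>pos_roots n. \<exists>c. gm n b a = c \<cdot>\<^sub>m xm \<alpha> \<and>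
  (root_pair n \<alpha> = (a, b) \<or> root_pair n \<alpha> = (cj n b, cj n a))" using \<alpha> by blast+
qed

lemma xp_xm_sp:
 assumes "chevalley_generators n xp xm" "\<alpha> : pos_roots n"
 shows "xp \<alpha> : spc n" "xm \<alpha> : spc n"
 using assms by (auto simp: chevalley_generators_def weight_space_def)

lemma n_plus_closed:
 assumes "chevalley_generators n xp xm"
 shows "n_plus n xp <= spc n" "0\<^sub>m (2 * n) (2 * n) : n_plus n xp"
  "X : n_plus n xp ==> Y : n_plus n xp ==> X + Y : n_plus n xp"
  "X : n_plus n xp ==> c \<cdot>\<^sub>m X : n_plus n xp" "\<alpha> : pos_roots n ==> xp \<alpha> : n_plus n xp"
proof -
 have s: "xp ` pos_roots n <= spc n" using xp_xm_sp[OF assms] by auto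
 note c = span_sp_closed[OF s n_plus_def]
 show "n_plus n xp <= spc n" "0\<^sub>m (2 * n) (2 * n) : n_plus n xp"
  "X : n_plus n xp ==> Y : n_plus n xp ==> X + Y : n_plus n xp"
  "X : n_plus n xp ==> c \<cdot>\<^sub>m X : n_plus n xp" by (rule c; assumption)+
 show "\<alpha> : pos_roots n ==> xp \<alpha> : n_plus n xp" using c(5) by auto
qed

lemma upper_in_n_plus:
 assumes ch: "chevalley_generators n xp xm" and X: "X : spc n"
  and up: "\<And>a b. a < 2 * n ==> b < 2 * n ==> X $$ (a, b) ~= 0 ==> hgt n a > hgt n b"
 shows "X : n_plus n xp"
 using X
proof (induction X rule: sp_gm_induct)
 case zero show ?case using n_plus_closed[OF ch] by blast
next
 case (add a b c Y)
 obtain \<alpha> d where "\<alpha> : pos_roots n" "gm n a b = d \<cdot>\<^sub>m xp \<alpha>"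
  using gm_upper_chevalley(1)[OF ch add(1,2) up[OF add(1,2,3)]] by blast
 hence "gm n a b : n_plus n xp" using n_plus_closed[OF ch] by metis
 thus ?case using add n_plus_closed[OF ch] by metis
qed



section \<open>Presentations of modules by vector spaces of finitely supported functions\<close>

text \<open>Operators on a subspace \<open>C\<close> without Lie relations: on representatives these
  hold only modulo a kernel.\<close>

locale lin_space = cvs sc
 for sc :: "complex => 'a::ab_group_add => 'a" +
 fixes L :: "'g lie_algebra" and C :: "'a set" and \<alpha> :: "'g => 'a => 'a"
 assumes C: "subsp C"
  and \<alpha>_closed: "x : carrier L ==> u : C ==> \<alpha> x u : C"
  and \<alpha>_add: "x : carrier L ==> \<alpha> x (u + w) = \<alpha> x u + \<alpha> x w"
  and \<alpha>_sc: "x : carrier L ==> \<alpha> x (sc c u) = sc c (\<alpha> x u)"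
begin

lemma \<alpha>_diff: "x : carrier L ==> \<alpha> x (u - w) = \<alpha> x u - \<alpha> x w"
 using \<alpha>_add[of x u "- w"] \<alpha>_sc[of x "- 1" w] by (simp add: sc_m1)

definition stable :: "'a set => bool" where
 "stable K \<longleftrightarrow> subsp K \<and> K <= C \<and> (\<forall>x\<in>carrier L. \<forall>u\<in>K. \<alpha> x u : K)"

definition ghull :: "'a set => 'a set" where "ghull S = \<Inter> {K. stable K \<and> S <= K}"

lemma stable_C: "stable C"
 by (simp add: stable_def C \<alpha>_closed)

lemma stable_ghull: "S <= C ==> stable (ghull S)"
 unfolding stable_def
proof (intro conjI ballI)
 assume S: "S <= C"
 show "subsp (ghull S)" by (rule subspI) (auto simp: ghull_def stable_def intro: subsp_zero subsp_add subsp_sc)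
 show "ghull S <= C" using stable_C S by (auto simp: ghull_def)
 show "\<alpha> x u : ghull S" if "x : carrier L" "u : ghull S" for x u using that by (auto simp: ghull_def stable_def)
qed

lemma ghull_subset: "S <= ghull S"
 by (auto simp: ghull_def)

lemma ghull_least: "stable K ==> S <= K ==> ghull S <= K"
 by (auto simp: ghull_def)

text \<open>\<open>M\<close> is the quotient of \<open>C\<close> by \<open>K\<close>, with
  \<open>ka\<close> as quotient map. Every module of the development is described in this way, so
  calculations take place with representatives and an isomorphism amounts to an equality of
  kernels.\<close>

definition presents :: "('a => 'b) => ('g, 'b) rep => 'a set => bool" where
 "presents ka M K \<longleftrightarrow> carrier M = ka ` C \<and> \<zero>\<^bsub>M\<^esub> = ka 0 \<and>
  (\<forall>u\<in>C. \<forall>w\<in>C. ka u \<oplus>\<^bsub>M\<^esub> ka w = ka (u + w)) \<and>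
  (\<forall>c. \<forall>u\<in>C. c \<odot>\<^bsub>M\<^esub> ka u = ka (sc c u)) \<and>
  (\<forall>x\<in>carrier L. \<forall>u\<in>C. act M x (ka u) = ka (\<alpha> x u)) \<and>
  K <= C \<and> (\<forall>u\<in>C. ka u = ka 0 \<longleftrightarrow> u : K)"

context
 fixes ka :: "'a => 'b" and M :: "('g, 'b) rep" and K
 assumes P: "presents ka M K"
begin

lemma pres_carrier: "carrier M = ka ` C"
 and pres_zero: "\<zero>\<^bsub>M\<^esub> = ka 0"
 and pres_add: "u : C ==> w : C ==> ka u \<oplus>\<^bsub>M\<^esub> ka w = ka (u + w)"
 and pres_smult: "u : C ==> c \<odot>\<^bsub>M\<^esub> ka u = ka (sc c u)"
 and pres_act: "x : carrier L ==> u : C ==> act M x (ka u) = ka (\<alpha> x u)"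
 and pres_K: "K <= C"
 and pres_ker: "u : C ==> ka u = ka 0 \<longleftrightarrow> u : K"
 using P by (simp_all add: presents_def)

lemma pres_C: "0 : C" "u : C ==> w : C ==> u + w : C" "u : C ==> w : C ==> u - w : C"
 "u : C ==> - u : C" "u : C ==> sc c u : C" using C by (auto intro: subsp_zero subsp_add subsp_diff subsp_minus subsp_sc)

lemma pres_vectorspace: "vectorspace (class_ring :: complex ring) M"
proof (rule vectorspaceI)
 show "\<exists>y\<in>carrier M. y \<oplus>\<^bsub>M\<^esub> x = \<zero>\<^bsub>M\<^esub>" if "x : carrier M" for x
 proof -
  obtain u where "u : C" "x = ka u" using \<open>x : carrier M\<close> pres_carrier by auto
  thus ?thesis using pres_carrier pres_zero pres_add[of "- u" u] pres_C(4)[of u] by (intro bexI[of _ "ka (- u)"]) auto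
 qed
qed (auto simp: pres_carrier pres_zero pres_add pres_smult pres_C sc_add sc_left sc_sc sc_one add_ac)

lemma pres_module: "Module.module (class_ring :: complex ring) M"
 using pres_vectorspace vectorspace.axioms(1) by blast

lemma pres_minus: "u : C ==> w : C ==> ka u \<ominus>\<^bsub>M\<^esub> ka w = ka (u - w)"
proof -
 assume u: "u : C" and w: "w : C"
 interpret M: Module.module "class_ring :: complex ring" M by (rule pres_module)
 have "ka (- w) \<oplus>\<^bsub>M\<^esub> ka w = \<zero>\<^bsub>M\<^esub>" using pres_add[of "- w" w] pres_C(4)[of w] w by (simp add: pres_zero)
 moreover have "ka w : carrier M" "ka (- w) : carrier M" using w pres_C(4)[of w] pres_carrier by auto
 ultimately have "\<ominus>\<^bsub>M\<^esub> ka w = ka (- w)" by (rule M.minus_equality)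
 thus ?thesis using pres_add[of u "- w"] u w pres_C(4)[of w] by (simp add: a_minus_def)
qed

lemma pres_eq: "u : C ==> w : C ==> ka u = ka w \<longleftrightarrow> u - w : K"
proof -
 assume u: "u : C" and w: "w : C"
 have "ka u = ka w \<longleftrightarrow> ka (u - w) = ka 0"
 proof
  assume "ka u = ka w"
  hence "ka u \<oplus>\<^bsub>M\<^esub> ka (- w) = ka w \<oplus>\<^bsub>M\<^esub> ka (- w)" by simp
  thus "ka (u - w) = ka 0" using pres_add[of _ "- w"] pres_C(4)[of w] u w by simp
 next
  assume "ka (u - w) = ka 0"
  hence "ka (u - w) \<oplus>\<^bsub>M\<^esub> ka w = ka 0 \<oplus>\<^bsub>M\<^esub> ka w" by simp
  thus "ka u = ka w" using pres_add[of _ w] pres_C(1) pres_C(3)[of u w] u w by simp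
 qed
 thus ?thesis using pres_ker pres_C u w by simp
qed

lemma pres_K_subsp: "subsp K"
proof (rule subspI)
 show "0 : K" using pres_ker[of 0] pres_C by simp
next
 fix x y assume "x : K" "y : K"
 hence "x : C" "y : C" "ka x = ka 0" "ka y = ka 0" using pres_ker pres_K by auto
 thus "x + y : K" using pres_ker pres_C pres_add by (metis add_0)
next
 fix c x assume "x : K"
 hence "x : C" "ka x = ka 0" using pres_ker pres_K by auto
 thus "sc c x : K" using pres_ker pres_C pres_smult by (metis sc_zero)
qed

lemma pres_K_stable: "stable K"
 unfolding stable_def
proof (intro conjI ballI pres_K_subsp pres_K)
 fix x u assume x: "x : carrier L" and "u : K"
 hence "u : C" "ka u = ka 0" using pres_ker pres_K by auto
 hence "ka (\<alpha> x u) = ka (\<alpha> x 0)" using pres_act x pres_C(1) by metis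
 also have "\<alpha> x 0 = 0" using \<alpha>_sc[OF x, of 0 0] by simp
 finally show "\<alpha> x u : K" using pres_ker \<alpha>_closed x \<open>u : C\<close> by blast
qed

lemma pres_lie_module:
 assumes "\<And>x y u. x : carrier L ==> y : carrier L ==> u : C ==>
   x \<oplus>\<^bsub>L\<^esub> y : carrier L \<and> \<alpha> (x \<oplus>\<^bsub>L\<^esub> y) u - (\<alpha> x u + \<alpha> y u) : K"
  and "\<And>c x u. x : carrier L ==> u : C ==> c \<odot>\<^bsub>L\<^esub> x : carrier L \<and> \<alpha> (c \<odot>\<^bsub>L\<^esub> x) u - sc c (\<alpha> x u) : K"
  and "\<And>x y u. x : carrier L ==> y : carrier L ==> u : C ==>
   bracket L x y : carrier L \<and> \<alpha> (bracket L x y) u - (\<alpha> x (\<alpha> y u) - \<alpha> y (\<alpha> x u)) : K"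
 shows "lie_module L M"
 unfolding lie_module_def lie_module_axioms_def
proof (intro conjI allI impI pres_vectorspace)
 fix x v assume x: "x : carrier L" and "v : carrier M"
 then obtain u where u: "u : C" "v = ka u" using pres_carrier by auto
 show "act M x v : carrier M" using u x pres_act \<alpha>_closed pres_carrier by auto
 fix c
 show "act M x (c \<odot>\<^bsub>M\<^esub> v) = c \<odot>\<^bsub>M\<^esub> act M x v"
  using u x by (simp add: pres_smult pres_act pres_C \<alpha>_closed \<alpha>_sc)
 show "act M (c \<odot>\<^bsub>L\<^esub> x) v = c \<odot>\<^bsub>M\<^esub> act M x v"
  using u x assms(2)[OF x u(1), of c] by (simp add: pres_smult pres_act pres_C \<alpha>_closed pres_eq)
next
 fix x v w assume x: "x : carrier L" and "v : carrier M" "w : carrier M"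
 then obtain u u' where u: "u : C" "v = ka u" "u' : C" "w = ka u'" using pres_carrier by auto
 show "act M x (v \<oplus>\<^bsub>M\<^esub> w) = act M x v \<oplus>\<^bsub>M\<^esub> act M x w"
  using u x by (simp add: pres_add pres_act pres_C \<alpha>_closed \<alpha>_add)
next
 fix x y v assume x: "x : carrier L" "y : carrier L" and "v : carrier M"
 then obtain u where u: "u : C" "v = ka u" using pres_carrier by auto
 show "act M (x \<oplus>\<^bsub>L\<^esub> y) v = act M x v \<oplus>\<^bsub>M\<^esub> act M y v"
  using u x assms(1)[OF x u(1)] by (simp add: pres_add pres_act pres_C \<alpha>_closed pres_eq)
 show "act M (bracket L x y) v = act M x (act M y v) \<ominus>\<^bsub>M\<^esub> act M y (act M x v)"
  using u x assms(3)[OF x u(1)] by (simp add: pres_minus pres_act pres_C \<alpha>_closed pres_eq)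
qed

lemma pres_stable_image:
 assumes "stable K'"
 shows "act_stable L (ka ` K') M"
proof -
 have K': "subsp K'" "K' <= C" "\<And>x u. x : carrier L ==> u : K' ==> \<alpha> x u : K'" using assms by (auto simp: stable_def)
 have "LinearCombinations.submodule (class_ring :: complex ring) (ka ` K') M"
 proof (rule submodule.intro[OF pres_module])
  show "ka ` K' <= carrier M" using K'(2) pres_carrier by auto
  show "v \<oplus>\<^bsub>M\<^esub> w : ka ` K'" if "v : ka ` K'" "w : ka ` K'" for v w
   using that K'(1,2) by (auto simp: pres_add subset_iff intro: subsp_add)
  show "\<zero>\<^bsub>M\<^esub> : ka ` K'" using K'(1) by (auto simp: pres_zero intro: subsp_zero)
  show "c \<odot>\<^bsub>M\<^esub> v : ka ` K'" if "v : ka ` K'" for c v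
   using that K'(1,2) by (auto simp: pres_smult subset_iff intro: subsp_sc)
 qed
 thus ?thesis using K' by (auto simp: act_stable_def pres_act subset_iff)
qed

lemma pres_stable_preimage:
 assumes "act_stable L N M"
 shows "stable {u : C. ka u : N}" "N = ka ` {u : C. ka u : N}" "K <= {u : C. ka u : N}"
proof -
 have s: "LinearCombinations.submodule (class_ring :: complex ring) N M"
  and a: "\<And>x v. x : carrier L ==> v : N ==> act M x v : N"
  using assms by (auto simp: act_stable_def)
 have N: "N <= carrier M" "ka 0 : N" "\<And>v w. v : N ==> w : N ==> v \<oplus>\<^bsub>M\<^esub> w : N"
  "\<And>c v. v : N ==> c \<odot>\<^bsub>M\<^esub> v : N"
  using submodule.subset[OF s] submodule.zero_closed[OF s] submodule.m_closed[OF s]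
   submodule.smult_closed[OF s] by (auto simp: pres_zero class_ring_simps)
 show "N = ka ` {u : C. ka u : N}" using N(1) pres_carrier by auto
 show "K <= {u : C. ka u : N}" using N(2) pres_K pres_ker by fastforce
 show "stable {u : C. ka u : N}" unfolding stable_def subsp_def using N a pres_C pres_add pres_smult pres_act \<alpha>_closed
  by (auto simp flip: pres_add pres_smult pres_act)
qed

text \<open>Submodules of \<open>M\<close> correspond to the stable subspaces that contain
  \<open>K\<close>, hence \<open>K\<close> joins the generators.\<close>

lemma pres_generated:
 assumes "S <= C"
 shows "generated_submodule L M (ka ` S) = ka ` ghull (K \<union> S)"
proof
 have KS: "K \<union> S <= C" using pres_K assms by auto
 show "generated_submodule L M (ka ` S) <= ka ` ghull (K \<union> S)" unfolding generated_submodule_def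
  using pres_stable_image[OF stable_ghull[OF KS]] ghull_subset[of "K \<union> S"] by blast
 have "ka ` ghull (K \<union> S) <= N" if N: "act_stable L N M" "ka ` S <= N" for N
 proof -
  have "ghull (K \<union> S) <= {u : C. ka u : N}" by (rule ghull_least) (use pres_stable_preimage[OF N(1)] N(2) assms in auto)
  thus ?thesis by auto
 qed
 thus "ka ` ghull (K \<union> S) <= generated_submodule L M (ka ` S)" unfolding generated_submodule_def by blast
qed

lemma pres_coset:
 assumes "K' <= C" "u : C"
 shows "ka ` K' +>\<^bsub>M\<^esub> ka u = ka ` {k + u | k. k : K'}"
 using assms by (auto simp: a_r_coset_def' pres_add subset_iff)

text \<open>The third isomorphism theorem: a quotient of a presented module is presented on the same
  space \<open>C\<close> by the larger kernel.\<close>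

lemma pres_quotient:
 assumes K': "stable K'" and KK': "K <= K'" and N: "N = ka ` K'"
 shows "presents (\<lambda>u. N +>\<^bsub>M\<^esub> ka u) (quotient_module M N) K'"
proof -
 have K'': "subsp K'" "K' <= C" "\<And>x u. x : carrier L ==> u : K' ==> \<alpha> x u : K'" using K' by (auto simp: stable_def)
 define ka' where "ka' u = N +>\<^bsub>M\<^esub> ka u" for u
 have ka': "ka' u = ka ` {k + u | k. k : K'}" if "u : C" for u unfolding ka'_def N using pres_coset[OF K''(2) that] .
 have el: "w : ka' u \<longleftrightarrow> (\<exists>k\<in>K'. w = ka (k + u))" if "u : C" for u w using ka'[OF that] by auto
 have eq: "ka' u = ka' w \<longleftrightarrow> u - w : K'" if u: "u : C" and w: "w : C" for u w
 proof
  assume "ka' u = ka' w"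
  moreover have "ka u : ka' u" using el[OF u, of "ka u"] subsp_zero[OF K''(1)] by force
  ultimately obtain k where k: "k : K'" "ka u = ka (k + w)" using el[OF w] by auto
  hence "u - (k + w) : K" using pres_eq u w K''(2) pres_C(2) by blast
  hence "(u - (k + w)) + k : K'" using KK' k subsp_add[OF K''(1)] by blast
  thus "u - w : K'" by (simp add: algebra_simps)
 next
  assume uw: "u - w : K'"
  have "\<exists>k'\<in>K'. k + u = k' + w" if "k : K'" for k
   using subsp_add[OF K''(1) that uw] by (intro bexI[of _ "k + (u - w)"]) auto
  moreover have "\<exists>k'\<in>K'. k + w = k' + u" if "k : K'" for k
   using subsp_diff[OF K''(1) that uw] by (intro bexI[of _ "k - (u - w)"]) (auto simp: algebra_simps)
  ultimately have "{k + u | k. k : K'} = {k + w | k. k : K'}" by blast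
  thus "ka' u = ka' w" using ka' u w by simp
 qed
 \<comment> \<open>Operations on cosets are unions over all representatives; as the result does not
   depend on the representative, the union is a single coset.\<close>
 have lift: "(\<Union>v\<in>ka' u. N +>\<^bsub>M\<^esub> f v) = ka' (g u)"
  if u: "u : C" and f: "\<And>w. w : C ==> f (ka w) = ka (g w)" and g: "\<And>w. w : C ==> g w : C"
   "\<And>k. k : K' ==> g (k + u) - g u : K'" for u f g
 proof -
  have "N +>\<^bsub>M\<^esub> f (ka (k + u)) = ka' (g u)" if k: "k : K'" for k
  proof -
   have ku: "k + u : C" using k K''(2) u pres_C(2) by blast
   thus ?thesis using f[OF ku] eq[OF g(1)[OF ku] g(1)[OF u]] g(2)[OF k] by (simp add: ka'_def)
  qed
  moreover have "ka' u = ka ` {k + u | k. k : K'}" "0 : K'" using ka' u K''(1) subsp_zero by auto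
  ultimately show ?thesis by auto
 qed
 have "carrier (quotient_module M N) = ka' ` C" by (auto simp: quotient_module_def A_RCOSETS_def' pres_carrier ka'_def)
 moreover have "\<zero>\<^bsub>quotient_module M N\<^esub> = ka' 0" using ka'[OF pres_C(1)] by (simp add: quotient_module_def N)
 moreover have "ka' u \<oplus>\<^bsub>quotient_module M N\<^esub> ka' w = ka' (u + w)" if u: "u : C" and w: "w : C" for u w
 proof -
  have "ka' u <+>\<^bsub>M\<^esub> ka' w = ka' (u + w)"
  proof (rule subset_antisym; rule subsetI)
   fix y assume "y : ka' u <+>\<^bsub>M\<^esub> ka' w"
   then obtain k k' where k: "k : K'" "k' : K'" "y = ka (k + u) \<oplus>\<^bsub>M\<^esub> ka (k' + w)"
    by (auto simp: set_add_def' el u w)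
   hence "y = ka ((k + u) + (k' + w))" using K''(2) u w pres_C(2) pres_add by (metis subsetD)
   also have "(k + u) + (k' + w) = (k + k') + (u + w)" by (simp add: algebra_simps)
   finally show "y : ka' (u + w)" using el[OF pres_C(2)[OF u w]] subsp_add[OF K''(1) k(1,2)] by blast
  next
   fix y assume "y : ka' (u + w)"
   then obtain k where k: "k : K'" "y = ka (k + (u + w))" using el[OF pres_C(2)[OF u w]] by auto
   hence "y = ka (k + u) \<oplus>\<^bsub>M\<^esub> ka (0 + w)" using K''(2) u w pres_C pres_add by (metis add.assoc add_0 subsetD)
   thus "y : ka' u <+>\<^bsub>M\<^esub> ka' w" using el[OF u] el[OF w] k subsp_zero[OF K''(1)] unfolding set_add_def' by blast
  qed
  thus ?thesis by (simp add: quotient_module_def)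
 qed
 moreover have "c \<odot>\<^bsub>quotient_module M N\<^esub> ka' u = ka' (sc c u)" if u: "u : C" for c u
  using lift[OF u, of "\<lambda>v. c \<odot>\<^bsub>M\<^esub> v" "sc c"] pres_smult pres_C(5) subsp_sc[OF K''(1)]
  by (simp add: quotient_module_def sc_add)
 moreover have "act (quotient_module M N) x (ka' u) = ka' (\<alpha> x u)" if "x : carrier L" and u: "u : C" for x u
  using lift[OF u, of "act M x" "\<alpha> x"] pres_act \<alpha>_closed K''(3) that by (simp add: quotient_module_def \<alpha>_add)
 moreover have "ka' u = ka' 0 \<longleftrightarrow> u : K'" if "u : C" for u using eq[OF that pres_C(1)] by simp
 ultimately show ?thesis unfolding presents_def ka'_def using K''(2) by auto
qed

end

text \<open>Both maps identify exactly the elements that differ by \<open>K\<close>, so sending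
  \<open>ka u\<close> to \<open>ka' u\<close> is well defined and injective.\<close>

lemma presents_isomorphic:
 assumes P: "presents ka M K" and P': "presents ka' M' K" and L: "lie_module L M" "lie_module L M'"
 shows "lie_module_isomorphic L M M'"
proof -
 define \<phi> where "\<phi> x = ka' (SOME u. u : C \<and> ka u = x)" for x
 have \<phi>: "\<phi> (ka u) = ka' u" if u: "u : C" for u
 proof -
  define w where "w = (SOME w. w : C \<and> ka w = ka u)"
  have "w : C \<and> ka w = ka u" unfolding w_def by (rule someI[of _ u]) (use u in simp)
  hence "ka' w = ka' u" using pres_eq[OF P, of w u] pres_eq[OF P', of w u] u by simp
  thus ?thesis by (simp add: \<phi>_def w_def)
 qed
 note s = pres_carrier[OF P] pres_carrier[OF P'] pres_add[OF P] pres_add[OF P'] pres_smult[OF P]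
  pres_smult[OF P'] pres_act[OF P] pres_act[OF P'] pres_C[OF P]
 have "\<phi> : LinearCombinations.module_hom (class_ring :: complex ring) M M'"
  unfolding LinearCombinations.module_hom_def by (auto simp: s \<phi>)
 hence "mod_hom (class_ring :: complex ring) M M' \<phi>"
  using pres_module[OF P] pres_module[OF P'] by (simp add: mod_hom_def mod_hom_axioms_def)
 moreover have "bij_betw \<phi> (carrier M) (carrier M')" unfolding bij_betw_def
 proof
  show "inj_on \<phi> (carrier M)" unfolding s inj_on_def using \<phi> pres_eq[OF P] pres_eq[OF P'] by auto
  show "\<phi> ` carrier M = carrier M'" unfolding s using \<phi> by (auto simp: image_image)
 qed
 moreover have "\<forall>x\<in>carrier L. \<forall>v\<in>carrier M. \<phi> (act M x v) = act M' x (\<phi> v)"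
  using \<phi> \<alpha>_closed by (auto simp: s)
 ultimately show ?thesis using L unfolding lie_module_isomorphic_def by blast
qed

end



section \<open>Words in a Lie algebra\<close>

definition FW :: "'g lie_algebra => ('g list \<Rightarrow>\<^sub>0 complex) set" where
 "FW L = {u. keys u <= lists (carrier L)}"

definition wact :: "'g => ('g list \<Rightarrow>\<^sub>0 complex) => ('g list \<Rightarrow>\<^sub>0 complex)" where
 "wact x = pm.lin_ext (\<lambda>ws. single (x # ws) 1)"

lemma wact_single [simp]: "wact x (single ws c) = single (x # ws) c"
 by (simp add: wact_def)
lemma wact_add: "wact x (u + w) = wact x u + wact x w"
 and wact_scale: "wact x (scale_pm c u) = scale_pm c (wact x u)"
 and wact_zero [simp]: "wact x 0 = 0"
 and wact_diff: "wact x (u - w) = wact x u - wact x w"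
 and wact_sum: "wact x (\<Sum>i\<in>I. f i) = (\<Sum>i\<in>I. wact x (f i))"
 by (simp_all add: wact_def pm.lin_ext_add pm.lin_ext_scale pm.lin_ext_diff pm.lin_ext_sum)

lemma FW_subsp: "pm.subsp (FW L)"
 by (rule pm.subspI)
  (auto simp: FW_def dest!: subsetD[OF Poly_Mapping.keys_add] subsetD[OF keys_scale_pm])

lemma fw_single: "ws : lists (carrier L) ==> single ws c : FW L"
 by (auto simp: FW_def)

lemma wact_closed: "x : carrier L ==> u : FW L ==> wact x u : FW L"
 unfolding wact_def by (rule pm.lin_ext_in[OF FW_subsp]) (auto simp: FW_def)

interpretation fw: lin_space scale_pm L "FW L" wact for L :: "'g lie_algebra"
 by unfold_locales (auto simp: FW_subsp wact_closed wact_add wact_scale)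

lemma fw_induct [consumes 1, case_names zero add]:
 assumes u: "u : FW L" and "P 0"
  and "\<And>ws c w. ws : lists (carrier L) ==> w : FW L ==> P w ==> P (single ws c + w)"
 shows "P u"
proof -
 have "u : FW L \<and> P u"
 proof (induction u rule: single_induct)
  case zero thus ?case using assms(2) pm.subsp_zero[OF FW_subsp] by auto
 next
  case (add a c g)
  hence "a : lists (carrier L)" using u by (auto simp: FW_def)
  thus ?case using add assms(3) fw_single pm.subsp_add[OF FW_subsp] by blast
 qed
 thus ?thesis by simp
qed

lemma fw_presents: "fw.presents L (\<lambda>u. u) (free_word_module L) {0}"
 unfolding fw.presents_def by (auto simp: free_word_module_def FW_def wact_def pm.lin_ext_def)

lemma fw_generated:
 assumes "S <= FW L"
 shows "generated_submodule L (free_word_module L) S = fw.ghull L S"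
proof -
 have "generated_submodule L (free_word_module L) S = fw.ghull L ({0} \<union> S)"
  using fw.pres_generated[OF fw_presents assms] by simp
 moreover have "fw.ghull L ({0} \<union> S) = fw.ghull L S"
 proof
  show "fw.ghull L S <= fw.ghull L ({0} \<union> S)" by (auto simp: fw.ghull_def)
  show "fw.ghull L ({0} \<union> S) <= fw.ghull L S" using fw.stable_ghull[OF assms] fw.ghull_subset[of S L]
   by (intro fw.ghull_least) (auto simp: fw.stable_def intro: pm.subsp_zero)
 qed
 ultimately show ?thesis by simp
qed

lemma enveloping_relationsI:
 assumes "x : carrier L" "ws : lists (carrier L)"
 shows "y : carrier L ==> single ((x \<oplus>\<^bsub>L\<^esub> y) # ws) 1 - single (x # ws) 1 - single (y # ws) 1 : env_rel L"
  "single ((c \<odot>\<^bsub>L\<^esub> x) # ws) 1 - single (x # ws) c : env_rel L"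
  "y : carrier L ==> single (x # y # ws) 1 - single (y # x # ws) 1 - single (bracket L x y # ws) 1 : env_rel L"
proof -
 show "single ((x \<oplus>\<^bsub>L\<^esub> y) # ws) 1 - single (x # ws) 1 - single (y # ws) 1 : env_rel L"
  if "y : carrier L" unfolding enveloping_relations_def
  by (rule UnI1, rule UnI1, rule CollectI, rule exI[of _ x], rule exI[of _ y], rule exI[of _ ws])
   (use assms that in blast)
 show "single ((c \<odot>\<^bsub>L\<^esub> x) # ws) 1 - single (x # ws) c : env_rel L" unfolding enveloping_relations_def
  by (rule UnI1, rule UnI2, rule CollectI, rule exI[of _ c], rule exI[of _ x], rule exI[of _ ws])
   (use assms in blast)
 show "single (x # y # ws) 1 - single (y # x # ws) 1 - single (bracket L x y # ws) 1 : env_rel L"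
  if "y : carrier L" unfolding enveloping_relations_def
  by (rule UnI2, rule CollectI, rule exI[of _ x], rule exI[of _ y], rule exI[of _ ws])
   (use assms that in blast)
qed

text \<open>The relations concern single words; premises for arbitrary \<open>s\<close> are natural
  because they are identities between operators.\<close>

lemma enveloping_subsetI:
 assumes "\<And>x y s. x : carrier L ==> y : carrier L ==> s : FW L ==>
   wact (x \<oplus>\<^bsub>L\<^esub> y) s - (wact x s + wact y s) : K"
  and "\<And>c x s. x : carrier L ==> s : FW L ==> wact (c \<odot>\<^bsub>L\<^esub> x) s - scale_pm c (wact x s) : K"
  and "\<And>x y s. x : carrier L ==> y : carrier L ==> s : FW L ==>
   wact x (wact y s) - wact y (wact x s) - wact (bracket L x y) s : K"
 shows "env_rel L <= K"
 unfolding enveloping_relations_def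
 using assms(1)[OF _ _ fw_single[of _ L 1]] assms(2)[OF _ fw_single[of _ L 1]] assms(3)[OF _ _ fw_single[of _ L 1]]
 by (auto simp: diff_diff_eq del: in_listsD)

locale closed_lie =
 fixes L :: "'g lie_algebra"
 assumes L_add: "x : carrier L ==> y : carrier L ==> x \<oplus>\<^bsub>L\<^esub> y : carrier L"
  and L_smult: "x : carrier L ==> c \<odot>\<^bsub>L\<^esub> x : carrier L"
  and L_bracket: "x : carrier L ==> y : carrier L ==> bracket L x y : carrier L"
begin

lemma enveloping_subset: "env_rel L <= FW L"
 unfolding enveloping_relations_def using L_add L_smult L_bracket by (auto intro!: pm.subsp_diff[OF FW_subsp] fw_single)

text \<open>The relation is imposed for single words only; linearity carries it to every
  \<open>u\<close>. The two lemmas that follow argue alike.\<close>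

lemma env_add:
 assumes K: "fw.stable L K" "env_rel L <= K"
  and "x : carrier L" "y : carrier L" "u : FW L"
 shows "wact (x \<oplus>\<^bsub>L\<^esub> y) u - (wact x u + wact y u) : K"
 using assms(5)
proof (induction u rule: fw_induct)
 case zero
 thus ?case using K(1) by (auto simp: fw.stable_def intro: pm.subsp_zero)
next
 case (add ws c w)
 have s: "pm.subsp K" using K(1) by (simp add: fw.stable_def)
 have "single ((x \<oplus>\<^bsub>L\<^esub> y) # ws) 1 - single (x # ws) 1 - single (y # ws) 1 : K"
  using K(2) enveloping_relationsI(1)[OF assms(3) add(1) assms(4)] by blast
 from pm.subsp_sc[OF s this, of c]
 have "single ((x \<oplus>\<^bsub>L\<^esub> y) # ws) c - single (x # ws) c - single (y # ws) c : K" by (simp add: pm.sc_diff)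
 from pm.subsp_add[OF s this add(3)] show ?case by (simp add: wact_add algebra_simps)
qed

lemma env_smult:
 assumes K: "fw.stable L K" "env_rel L <= K"
  and "x : carrier L" "u : FW L"
 shows "wact (d \<odot>\<^bsub>L\<^esub> x) u - scale_pm d (wact x u) : K"
 using assms(4)
proof (induction u rule: fw_induct)
 case zero
 thus ?case using K(1) by (auto simp: fw.stable_def intro: pm.subsp_zero)
next
 case (add ws c w)
 have s: "pm.subsp K" using K(1) by (simp add: fw.stable_def)
 have "single ((d \<odot>\<^bsub>L\<^esub> x) # ws) 1 - single (x # ws) d : K"
  using K(2) enveloping_relationsI(2)[OF assms(3) add(1)] by blast
 from pm.subsp_sc[OF s this, of c]
 have "single ((d \<odot>\<^bsub>L\<^esub> x) # ws) c - single (x # ws) (d * c) : K" by (simp add: pm.sc_diff mult.commute)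
 from pm.subsp_add[OF s this add(3)] show ?case by (simp add: wact_add pm.sc_add algebra_simps)
qed

lemma env_bracket:
 assumes K: "fw.stable L K" "env_rel L <= K"
  and "x : carrier L" "y : carrier L" "u : FW L"
 shows "wact (bracket L x y) u - (wact x (wact y u) - wact y (wact x u)) : K"
 using assms(5)
proof (induction u rule: fw_induct)
 case zero
 thus ?case using K(1) by (auto simp: fw.stable_def intro: pm.subsp_zero)
next
 case (add ws c w)
 have s: "pm.subsp K" using K(1) by (simp add: fw.stable_def)
 have "single (x # y # ws) 1 - single (y # x # ws) 1 - single (bracket L x y # ws) 1 : K"
  using K(2) enveloping_relationsI(3)[OF assms(3) add(1) assms(4)] by blast
 from pm.subsp_sc[OF s this, of "- c"]
 have "single (bracket L x y # ws) c - (single (x # y # ws) c - single (y # x # ws) c) : K"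
  by (simp only: pm.sc_diff scale_pm_single mult_minus1_right mult_1_right single_uminus) (simp add: algebra_simps)
 from pm.subsp_add[OF s this add(3)] show ?case by (simp add: wact_add algebra_simps)
qed

lemma fw_lie_module:
 assumes "fw.presents L ka M K" "env_rel L <= K"
 shows "lie_module L M"
proof (rule fw.pres_lie_module[OF assms(1)])
 note st = fw.pres_K_stable[OF assms(1)]
qed (simp_all add: L_add L_smult L_bracket env_add[OF fw.pres_K_stable[OF assms(1)] assms(2)]
  env_smult[OF fw.pres_K_stable[OF assms(1)] assms(2)] env_bracket[OF fw.pres_K_stable[OF assms(1)] assms(2)])

lemma presented_module_presents:
 assumes "R <= FW L"
 shows "relation_submodule L R = fw.ghull L (env_rel L \<union> R)"
  "fw.presents L (\<lambda>u. relation_submodule L R +>\<^bsub>free_word_module L\<^esub> u) (presented_module L R)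
   (fw.ghull L (env_rel L \<union> R))"
proof -
 have S: "env_rel L \<union> R <= FW L" using enveloping_subset assms by auto
 show r: "relation_submodule L R = fw.ghull L (env_rel L \<union> R)"
  unfolding relation_submodule_def by (rule fw_generated[OF S])
 have st: "fw.stable L (fw.ghull L (env_rel L \<union> R))" by (rule fw.stable_ghull[OF S])
 show "fw.presents L (\<lambda>u. relation_submodule L R +>\<^bsub>free_word_module L\<^esub> u) (presented_module L R)
   (fw.ghull L (env_rel L \<union> R))" unfolding presented_module_def r
  by (rule fw.pres_quotient[OF fw_presents st]) (use st in \<open>auto simp: fw.stable_def intro: pm.subsp_zero\<close>)
qed

end

context lin_space begin

lemma pres_finsum:
 assumes P: "presents ka M K" and "finite A" "\<And>i. i : A ==> f i : C"
 shows "(\<Oplus>\<^bsub>M\<^esub>i\<in>A. ka (f i)) = ka (\<Sum>i\<in>A. f i)"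
 using assms(2,3)
proof (induction A rule: finite_induct)
 interpret M: Module.module "class_ring :: complex ring" M by (rule pres_module[OF P])
 case empty thus ?case by (simp add: pres_zero[OF P])
next
 interpret M: Module.module "class_ring :: complex ring" M by (rule pres_module[OF P])
 case (insert x A)
 have "(\<Oplus>\<^bsub>M\<^esub>i\<in>insert x A. ka (f i)) = ka (f x) \<oplus>\<^bsub>M\<^esub> (\<Oplus>\<^bsub>M\<^esub>i\<in>A. ka (f i))"
  by (rule M.finsum_insert) (use insert pres_carrier[OF P] in auto)
 thus ?case using insert pres_add[OF P, of "f x" "\<Sum>i\<in>A. f i"] subsp_sum[OF C, of A f] by simp
qed

lemma foldr_\<alpha>_closed: "ws : lists (carrier L) ==> u : C ==> foldr \<alpha> ws u : C"
 by (induction ws) (auto intro: \<alpha>_closed)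

lemma pres_foldr:
 assumes P: "presents ka M K" and "ws : lists (carrier L)" "u : C"
 shows "foldr (act M) ws (ka u) = ka (foldr \<alpha> ws u)"
 using assms(2)
proof (induction ws)
 case (Cons x ws)
 hence "foldr \<alpha> ws u : C" using foldr_\<alpha>_closed assms(3) by blast
 thus ?case using Cons pres_act[OF P, of x "foldr \<alpha> ws u"] by auto
qed simp

text \<open>The lift of \<open>word_action\<close> to representatives; as a linear extension it is
  additive without conditions on carriers.\<close>

definition wordmap :: "'a => ('g list \<Rightarrow>\<^sub>0 complex) => 'a" where
 "wordmap u0 = lin_ext (\<lambda>ws. foldr \<alpha> ws u0)"

lemma wordmap_closed: "u : FW L ==> u0 : C ==> wordmap u0 u : C"
 unfolding wordmap_def by (rule lin_ext_in[OF C]) (auto simp: FW_def intro!: foldr_\<alpha>_closed)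

lemma pres_word_action:
 assumes P: "presents ka M K" and u: "u : FW L" and u0: "u0 : C"
 shows "word_action M u (ka u0) = ka (wordmap u0 u)"
proof -
 interpret M: Module.module "class_ring :: complex ring" M by (rule pres_module[OF P])
 have ws: "ws : lists (carrier L)" if "ws : keys u" for ws using that u by (auto simp: FW_def)
 have "word_action M u (ka u0) = (\<Oplus>\<^bsub>M\<^esub>ws\<in>keys u. ka (sc (lookup u ws) (foldr \<alpha> ws u0)))"
  unfolding word_action_def
 proof (rule M.finsum_cong')
  show "(\<lambda>ws. ka (sc (lookup u ws) (foldr \<alpha> ws u0))) : keys u \<rightarrow> carrier M"
   using ws foldr_\<alpha>_closed u0 subsp_sc[OF C] pres_carrier[OF P] by auto
  fix ws assume "ws : keys u"
  thus "lookup u ws \<odot>\<^bsub>M\<^esub> foldr (act M) ws (ka u0) = ka (sc (lookup u ws) (foldr \<alpha> ws u0))"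
   using ws pres_foldr[OF P] u0 pres_smult[OF P] foldr_\<alpha>_closed by metis
 qed simp
 also have "... = ka (wordmap u0 u)" unfolding wordmap_def lin_ext_def
  by (rule pres_finsum[OF P]) (use ws foldr_\<alpha>_closed u0 subsp_sc[OF C] in auto)
 finally show ?thesis .
qed

lemma wordmap_add: "wordmap u0 (u + w) = wordmap u0 u + wordmap u0 w"
 and wordmap_scale: "wordmap u0 (scale_pm c u) = sc c (wordmap u0 u)"
 and wordmap_single [simp]: "wordmap u0 (single ws c) = sc c (foldr \<alpha> ws u0)"
 and wordmap_zero [simp]: "wordmap u0 0 = 0"
 and wordmap_diff: "wordmap u0 (u - w) = wordmap u0 u - wordmap u0 w"
 and wordmap_sum: "wordmap u0 (\<Sum>i\<in>I. f i) = (\<Sum>i\<in>I. wordmap u0 (f i))"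
 by (simp_all add: wordmap_def lin_ext_add lin_ext_scale lin_ext_diff lin_ext_sum)

lemma wordmap_wact:
 assumes "x : carrier L"
 shows "wordmap u0 (wact x u) = \<alpha> x (wordmap u0 u)"
proof (induction u rule: single_induct)
 case zero thus ?case using \<alpha>_sc[OF assms, of 0 0] by simp
next
 case (add a c g) thus ?case by (simp add: wact_add wordmap_add \<alpha>_add[OF assms] \<alpha>_sc[OF assms])
qed

end

context lie_module begin

lemma foldr_act_closed: "ws : lists (carrier L) ==> v : carrier M ==> foldr (act M) ws v : carrier M"
 by (induction ws) (auto intro: act_closed)

lemma cmplx [simp]: "(c::complex) : carrier class_ring" "a \<oplus>\<^bsub>class_ring\<^esub> b = a + (b::complex)"
  "a \<otimes>\<^bsub>class_ring\<^esub> b = a * (b::complex)" "\<zero>\<^bsub>class_ring\<^esub> = (0::complex)" "\<one>\<^bsub>class_ring\<^esub> = (1::complex)"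
 by (simp_all add: class_ring_simps)

lemma word_action_superset:
 assumes "finite A" "keys u <= A" "A <= lists (carrier L)" "v : carrier M"
 shows "word_action M u v = (\<Oplus>\<^bsub>M\<^esub>ws\<in>A. lookup u ws \<odot>\<^bsub>M\<^esub> foldr (act M) ws v)"
 unfolding word_action_def
proof (rule M.add.finprod_mono_neutral_cong_left[OF assms(1,2)])
 show "lookup u ws \<odot>\<^bsub>M\<^esub> foldr (act M) ws v = \<zero>\<^bsub>M\<^esub>" if "ws : A - keys u" for ws
 proof -
  have "foldr (act M) ws v : carrier M" using that assms foldr_act_closed by blast
  moreover have "lookup u ws = 0" using that by (simp add: in_keys_iff)
  ultimately show ?thesis using smult_l_null by simp
 qed
 show "(\<lambda>ws. lookup u ws \<odot>\<^bsub>M\<^esub> foldr (act M) ws v) : A \<rightarrow> carrier M"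
  using subsetD[OF assms(3)] assms(4) foldr_act_closed by (intro Pi_I smult_closed) auto
qed simp

lemma word_action_closed: "u : FW L ==> v : carrier M ==> word_action M u v : carrier M"
 unfolding word_action_def by (rule M.finsum_closed) (auto simp: FW_def intro!: smult_closed foldr_act_closed)

lemma word_action_add:
 assumes u: "u : FW L" "w : FW L" and v: "v : carrier M"
 shows "word_action M (u + w) v = word_action M u v \<oplus>\<^bsub>M\<^esub> word_action M w v"
proof -
 let ?A = "keys u \<union> keys w" and ?f = "\<lambda>ws. foldr (act M) ws v"
 have A: "finite ?A" "?A <= lists (carrier L)" using u by (auto simp: FW_def)
 have f: "?f ws : carrier M" if "ws : ?A" for ws using that A v foldr_act_closed by blast
 have "word_action M (u + w) v = (\<Oplus>\<^bsub>M\<^esub>ws\<in>?A. lookup (u + w) ws \<odot>\<^bsub>M\<^esub> ?f ws)"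
  by (rule word_action_superset[OF A(1) _ A(2) v]) (auto dest: subsetD[OF Poly_Mapping.keys_add])
 also have "... = (\<Oplus>\<^bsub>M\<^esub>ws\<in>?A. lookup u ws \<odot>\<^bsub>M\<^esub> ?f ws \<oplus>\<^bsub>M\<^esub> lookup w ws \<odot>\<^bsub>M\<^esub> ?f ws)"
  by (rule M.finsum_cong') (use f smult_l_distr[of _ _ "?f _"] in \<open>auto simp: lookup_add\<close>)
 also have "... = (\<Oplus>\<^bsub>M\<^esub>ws\<in>?A. lookup u ws \<odot>\<^bsub>M\<^esub> ?f ws) \<oplus>\<^bsub>M\<^esub> (\<Oplus>\<^bsub>M\<^esub>ws\<in>?A. lookup w ws \<odot>\<^bsub>M\<^esub> ?f ws)"
  by (rule M.finsum_addf) (use f in auto)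
 also have "... = word_action M u v \<oplus>\<^bsub>M\<^esub> word_action M w v"
  using word_action_superset[OF A(1) _ A(2) v, of u] word_action_superset[OF A(1) _ A(2) v, of w] by simp
 finally show ?thesis .
qed

lemma word_action_single:
 assumes "ws : lists (carrier L)" "v : carrier M"
 shows "word_action M (single ws c) v = c \<odot>\<^bsub>M\<^esub> foldr (act M) ws v"
proof -
 have "foldr (act M) ws v : carrier M" using assms foldr_act_closed by blast
 thus ?thesis using word_action_superset[of "{ws}" "single ws c" v] assms by (simp add: M.finsum_insert)
qed

lemma word_action_zero: "word_action M 0 v = \<zero>\<^bsub>M\<^esub>"
 by (simp add: word_action_def)

lemma word_action_scale:
 assumes "u : FW L" and v: "v : carrier M"
 shows "word_action M (scale_pm d u) v = d \<odot>\<^bsub>M\<^esub> word_action M u v"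
 using assms(1)
proof (induction u rule: fw_induct)
 case zero thus ?case by (simp add: word_action_zero)
next
 case (add ws c w)
 have s: "single ws c : FW L" "single ws (d * c) : FW L"
  "scale_pm d w : FW L" using fw_single[OF add(1)] pm.subsp_sc[OF FW_subsp add(2)] by blast+
 have f: "foldr (act M) ws v : carrier M" using add(1) v foldr_act_closed by blast
 have "word_action M (scale_pm d (single ws c + w)) v = (d * c) \<odot>\<^bsub>M\<^esub> foldr (act M) ws v \<oplus>\<^bsub>M\<^esub> d \<odot>\<^bsub>M\<^esub> word_action M w v"
  using word_action_add[OF s(2,3) v] word_action_single[OF add(1) v] add(3) by (simp add: pm.sc_add)
 also have "... = d \<odot>\<^bsub>M\<^esub> (c \<odot>\<^bsub>M\<^esub> foldr (act M) ws v \<oplus>\<^bsub>M\<^esub> word_action M w v)"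
  using smult_assoc1[of d c "foldr (act M) ws v"] f word_action_closed[OF add(2) v]
   smult_r_distr[of d "c \<odot>\<^bsub>M\<^esub> foldr (act M) ws v" "word_action M w v"] smult_closed[of c "foldr (act M) ws v"]
  by simp
 also have "... = d \<odot>\<^bsub>M\<^esub> word_action M (single ws c + w) v"
  using word_action_add[OF s(1) add(2) v] word_action_single[OF add(1) v] by simp
 finally show ?case .
qed

lemma act_zero: "x : carrier L ==> act M x \<zero>\<^bsub>M\<^esub> = \<zero>\<^bsub>M\<^esub>"
 using act_smult_right[of x "\<zero>\<^bsub>M\<^esub>" 0] act_closed[of x "\<zero>\<^bsub>M\<^esub>"] smult_l_null[of "\<zero>\<^bsub>M\<^esub>"]
  smult_l_null[of "act M x \<zero>\<^bsub>M\<^esub>"] by simp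

lemma word_action_wact:
 assumes x: "x : carrier L" and "u : FW L" and v: "v : carrier M"
 shows "word_action M (wact x u) v = act M x (word_action M u v)"
 using assms(2)
proof (induction u rule: fw_induct)
 case zero thus ?case using act_zero[OF x] by (simp add: word_action_zero)
next
 case (add ws c w)
 have xs: "x # ws : lists (carrier L)" using add(1) x by simp
 have f: "foldr (act M) ws v : carrier M" using add(1) v foldr_act_closed by blast
 have "word_action M (wact x (single ws c + w)) v = c \<odot>\<^bsub>M\<^esub> act M x (foldr (act M) ws v) \<oplus>\<^bsub>M\<^esub> act M x (word_action M w v)"
  using word_action_add[OF fw_single[OF xs] wact_closed[OF x add(2)] v] word_action_single[OF xs v] add(3) by (simp add: wact_add)
 also have "... = act M x (c \<odot>\<^bsub>M\<^esub> foldr (act M) ws v \<oplus>\<^bsub>M\<^esub> word_action M w v)"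
  using act_add_right[OF x smult_closed[of c, OF _ f] word_action_closed[OF add(2) v]] act_smult_right[OF x f] by simp
 also have "... = act M x (word_action M (single ws c + w) v)"
  using word_action_add[OF fw_single[OF add(1)] add(2) v] word_action_single[OF add(1) v] by simp
 finally show ?case .
qed

end

text \<open>The orbit of a nonzero vector is a nonzero submodule, hence everything, and the kernel
  is the annihilator of \<open>v\<close>.\<close>

lemma irreducible_presents:
 assumes irr: "irreducible_module L M" and v: "v : carrier M" "v ~= \<zero>\<^bsub>M\<^esub>"
 shows "fw.presents L (\<lambda>u. word_action M u v) M {u : FW L. word_action M u v = \<zero>\<^bsub>M\<^esub>}"
proof -
 interpret lie_module L M using irr by (simp add: irreducible_module_def)
 let ?N = "(\<lambda>u. word_action M u v) ` FW L"
 note C = pm.subsp_add[OF FW_subsp] pm.subsp_sc[OF FW_subsp] pm.subsp_zero[OF FW_subsp]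
 have v1: "word_action M (single [] 1) v = v" using word_action_single[of "[]" v 1] smult_one[OF v(1)] v by simp
 have "act_stable L ?N M" unfolding act_stable_def
 proof (intro conjI ballI)
  show "LinearCombinations.submodule (class_ring :: complex ring) ?N M"
  proof (rule submodule.intro[OF module_axioms])
   show "?N <= carrier M" using word_action_closed v by auto
   show "a \<oplus>\<^bsub>M\<^esub> b : ?N" if "a : ?N" "b : ?N" for a b
    using that C(1)[of _ L] word_action_add[symmetric] v by auto
   show "\<zero>\<^bsub>M\<^esub> : ?N" using word_action_zero C(3) by (metis imageI)
   show "c \<odot>\<^bsub>M\<^esub> a : ?N" if "a : ?N" for c a using that C(2)[of _ L] word_action_scale[symmetric] v by auto
  qed
  show "act M x a : ?N" if "x : carrier L" "a : ?N" for x a using that wact_closed[of _ L] word_action_wact[symmetric] v by auto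
 qed
 moreover have "v : ?N" using v1 fw_single[of "[]" L 1] by (metis imageI lists.Nil)
 ultimately have N: "?N = carrier M" using irr v(2) unfolding irreducible_module_def by blast
 show ?thesis unfolding fw.presents_def using N v
  by (auto simp: word_action_zero word_action_add word_action_scale word_action_wact)
qed



section \<open>Coordinates on the irreducible module of highest weight a multiple of the first fundamental weight\<close>

lemma (in cvs) lspan_image_sum:
 assumes "x : lspan (f ` S)"
 shows "\<exists>A c. finite A \<and> A <= S \<and> x = (\<Sum>a\<in>A. sc (c a) (f a))"
 using assms
proof induction
 case lspan_zero
 show ?case by (rule exI[of _ "{}"]) auto
next
 case (lspan_step x y d)
 then obtain A c s where A: "finite A" "A <= S" "y = (\<Sum>a\<in>A. sc (c a) (f a))" and s: "s : S" "x = f s" by auto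
 show ?case
 proof (cases "s : A")
  case True
  let ?c = "c(s := c s + d)"
  have "(\<Sum>a\<in>A. sc (?c a) (f a)) = sc (c s + d) (f s) + (\<Sum>a\<in>A - {s}. sc (?c a) (f a))"
   using A(1) True by (simp add: sum.remove)
  also have "(\<Sum>a\<in>A - {s}. sc (?c a) (f a)) = (\<Sum>a\<in>A - {s}. sc (c a) (f a))" by (rule sum.cong) auto
  also have "sc (c s + d) (f s) + (\<Sum>a\<in>A - {s}. sc (c a) (f a)) = sc d (f s) + (\<Sum>a\<in>A. sc (c a) (f a))"
   using A(1) True by (simp add: sum.remove sc_left algebra_simps)
  finally show ?thesis using A s by (intro exI[of _ A] exI[of _ ?c]) simp
 next
  case False
  let ?c = "c(s := d)"
  have "(\<Sum>a\<in>A. sc (?c a) (f a)) = (\<Sum>a\<in>A. sc (c a) (f a))" by (rule sum.cong) (use False in auto)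
  thus ?thesis using A s False by (intro exI[of _ "insert s A"] exI[of _ ?c]) simp
 qed
qed

text \<open>Elimination modulo \<open>K\<close>: applying \<open>h\<close> minus one eigenvalue
  removes a summand and multiplies the summand at \<open>i0\<close> by a nonzero difference of
  eigenvalues.\<close>

lemma (in lin_space) eigen_separate:
 assumes K: "stable K" and h: "h : carrier L"
  and "finite B" "i0 \<notin> B" "\<And>i. i : insert i0 B ==> \<alpha> h (x i) - sc (ev i) (x i) : K"
  and "\<And>i. i : B ==> ev i ~= ev i0" and "(\<Sum>i\<in>insert i0 B. x i) : K"
 shows "x i0 : K"
 using assms(3-7)
proof (induction B arbitrary: x rule: finite_induct)
 case (insert j B)
 have s: "subsp K" using K by (simp add: stable_def)
 let ?y = "\<lambda>i. sc (ev i - ev j) (x i)"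
 let ?I = "insert i0 (insert j B)"
 have fin: "finite ?I" using insert by simp
 have sumK: "\<alpha> h (\<Sum>i\<in>?I. x i) : K" using K h insert.prems(4) by (auto simp: stable_def)
 have "\<alpha> h (\<Sum>i\<in>A. x i) = (\<Sum>i\<in>A. \<alpha> h (x i))" if "finite A" for A
  using that \<alpha>_sc[OF h, of 0 0] by (induction A rule: finite_induct) (auto simp: \<alpha>_add[OF h])
 hence "(\<Sum>i\<in>?I. \<alpha> h (x i)) : K" using sumK fin by simp
 moreover have "(\<Sum>i\<in>?I. \<alpha> h (x i) - sc (ev i) (x i)) : K" by (rule subsp_sum[OF s]) (use insert in auto)
 ultimately have "(\<Sum>i\<in>?I. sc (ev i) (x i)) : K" using subsp_diff[OF s] by (fastforce simp: sum_subtractf)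
 moreover have "sc (ev j) (\<Sum>i\<in>?I. x i) : K" by (rule subsp_sc[OF s]) (use insert in simp)
 ultimately have "(\<Sum>i\<in>?I. sc (ev i) (x i)) - sc (ev j) (\<Sum>i\<in>?I. x i) : K" by (rule subsp_diff[OF s])
 moreover have "(\<Sum>i\<in>?I. sc (ev i) (x i)) - sc (ev j) (\<Sum>i\<in>?I. x i) = (\<Sum>i\<in>?I. ?y i)"
  by (simp only: sc_sum sum_subtractf[symmetric]) (rule sum.cong, auto simp: sc_left[of _ "- ev j", simplified] sc_uminus)
 ultimately have "(\<Sum>i\<in>?I. ?y i) : K" by simp
 moreover have "(\<Sum>i\<in>?I. ?y i) = (\<Sum>i\<in>insert i0 B. ?y i)" using insert by (simp add: insert_commute)
 ultimately have "(\<Sum>i\<in>insert i0 B. ?y i) : K" by simp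
 moreover have "\<alpha> h (?y i) - sc (ev i) (?y i) : K" if "i : insert i0 B" for i
 proof -
  have "sc (ev i - ev j) (\<alpha> h (x i) - sc (ev i) (x i)) : K" by (rule subsp_sc[OF s]) (use insert that in auto)
  thus ?thesis by (simp add: \<alpha>_sc[OF h] sc_diff sc_sc mult.commute)
 qed
 ultimately have "?y i0 : K" using insert by (intro insert.IH[of ?y]) auto
 hence "sc (1 / (ev i0 - ev j)) (?y i0) : K" by (rule subsp_sc[OF s])
 moreover have "ev i0 - ev j ~= 0" using insert.prems(3)[of j] by auto
 ultimately show ?case by (simp add: sc_sc sc_one)
qed simp

lemma sum_fun_apply: "(\<Sum>i\<in>I. f i) x = (\<Sum>i\<in>I. f i x)"
 by (induction I rule: infinite_finite_induct) auto

definition sc_fun :: "complex => ('a => complex) => 'a => complex" where "sc_fun a f = (\<lambda>x. a * f x)"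

interpretation fsp: cvs sc_fun by unfold_locales (auto simp: sc_fun_def fun_eq_iff algebra_simps)

text \<open>
 The symmetric functions on index sequences of length \<open>m\<close> carry the action of the Lie algebra on
 the \<open>m\<close>-th symmetric power of the natural representation (in dual coordinates); \<open>vac\<close> is
 the highest weight vector. Only the first \<open>m\<close> values of a sequence matter.
\<close>

definition sact :: "nat => nat => complex mat => ((nat => nat) => complex) => (nat => nat) => complex" where
 "sact n m X f = (\<lambda>c. if \<forall>p<m. c p < 2 * n then \<Sum>p<m. \<Sum>b<2 * n. X $$ (c p, b) * f (c(p := b)) else 0)"

lemma sact_invalid: "\<not> (\<forall>p<m. c p < 2 * n) ==> sact n m X f c = 0"
 unfolding sact_def by (rule if_not_P)

definition vac :: "nat => (nat => nat) => complex" where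
 "vac m c = (if \<forall>p<m. c p = 0 then 1 else 0)"

interpretation sym: lin_space sc_fun "sp n" UNIV "sact n m" for n m
 by unfold_locales (auto simp: fsp.subsp_def sact_def sc_fun_def fun_eq_iff algebra_simps sum.distrib sum_distrib_left)

lemma sact_eqI:
 assumes "\<And>c p b. \<forall>p<m. c p < 2 * n ==> p < m ==> b < 2 * n ==> X $$ (c p, b) = u * Y $$ (c p, b) + w * Z $$ (c p, b)"
 shows "sact n m X f = sc_fun u (sact n m Y f) + sc_fun w (sact n m Z f)"
proof
 fix c
 show "sact n m X f c = (sc_fun u (sact n m Y f) + sc_fun w (sact n m Z f)) c"
 proof (cases "\<forall>p<m. c p < 2 * n")
  case True
  have "(\<Sum>p<m. \<Sum>b<2*n. X $$ (c p, b) * f (c(p := b))) =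
    (\<Sum>p<m. \<Sum>b<2*n. u * (Y $$ (c p, b) * f (c(p := b))) + w * (Z $$ (c p, b) * f (c(p := b))))"
   using assms[OF True] by (intro sum.cong refl) (simp add: algebra_simps)
  thus ?thesis using True by (simp add: sact_def sc_fun_def sum.distrib sum_distrib_left)
 next
  case False
  show ?thesis by (simp add: sact_invalid[OF False] sc_fun_def)
 qed
qed

lemma sact_add_left: "X : spc n ==> Y : spc n ==>
  sact n m (X + Y) f = sact n m X f + sact n m Y f" using sact_eqI[of m n "X + Y" 1 X 1 Y f] by (simp add: sp_dims fsp.sc_one)

lemma sact_smult_left: "X : spc n ==> sact n m (a \<cdot>\<^sub>m X) f = sc_fun a (sact n m X f)"
 using sact_eqI[of m n "a \<cdot>\<^sub>m X" a X 0 X f] by (simp add: sp_dims)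

text \<open>One summand of the Leibniz rule. Different slots commute, so a commutator of two actions
  is computed slot by slot.\<close>

definition slot :: "nat => complex mat => nat => ((nat => nat) => complex) => (nat => nat) => complex" where
 "slot n X p f c = (\<Sum>b<2 * n. X $$ (c p, b) * f (c(p := b)))"

lemma slot_same:
 assumes "X : spc n" "Y : spc n" "c p < 2 * n"
 shows "slot n X p (slot n Y p f) c = (\<Sum>d<2 * n. (X * Y) $$ (c p, d) * f (c(p := d)))"
proof -
 have "slot n X p (slot n Y p f) c = (\<Sum>d<2 * n. \<Sum>b<2 * n. X $$ (c p, b) * Y $$ (b, d) * f (c(p := d)))"
  by (simp add: slot_def sum_distrib_left mult.assoc) (rule sum.swap)
 thus ?thesis using assms by (simp add: mat_mult_entry[OF sp_carrierD sp_carrierD] sum_distrib_right)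
qed

lemma slot_commute:
 assumes "p ~= q"
 shows "slot n X p (slot n Y q f) c = slot n Y q (slot n X p f) c"
proof -
 have "slot n X p (slot n Y q f) c = (\<Sum>b<2 * n. \<Sum>d<2 * n. X $$ (c p, b) * (Y $$ (c q, d) * f (c(p := b, q := d))))"
  using assms by (simp add: slot_def sum_distrib_left)
 also have "... = (\<Sum>d<2 * n. \<Sum>b<2 * n. X $$ (c p, b) * (Y $$ (c q, d) * f (c(p := b, q := d))))" by (rule sum.swap)
 also have "... = slot n Y q (slot n X p f) c"
  using assms by (simp add: slot_def sum_distrib_left fun_upd_twist mult.left_commute)
 finally show ?thesis .
qed

lemma sact_slot: "\<forall>p<m. c p < 2 * n ==> sact n m X f c = (\<Sum>p<m. slot n X p f c)"
 by (simp add: sact_def slot_def)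

lemma sact_sact:
 assumes c: "\<forall>p<m. c p < 2 * n"
 shows "sact n m X (sact n m Y f) c = (\<Sum>p<m. \<Sum>q<m. slot n X p (slot n Y q f) c)"
proof -
 have "slot n X p (sact n m Y f) c = slot n X p (\<lambda>c. \<Sum>q<m. slot n Y q f c) c" for p
  unfolding slot_def[of n X] by (rule sum.cong[OF refl]) (use c in \<open>simp add: sact_slot\<close>)
 moreover have "slot n X p (\<lambda>c. \<Sum>q<m. slot n Y q f c) c = (\<Sum>q<m. slot n X p (slot n Y q f) c)" for p
  unfolding slot_def[of n X] sum_distrib_left by (rule sum.swap)
 ultimately show ?thesis by (simp add: sact_slot[OF c])
qed

lemma sact_bracket:
 assumes X: "X : spc n" and Y: "Y : spc n"
 shows "sact n m (br X Y) f = sact n m X (sact n m Y f) - sact n m Y (sact n m X f)"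
proof
 fix c
 show "sact n m (br X Y) f c = (sact n m X (sact n m Y f) - sact n m Y (sact n m X f)) c"
 proof (cases "\<forall>p<m. c p < 2 * n")
  case c: True
  have "(\<Sum>q<m. slot n X p (slot n Y q f) c - slot n Y q (slot n X p f) c) = slot n (br X Y) p f c" if p: "p < m" for p
  proof -
   have "(\<Sum>q<m. slot n X p (slot n Y q f) c - slot n Y q (slot n X p f) c) =
     (\<Sum>q<m. if q = p then slot n (br X Y) p f c else 0)"
   proof (rule sum.cong[OF refl])
    fix q
    show "slot n X p (slot n Y q f) c - slot n Y q (slot n X p f) c = (if q = p then slot n (br X Y) p f c else 0)"
    proof (cases "q = p")
     case True
     thus ?thesis using c p slot_same[OF X Y, of c p f] slot_same[OF Y X, of c p f] sp_dims[OF X] sp_dims[OF Y]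
      by (simp add: slot_def[of n "br X Y"] sum_subtractf[symmetric] left_diff_distrib del: index_mult_mat(1))
    qed (simp add: slot_commute)
   qed
   thus ?thesis using p by simp
  qed
  hence "sact n m (br X Y) f c = (\<Sum>p<m. \<Sum>q<m. slot n X p (slot n Y q f) c - slot n Y q (slot n X p f) c)"
   by (simp add: sact_slot[OF c])
  also have "... = sact n m X (sact n m Y f) c - (\<Sum>p<m. \<Sum>q<m. slot n Y q (slot n X p f) c)"
   by (simp add: sum_subtractf sact_sact[OF c])
  also have "(\<Sum>p<m. \<Sum>q<m. slot n Y q (slot n X p f) c) = sact n m Y (sact n m X f) c"
   unfolding sact_sact[OF c] by (rule sum.swap)
  finally show ?thesis by simp
 next
  case False
  show ?thesis by (simp add: sact_invalid[OF False])
 qed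
qed

text \<open>\<open>vac\<close> is supported on sequences that are 0 throughout, so only the first
  column of \<open>X\<close> matters.\<close>

lemma sact_vac:
 assumes X: "\<And>a. 0 < a ==> a < 2 * n ==> X $$ (a, 0) = 0" and n: "n \<ge> 1"
 shows "sact n m X (vac m) = sc_fun (of_nat m * X $$ (0, 0)) (vac m)"
proof
 fix c
 show "sact n m X (vac m) c = sc_fun (of_nat m * X $$ (0, 0)) (vac m) c"
 proof (cases "\<forall>p<m. c p < 2 * n")
  case c: True
  have "(\<Sum>b<2*n. X $$ (c p, b) * vac m (c(p := b))) = X $$ (0, 0) * vac m c" if p: "p < m" for p
  proof -
   have "(\<Sum>b<2*n. X $$ (c p, b) * vac m (c(p := b))) = (\<Sum>b<2*n. if b = 0 then X $$ (c p, 0) * vac m (c(p := 0)) else 0)"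
    by (rule sum.cong) (use p in \<open>auto simp: vac_def\<close>)
   also have "... = X $$ (c p, 0) * vac m (c(p := 0))" using n by simp
   also have "... = X $$ (0, 0) * vac m c"
   proof (cases "c p = 0")
    case True
    thus ?thesis using fun_upd_idem[of c p 0] by simp
   next
    case False
    thus ?thesis using X[of "c p"] c p by (auto simp: vac_def)
   qed
   finally show ?thesis .
  qed
  thus ?thesis using c by (simp add: sact_def sc_fun_def)
 next
  case False
  hence "vac m c = 0" using n by (auto simp: vac_def)
  thus ?thesis by (simp add: sact_invalid[OF False] sc_fun_def)
 qed
qed

definition tr :: "nat => nat => nat => nat" where
 "tr p q i = (if i = p then q else if i = q then p else i)"

lemma tr_tr: "tr p q (tr p q i) = i"
 and tr_inj: "tr p q i = tr p q j \<longleftrightarrow> i = j"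
 by (auto simp: tr_def)

section \<open>A contravariant Hermitian form on functions of sequences\<close>

abbreviation "slots n m \<equiv> PiE {..<m} (\<lambda>_. {..<2 * n})"

definition form :: "nat => nat => ((nat => nat) => complex) => ((nat => nat) => complex) => complex" where
 "form n m f g = (\<Sum>c\<in>slots n m. f c * cnj (g c))"

text \<open>\<open>sp\<close> is closed under conjugate transposition, so the standard Hermitian
  form is contravariant. Orthogonality then does the work that irreducibility of the symmetric power
  would do.\<close>

definition adj :: "complex mat => complex mat" where
 "adj X = mat (dim_col X) (dim_row X) (\<lambda>(i, j). cnj (X $$ (j, i)))"

lemma adj_sp: "X : spc n ==> adj X : spc n"
 unfolding sp_iff
proof (intro conjI allI impI)
 fix a b assume X: "X : mats n \<and> (\<forall>a<2 * n. \<forall>b<2 * n. X $$ (a, b) = - (sg n a * sg n b * X $$ (cj n b, cj n a)))"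
  and ab: "a < 2 * n" "b < 2 * n"
 have e: "adj X $$ (i, j) = cnj (X $$ (j, i))" if "i < 2 * n" "j < 2 * n" for i j using that X by (auto simp: adj_def)
 have h: "X $$ (b, a) = - (sg n b * sg n a * X $$ (cj n a, cj n b))" using X ab by blast
 show "adj X $$ (a, b) = - (sg n a * sg n b * adj X $$ (cj n b, cj n a))"
  unfolding e[OF ab] e[OF cj_less[OF ab(2)] cj_less[OF ab(1)]] by (subst h) (simp add: sg_def)
qed (auto simp: adj_def)

lemma form_sact:
 assumes X: "X : spc n"
 shows "form n m f (sact n m X g) = form n m (sact n m (adj X) f) g"
proof -
 let ?I = "slots n m"
 have val: "\<forall>p<m. c p < 2 * n" if "c : ?I" for c using that by (auto dest: PiE_mem)
 have slot: "(\<Sum>c\<in>?I. f c * cnj (slot n X p g c)) = (\<Sum>c\<in>?I. slot n (adj X) p f c * cnj (g c))" if p: "p < m" for p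
 proof -
  have "(\<Sum>c\<in>?I. f c * cnj (slot n X p g c)) = (\<Sum>(c, b)\<in>?I \<times> {..<2 * n}. f c * (cnj (X $$ (c p, b)) * cnj (g (c(p := b)))))"
   by (simp add: slot_def sum_distrib_left sum.cartesian_product)
  also have "... = (\<Sum>(c, b)\<in>?I \<times> {..<2 * n}. f (c(p := b)) * (cnj (X $$ (b, c p)) * cnj (g c)))"
   by (rule sum.reindex_bij_witness[of _ "\<lambda>(c, b). (c(p := b), c p)" "\<lambda>(c, b). (c(p := b), c p)"])
    (use p in \<open>auto simp: PiE_def Pi_def extensional_def\<close>)
  also have "... = (\<Sum>c\<in>?I. slot n (adj X) p f c * cnj (g c))" unfolding sum.cartesian_product[symmetric]
  proof (rule sum.cong[OF refl])
   fix c assume "c : ?I"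
   thus "(\<Sum>b<2 * n. f (c(p := b)) * (cnj (X $$ (b, c p)) * cnj (g c))) = slot n (adj X) p f c * cnj (g c)"
    using val p sp_dims[OF X] by (simp add: slot_def adj_def sum_distrib_left sum_distrib_right mult_ac)
  qed
  finally show ?thesis .
 qed
 have "form n m f (sact n m X g) = (\<Sum>c\<in>?I. \<Sum>p<m. f c * cnj (slot n X p g c))"
  unfolding form_def by (rule sum.cong[OF refl]) (simp add: sact_slot[OF val] sum_distrib_left)
 also have "... = (\<Sum>p<m. \<Sum>c\<in>?I. f c * cnj (slot n X p g c))" by (rule sum.swap)
 also have "... = (\<Sum>p<m. \<Sum>c\<in>?I. slot n (adj X) p f c * cnj (g c))" using slot by simp
 also have "... = (\<Sum>c\<in>?I. \<Sum>p<m. slot n (adj X) p f c * cnj (g c))" by (rule sum.swap)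
 also have "... = form n m (sact n m (adj X) f) g"
  unfolding form_def by (rule sum.cong[OF refl]) (simp add: sact_slot[OF val] sum_distrib_right)
 finally show ?thesis .
qed

lemma form_self: "form n m f f = 0 ==> c : slots n m ==> f c = 0"
proof -
 assume "form n m f f = 0" and c: "c : slots n m"
 hence "complex_of_real (\<Sum>c\<in>slots n m. (cmod (f c))\<^sup>2) = 0"
  by (simp only: form_def of_real_sum complex_norm_square)
 hence "(\<Sum>c\<in>slots n m. (cmod (f c))\<^sup>2) = 0" by (simp only: of_real_eq_0_iff)
 hence "(cmod (f c))\<^sup>2 = 0" using c by (subst (asm) sum_nonneg_eq_0_iff) (auto intro: finite_PiE)
 thus ?thesis by simp
qed

lemma form_linear: "form n m f 0 = 0" "form n m f (g + h) = form n m f g + form n m f h"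
 "form n m f (sc_fun a g) = cnj a * form n m f g"
 by (simp_all add: form_def sc_fun_def distrib_left sum.distrib sum_distrib_left mult_ac)

text \<open>Sequences are functions on all of \<open>nat\<close>; the form sees only their
  restrictions to the \<open>m\<close> slots, and for local functions these restrictions decide the
  value.\<close>

definition local_fun :: "nat => ((nat => nat) => complex) => bool" where
 "local_fun m f \<longleftrightarrow> (\<forall>c c'. (\<forall>p<m. c p = c' p) \<longrightarrow> f c = f c')"

lemma local_sact: "local_fun m f ==> local_fun m (sact n m X f)"
 unfolding local_fun_def
proof (intro allI impI)
 fix c c' :: "nat => nat" assume f: "\<forall>c c'. (\<forall>p<m. c p = c' p) \<longrightarrow> f c = f c'" and c: "\<forall>p<m. c p = c' p"
 have "f (c(p := b)) = f (c'(p := b))" for p b using f c by simp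
 hence "(\<Sum>p<m. \<Sum>b<2 * n. X $$ (c p, b) * f (c(p := b))) = (\<Sum>p<m. \<Sum>b<2 * n. X $$ (c' p, b) * f (c'(p := b)))"
  using c by (intro sum.cong refl) simp
 moreover have "(\<forall>p<m. c p < 2 * n) \<longleftrightarrow> (\<forall>p<m. c' p < 2 * n)" using c by simp
 ultimately show "sact n m X f c = sact n m X f c'" by (simp only: sact_def)
qed

lemma local_wordmap: "local_fun m (sym.wordmap n m (vac m) u)"
proof -
 have "local_fun m (foldr (sact n m) ws (vac m))" for ws
 proof (induction ws)
  case Nil show ?case by (simp add: local_fun_def vac_def)
 qed (simp add: local_sact)
 thus ?thesis unfolding sym.wordmap_def fsp.lin_ext_def local_fun_def sum_fun_apply sc_fun_def
  by (intro allI impI sum.cong refl) metis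
qed

interpretation spl: closed_lie "sp n" for n by unfold_locales (auto intro: sp_add sp_smult sp_bracket)

lemma (in closed_lie) enveloping_in_kernel:
 assumes "lie_module L M" and P: "fw.presents L ka M K"
 shows "env_rel L <= K"
proof (rule enveloping_subsetI)
 interpret lie_module L M by fact
 note simps = wact_closed fw.pres_act[OF P] fw.pres_add[OF P] fw.pres_smult[OF P] fw.pres_minus[OF P] fw.pres_C[OF P]
  L_add L_smult L_bracket
 fix x s assume x: "x : carrier L" and s: "s : FW L"
 have c: "ka s : carrier M" using s fw.pres_carrier[OF P] by simp
 show "wact (d \<odot>\<^bsub>L\<^esub> x) s - scale_pm d (wact x s) : K" for d
  using act_smult_left[OF x c, of d] x s by (simp add: simps flip: fw.pres_eq[OF P])
 fix y assume y: "y : carrier L"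
 show "wact (x \<oplus>\<^bsub>L\<^esub> y) s - (wact x s + wact y s) : K"
  using act_add_left[OF x y c] x y s by (simp add: simps flip: fw.pres_eq[OF P])
 show "wact x (wact y s) - wact y (wact x s) - wact (bracket L x y) s : K"
  using act_bracket[OF x y c] x y s by (simp add: simps flip: fw.pres_eq[OF P])
qed

section \<open>The annihilator of a highest weight vector\<close>

locale hw_rep =
 fixes n m :: nat and xp xm :: "root_label => complex mat" and V :: "(complex mat, 'v) rep" and v :: 'v
 assumes n: "n \<ge> 1" and ch: "chevalley_generators n xp xm"
  and irr: "irreducible_module (sp n) V"
  and hw: "highest_weight_vector n xp V (\<lambda>h. of_nat m * \<delta> 1 h) v"
begin

sublocale V: lie_module "sp n" V using irr by (simp add: irreducible_module_def)

lemma v: "v : carrier V" "v ~= \<zero>\<^bsub>V\<^esub>"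
 using hw by (auto simp: highest_weight_vector_def)

abbreviation "\<sigma> \<equiv> sym.wordmap n m (vac m)"
definition "Kv = {u : FW (sp n). word_action V u v = \<zero>\<^bsub>V\<^esub>}"

lemma V_presents: "fw.presents (sp n) (\<lambda>u. word_action V u v) V Kv"
 unfolding Kv_def by (rule irreducible_presents[OF irr v])

definition "borel X \<longleftrightarrow> X : spc n \<and> (\<forall>a<2*n. \<forall>b<2*n. X $$ (a, b) ~= 0 \<longrightarrow> hgt n a \<ge> hgt n b)"

text \<open>The relations of a Verma module, stated for the whole Borel subalgebra at once: the
  entry at \<open>(0, 0)\<close> is the value of \<open>\<delta> 1\<close>.\<close>

definition "R0 = {single [X] 1 - single [] (of_nat m * X $$ (0, 0)) | X. borel X}"
definition "N0 = fw.ghull (sp n) (env_rel (sp n) \<union> R0)"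

lemma R0_subset: "env_rel (sp n) \<union> R0 <= FW (sp n)"
 using spl.enveloping_subset by (auto simp: R0_def borel_def intro!: pm.subsp_diff[OF FW_subsp] fw_single)

lemma N0: "fw.stable (sp n) N0" "env_rel (sp n) <= N0" "R0 <= N0" "pm.subsp N0"
 using fw.stable_ghull[OF R0_subset] fw.ghull_subset[of "env_rel (sp n) \<union> R0" "sp n"] by (auto simp: N0_def fw.stable_def)

text \<open>The diagonal part of \<open>X\<close> lies in the Cartan subalgebra, and what remains is
  strictly upper triangular with respect to \<open>hgt\<close>, hence in
  \<open>n_plus\<close>.\<close>

lemma borel_v: "borel X ==> act V X v = (of_nat m * X $$ (0, 0)) \<odot>\<^bsub>V\<^esub> v"
proof -
 assume b: "borel X"
 hence X: "X : spc n" by (simp add: borel_def)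
 define D where "D = mat (2 * n) (2 * n) (\<lambda>(i, j). if i = j then X $$ (i, i) else 0)"
 define U where "U = X + (- 1) \<cdot>\<^sub>m D"
 have D: "D : spc n" unfolding sp_iff
 proof (intro conjI allI impI)
  fix a b assume ab: "a < 2 * n" "b < 2 * n"
  have "cj n b = cj n a \<longleftrightarrow> a = b" using ab cj_cj by metis
  thus "D $$ (a, b) = - (sg n a * sg n b * D $$ (cj n b, cj n a))" using ab cj_less sp_sym[OF X ab(1) ab(1)] by (auto simp: D_def)
 qed (simp add: D_def)
 have U: "U : spc n" unfolding U_def by (intro sp_add sp_smult X D)
 have XU: "X = U + D" unfolding U_def by (rule eq_matI) (use sp_dims[OF X] in \<open>auto simp: D_def\<close>)
 have Dc: "D : cartan n" by (rule diagonal_in_cartan[OF D]) (simp add: D_def)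
 have Un: "U : n_plus n xp"
 proof (rule upper_in_n_plus[OF ch U])
  fix i j assume ij: "i < 2 * n" "j < 2 * n" "U $$ (i, j) ~= 0"
  have "U $$ (i, j) = X $$ (i, j) - (if i = j then X $$ (i, i) else 0)" using ij sp_dims[OF X] by (simp add: U_def D_def)
  hence "i ~= j" "X $$ (i, j) ~= 0" using ij(3) by (auto split: if_splits)
  moreover have "hgt n i = hgt n j ==> i = j" using ij by (auto simp: hgt_def split: if_splits)
  ultimately show "hgt n j < hgt n i" using b ij unfolding borel_def by (metis order_le_less)
 qed
 have "act V X v = act V U v \<oplus>\<^bsub>V\<^esub> act V D v" using V.act_add_left[of U D v] U D v XU by simp
 also have "act V U v = \<zero>\<^bsub>V\<^esub>" using hw Un by (simp add: highest_weight_vector_def)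
 also have "act V D v = (of_nat m * \<delta> 1 D) \<odot>\<^bsub>V\<^esub> v" using hw Dc by (simp add: highest_weight_vector_def)
 also have "\<delta> 1 D = X $$ (0, 0)" using n by (simp add: \<delta>_def D_def)
 finally show ?thesis using v V.smult_closed[of "of_nat m * X $$ (0, 0)" v] by simp
qed

lemma N0_Kv: "N0 <= Kv"
 unfolding N0_def
proof (rule fw.ghull_least)
 show "fw.stable (sp n) Kv" by (rule fw.pres_K_stable[OF V_presents])
 have "R0 <= Kv"
 proof
  fix r assume "r : R0"
  then obtain X where X: "borel X" "r = single [X] 1 - single [] (of_nat m * X $$ (0, 0))" by (auto simp: R0_def)
  have w: "[X] : lists (carrier (sp n))" "[] : lists (carrier (sp n))" using X by (auto simp: borel_def)
  have "act V X v : carrier V" using V.act_closed[of X v] X v by (simp add: borel_def)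
  hence "word_action V (single [X] 1) v = act V X v" using V.word_action_single[OF w(1) v(1), of 1] V.smult_one by simp
  also have "... = word_action V (single [] (of_nat m * X $$ (0, 0))) v"
   using V.word_action_single[OF w(2) v(1)] borel_v[OF X(1)] by simp
  finally show "r : Kv" unfolding X(2) using fw.pres_eq[OF V_presents fw_single[OF w(1)] fw_single[OF w(2)]] by blast
 qed
 thus "env_rel (sp n) \<union> R0 <= Kv" using spl.enveloping_in_kernel[OF V.lie_module_axioms V_presents] by blast
qed

lemma sigma_zero: "u : N0 ==> \<sigma> u = 0"
proof -
 have "N0 <= {u : FW (sp n). \<sigma> u = 0}" unfolding N0_def
 proof (rule fw.ghull_least)
  show "fw.stable (sp n) {u : FW (sp n). \<sigma> u = 0}" unfolding fw.stable_def
  proof (intro conjI ballI pm.subspI)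
   fix X u assume X: "X : carrier (sp n)" and "u : {u : FW (sp n). \<sigma> u = 0}"
   thus "wact X u : {u : FW (sp n). \<sigma> u = 0}"
    using wact_closed[OF X] sym.wordmap_wact[OF X] sym.\<alpha>_sc[OF X, of m 0 0] by simp
  qed (auto simp: sym.wordmap_add sym.wordmap_scale intro: pm.subsp_zero[OF FW_subsp]
    pm.subsp_add[OF FW_subsp] pm.subsp_sc[OF FW_subsp])
  have "\<sigma> r = 0" if "r : env_rel (sp n) \<union> R0" for r using that
  proof
   assume "r : env_rel (sp n)"
   thus ?thesis unfolding enveloping_relations_def
    by (auto simp: sym.wordmap_diff fsp.sc_one sact_add_left sact_smult_left sact_bracket)
  next
   assume "r : R0"
   then obtain X where X: "borel X" "r = single [X] 1 - single [] (of_nat m * X $$ (0, 0))" by (auto simp: R0_def)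
   have "X $$ (a, 0) = 0" if "0 < a" "a < 2 * n" for a
   proof (rule ccontr)
    assume "X $$ (a, 0) ~= 0"
    hence "hgt n a \<ge> hgt n 0" using X(1) that n by (auto simp: borel_def)
    thus False using that n by (auto simp: hgt_def split: if_splits)
   qed
   from sact_vac[OF this n] show ?thesis by (simp add: X(2) sym.wordmap_diff fsp.sc_one)
  qed
  thus "env_rel (sp n) \<union> R0 <= {u : FW (sp n). \<sigma> u = 0}" using R0_subset by auto
 qed
 thus "u : N0 ==> \<sigma> u = 0" by auto
qed

section \<open>Spanning by lowering words modulo the Verma relations\<close>

definition "LW = lists {(a, b). a < 2 * n \<and> b < 2 * n \<and> hgt n a < hgt n b}"
definition "W w = single (map (\<lambda>(a, b). gm n a b) w) (1::complex)"
text \<open>Combinations of lowering words, up to Verma relations. That this is everything is the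
  spanning half of the triangular decomposition, see \<open>carrier_EN\<close>.\<close>

definition "EN = {e + k | e k. e : pm.lspan (W ` LW) \<and> k : N0}"

lemma LW_Cons: "(a, b) # w : LW \<longleftrightarrow> a < 2 * n \<and> b < 2 * n \<and> hgt n a < hgt n b \<and> w : LW"
 by (auto simp: LW_def)

lemma W_Cons: "W ((a, b) # w) = wact (gm n a b) (W w)"
 by (simp add: W_def)

lemma W_closed: "w : LW ==> W w : FW (sp n)"
 unfolding W_def by (rule fw_single) (auto simp: LW_def intro!: gm_sp)

lemma EN_subsp: "pm.subsp EN"
proof (rule pm.subspI)
 show "0 : EN" unfolding EN_def using pm.lspan_zero pm.subsp_zero[OF N0(4)] by force
 show "x + y : EN" if xy: "x : EN" "y : EN" for x y
 proof -
  obtain e k e' k' where "x = e + k" "y = e' + k'" "e : pm.lspan (W ` LW)" "e' : pm.lspan (W ` LW)" "k : N0" "k' : N0"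
   using xy by (auto simp: EN_def)
  thus ?thesis unfolding EN_def using pm.lspan_add pm.subsp_add[OF N0(4)]
   by (intro CollectI exI[of _ "e + e'"] exI[of _ "k + k'"]) (auto simp: algebra_simps)
 qed
 show "scale_pm c x : EN" if "x : EN" for c x
 proof -
  obtain e k where "x = e + k" "e : pm.lspan (W ` LW)" "k : N0" using \<open>x : EN\<close> by (auto simp: EN_def)
  thus ?thesis unfolding EN_def using pm.lspan_sc pm.subsp_sc[OF N0(4)]
   by (intro CollectI exI[of _ "scale_pm c e"] exI[of _ "scale_pm c k"]) (auto simp: pm.sc_add)
 qed
qed

lemma N0_EN: "N0 <= EN"
 unfolding EN_def using pm.lspan_zero by force

lemma W_EN: "w : LW ==> W w : EN"
 unfolding EN_def using pm.subsp_zero[OF N0(4)] pm.lspan_base[of "W w" "W ` LW"] by force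

lemma EN_lower:
 assumes "a < 2 * n" "b < 2 * n" "hgt n a < hgt n b" "u : EN"
 shows "wact (gm n a b) u : EN"
proof -
 obtain e k where ek: "u = e + k" "e : pm.lspan (W ` LW)" "k : N0" using assms by (auto simp: EN_def)
 have "wact (gm n a b) e : pm.lspan (W ` LW)" using ek(2)
 proof induction
  case (lspan_step x y c)
  then obtain w where "w : LW" "x = W w" by auto
  hence "wact (gm n a b) x = W ((a, b) # w)" "(a, b) # w : LW" using assms by (auto simp: LW_Cons W_Cons)
  hence "wact (gm n a b) x : W ` LW" by blast
  thus ?case using lspan_step by (auto simp: wact_add wact_scale intro: pm.lspan_step)
 qed (simp add: pm.lspan_zero)
 moreover have "wact (gm n a b) k : N0" using ek(3) N0(1) gm_sp assms by (auto simp: fw.stable_def)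
 ultimately show ?thesis unfolding EN_def ek(1) wact_add by blast
qed

lemma env:
 assumes "X : spc n" "u : FW (sp n)"
 shows "Y : spc n ==> wact (X + Y) u - (wact X u + wact Y u) : N0"
  "wact (c \<cdot>\<^sub>m X) u - scale_pm c (wact X u) : N0"
  "Y : spc n ==> wact (br X Y) u - (wact X (wact Y u) - wact Y (wact X u)) : N0"
 using spl.env_add[OF N0(1,2), of X Y u] spl.env_smult[OF N0(1,2), of X u c]
  spl.env_bracket[OF N0(1,2), of X Y u] assms by auto

text \<open>Induction on the word for all \<open>X\<close> at once: passing the front letter leaves
  a bracket, which is again an element of \<open>sp\<close> acting on the shorter word.\<close>

lemma wact_W_EN: "w : LW ==> X : spc n ==> wact X (W w) : EN"
proof (induction w arbitrary: X)
 case Nil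
 have "wact X (W []) : EN" using Nil(2)
 proof (induction X rule: sp_gm_induct)
  case zero
  have "wact (0 \<cdot>\<^sub>m 0\<^sub>m (2*n) (2*n)) (W []) - scale_pm 0 (wact (0\<^sub>m (2*n) (2*n)) (W [])) : N0"
   by (rule env(2)[OF sp_zero W_closed]) (simp add: LW_def)
  thus ?case using N0_EN by auto
 next
  case (add a b c Y)
  have g: "wact (gm n a b) (W []) : EN"
  proof (cases "hgt n a < hgt n b")
   case True thus ?thesis using EN_lower add W_EN[of "[]"] by (simp add: LW_def)
  next
   case False
   have "borel (gm n a b)" unfolding borel_def
   proof (intro conjI allI impI gm_sp add)
    fix i j assume ij: "i < 2 * n" "j < 2 * n" "gm n a b $$ (i, j) ~= 0"
    hence "i = a \<and> j = b \<or> i = cj n b \<and> j = cj n a" unfolding gm_index[OF ij(1,2)] by (auto split: if_splits)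
    thus "hgt n j <= hgt n i" using False hgt_cj add by auto
   qed
   hence "single [gm n a b] 1 - single [] (of_nat m * gm n a b $$ (0, 0)) : N0" using N0(3) by (auto simp: R0_def)
   moreover have "single [] (of_nat m * gm n a b $$ (0, 0)) : EN"
    using pm.subsp_sc[OF EN_subsp W_EN[of "[]"], of "of_nat m * gm n a b $$ (0, 0)"] by (simp add: LW_def W_def)
   ultimately show ?thesis using pm.subsp_cong[OF EN_subsp] N0_EN by (auto simp: W_def)
  qed
  have c: "W [] : FW (sp n)" by (rule W_closed) (simp add: LW_def)
  have "wact (c \<cdot>\<^sub>m gm n a b) (W []) : EN"
   using env(2)[OF gm_sp[OF add(1,2)] c] pm.subsp_cong[OF EN_subsp] N0_EN pm.subsp_sc[OF EN_subsp g] by blast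
  thus ?case using env(1)[OF sp_smult[OF gm_sp[OF add(1,2)]] c add(4)] pm.subsp_cong[OF EN_subsp] N0_EN
    pm.subsp_add[OF EN_subsp _ add(5)] by blast
 qed
 thus ?case .
next
 case (Cons ab w)
 obtain a b where ab: "ab = (a, b)" by force
 have w: "w : LW" "a < 2 * n" "b < 2 * n" "hgt n a < hgt n b" using Cons ab by (auto simp: LW_Cons)
 have g: "gm n a b : spc n" using w gm_sp by blast
 have "wact (br X (gm n a b)) (W w) : EN" using Cons.IH w(1) sp_bracket[OF Cons(3) g] by blast
 moreover have "wact (gm n a b) (wact X (W w)) : EN" using EN_lower w Cons by blast
 ultimately have "wact X (wact (gm n a b) (W w)) : EN"
  using pm.subsp_add[OF EN_subsp] env(3)[OF Cons(3) W_closed[OF w(1)] g] N0_EN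
   pm.subsp_diff[OF EN_subsp, of "wact (br X (gm n a b)) (W w) + wact (gm n a b) (wact X (W w))"
    "wact (br X (gm n a b)) (W w) - (wact X (wact (gm n a b) (W w)) - wact (gm n a b) (wact X (W w)))"]
  by (auto simp: algebra_simps)
 thus ?case by (simp add: ab W_Cons)
qed

lemma carrier_EN: "FW (sp n) <= EN"
proof
 have st: "wact X u : EN" if X: "X : spc n" and u: "u : EN" for X u
 proof -
  obtain e k where ek: "u = e + k" "e : pm.lspan (W ` LW)" "k : N0" using u by (auto simp: EN_def)
  have "wact X e : EN" using ek(2)
  proof induction
   case (lspan_step x y c)
   thus ?case using wact_W_EN[OF _ X]
    by (auto simp: wact_add wact_scale intro!: pm.subsp_add[OF EN_subsp] pm.subsp_sc[OF EN_subsp])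
  qed (simp add: pm.subsp_zero[OF EN_subsp])
  moreover have "wact X k : EN" using ek(3) N0(1) X N0_EN by (auto simp: fw.stable_def)
  ultimately show ?thesis unfolding ek(1) wact_add by (rule pm.subsp_add[OF EN_subsp])
 qed
 fix u assume "u : FW (sp n)"
 thus "u : EN"
 proof (induction u rule: fw_induct)
  case (add ws c w)
  have "single ws 1 : EN" using add(1)
  proof (induction ws)
   case Nil thus ?case using W_EN[of "[]"] by (simp add: W_def LW_def)
  next
   case (Cons X ws) thus ?case using st[of X "single ws 1"] by simp
  qed
  hence "single ws c : EN" using pm.subsp_sc[OF EN_subsp, of "single ws 1" c] by simp
  thus ?case using add(3) pm.subsp_add[OF EN_subsp] by blast
 qed (simp add: pm.subsp_zero[OF EN_subsp])
qed

definition "drop_wt w = (\<Sum>(a, b)\<leftarrow>w. hgt n b - hgt n a)"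
definition "h0 = mat (2 * n) (2 * n) (\<lambda>(i, j). if i = j then of_int (hgt n i) else (0::complex))"

lemma drop_wt_pos: "w : LW ==> w ~= [] ==> drop_wt w > 0"
proof (induction w)
 case (Cons ab w)
 obtain a b where ab: "ab = (a, b)" by force
 have "hgt n b - hgt n a > 0" "w : LW" using Cons(2) by (auto simp: ab LW_Cons)
 thus ?case using Cons.IH by (cases w) (auto simp: drop_wt_def ab)
qed simp

lemma h0_sp: "h0 : spc n"
 unfolding sp_iff
proof (intro conjI allI impI)
 fix a b assume ab: "a < 2 * n" "b < 2 * n"
 have "cj n b = cj n a \<longleftrightarrow> a = b" using ab cj_cj by metis
 thus "h0 $$ (a, b) = - (sg n a * sg n b * h0 $$ (cj n b, cj n a))" using ab cj_less sg_sg by (auto simp: h0_def hgt_cj)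
qed (simp add: h0_def)

lemma h0_borel: "borel h0"
 by (simp add: borel_def h0_sp) (simp add: h0_def)

lemma h0_gm:
 assumes ab: "a < 2 * n" "b < 2 * n"
 shows "br h0 (gm n a b) = of_int (hgt n a - hgt n b) \<cdot>\<^sub>m gm n a b"
proof (rule eq_matI)
 fix i j assume "i < dim_row (of_int (hgt n a - hgt n b) \<cdot>\<^sub>m gm n a b)" "j < dim_col (of_int (hgt n a - hgt n b) \<cdot>\<^sub>m gm n a b)"
 hence ij: "i < 2 * n" "j < 2 * n" by (auto simp: gm_def)
 have "br h0 (gm n a b) $$ (i, j) = (h0 $$ (i, i) - h0 $$ (j, j)) * gm n a b $$ (i, j)"
  by (rule mat_diag_bracket_entry[where m = "2 * n"]) (use ij in \<open>auto simp: h0_def\<close>)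
 also have "h0 $$ (i, i) - h0 $$ (j, j) = of_int (hgt n i - hgt n j)" using ij by (simp add: h0_def)
 also have "of_int (hgt n i - hgt n j) * gm n a b $$ (i, j) = of_int (hgt n a - hgt n b) * gm n a b $$ (i, j)"
 proof (cases "gm n a b $$ (i, j) = 0")
  case False
  hence "i = a \<and> j = b \<or> i = cj n b \<and> j = cj n a" unfolding gm_index[OF ij(1,2)] by (auto split: if_splits)
  hence "hgt n i - hgt n j = hgt n a - hgt n b" using hgt_cj ab by auto
  thus ?thesis by simp
 qed simp
 finally show "br h0 (gm n a b) $$ (i, j) = (of_int (hgt n a - hgt n b) \<cdot>\<^sub>m gm n a b) $$ (i, j)"
  using ij by (simp add: gm_def)
qed (auto simp: gm_def h0_def)

text \<open>Modulo the Verma relations the generator has eigenvalue \<open>m * n\<close>, because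
  \<open>h0\<close> has entry \<open>n\<close> at \<open>(0, 0)\<close>, and every lowering letter
  subtracts its drop in height.\<close>

lemma h0_W: "w : LW ==> wact h0 (W w) - scale_pm (of_nat m * of_nat n - of_int (drop_wt w)) (W w) : N0"
proof (induction w)
 case Nil
 have "h0 $$ (0, 0) = of_nat n" using n by (simp add: h0_def hgt_def)
 moreover have "single [h0] 1 - single [] (of_nat m * h0 $$ (0, 0)) : N0" using N0(3) h0_borel by (auto simp: R0_def)
 ultimately show ?case by (simp add: W_def drop_wt_def)
next
 case (Cons ab w)
 obtain a b where ab: "ab = (a, b)" by force
 have w: "w : LW" "a < 2 * n" "b < 2 * n" "hgt n a < hgt n b" using Cons ab by (auto simp: LW_Cons)
 have g: "gm n a b : spc n" using w gm_sp by blast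
 let ?G = "wact (gm n a b)" and ?e = "of_nat m * of_nat n - of_int (drop_wt w) :: complex"
  and ?d = "of_int (hgt n a - hgt n b) :: complex"
 have "?G (wact h0 (W w) - scale_pm ?e (W w)) : N0" using Cons.IH[OF w(1)] N0(1) g by (auto simp: fw.stable_def)
 hence 1: "?G (wact h0 (W w)) - scale_pm ?e (?G (W w)) : N0" by (simp add: wact_diff wact_scale)
 have 2: "wact (br h0 (gm n a b)) (W w) - (wact h0 (?G (W w)) - ?G (wact h0 (W w))) : N0"
  by (rule env(3)[OF h0_sp W_closed[OF w(1)] g])
 have 3: "wact (br h0 (gm n a b)) (W w) - scale_pm ?d (?G (W w)) : N0"
  unfolding h0_gm[OF w(2,3)] by (rule env(2)[OF g W_closed[OF w(1)]])
 have "(?G (wact h0 (W w)) - scale_pm ?e (?G (W w)))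
   - (wact (br h0 (gm n a b)) (W w) - (wact h0 (?G (W w)) - ?G (wact h0 (W w))))
   + (wact (br h0 (gm n a b)) (W w) - scale_pm ?d (?G (W w))) : N0"
  by (intro pm.subsp_add[OF N0(4)] pm.subsp_diff[OF N0(4)] 1 2 3)
 moreover have "(?G (wact h0 (W w)) - scale_pm ?e (?G (W w)))
   - (wact (br h0 (gm n a b)) (W w) - (wact h0 (?G (W w)) - ?G (wact h0 (W w))))
   + (wact (br h0 (gm n a b)) (W w) - scale_pm ?d (?G (W w)))
   = wact h0 (?G (W w)) - scale_pm (?e + ?d) (?G (W w))" by (simp only: pm.sc_left) (simp add: algebra_simps)
 moreover have "?e + ?d = of_nat m * of_nat n - of_int (drop_wt (ab # w))" by (simp add: drop_wt_def ab)
 ultimately show ?case by (simp only: ab W_Cons)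
qed

text \<open>The value at the constant sequence 0 reads off the coefficient of the empty word, as
  nonempty lowering words do not contribute. If that coefficient were nonzero, separating
  eigenvalues of \<open>h0\<close> would put the empty word into the annihilator of
  \<open>v\<close>.\<close>

lemma sigma_at_zero:
 assumes u: "u : Kv"
 shows "\<sigma> u (\<lambda>_. 0) = 0"
proof -
 have Kst: "fw.stable (sp n) Kv" by (rule fw.pres_K_stable[OF V_presents])
 have Ks: "pm.subsp Kv" using Kst by (simp add: fw.stable_def)
 have "u : FW (sp n)" using u by (simp add: Kv_def)
 then obtain e k where ek: "u = e + k" "e : pm.lspan (W ` LW)" "k : N0" using carrier_EN by (auto simp: EN_def)
 obtain A c where A: "finite A" "A <= LW" "e = (\<Sum>w\<in>A. scale_pm (c w) (W w))" using pm.lspan_image_sum[OF ek(2)] by blast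
 have eK: "e : Kv" using u ek N0_Kv pm.subsp_diff[OF Ks, of u k] by auto
 let ?x = "\<lambda>w. scale_pm (c w) (W w)"
 have "c [] = 0" if "[] : A"
 proof (rule ccontr)
  assume c: "c [] ~= 0"
  have "?x [] : Kv"
  proof (rule fw.eigen_separate[OF Kst, where h = h0 and B = "A - {[]}" and
     ev = "\<lambda>w. of_nat m * of_nat n - of_int (drop_wt w)"])
   fix w assume "w : insert [] (A - {[]})"
   hence "w : LW" using A(2) that by auto
   from pm.subsp_sc[OF N0(4) h0_W[OF this], of "c w"]
   have "wact h0 (?x w) - scale_pm (of_nat m * of_nat n - of_int (drop_wt w)) (?x w) : N0"
    by (simp add: pm.sc_diff pm.sc_sc wact_scale mult.commute)
   thus "wact h0 (?x w) - scale_pm (of_nat m * of_nat n - of_int (drop_wt w)) (?x w) : Kv" using N0_Kv by blast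
  next
   fix w assume w: "w : A - {[]}"
   hence "drop_wt w > 0" using drop_wt_pos A(2) by blast
   thus "of_nat m * of_nat n - of_int (drop_wt w) ~= of_nat m * of_nat n - (of_int (drop_wt []) :: complex)"
    by (simp add: drop_wt_def)
  next
   show "(\<Sum>w\<in>insert [] (A - {[]}). ?x w) : Kv" using eK A(3) that by (simp add: insert_absorb)
  qed (use A h0_sp in auto)
  hence "scale_pm (1 / c []) (?x []) : Kv" by (rule pm.subsp_sc[OF Ks])
  hence "single [] 1 : Kv" using c by (simp add: W_def)
  hence "word_action V (single [] 1) v = \<zero>\<^bsub>V\<^esub>" by (simp add: Kv_def)
  thus False using V.word_action_single[of "[]" v 1] V.smult_one v by simp
 qed
 hence "\<sigma> (?x w) (\<lambda>_. 0) = 0" if w: "w : A" for w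
 proof (cases w)
  case Nil thus ?thesis using \<open>[] : A ==> c [] = 0\<close> w by simp
 next
  case (Cons ab w')
  obtain a b where ab: "ab = (a, b)" by force
  have wl: "a < 2 * n" "b < 2 * n" "hgt n a < hgt n b" using A(2) w Cons ab LW_Cons by blast+
  \<comment> \<open>Row 0 of a lowering letter vanishes, so its action leaves nothing at the
    sequence 0.\<close>
  have z: "gm n a b $$ (0, j) = 0" if j: "j < 2 * n" for j
  proof -
   have "a ~= 0" using wl by (auto simp: hgt_def split: if_splits)
   moreover have "cj n b ~= 0" using wl n by (auto simp: hgt_def cj_def split: if_splits)
   ultimately show ?thesis using gm_index[of 0 n j a b] j n by auto
  qed
  have "\<sigma> (?x w) = sc_fun (c w) (sact n m (gm n a b) (\<sigma> (W w')))"
   using Cons ab sym.wordmap_wact[of "gm n a b" n m "vac m" "W w'"] gm_sp[OF wl(1,2)] by (simp add: sym.wordmap_scale W_Cons)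
  thus ?thesis using z by (simp add: sact_def sc_fun_def)
 qed
 hence "\<sigma> e (\<lambda>_. 0) = 0" unfolding A(3) sym.wordmap_sum sum_fun_apply by simp
 thus ?thesis using sigma_zero[OF ek(3)] by (simp add: ek(1) sym.wordmap_add)
qed

text \<open>The function of \<open>u\<close> is orthogonal to every word applied to
  \<open>vac\<close>: letters cross the form as adjoints acting on \<open>u\<close>, which stays in
  \<open>Kv\<close>, and pairing with \<open>vac\<close> is evaluation at 0. Being a combination of
  such words itself, the function is orthogonal to itself.\<close>

lemma sigma_Kv:
 assumes u: "u : Kv" and c: "\<forall>p<m. c p < 2 * n"
 shows "\<sigma> u c = 0"
proof -
 have Kst: "fw.stable (sp n) Kv" by (rule fw.pres_K_stable[OF V_presents])
 have words: "form n m (\<sigma> u) (foldr (sact n m) ws (vac m)) = 0" if "ws : lists (spc n)" "u : Kv" for ws u using that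
 proof (induction ws arbitrary: u)
  case Nil
  let ?z = "restrict (\<lambda>_. 0) {..<m}"
  have z: "?z : slots n m" using n by auto
  have "vac m d = (if d = ?z then 1 else 0)" if "d : slots n m" for d
   using that by (auto simp: vac_def fun_eq_iff PiE_def extensional_def)
  hence "form n m (\<sigma> u) (vac m) = (\<Sum>d\<in>slots n m. if d = ?z then \<sigma> u ?z else 0)"
   unfolding form_def by (intro sum.cong refl) auto
  also have "... = \<sigma> u ?z" using z by (simp add: finite_PiE)
  also have "... = \<sigma> u (\<lambda>_. 0)" using local_wordmap[of m n u] by (simp add: local_fun_def)
  finally show ?case using sigma_at_zero[of u] Nil by simp
 next
  case (Cons X ws)
  hence X: "X : spc n" "ws : lists (spc n)" by auto
  have "wact (adj X) u : Kv" using Kst adj_sp[OF X(1)] Cons.prems by (auto simp: fw.stable_def)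
  from Cons.IH[OF this] show ?case using form_sact[OF X(1)] sym.wordmap_wact[of "adj X" n m "vac m" u] adj_sp[OF X(1)] by simp
 qed
 have w: "\<sigma> u = fsp.lin_ext (\<lambda>ws. foldr (sact n m) ws (vac m)) u" by (simp only: sym.wordmap_def)
 have "fsp.lin_ext (\<lambda>ws. foldr (sact n m) ws (vac m)) u : {g. form n m (\<sigma> u) g = 0}"
 proof (rule fsp.lin_ext_in)
  show "fsp.subsp {g. form n m (\<sigma> u) g = 0}" by (rule fsp.subspI) (simp_all add: form_linear)
  fix ws assume ws: "ws : keys u"
  have "ws : lists (carrier (sp n))" using ws u unfolding Kv_def FW_def by blast
  thus "foldr (sact n m) ws (vac m) : {g. form n m (\<sigma> u) g = 0}" using words[of ws u] u by simp
 qed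
 hence 0: "form n m (\<sigma> u) (\<sigma> u) = 0" unfolding w[symmetric] by (rule CollectD)
 have "restrict c {..<m} : slots n m" using c by auto
 from form_self[OF 0 this] have "\<sigma> u (restrict c {..<m}) = 0" .
 moreover have "\<forall>p<m. c p = restrict c {..<m} p" by simp
 ultimately show ?thesis using local_wordmap[of m n u] unfolding local_fun_def by metis
qed

lemma sigma_invalid: "\<not> (\<forall>p<m. c p < 2 * n) ==> \<sigma> u c = 0"
proof -
 assume c: "\<not> (\<forall>p<m. c p < 2 * n)"
 hence v: "vac m c = 0" using n by (auto simp: vac_def)
 have "foldr (sact n m) ws (vac m) c = 0" for ws using v sact_invalid[OF c] by (cases ws) auto
 thus ?thesis by (simp add: sym.wordmap_def fsp.lin_ext_def sum_fun_apply sc_fun_def)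
qed

text \<open>For the converse, the image in \<open>V\<close> of the kernel of \<open>\<sigma>\<close>
  is a submodule; it is not all of \<open>V\<close>, because \<open>vac\<close> does not vanish at
  0.\<close>

lemma Kv_iff: "u : FW (sp n) ==> u : Kv \<longleftrightarrow> \<sigma> u = 0"
proof
 assume "u : Kv"
 hence "\<sigma> u c = 0" for c using sigma_Kv sigma_invalid by metis
 thus "\<sigma> u = 0" by (simp add: fun_eq_iff)
next
 let ?K = "{u : FW (sp n). \<sigma> u = 0}"
 assume u: "u : FW (sp n)" and s: "\<sigma> u = 0"
 have "fw.stable (sp n) ?K" unfolding fw.stable_def
 proof (intro conjI ballI pm.subspI)
  fix X u assume X: "X : carrier (sp n)" and "u : ?K"
  thus "wact X u : ?K" using wact_closed[OF X] sym.wordmap_wact[OF X] sym.\<alpha>_sc[OF X, of m 0 0] by simp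
 qed (auto simp: sym.wordmap_add sym.wordmap_scale intro: pm.subsp_zero[OF FW_subsp]
   pm.subsp_add[OF FW_subsp] pm.subsp_sc[OF FW_subsp])
 from fw.pres_stable_image[OF V_presents this]
 have "(\<lambda>u. word_action V u v) ` ?K = {\<zero>\<^bsub>V\<^esub>} \<or> (\<lambda>u. word_action V u v) ` ?K = carrier V"
  using irr by (simp add: irreducible_module_def)
 thus "u : Kv"
 proof
  assume "(\<lambda>u. word_action V u v) ` ?K = {\<zero>\<^bsub>V\<^esub>}"
  thus ?thesis using u s by (auto simp: Kv_def)
 next
  assume "(\<lambda>u. word_action V u v) ` ?K = carrier V"
  hence "v : (\<lambda>u. word_action V u v) ` ?K" using v(1) by simp
  then obtain w where w': "v = word_action V w v" "w : ?K" by (rule imageE)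
  have w: "w : ?K" "word_action V w v = v" using w'(2) w'(1)[symmetric] by blast+
  have "word_action V (single [] 1) v = v" using V.word_action_single[of "[]" v 1] V.smult_one v by simp
  hence "single [] 1 - w : Kv" using fw.pres_eq[OF V_presents, of "single [] 1" w] w fw_single[of "[]" "sp n" 1] by auto
  from sigma_at_zero[OF this] have "vac m (\<lambda>_. 0) = 0" using w by (simp add: sym.wordmap_diff fsp.sc_one)
  thus ?thesis by (simp add: vac_def)
 qed
qed

text \<open>An embedding of \<open>V\<close> into functions of sequences; by \<open>Kv_iff\<close>
  the choice of \<open>u\<close> does not matter.\<close>

definition coord :: "(nat => nat) => 'v => complex" where
 "coord c x = \<sigma> (SOME u. u : FW (sp n) \<and> word_action V u v = x) c"

lemma coord_word: "u : FW (sp n) ==> coord c (word_action V u v) = \<sigma> u c"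
proof -
 assume u: "u : FW (sp n)"
 define w where "w = (SOME w. w : FW (sp n) \<and> word_action V w v = word_action V u v)"
 have w: "w : FW (sp n) \<and> word_action V w v = word_action V u v" unfolding w_def by (rule someI[of _ u]) (use u in simp)
 hence "w - u : Kv" using fw.pres_eq[OF V_presents] u by blast
 hence "\<sigma> (w - u) = 0" using Kv_iff pm.subsp_diff[OF FW_subsp] u w by blast
 thus ?thesis by (simp add: coord_def sym.wordmap_diff flip: w_def)
qed

lemma carrier_word: "x : carrier V ==> \<exists>u\<in>FW (sp n). x = word_action V u v"
 using fw.pres_carrier[OF V_presents] by auto

lemma coord_add: "x : carrier V ==> y : carrier V ==> coord c (x \<oplus>\<^bsub>V\<^esub> y) = coord c x + coord c y"
proof -
 assume "x : carrier V" "y : carrier V"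
 then obtain u w where u: "u : FW (sp n)" "w : FW (sp n)"
  "x = word_action V u v" "y = word_action V w v" using carrier_word by metis
 have "x \<oplus>\<^bsub>V\<^esub> y = word_action V (u + w) v" using fw.pres_add[OF V_presents u(1,2)] u by simp
 thus ?thesis using u coord_word pm.subsp_add[OF FW_subsp u(1,2)] by (simp add: sym.wordmap_add)
qed

lemma coord_smult: "x : carrier V ==> coord c (a \<odot>\<^bsub>V\<^esub> x) = a * coord c x"
proof -
 assume "x : carrier V"
 then obtain u where u: "u : FW (sp n)" "x = word_action V u v" using carrier_word by metis
 have "a \<odot>\<^bsub>V\<^esub> x = word_action V (scale_pm a u) v" using fw.pres_smult[OF V_presents u(1)] u by simp
 thus ?thesis using u coord_word pm.subsp_sc[OF FW_subsp u(1)] by (simp add: sym.wordmap_scale sc_fun_def)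
qed

lemma coord_act: "X : spc n ==> x : carrier V ==> coord c (act V X x) = sact n m X (\<lambda>c. coord c x) c"
 using carrier_word[of x] fw.pres_act[OF V_presents, of X] wact_closed[of X "sp n"] sym.wordmap_wact[of X n m "vac m"]
 by (auto simp: coord_word)

lemma coord_v: "coord c v = vac m c"
 using coord_word[of "single [] 1" c] fw_single[of "[]" "sp n" 1] V.word_action_single[of "[]" v 1] V.smult_one v
 by (simp add: fsp.sc_one)

lemma coord_inj: "x : carrier V ==> (\<And>c. coord c x = 0) ==> x = \<zero>\<^bsub>V\<^esub>"
 using carrier_word[of x] Kv_iff by (auto simp: coord_word Kv_def fun_eq_iff)

end



section \<open>Straightening\<close>

text \<open>The letter of colour \<open>a\<close>: its first column is the basis vector
  \<open>a\<close>, so it moves basis vector 0 to \<open>a\<close>. The factor 1/2 undoes the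
  doubling in \<open>gm n n 0\<close>.\<close>

definition ym :: "nat => nat => complex mat" where
 "ym n a = (if a = n then (1 / 2) \<cdot>\<^sub>m gm n n 0 else gm n a 0)"

text \<open>The parabolic subalgebra that stabilises the line of basis vector 0. It acts on highest
  weight vectors by scalars, and the \<open>ym n a\<close> with \<open>0 < a\<close> span a
  complement.\<close>

definition par :: "nat => complex mat => bool" where
 "par n X \<longleftrightarrow> X : spc n \<and> (\<forall>b. 0 < b \<longrightarrow> b < 2 * n \<longrightarrow> X $$ (b, 0) = 0)"

text \<open>A recolouring element: parabolic, and its bracket with \<open>ym n n\<close> is
  \<open>ym n c\<close> up to parabolic elements. For \<open>c = n\<close> it lies in the Cartan
  subalgebra, and the factor 1/2 normalises its eigenvalue on \<open>ym n n\<close> to 1.\<close>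

definition ycol :: "nat => nat => complex mat" where
 "ycol n c = (if c = n then (1 / 2) \<cdot>\<^sub>m gm n n n else gm n c n)"

lemma ym_sp: "a < 2 * n ==> ym n a : spc n"
 by (auto simp: ym_def intro!: sp_smult gm_sp)

lemma ym_col0:
 assumes "0 < a" "a < 2 * n" "b < 2 * n"
 shows "ym n a $$ (b, 0) = (if b = a then 1 else 0)"
proof -
 have n: "0 < 2 * n" using assms by simp
 have "cj n a = 0 \<longleftrightarrow> a = n" using assms by (auto simp: cj_def)
 moreover have "cj n 0 = n" "sg n 0 = 1" "sg n n = - 1" using n by (auto simp: cj_def sg_def)
 ultimately show ?thesis using assms n by (auto simp: ym_def gm_index index_smult_mat carrier_matD[OF gm_carrier])
qed

lemma ycol_sp: "c < 2 * n ==> ycol n c : spc n"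
 by (auto simp: ycol_def intro!: sp_smult gm_sp)

lemma ycol_entries:
 assumes "0 < c" "c < 2 * n" "0 < b" "b < 2 * n"
 shows "ycol n c $$ (b, 0) = 0" "ycol n c $$ (b, n) - (if b = n then ycol n c $$ (0, 0) else 0) = (if b = c then 1 else 0)"
proof -
 have n: "0 < n" "n < 2 * n" using assms by auto
 have "cj n c = 0 \<longleftrightarrow> c = n" "cj n c = n \<longleftrightarrow> c = 0" using assms by (auto simp: cj_def)
 moreover have "cj n n = 0" "sg n n * sg n n = 1" using n by (auto simp: cj_def sg_def)
 ultimately show "ycol n c $$ (b, 0) = 0" "ycol n c $$ (b, n) - (if b = n then ycol n c $$ (0, 0) else 0) = (if b = c then 1 else 0)"
  using assms n by (auto simp: ycol_def gm_index index_smult_mat carrier_matD[OF gm_carrier])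
qed

lemma ycol_par: "0 < c ==> c < 2 * n ==> par n (ycol n c)"
 by (simp add: par_def ycol_sp ycol_entries)

lemma ym_n_entry:
 assumes "i < 2 * n" "j < 2 * n"
 shows "ym n n $$ (i, j) = (if i = n \<and> j = 0 then 1 else 0)"
proof -
 have n: "0 < n" using assms by auto
 have "cj n n = 0" "cj n 0 = n" "sg n n * sg n 0 = - 1" using n by (auto simp: cj_def sg_def)
 thus ?thesis using assms n by (auto simp: ym_def gm_index index_smult_mat carrier_matD[OF gm_carrier])
qed

lemma ycol_bracket:
 assumes c: "0 < c" "c < 2 * n" and b: "0 < b" "b < 2 * n"
 shows "br (ycol n c) (ym n n) $$ (b, 0) = (if b = c then 1 else 0)"
proof -
 have n: "0 < n" "n < 2 * n" using c by auto
 note C = sp_carrierD[OF ycol_sp[OF c(2)]] sp_carrierD[OF ym_sp[OF n(2)]]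
 have "(ycol n c * ym n n) $$ (b, 0) = (\<Sum>k<2*n. ycol n c $$ (b, k) * ym n n $$ (k, 0))"
  by (rule mat_mult_entry[OF C]) (use b n in auto)
 also have "... = (\<Sum>k<2*n. if k = n then ycol n c $$ (b, n) else 0)"
  by (rule sum.cong) (use n in \<open>auto simp: ym_n_entry\<close>)
 finally have 1: "(ycol n c * ym n n) $$ (b, 0) = ycol n c $$ (b, n)" using n by simp
 have "(ym n n * ycol n c) $$ (b, 0) = (\<Sum>k<2*n. ym n n $$ (b, k) * ycol n c $$ (k, 0))"
  by (rule mat_mult_entry[OF C(2,1)]) (use b n in auto)
 also have "... = (\<Sum>k<2*n. if k = 0 then if b = n then ycol n c $$ (0, 0) else 0 else 0)"
  by (rule sum.cong) (use b in \<open>auto simp: ym_n_entry\<close>)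
 finally have 2: "(ym n n * ycol n c) $$ (b, 0) = (if b = n then ycol n c $$ (0, 0) else 0)" using n by simp
 have "br (ycol n c) (ym n n) $$ (b, 0) = (ycol n c * ym n n) $$ (b, 0) - (ym n n * ycol n c) $$ (b, 0)"
  by (rule index_minus_mat(1)) (use C b n in auto)
 thus ?thesis unfolding 1 2 using ycol_entries(2)[OF c b] by simp
qed

definition expo :: "nat set => nat => (nat => nat) set" where
 "expo S s = {e. (\<forall>v. v \<notin> S \<longrightarrow> e v = 0) \<and> sum e S <= s}"

definition expo_lists :: "nat => nat => nat list set" where
 "expo_lists q s = {l. length l = q \<and> sum_list l <= s}"

lemma finite_expo: "finite S ==> finite (expo S s)"
proof (rule finite_subset)
 show "expo S s <= {e. \<forall>v. (v : S \<longrightarrow> e v : {..s}) \<and> (v \<notin> S \<longrightarrow> e v = 0)}" if "finite S"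
  using that unfolding expo_def by (auto dest: order_trans[OF member_le_sum[of _ S]])
 show "finite {e. \<forall>v. (v : S \<longrightarrow> e v : {..s}) \<and> (v \<notin> S \<longrightarrow> e v = (0::nat))}" if "finite S"
  by (rule finite_set_of_finite_funs) (use that in auto)
qed

lemma expo_lists_bij:
 assumes "distinct vs"
 shows "bij_betw (\<lambda>e. map e vs) (expo (set vs) s) (expo_lists (length vs) s)"
 unfolding bij_betw_def
proof
 show "inj_on (\<lambda>e. map e vs) (expo (set vs) s)" by (rule inj_onI) (auto simp: expo_def fun_eq_iff; metis)
 have sl: "sum_list (map e vs) = sum e (set vs)" for e :: "nat => nat" using assms by (simp add: sum_list_distinct_conv_sum_set)
 show "(\<lambda>e. map e vs) ` expo (set vs) s = expo_lists (length vs) s"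
 proof (intro equalityI subsetI)
  fix l assume l: "l : expo_lists (length vs) s"
  define e where "e v = (case map_of (zip vs l) v of None => 0 | Some t => t)" for v
  have "map e vs = l" using l assms by (auto simp: e_def expo_lists_def map_of_zip_nth intro!: nth_equalityI)
  moreover have "e v = 0" if "v \<notin> set vs" for v
   using that l by (auto simp: e_def expo_lists_def split: option.split dest!: map_of_SomeD set_zip_leftD)
  ultimately show "l : (\<lambda>e. map e vs) ` expo (set vs) s"
   using l sl[of e] by (intro image_eqI[of _ _ e]) (auto simp: expo_def expo_lists_def)
 qed (use sl in \<open>auto simp: expo_def expo_lists_def\<close>)
qed

text \<open>A common setting for the graded and the filtered side. The index \<open>d\<close> of
  \<open>wd\<close> is a total degree: a word of smaller degree is completed by powers of a
  homogenising parameter, absorbed in \<open>v0\<close>. This is why \<open>rel_par\<close> passes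
  from \<open>v0 d\<close> to \<open>v0 (d + s)\<close> with a power sum of the parameters as
  scalar. \<open>rel_hom\<close> is the deformed relation, assumed for letters of colour
  \<open>n\<close> only.\<close>

locale fusion_core = cvs sc for sc :: "complex => 'm::ab_group_add => 'm" +
 fixes n :: nat and J :: "nat set" and z :: "nat => complex" and m :: "nat => nat"
  and N :: "'m set" and ac :: "complex mat => nat => 'm => 'm" and v0 :: "nat => 'm"
  and wd :: "nat => (complex mat \<times> nat) list => 'm"
 assumes n: "n \<ge> 1" and J: "finite J"
  and N: "subsp N"
  and ac_add: "X : spc n ==> ac X s (u + w) = ac X s u + ac X s w"
  and ac_sc: "X : spc n ==> ac X s (sc c u) = sc c (ac X s u)"
  and ac_N: "X : spc n ==> u : N ==> ac X s u : N"
  and wd_Nil: "wd d [] = v0 d"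
  and wd_Cons: "wd d ((X, s) # ws) = ac X s (wd (d - s) ws)"
  and rel_add: "X : spc n ==> Y : spc n ==> ok_word n ws ==>
   ac (X + Y) s (wd d ws) - (ac X s (wd d ws) + ac Y s (wd d ws)) : N"
  and rel_smult: "X : spc n ==> ok_word n ws ==>
   ac (c \<cdot>\<^sub>m X) s (wd d ws) - sc c (ac X s (wd d ws)) : N"
  and rel_bracket: "X : spc n ==> Y : spc n ==> ok_word n ws ==>
   ac (br X Y) (s + t) (wd d ws) - (ac X s (ac Y t (wd d ws)) - ac Y t (ac X s (wd d ws))) : N"
  and rel_par: "par n X ==> ac X s (v0 d) - sc ((\<Sum>j\<in>J. of_nat (m j) * z j ^ s) * X $$ (0, 0)) (v0 (d + s)) : N"
  and rel_hom: "q \<ge> 1 ==> (\<Sum>j\<in>J. min q (m j)) < q + s ==> s <= d ==>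
   (\<Sum>l\<in>expo_lists q s. sc (fps_nth (qser J z m q) (s - sum_list l)) (wd d (map (\<lambda>t. (ym n n, t)) l))) : N"
begin

definition ok :: "(complex mat \<times> nat) list => bool" where "ok ws \<longleftrightarrow> ok_word n ws"
definition deg :: "('b \<times> nat) list => nat" where "deg ws = degsum ws"
definition yw :: "(nat \<times> nat) list => (complex mat \<times> nat) list" where "yw w = map (\<lambda>(a, s). (ym n a, s)) w"
definition yok :: "(nat \<times> nat) list => bool" where "yok w \<longleftrightarrow> fst ` set w <= {1..<2 * n}"

lemma ok_simps [simp]: "ok []" "ok ((X, s) # ws) \<longleftrightarrow> X : spc n \<and> ok ws" "ok (us @ vs) \<longleftrightarrow> ok us \<and> ok vs"
 by (auto simp: ok_def)
lemma deg_simps [simp]: "deg [] = 0" "deg ((x, s) # ws) = s + deg ws" "deg (us @ vs) = deg us + deg vs"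
 by (auto simp: deg_def)
lemma yw_simps [simp]: "yw [] = []" "yw ((a, s) # w) = (ym n a, s) # yw w" "yw (u @ w) = yw u @ yw w"
  "length (yw w) = length w" by (auto simp: yw_def)
lemma yok_simps [simp]: "yok []" "yok ((a, s) # w) \<longleftrightarrow> 0 < a \<and> a < 2 * n \<and> yok w" "yok (u @ w) \<longleftrightarrow> yok u \<and> yok w"
 by (auto simp: yok_def)
lemma deg_yw [simp]: "deg (yw w) = deg w"
 by (induction w) auto
lemma ok_yw: "yok w ==> ok (yw w)"
 by (induction w) (auto intro: ym_sp)

lemma ac_diff: "X : spc n ==> ac X s (u - w) = ac X s u - ac X s w"
 using ac_add[of X s u "- w"] ac_sc[of X s "- 1" w] by (simp add: sc_m1)
lemma ac_zero: "X : spc n ==> ac X s 0 = 0"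
 using ac_sc[of X s 0 0] by simp
lemma ac_sum: "X : spc n ==> ac X s (\<Sum>i\<in>I. f i) = (\<Sum>i\<in>I. ac X s (f i))"
 by (induction I rule: infinite_finite_induct) (auto simp: ac_add ac_zero)

lemmas rel_add' = rel_add[folded ok_def]
 and rel_smult' = rel_smult[folded ok_def] and rel_bracket' = rel_bracket[folded ok_def]

text \<open>The first column of \<open>X\<close> is cleared one entry at a time, and what is left is
  parabolic.\<close>

lemma decompose_aux:
 assumes "finite A" "A <= {1..<2 * n}" "X : spc n" "\<And>b. b : {1..<2 * n} - A ==> X $$ (b, 0) = 0"
 shows "\<exists>R. par n R \<and> (\<forall>s d ws. ok ws \<longrightarrow> ac X s (wd d ws) -
  (ac R s (wd d ws) + (\<Sum>a\<in>A. sc (X $$ (a, 0)) (ac (ym n a) s (wd d ws)))) : N)" using assms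
proof (induction A arbitrary: X rule: finite_induct)
 case empty
 hence "par n X" by (auto simp: par_def)
 thus ?case by (intro exI[of _ X]) (auto intro: subsp_zero[OF N])
next
 case (insert a A)
 have a: "0 < a" "a < 2 * n" using insert.prems by auto
 let ?c = "- X $$ (a, 0)"
 define X' where "X' = X + ?c \<cdot>\<^sub>m ym n a"
 have X': "X' : spc n" unfolding X'_def by (intro sp_add sp_smult ym_sp insert.prems a)
 have ent: "X' $$ (b, 0) = X $$ (b, 0) + ?c * (if b = a then 1 else 0)" if "b < 2 * n" for b
  using that a ym_col0[OF a that] sp_dims[OF ym_sp[OF a(2)]] n by (simp add: X'_def)
 have "X' $$ (b, 0) = 0" if "b : {1..<2 * n} - A" for b using ent[of b] insert.prems(3)[of b] that by (cases "b = a") auto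
 then obtain R where R: "par n R" "\<And>s d ws. ok ws ==> ac X' s (wd d ws) -
   (ac R s (wd d ws) + (\<Sum>a\<in>A. sc (X' $$ (a, 0)) (ac (ym n a) s (wd d ws)))) : N"
  using insert.IH[OF _ X'] insert.prems(1) by blast
 have "ac X s (wd d ws) - (ac R s (wd d ws) + (\<Sum>a\<in>insert a A. sc (X $$ (a, 0)) (ac (ym n a) s (wd d ws)))) : N"
  if ws: "ok ws" for s d ws
 proof -
  let ?u = "wd d ws"
  have "ac X' s ?u - (ac X s ?u + ac (?c \<cdot>\<^sub>m ym n a) s ?u) : N"
   unfolding X'_def by (rule rel_add'[OF insert.prems(2) sp_smult[OF ym_sp[OF a(2)]] ws])
  moreover have "ac (?c \<cdot>\<^sub>m ym n a) s ?u - sc ?c (ac (ym n a) s ?u) : N" by (rule rel_smult'[OF ym_sp[OF a(2)] ws])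
  ultimately have 1: "(ac X' s ?u - (ac X s ?u + ac (?c \<cdot>\<^sub>m ym n a) s ?u)) + (ac (?c \<cdot>\<^sub>m ym n a) s ?u - sc ?c (ac (ym n a) s ?u)) : N"
   by (rule subsp_add[OF N])
  have eq: "(\<Sum>a\<in>A. sc (X' $$ (a, 0)) (ac (ym n a) s ?u)) = (\<Sum>a\<in>A. sc (X $$ (a, 0)) (ac (ym n a) s ?u))"
  proof (rule sum.cong)
   fix b assume b: "b : A"
   hence "b ~= a" "b < 2 * n" using insert by auto
   thus "sc (X' $$ (b, 0)) (ac (ym n b) s ?u) = sc (X $$ (b, 0)) (ac (ym n b) s ?u)" using ent[of b] by simp
  qed simp
  have alg: "(x' - (r + S)) - ((x' - (x + q)) + (q - - p)) = x - (r + (p + S))" for x' r S x q p :: 'm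
   by (simp add: algebra_simps)
  have "ac X s ?u - (ac R s ?u + (sc (X $$ (a, 0)) (ac (ym n a) s ?u) + (\<Sum>a\<in>A. sc (X $$ (a, 0)) (ac (ym n a) s ?u)))) : N"
   using subsp_diff[OF N R(2)[OF ws, of s d, unfolded eq] 1] unfolding sc_uminus alg .
  thus ?thesis using insert(1,2) by (simp only: sum.insert not_False_eq_True)
 qed
 thus ?case using R(1) by blast
qed

lemma decompose:
 assumes "X : spc n"
 shows "\<exists>R. par n R \<and> (\<forall>s d ws. ok ws \<longrightarrow> ac X s (wd d ws) -
  (ac R s (wd d ws) + (\<Sum>a\<in>{1..<2 * n}. sc (X $$ (a, 0)) (ac (ym n a) s (wd d ws)))) : N)"
 using decompose_aux[of "{1..<2 * n}" X] assms by auto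

text \<open>The filtration by length. The strict inequality makes \<open>B d 0\<close> equal to
  \<open>N\<close>, where the final descent ends.\<close>

definition B :: "nat => nat => 'm set" where
 "B d r = lspan (N \<union> {wd d (yw w) | w. length w < r \<and> yok w \<and> deg w <= d})"

lemma B_subsp: "subsp (B d r)"
 unfolding B_def by (rule subsp_lspan)
lemma N_B: "u : N ==> u : B d r"
 unfolding B_def by (rule lspan_base) simp
lemma word_B: "length w < r ==> yok w ==> deg w <= d ==> wd d (yw w) : B d r"
 unfolding B_def by (rule lspan_base) auto
lemma B_mono: "r <= r' ==> B d r <= B d r'"
 unfolding B_def by (rule lspan_mono) auto
lemma B_least: "subsp S ==> N <= S ==> (\<And>w. length w < r ==> yok w ==> deg w <= d ==> wd d (yw w) : S) ==> B d r <= S"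
 unfolding B_def by (rule lspan_least) auto

lemma vimage_subsp: "X : spc n ==> subsp S ==> subsp {u. ac X s u : S}"
 by (rule subspI) (auto simp: ac_zero ac_add ac_sc intro: subsp_zero subsp_add subsp_sc)

lemma ym_B:
 assumes a: "0 < a" "a < 2 * n" and u: "u : B d r"
 shows "ac (ym n a) s u : B (d + s) (r + 1)"
proof -
 have "B d r <= {u. ac (ym n a) s u : B (d + s) (r + 1)}"
 proof (rule B_least[OF vimage_subsp[OF ym_sp[OF a(2)] B_subsp]])
  fix w assume "length w < r" "yok w" "deg w <= d"
  hence "wd (d + s) (yw ((a, s) # w)) : B (d + s) (r + 1)" using a by (intro word_B) auto
  thus "wd d (yw w) : {u. ac (ym n a) s u : B (d + s) (r + 1)}" by (simp add: wd_Cons)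
 qed (use ac_N[OF ym_sp[OF a(2)]] N_B in auto)
 thus ?thesis using u by auto
qed

text \<open>The parabolic part is treated by a premise, so that the lemma can serve inside the
  induction that proves this premise.\<close>

lemma sp_word_B:
 assumes X: "X : spc n" and w: "yok w" "deg w <= d" "length w < r"
  and IH: "\<And>R. par n R ==> ac R s (wd d (yw w)) : B (d + s) (r + 1)"
 shows "ac X s (wd d (yw w)) : B (d + s) (r + 1)"
proof -
 from decompose[OF X] obtain R where R': "par n R \<and> (\<forall>s d ws. ok ws \<longrightarrow> ac X s (wd d ws) -
  (ac R s (wd d ws) + (\<Sum>a\<in>{1..<2 * n}. sc (X $$ (a, 0)) (ac (ym n a) s (wd d ws)))) : N)" ..
 note R = conjunct1[OF R'] conjunct2[OF R', rule_format, OF ok_yw[OF w(1)], of s d]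
 have "(\<Sum>a\<in>{1..<2 * n}. sc (X $$ (a, 0)) (ac (ym n a) s (wd d (yw w)))) : B (d + s) (r + 1)"
 proof (rule subsp_sum[OF B_subsp])
  fix a assume "a : {1..<2 * n}"
  hence "0 < a" "a < 2 * n" by auto
  from ym_B[OF this word_B[OF w(3,1,2)]]
  show "sc (X $$ (a, 0)) (ac (ym n a) s (wd d (yw w))) : B (d + s) (r + 1)" by (rule subsp_sc[OF B_subsp])
 qed
 hence "ac R s (wd d (yw w)) + (\<Sum>a\<in>{1..<2 * n}. sc (X $$ (a, 0)) (ac (ym n a) s (wd d (yw w)))) : B (d + s) (r + 1)"
  by (rule subsp_add[OF B_subsp IH[OF R(1)]])
 thus ?thesis using subsp_cong[OF B_subsp N_B[OF R(2)]] by blast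
qed

text \<open>A parabolic element moving to the right leaves brackets, each a single letter in place
  of another, so lengths do not grow; on reaching \<open>v0\<close> it becomes a scalar.\<close>

lemma par_word_B:
 assumes "par n X" "yok w" "deg w <= d"
 shows "ac X s (wd d (yw w)) : B (d + s) (length w + 1)"
 using assms
proof (induction w arbitrary: X s d)
 case Nil
 have "v0 (d + s) : B (d + s) 1" using word_B[of "[]" 1 "d + s"] by (simp add: wd_Nil)
 hence "sc c (v0 (d + s)) : B (d + s) 1" for c by (rule subsp_sc[OF B_subsp])
 thus ?case using subsp_cong[OF B_subsp N_B[OF rel_par[OF Nil(1), of s d]]] by (simp add: wd_Nil)
next
 case (Cons y w)
 obtain a t where at: "y = (a, t)" by force
 have a: "0 < a" "a < 2 * n" "yok w" "t + deg w <= d" using Cons.prems by (auto simp: at)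
 have X: "X : spc n" using Cons.prems by (simp add: par_def)
 note y = ym_sp[OF a(2)]
 let ?u = "wd (d - t) (yw w)" and ?r = "length w + 1"
 have dw: "deg w <= d - t" using a by simp
 have "ac (ym n a) t (ac X s ?u) : B (d - t + s + t) (?r + 1)" by (rule ym_B[OF a(1,2) Cons.IH[OF Cons.prems(1) a(3) dw]])
 moreover have "ac (br X (ym n a)) (s + t) ?u : B (d - t + (s + t)) (?r + 1)" by (rule sp_word_B[OF sp_bracket[OF X y] a(3) dw])
   (use Cons.IH[OF _ a(3) dw] B_mono[of ?r "?r + 1"] in \<open>auto\<close>)
 moreover have "d - t + s + t = d + s" "d - t + (s + t) = d + s" using a by auto
 ultimately have 1: "ac (br X (ym n a)) (s + t) ?u + ac (ym n a) t (ac X s ?u) : B (d + s) (?r + 1)"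
  using subsp_add[OF B_subsp] by metis
 have "ac (br X (ym n a)) (s + t) ?u - (ac X s (ac (ym n a) t ?u) - ac (ym n a) t (ac X s ?u)) : B (d + s) (?r + 1)"
  by (rule N_B[OF rel_bracket'[OF X y ok_yw[OF a(3)]]])
 from subsp_diff[OF B_subsp 1 this] show ?case by (simp add: at wd_Cons)
qed

lemma par_B:
 assumes X: "par n X" and u: "u : B d r"
 shows "ac X s u : B (d + s) r"
proof -
 have sp: "X : spc n" using X by (simp add: par_def)
 have "B d r <= {u. ac X s u : B (d + s) r}"
 proof (rule B_least[OF vimage_subsp[OF sp B_subsp]])
  fix w assume w: "length w < r" "yok w" "deg w <= d"
  thus "wd d (yw w) : {u. ac X s u : B (d + s) r}" using par_word_B[OF X w(2,3)] B_mono[of "length w + 1" r] by auto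
 qed (use ac_N[OF sp] N_B in auto)
 thus ?thesis using u by auto
qed

lemma sp_B:
 assumes X: "X : spc n" and u: "u : B d r"
 shows "ac X s u : B (d + s) (r + 1)"
proof -
 have "B d r <= {u. ac X s u : B (d + s) (r + 1)}"
 proof (rule B_least[OF vimage_subsp[OF X B_subsp]])
  fix w assume w: "length w < r" "yok w" "deg w <= d"
  have "ac X s (wd d (yw w)) : B (d + s) (r + 1)"
   by (rule sp_word_B[OF X w(2,3,1)]) (use par_word_B[OF _ w(2,3)] B_mono[of "length w + 1" "r + 1"] w in auto)
  thus "wd d (yw w) : {u. ac X s u : B (d + s) (r + 1)}" by simp
 qed (use ac_N[OF X] N_B in auto)
 thus ?thesis using u by auto
qed

lemma word_in_B: "ok ws ==> deg ws <= d ==> wd d ws : B d (length ws + 1)"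
proof (induction ws arbitrary: d)
 case Nil
 thus ?case using word_B[of "[]" 1 d] by simp
next
 case (Cons x ws)
 obtain X s where x: "x = (X, s)" by force
 have "wd (d - s) ws : B (d - s) (length ws + 1)" using Cons by (auto simp: x)
 from sp_B[OF _ this, of X s] show ?case using Cons.prems by (simp add: x wd_Cons)
qed

text \<open>The letters to the right absorb the parabolic letter, and each letter in front adds at
  most one to the length.\<close>

lemma par_letter_B:
 assumes "ok us" "par n X" "ok vs" "deg us + s + deg vs <= d"
 shows "wd d (us @ (X, s) # vs) : B d (length us + length vs + 1)"
 using assms
proof (induction us arbitrary: d)
 case Nil
 have "wd (d - s) vs : B (d - s) (length vs + 1)" using Nil by (intro word_in_B) auto
 from par_B[OF Nil(2) this, of s] show ?case using Nil by (simp add: wd_Cons)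
next
 case (Cons y us)
 obtain Y t where y: "y = (Y, t)" by force
 have "wd (d - t) (us @ (X, s) # vs) : B (d - t) (length us + length vs + 1)" using Cons by (auto simp: y)
 from sp_B[OF _ this, of Y t] show ?case using Cons.prems by (simp add: y wd_Cons)
qed

lemma swap_B:
 assumes "ok (x # y # vs)" "deg (x # y # vs) <= d"
 shows "wd d (x # y # vs) - wd d (y # x # vs) : B d (length vs + 2)"
proof -
 obtain X s Y t where xy: "x = (X, s)" "y = (Y, t)" by force
 have X: "X : spc n" "Y : spc n" "ok vs" using assms by (auto simp: xy)
 let ?u = "wd (d - (s + t)) vs"
 have "ac (br X Y) (s + t) ?u - (ac X s (ac Y t ?u) - ac Y t (ac X s ?u)) : B d (length vs + 2)"
  by (rule N_B[OF rel_bracket'[OF X]])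
 moreover have "wd d ((br X Y, s + t) # vs) : B d (length ((br X Y, s + t) # vs) + 1)"
  by (rule word_in_B) (use X sp_bracket assms in \<open>auto simp: xy\<close>)
 hence "ac (br X Y) (s + t) ?u : B d (length vs + 2)" by (simp add: wd_Cons)
 ultimately have "ac X s (ac Y t ?u) - ac Y t (ac X s ?u) : B d (length vs + 2)" using subsp_cong[OF B_subsp] by blast
 thus ?thesis by (simp add: xy wd_Cons add.commute)
qed

lemma move_B:
 assumes "ok (us @ x # vs)" "deg (us @ x # vs) <= d"
 shows "wd d (us @ x # vs) - wd d (x # us @ vs) : B d (length us + length vs + 1)"
 using assms
proof (induction us arbitrary: d)
 case Nil
 thus ?case by (simp add: subsp_zero[OF B_subsp])
next
 case (Cons y us)
 obtain X s Y t where xy: "x = (X, s)" "y = (Y, t)" by force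
 have "wd (d - t) (us @ x # vs) - wd (d - t) (x # us @ vs) : B (d - t) (length us + length vs + 1)" using Cons by (auto simp: xy)
 from sp_B[OF _ this, of Y t]
 have 1: "wd d (y # us @ x # vs) - wd d (y # x # us @ vs) : B d (length us + length vs + 1 + 1)"
  using Cons.prems by (simp add: xy wd_Cons ac_diff)
 have "wd d (y # x # us @ vs) - wd d (x # y # us @ vs) : B d (length (us @ vs) + 2)"
  by (rule swap_B) (use Cons.prems in \<open>auto simp: xy\<close>)
 with 1 have "(wd d (y # us @ x # vs) - wd d (y # x # us @ vs)) + (wd d (y # x # us @ vs) - wd d (x # y # us @ vs))
   : B d (length us + length vs + 2)" by (intro subsp_add[OF B_subsp]) auto
 thus ?case by simp
qed

lemma deg_mset: "mset ws = mset ws' ==> deg ws = deg ws'"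
 unfolding deg_def by (metis mset_map sum_mset_sum_list)

lemma ok_mset: "mset ws = mset ws' ==> ok ws = ok ws'"
 unfolding ok_def by (metis set_mset_mset)

text \<open>Exchanging neighbours costs a word with one letter less. Up to shorter words the letters
  are commuting variables, which is what lets polynomials govern them.\<close>

lemma permute_B:
 assumes "mset ws = mset ws'" "ok ws" "deg ws <= d"
 shows "wd d ws - wd d ws' : B d (length ws)"
 using assms
proof (induction ws arbitrary: ws' d)
 case Nil
 thus ?case by (simp add: subsp_zero[OF B_subsp])
next
 case (Cons x ws)
 obtain X s where x: "x = (X, s)" by force
 have "x : set ws'" using Cons.prems(1) by (metis list.set_intros(1) set_mset_mset)
 then obtain us vs where ws': "ws' = us @ x # vs" by (metis split_list)
 have ms: "mset ws = mset (us @ vs)" using Cons.prems(1) by (simp add: ws')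
 have "wd (d - s) ws - wd (d - s) (us @ vs) : B (d - s) (length ws)"
  by (rule Cons.IH[OF ms]) (use Cons.prems in \<open>auto simp: x\<close>)
 from sp_B[OF _ this, of X s]
 have 1: "wd d (x # ws) - wd d (x # us @ vs) : B d (length ws + 1)" using Cons.prems by (simp add: x wd_Cons ac_diff)
 have len: "length ws = length us + length vs" using mset_eq_length[OF ms] by simp
 have "wd d ws' - wd d (x # us @ vs) : B d (length us + length vs + 1)"
  unfolding ws' by (rule move_B) (use Cons.prems ok_mset[OF Cons.prems(1)] deg_mset[OF Cons.prems(1)] ws' in auto)
 from subsp_diff[OF B_subsp 1 this[folded len]] show ?case by simp
qed

end



section \<open>Relations for all colours\<close>

context fusion_core
begin

text \<open>The polynomial \<open>hpol\<close> times the monomial with exponents \<open>a\<close>,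
  read as a combination of words in which the variable \<open>v\<close> is a letter of colour
  \<open>ka v\<close>.\<close>

definition RR :: "(nat => nat) => (nat => nat) => nat => nat => nat list => 'm" where
 "RR ka a s d vs = (\<Sum>e\<in>expo (set vs) s. sc (fps_nth (qser J z m (length vs)) (s - sum e (set vs)))
  (wd d (yw (map (\<lambda>v. (ka v, a v + e v)) vs))))"

lemma deg_map: "distinct vs ==> deg (map f vs) = (\<Sum>v\<in>set vs. snd (f v))"
 by (simp add: deg_def sum_list_distinct_conv_sum_set o_def)

lemma yok_map: "yok (map f vs) \<longleftrightarrow> (\<forall>v\<in>set vs. 0 < fst (f v) \<and> fst (f v) < 2 * n)"
 by (auto simp: yok_def image_subset_iff)

lemma RR_base:
 assumes vs: "distinct vs" "length vs \<ge> 1" and s: "(\<Sum>j\<in>J. min (length vs) (m j)) < length vs + s" "s <= d"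
  and ka: "\<And>v. v : set vs ==> ka v = n \<and> a v = 0"
 shows "RR ka a s d vs : N"
proof -
 have "RR ka a s d vs = (\<Sum>e\<in>expo (set vs) s. sc (fps_nth (qser J z m (length vs)) (s - sum_list (map e vs)))
  (wd d (map (\<lambda>t. (ym n n, t)) (map e vs))))" unfolding RR_def
 proof (intro sum.cong refl)
  fix e :: "nat => nat"
  have "sum_list (map e vs) = sum e (set vs)" using vs by (simp add: sum_list_distinct_conv_sum_set)
  moreover have "yw (map (\<lambda>v. (ka v, a v + e v)) vs) = map (\<lambda>t. (ym n n, t)) (map e vs)"
   using ka by (auto simp: yw_def)
  ultimately show "sc (fps_nth (qser J z m (length vs)) (s - sum e (set vs))) (wd d (yw (map (\<lambda>v. (ka v, a v + e v)) vs))) =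
   sc (fps_nth (qser J z m (length vs)) (s - sum_list (map e vs))) (wd d (map (\<lambda>t. (ym n n, t)) (map e vs)))" by simp
 qed
 also have "... = (\<Sum>l\<in>expo_lists (length vs) s. sc (fps_nth (qser J z m (length vs)) (s - sum_list l)) (wd d (map (\<lambda>t. (ym n n, t)) l)))"
  by (rule sum.reindex_bij_betw[OF expo_lists_bij[OF vs(1)]])
 finally show ?thesis using rel_hom[OF vs(2) s] by simp
qed

text \<open>The derivation rule for moving \<open>X\<close> through a word to the generator; the
  last term is its eigenvalue there.\<close>

lemma expand:
 assumes X: "par n X" and "distinct vs" "\<And>v. v : set vs ==> fst (f v) : spc n" "deg (map f vs) <= d"
 shows "ac X b (wd d (map f vs)) - ((\<Sum>v\<in>set vs. wd (d + b) (map (f(v := (br X (fst (f v)), b + snd (f v)))) vs)) +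
  sc ((\<Sum>j\<in>J. of_nat (m j) * z j ^ b) * X $$ (0, 0)) (wd (d + b) (map f vs))) : N" using assms(2-4)
proof (induction vs arbitrary: d)
 case Nil
 thus ?case using rel_par[OF X, of b d] by (simp add: wd_Nil)
next
 case (Cons v vs)
 obtain Y t where Y: "f v = (Y, t)" by force
 have Xs: "X : spc n" using X by (simp add: par_def)
 have Ys: "Y : spc n" using Cons.prems(2)[of v] Y by simp
 have okv: "ok (map f vs)" using Cons.prems(2) by (auto simp: ok_def)
 have dt: "t <= d" "deg (map f vs) <= d - t" using Cons.prems(3) Y by auto
 let ?u = "wd (d - t) (map f vs)" and ?P = "(\<Sum>j\<in>J. of_nat (m j) * z j ^ b) * X $$ (0, 0)"
 let ?S = "\<Sum>w\<in>set vs. wd (d - t + b) (map (f(w := (br X (fst (f w)), b + snd (f w)))) vs)"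
 have "ac X b ?u - (?S + sc ?P (wd (d - t + b) (map f vs))) : N" using Cons.prems dt by (intro Cons.IH) auto
 from ac_N[OF Ys this, of t]
 have 1: "ac Y t (ac X b ?u) - (ac Y t ?S + sc ?P (ac Y t (wd (d - t + b) (map f vs)))) : N"
  by (simp add: ac_diff[OF Ys] ac_add[OF Ys] ac_sc[OF Ys])
 have 2: "ac (br X Y) (b + t) ?u - (ac X b (ac Y t ?u) - ac Y t (ac X b ?u)) : N" by (rule rel_bracket'[OF Xs Ys okv])
 have e: "d + b - t = d - t + b" "d + b - (b + t) = d - t" using dt by auto
 have "ac Y t ?S = (\<Sum>w\<in>set vs. wd (d + b) (map (f(w := (br X (fst (f w)), b + snd (f w)))) (v # vs)))"
  unfolding ac_sum[OF Ys]
 proof (rule sum.cong)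
  fix w assume "w : set vs"
  hence "w ~= v" using Cons.prems(1) by auto
  thus "ac Y t (wd (d - t + b) (map (f(w := (br X (fst (f w)), b + snd (f w)))) vs)) =
    wd (d + b) (map (f(w := (br X (fst (f w)), b + snd (f w)))) (v # vs))" using Y by (simp add: wd_Cons e)
 qed simp
 moreover have "wd (d + b) (map (f(v := (br X (fst (f v)), b + snd (f v)))) (v # vs)) = ac (br X Y) (b + t) ?u"
 proof -
  have M: "map (f(v := (br X Y, b + t))) vs = map f vs" using Cons.prems(1) by auto
  show ?thesis using Y by (simp add: wd_Cons e M)
 qed
 moreover have "wd (d + b) (map f (v # vs)) = ac Y t (wd (d - t + b) (map f vs))"
  "wd d (map f (v # vs)) = ac Y t ?u" using Y by (simp_all add: wd_Cons e)
 ultimately have eq: "ac X b (wd d (map f (v # vs))) - ((\<Sum>w\<in>set (v # vs). wd (d + b) (map (f(w := (br X (fst (f w)), b + snd (f w)))) (v # vs))) +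
   sc ?P (wd (d + b) (map f (v # vs)))) =
  (ac Y t (ac X b ?u) - (ac Y t ?S + sc ?P (ac Y t (wd (d - t + b) (map f vs))))) -
  (ac (br X Y) (b + t) ?u - (ac X b (ac Y t ?u) - ac Y t (ac X b ?u)))" using Cons.prems(1) by (simp add: algebra_simps)
 show ?case unfolding eq by (rule subsp_diff[OF N 1 2])
qed

text \<open>Up to shorter words, only the first column of a letter counts.\<close>

lemma letter_expand:
 assumes Z: "Z : spc n" and "ok us" "ok ws" "deg us + t + deg ws <= d"
 shows "wd d (us @ (Z, t) # ws) - (\<Sum>x\<in>{1..<2 * n}. sc (Z $$ (x, 0)) (wd d (us @ (ym n x, t) # ws)))
  : B d (length us + length ws + 1)" using assms(2-4)
proof (induction us arbitrary: d)
 case Nil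
 from decompose[OF Z] obtain R where R': "par n R \<and> (\<forall>s d ws. ok ws \<longrightarrow> ac Z s (wd d ws) -
  (ac R s (wd d ws) + (\<Sum>a\<in>{1..<2 * n}. sc (Z $$ (a, 0)) (ac (ym n a) s (wd d ws)))) : N)" ..
 note R = conjunct1[OF R'] conjunct2[OF R', rule_format]
 have "wd d ((R, t) # ws) : B d (length ws + 1)" using par_letter_B[of "[]" R ws t d] Nil R(1) by simp
 moreover have "wd d ((Z, t) # ws) - (wd d ((R, t) # ws) + (\<Sum>x\<in>{1..<2 * n}. sc (Z $$ (x, 0)) (wd d ((ym n x, t) # ws)))) : B d (length ws + 1)"
  unfolding wd_Cons by (rule N_B[OF R(2)]) (use Nil in auto)
 ultimately have "(wd d ((Z, t) # ws) - (wd d ((R, t) # ws) + (\<Sum>x\<in>{1..<2 * n}. sc (Z $$ (x, 0)) (wd d ((ym n x, t) # ws)))))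
   + wd d ((R, t) # ws) : B d (length ws + 1)" by (intro subsp_add[OF B_subsp]) auto
 thus ?case by (simp add: algebra_simps)
next
 case (Cons y us)
 obtain Y r where y: "y = (Y, r)" by force
 have Y: "Y : spc n" using Cons.prems by (simp add: y)
 have "wd (d - r) (us @ (Z, t) # ws) - (\<Sum>x\<in>{1..<2 * n}. sc (Z $$ (x, 0)) (wd (d - r) (us @ (ym n x, t) # ws)))
  : B (d - r) (length us + length ws + 1)" using Cons.prems by (intro Cons.IH) (auto simp: y)
 from sp_B[OF Y this, of r] show ?case using Cons.prems by (simp add: y wd_Cons ac_diff[OF Y] ac_sum[OF Y] ac_sc[OF Y])
qed

lemma letter_expand_map:
 assumes Z: "Z : spc n" and vs: "distinct vs" "v : set vs"
  and f: "\<And>w. w : set vs ==> w ~= v ==> fst (f w) : spc n" and deg: "deg (map (f(v := (Z, t))) vs) <= d"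
 shows "wd d (map (f(v := (Z, t))) vs) - (\<Sum>x\<in>{1..<2 * n}. sc (Z $$ (x, 0)) (wd d (map (f(v := (ym n x, t))) vs)))
  : B d (length vs)"
proof -
 obtain us ws where uw: "vs = us @ v # ws" using vs(2) by (metis split_list)
 have nv: "v \<notin> set us" "v \<notin> set ws" using vs(1) uw by auto
 hence e: "map (f(v := y)) vs = map f us @ y # map f ws" for y using uw by auto
 show ?thesis unfolding e using letter_expand[OF Z, of "map f us" "map f ws" t d] f deg uw nv unfolding e
  by (auto simp: ok_def image_iff)
qed

lemma tr_set:
 assumes "v : set vs" "w : set vs" "distinct vs"
 shows "mset (map (tr v w) vs) = mset vs" "tr v w ` set vs = set vs"
proof -
 have inj: "inj (tr v w)" using tr_inj by (auto simp: inj_on_def)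
 show "tr v w ` set vs = set vs"
 proof
  show "tr v w ` set vs <= set vs" using assms by (auto simp: tr_def)
  thus "set vs <= tr v w ` set vs" using tr_tr by (metis image_eqI image_subset_iff subsetI)
 qed
 thus "mset (map (tr v w) vs) = mset vs"
  using assms(3) inj by (intro set_eq_iff_mset_eq_distinct[THEN iffD1]) (auto simp: distinct_map inj_on_def)
qed

text \<open>\<open>hpol\<close> is symmetric in its variables, so exchanging the data of two of them
  merely permutes letters in each word.\<close>

lemma RR_tr:
 assumes vs: "distinct vs" "v : set vs" "w : set vs" and ka: "\<And>v. v : set vs ==> 0 < ka v \<and> ka v < 2 * n"
  and d: "s + sum a (set vs) <= d"
 shows "RR (\<lambda>i. ka (tr v w i)) (\<lambda>i. a (tr v w i)) s d vs - RR ka a s d vs : B d (length vs)"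
proof -
 let ?t = "tr v w"
 let ?q = "\<lambda>e. fps_nth (qser J z m (length vs)) (s - sum e (set vs))"
 have tim: "?t ` set vs = set vs" using tr_set vs by blast
 have sumt: "sum (\<lambda>i. e (?t i)) (set vs) = sum e (set vs)" for e :: "nat => nat"
  by (rule sum.reindex_bij_witness[of _ ?t ?t]) (use tim tr_tr in auto)
 have "RR (\<lambda>i. ka (?t i)) (\<lambda>i. a (?t i)) s d vs =
   (\<Sum>e\<in>expo (set vs) s. sc (?q e) (wd d (yw (map (\<lambda>i. (ka i, a i + e i)) (map ?t vs)))))" unfolding RR_def
 proof (rule sum.reindex_bij_witness[of _ "\<lambda>e i. e (?t i)" "\<lambda>e i. e (?t i)"])
  fix e assume e: "e : expo (set vs) s"
  have "?t i \<notin> set vs" if "i \<notin> set vs" for i using that tim tr_tr by (metis image_eqI)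
  thus "(\<lambda>i. e (?t i)) : expo (set vs) s" using e sumt by (auto simp: expo_def)
  thus "(\<lambda>i. e (?t i)) : expo (set vs) s" .
  show "sc (?q (\<lambda>i. e (?t i))) (wd d (yw (map (\<lambda>i. (ka i, a i + e (?t i))) (map ?t vs)))) =
    sc (?q e) (wd d (yw (map (\<lambda>i. (ka (?t i), a (?t i) + e i)) vs)))" unfolding sumt by (simp add: tr_tr o_def)
 qed (simp_all add: tr_tr)
 hence "RR (\<lambda>i. ka (?t i)) (\<lambda>i. a (?t i)) s d vs - RR ka a s d vs =
   (\<Sum>e\<in>expo (set vs) s. sc (?q e) (wd d (yw (map (\<lambda>i. (ka i, a i + e i)) (map ?t vs))) - wd d (yw (map (\<lambda>i. (ka i, a i + e i)) vs))))"
  by (simp add: RR_def sum_subtractf sc_diff)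
 also have "... : B d (length vs)"
 proof (intro subsp_sum[OF B_subsp] subsp_sc[OF B_subsp])
  fix e assume e: "e : expo (set vs) s"
  let ?g = "\<lambda>i. (ka i, a i + e i)"
  have ms: "mset (yw (map ?g (map ?t vs))) = mset (yw (map ?g vs))" using tr_set(1)[OF vs(2,3,1)] by (simp only: yw_def mset_map)
  have "yok (map ?g vs)" using ka by (auto simp: yok_map)
  hence o: "ok (yw (map ?g vs))" by (rule ok_yw)
  have dg: "deg (yw (map ?g vs)) <= d" using e d vs(1) by (simp add: deg_map expo_def sum.distrib)
  show "wd d (yw (map ?g (map ?t vs))) - wd d (yw (map ?g vs)) : B d (length vs)"
   using permute_B[OF ms] ok_mset[OF ms] deg_mset[OF ms] o dg by simp
 qed
 finally show ?thesis .
qed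

text \<open>The action recolours one variable at a time and raises its exponent by \<open>b\<close>,
  uniformly in the summation index \<open>e\<close>; so it maps relations of this shape to
  combinations of such relations.\<close>

lemma RR_step:
 assumes X: "par n X" and vs: "distinct vs" and ka: "\<And>v. v : set vs ==> 0 < ka v \<and> ka v < 2 * n"
  and d: "s + sum a (set vs) <= d"
 shows "ac X b (RR ka a s d vs) -
  ((\<Sum>v\<in>set vs. \<Sum>x\<in>{1..<2 * n}. sc (br X (ym n (ka v)) $$ (x, 0)) (RR (ka(v := x)) (a(v := a v + b)) s (d + b) vs)) +
   sc ((\<Sum>j\<in>J. of_nat (m j) * z j ^ b) * X $$ (0, 0)) (RR ka a s (d + b) vs)) : B (d + b) (length vs)"
proof -
 let ?E = "expo (set vs) s" and ?P = "(\<Sum>j\<in>J. of_nat (m j) * z j ^ b) * X $$ (0, 0)"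
 let ?q = "\<lambda>e. fps_nth (qser J z m (length vs)) (s - sum e (set vs))"
 let ?f = "\<lambda>e v. (ym n (ka v), a v + e v)"
 let ?Z = "\<lambda>v. br X (ym n (ka v))"
 let ?w = "\<lambda>e v x. wd (d + b) (map ((?f e)(v := (ym n x, b + (a v + e v)))) vs)"
 have Xs: "X : spc n" using X by (simp add: par_def)
 have yf: "yw (map (\<lambda>v. (ka v, a v + e v)) vs) = map (?f e) vs" for e by (simp add: yw_def)
 have yfx: "yw (map (\<lambda>w. ((ka(v := x)) w, (a(v := a v + b)) w + e w)) vs) = map ((?f e)(v := (ym n x, b + (a v + e v)))) vs"
  for e v x by (auto simp: yw_def)
 define T where "T e = (\<Sum>v\<in>set vs. \<Sum>x\<in>{1..<2 * n}. sc (?Z v $$ (x, 0)) (?w e v x))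
   + sc ?P (wd (d + b) (map (?f e) vs))" for e
 have main: "ac X b (wd d (map (?f e) vs)) - T e : B (d + b) (length vs)" if e: "e : ?E" for e
 proof -
  let ?g = "\<lambda>v. (?f e)(v := (br X (fst (?f e v)), b + snd (?f e v)))"
  have dg: "deg (map (?f e) vs) <= d" using e d vs by (simp add: deg_map expo_def sum.distrib)
  have 1: "ac X b (wd d (map (?f e) vs)) - ((\<Sum>v\<in>set vs. wd (d + b) (map (?g v) vs)) + sc ?P (wd (d + b) (map (?f e) vs))) : N"
   by (rule expand[OF X vs _ dg]) (use ka ym_sp in auto)
  have 2: "(\<Sum>v\<in>set vs. wd (d + b) (map (?g v) vs) - (\<Sum>x\<in>{1..<2 * n}. sc (?Z v $$ (x, 0)) (?w e v x)))
    : B (d + b) (length vs)"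
  proof (rule subsp_sum[OF B_subsp])
   fix v assume v: "v : set vs"
   have "deg (map (?g v) vs) = (\<Sum>w\<in>set vs. snd (?g v w))" by (rule deg_map[OF vs])
   also have "... = (\<Sum>w\<in>set vs. (a w + e w) + (if w = v then b else 0))" by (rule sum.cong) auto
   also have "... <= d + b" using dg vs v by (simp add: sum.distrib deg_map)
   finally have dg': "deg (map (?g v) vs) <= d + b" .
   have Zs: "?Z v : spc n" using sp_bracket[OF Xs ym_sp] ka[OF v] by blast
   show "wd (d + b) (map (?g v) vs) - (\<Sum>x\<in>{1..<2 * n}. sc (?Z v $$ (x, 0)) (?w e v x))
    : B (d + b) (length vs)" using letter_expand_map[OF Zs vs v, of "?f e" "b + (a v + e v)" "d + b"] dg' ka ym_sp by simp
  qed
  from subsp_add[OF B_subsp N_B[OF 1] 2] show ?thesis unfolding T_def by (simp add: sum_subtractf algebra_simps)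
 qed
 have "(\<Sum>e\<in>?E. sc (?q e) (ac X b (wd d (map (?f e) vs)) - T e)) : B (d + b) (length vs)"
  by (intro subsp_sum[OF B_subsp] subsp_sc[OF B_subsp] main)
 moreover have "(\<Sum>e\<in>?E. sc (?q e) (ac X b (wd d (map (?f e) vs)))) = ac X b (RR ka a s d vs)"
  by (simp add: RR_def yf ac_sum[OF Xs] ac_sc[OF Xs])
 moreover have "(\<Sum>e\<in>?E. sc (?q e) (T e)) =
  (\<Sum>v\<in>set vs. \<Sum>x\<in>{1..<2 * n}. sc (?Z v $$ (x, 0)) (RR (ka(v := x)) (a(v := a v + b)) s (d + b) vs)) + sc ?P (RR ka a s (d + b) vs)"
 proof -
  have "(\<Sum>e\<in>?E. sc (?q e) (T e)) = (\<Sum>e\<in>?E. \<Sum>v\<in>set vs. \<Sum>x\<in>{1..<2 * n}. sc (?Z v $$ (x, 0)) (sc (?q e) (?w e v x)))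
    + (\<Sum>e\<in>?E. sc ?P (sc (?q e) (wd (d + b) (map (?f e) vs))))"
   by (simp add: T_def sc_add sc_sum sc_sc sum.distrib mult.commute)
  also have "(\<Sum>e\<in>?E. \<Sum>v\<in>set vs. \<Sum>x\<in>{1..<2 * n}. sc (?Z v $$ (x, 0)) (sc (?q e) (?w e v x))) =
    (\<Sum>v\<in>set vs. \<Sum>x\<in>{1..<2 * n}. \<Sum>e\<in>?E. sc (?Z v $$ (x, 0)) (sc (?q e) (?w e v x)))"
   by (subst sum.swap, rule sum.cong[OF refl], rule sum.swap)
  finally show ?thesis by (simp only: RR_def yf yfx sc_sum)
 qed
 ultimately show ?thesis by (simp add: sc_diff sum_subtractf)
qed

text \<open>Induction on the set \<open>D\<close> of variables that no longer have colour
  \<open>n\<close> and exponent 0. A recolouring element applied to a relation affects every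
  variable in turn: changes inside \<open>D\<close> are covered by the induction hypothesis, and
  those outside give equal terms by symmetry, so that dividing by their number yields the relation
  wanted.\<close>

theorem RR_B:
 assumes vs: "distinct vs" "length vs \<ge> 1" and s: "(\<Sum>j\<in>J. min (length vs) (m j)) < length vs + s"
  and "\<And>v. v : set vs ==> 0 < ka v \<and> ka v < 2 * n" and "s + sum a (set vs) <= d"
 shows "RR ka a s d vs : B d (length vs)"
proof -
 have "RR ka a s d vs : B d (length vs)"
  if "finite D" "D <= set vs" "\<And>v. v : set vs ==> 0 < ka v \<and> ka v < 2 * n" "s + sum a (set vs) <= d"
   "\<And>v. v : set vs - D ==> ka v = n \<and> a v = 0" for D ka a d using that
 proof (induction D arbitrary: ka a d rule: finite_induct)
  case empty
  thus ?case by (intro N_B RR_base vs s) auto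
 next
  case (insert v0 D)
  note ka = insert.prems(2) and d = insert.prems(3) and un = insert.prems(4)
  have v0: "v0 : set vs" using insert by auto
  define c where "c = ka v0"
  define b where "b = a v0"
  \<comment> \<open>Variable \<open>v0\<close> is reset to its base colour and exponent;
    \<open>ycol n c\<close> with \<open>t^b\<close> is to bring the old values back.\<close>
  define ka1 where "ka1 = ka(v0 := n)"
  define a1 where "a1 = a(v0 := 0)"
  have suma: "sum a (set vs) = sum a1 (set vs) + b"
  proof -
   have "sum a (set vs) = (\<Sum>v\<in>set vs. a1 v + (if v = v0 then b else 0))" by (rule sum.cong) (auto simp: a1_def b_def)
   thus ?thesis using v0 by (simp add: sum.distrib)
  qed
  have sumx: "sum (a1(v := a1 v + b)) (set vs) = sum a1 (set vs) + b" if "v : set vs" for v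
  proof -
   have "sum (a1(v := a1 v + b)) (set vs) = (\<Sum>w\<in>set vs. a1 w + (if w = v then b else 0))" by (rule sum.cong) auto
   thus ?thesis using that by (simp add: sum.distrib)
  qed
  have c: "0 < c" "c < 2 * n" using ka[OF v0] by (auto simp: c_def)
  have D: "D <= set vs" "v0 \<notin> D" using insert by auto
  have ka1: "0 < ka1 v \<and> ka1 v < 2 * n" if "v : set vs" for v using ka[OF that] n by (auto simp: ka1_def)
  have un1: "ka1 v = n \<and> a1 v = 0" if "v : set vs - D" for v
   using un[of v] that by (cases "v = v0") (auto simp: ka1_def a1_def)
  let ?X = "ycol n c" and ?d = "d - b" and ?q = "length vs"
  have db: "?d + b = d" "s + sum a1 (set vs) <= ?d" "s + sum a1 (set vs) <= d" using d suma by auto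
  let ?T = "\<lambda>v x. RR (ka1(v := x)) (a1(v := a1 v + b)) s d vs"
  let ?co = "\<lambda>v x. br ?X (ym n (ka1 v)) $$ (x, 0)"
  let ?P = "(\<Sum>j\<in>J. of_nat (m j) * z j ^ b) * ?X $$ (0, 0)"
  have "RR ka1 a1 s ?d vs : B ?d ?q" by (rule insert.IH[OF D(1) ka1 db(2) un1])
  from par_B[OF ycol_par[OF c] this, of b] have 1: "ac ?X b (RR ka1 a1 s ?d vs) : B d ?q" by (simp only: db)
  have 2: "sc ?P (RR ka1 a1 s d vs) : B d ?q" by (rule subsp_sc[OF B_subsp insert.IH[OF D(1) ka1 db(3) un1]])
  have 3: "ac ?X b (RR ka1 a1 s ?d vs) - ((\<Sum>v\<in>set vs. \<Sum>x\<in>{1..<2 * n}. sc (?co v x) (?T v x)) + sc ?P (RR ka1 a1 s d vs)) : B d ?q"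
   using RR_step[OF ycol_par[OF c] vs(1) ka1 db(2), where b = b] by (simp only: db)
  from subsp_diff[OF B_subsp subsp_diff[OF B_subsp 1 2] 3]
  have "(\<Sum>v\<in>set vs. \<Sum>x\<in>{1..<2 * n}. sc (?co v x) (?T v x)) : B d ?q" by (simp add: algebra_simps)
  moreover have "(\<Sum>v\<in>D. \<Sum>x\<in>{1..<2 * n}. sc (?co v x) (?T v x)) : B d ?q"
  proof (intro subsp_sum[OF B_subsp] subsp_sc[OF B_subsp] insert.IH[OF D(1)])
   fix v x w assume v: "v : D" "x : {1..<2 * n}"
   hence vv: "v : set vs" using D by auto
   show "s + sum (a1(v := a1 v + b)) (set vs) <= d" using d suma sumx[OF vv] by simp
   show "0 < (ka1(v := x)) w \<and> (ka1(v := x)) w < 2 * n" if "w : set vs" using ka1[OF that] v by auto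
   show "(ka1(v := x)) w = n \<and> (a1(v := a1 v + b)) w = 0" if "w : set vs - D" using un1[OF that] that v by auto
  qed
  ultimately have "(\<Sum>v\<in>set vs. \<Sum>x\<in>{1..<2 * n}. sc (?co v x) (?T v x)) - (\<Sum>v\<in>D. \<Sum>x\<in>{1..<2 * n}. sc (?co v x) (?T v x)) : B d ?q"
   by (rule subsp_diff[OF B_subsp])
  also have "(\<Sum>v\<in>set vs. \<Sum>x\<in>{1..<2 * n}. sc (?co v x) (?T v x)) - (\<Sum>v\<in>D. \<Sum>x\<in>{1..<2 * n}. sc (?co v x) (?T v x)) =
   (\<Sum>v\<in>set vs - D. \<Sum>x\<in>{1..<2 * n}. sc (?co v x) (?T v x))" by (rule sum_diff[symmetric]) (use D in auto)
  \<comment> \<open>A variable of base colour acquires the colour \<open>c\<close> with coefficient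
    1 and no other colour.\<close>
  also have "... = (\<Sum>v\<in>set vs - D. ?T v c)"
  proof (rule sum.cong)
   fix v assume v: "v : set vs - D"
   have "(\<Sum>x\<in>{1..<2 * n}. sc (?co v x) (?T v x)) = (\<Sum>x\<in>{1..<2 * n}. if x = c then ?T v c else 0)"
    using un1[OF v] ycol_bracket[OF c] by (intro sum.cong) (auto simp: sc_one)
   thus "(\<Sum>x\<in>{1..<2 * n}. sc (?co v x) (?T v x)) = ?T v c" using c by simp
  qed simp
  finally have 4: "(\<Sum>v\<in>set vs - D. ?T v c) : B d ?q" .
  have goal: "?T v0 c = RR ka a s d vs"
  proof -
   have "ka1(v0 := c) = ka" "a1(v0 := a1 v0 + b) = a" by (auto simp: ka1_def a1_def c_def b_def)
   thus ?thesis by simp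
  qed
  \<comment> \<open>Both \<open>v\<close> and \<open>v0\<close> carry base data, so the
    transposition of the two identifies the terms.\<close>
  have "?T v c - ?T v0 c : B d ?q" if v: "v : set vs - D" for v
  proof -
   have vv: "v : set vs" "v \<notin> D" using v by auto
   have k: "RR (ka1(v := c)) (a1(v := a1 v + b)) s d vs =
     RR (\<lambda>i. (ka1(v0 := c)) (tr v v0 i)) (\<lambda>i. (a1(v0 := a1 v0 + b)) (tr v v0 i)) s d vs" unfolding RR_def
   proof (intro sum.cong refl arg_cong2[of _ _ _ _ sc] arg_cong[of _ _ "\<lambda>l. wd d (yw l)"] map_cong)
    fix e w assume w: "w : set vs"
    show "((ka1(v := c)) w, (a1(v := a1 v + b)) w + e w) =
      ((ka1(v0 := c)) (tr v v0 w), (a1(v0 := a1 v0 + b)) (tr v v0 w) + e w)"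
     using un1[OF v] un1[of v0] v0 D by (auto simp: tr_def)
   qed
   show ?thesis unfolding k by (rule RR_tr[OF vs(1) vv(1) v0]) (use ka1 c d suma sumx[OF v0] in auto)
  qed
  hence "(\<Sum>v\<in>set vs - D. ?T v c - ?T v0 c) : B d ?q" by (rule subsp_sum[OF B_subsp])
  from subsp_diff[OF B_subsp 4 this] have "(\<Sum>v\<in>set vs - D. ?T v0 c) : B d ?q" by (simp add: sum_subtractf)
  hence "sc (of_nat (card (set vs - D))) (?T v0 c) : B d ?q"
   using sc_sum_left[of "\<lambda>_. 1" "set vs - D" "?T v0 c"] by (simp add: sc_one)
  hence "sc (1 / of_nat (card (set vs - D))) (sc (of_nat (card (set vs - D))) (?T v0 c)) : B d ?q" by (rule subsp_sc[OF B_subsp])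
  moreover have "card (set vs - D) ~= 0" using v0 D by auto
  ultimately show ?case using goal by (simp add: sc_sc sc_one)
 qed
 from this[of "set vs" ka a d] show ?thesis using assms(4,5) by auto
qed

end



section \<open>Injectivity\<close>

definition expo_eq :: "nat set => nat => (nat => nat) set" where
 "expo_eq S t = {e. (\<forall>v. v \<notin> S \<longrightarrow> e v = 0) \<and> sum e S = t}"

lemma finite_expo_eq: "finite S ==> finite (expo_eq S t)"
 by (rule finite_subset[OF _ finite_expo[of S t]]) (auto simp: expo_eq_def expo_def)

lemma pvar_power: "pvar v ^ k = single (\<lambda>i. if i = v then k else 0) 1"
proof (induction k)
 case 0
 have "(\<lambda>i. if i = v then 0 else 0) = (0 :: nat => nat)" by auto
 thus ?case by (simp only: power_0 single_one)
next
 case (Suc k)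
 have "(\<lambda>i. if i = v then 1 else 0) + (\<lambda>i. if i = v then k else 0) = (\<lambda>i. if i = v then Suc k else 0)"
  by (auto simp: fun_eq_iff)
 thus ?case unfolding power_Suc Suc unfolding pvar_def by (simp only: mult_single) simp
qed

text \<open>The complete homogeneous polynomial of degree \<open>t\<close>, written as the sum of
  all monomials of that degree.\<close>

lemma geo_prod_nth:
 assumes "finite S"
 shows "fps_nth (\<Prod>i\<in>S. geo (pvar i)) t = (\<Sum>e\<in>expo_eq S t. single e 1)"
 using assms
proof (induction S arbitrary: t rule: finite_induct)
 case empty
 have "expo_eq {} t = (if t = 0 then {0} else {})" by (auto simp: expo_eq_def fun_eq_iff)
 thus ?case by (simp flip: zero_fun_def)
next
 case (insert x S)
 have "fps_nth (\<Prod>i\<in>insert x S. geo (pvar i)) t = (\<Sum>k\<in>{0..t}. \<Sum>e\<in>expo_eq S (t - k). single (e(x := k)) 1)"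
 proof -
  have "fps_nth (\<Prod>i\<in>insert x S. geo (pvar i)) t = (\<Sum>k\<in>{0..t}. pvar x ^ k * (\<Sum>e\<in>expo_eq S (t - k). single e 1))"
   using insert by (simp add: fps_mult_nth geo_def)
  also have "... = (\<Sum>k\<in>{0..t}. \<Sum>e\<in>expo_eq S (t - k). single (e(x := k)) 1)"
  proof (rule sum.cong[OF refl], unfold sum_distrib_left, rule sum.cong[OF refl])
   fix k e assume "e : expo_eq S (t - k)"
   hence "(\<lambda>i. if i = x then k else 0) + e = e(x := k)" using insert by (auto simp: expo_eq_def fun_eq_iff)
   thus "pvar x ^ k * single e 1 = single (e(x := k)) 1" by (simp add: pvar_power mult_single)
  qed
  finally show ?thesis .
 qed
 also have "... = (\<Sum>(k, e)\<in>Sigma {0..t} (\<lambda>k. expo_eq S (t - k)). single (e(x := k)) 1)"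
  by (rule sum.Sigma) (use insert finite_expo_eq in auto)
 also have "... = (\<Sum>f\<in>expo_eq (insert x S) t. single f 1)"
 proof (rule sum.reindex_bij_witness[of _ "\<lambda>f. (f x, f(x := 0))" "\<lambda>(k, e). e(x := k)"])
  fix f assume "f : expo_eq (insert x S) t"
  hence f: "\<And>v. v ~= x ==> v \<notin> S ==> f v = 0" "f x + sum f S = t" using insert by (auto simp: expo_eq_def)
  have "sum (f(x := 0)) S = sum f S" by (rule sum.cong) (use insert in auto)
  thus "(f x, f(x := 0)) : Sigma {0..t} (\<lambda>k. expo_eq S (t - k))" using f by (auto simp: expo_eq_def)
 next
  fix p assume p: "p : Sigma {0..t} (\<lambda>k. expo_eq S (t - k))"
  obtain k e where ke: "p = (k, e)" by force
  have e: "\<And>v. v \<notin> S ==> e v = 0" "sum e S = t - k" "k <= t" using p by (auto simp: ke expo_eq_def)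
  have "sum (e(x := k)) S = sum e S" by (rule sum.cong) (use insert in auto)
  thus "(case p of (k, e) => e(x := k)) : expo_eq (insert x S) t" using insert e by (auto simp: ke expo_eq_def)
  show "((case p of (k, e) => e(x := k)) x, (case p of (k, e) => e(x := k))(x := 0)) = p"
   using e(1)[OF insert(2)] by (auto simp: ke fun_eq_iff)
 qed auto
 finally show ?case .
qed

definition fps_const_map :: "complex fps => pol fps" where
 "fps_const_map F = Abs_fps (\<lambda>t. pconst (fps_nth F t))"

lemma pconst_sum: "pconst (\<Sum>i\<in>I. f i) = (\<Sum>i\<in>I. pconst (f i))"
 by (induction I rule: infinite_finite_induct) (auto simp: pconst_simps)

lemma fps_const_map_mult: "fps_const_map (F * G) = fps_const_map F * fps_const_map G"
 by (rule fps_ext) (simp add: fps_const_map_def fps_mult_nth pconst_sum pconst_simps)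
lemma fps_const_map_1: "fps_const_map 1 = 1"
 by (rule fps_ext) (simp add: fps_const_map_def pconst_simps)
lemma fps_const_map_lf: "fps_const_map (lf x) = lf (pconst x)"
 by (rule fps_ext) (simp add: fps_const_map_def lf_nth pconst_simps)
lemma fps_const_map_power: "fps_const_map (F ^ k) = fps_const_map F ^ k"
 by (induction k) (auto simp: fps_const_map_mult fps_const_map_1)

lemma qser_pconst: "qser J (\<lambda>j. pconst (z j)) m q = fps_const_map (qser J z m q)"
proof -
 have "fps_const_map (\<Prod>j\<in>J. F j) = (\<Prod>j\<in>J. fps_const_map (F j))" for F
  by (induction J rule: infinite_finite_induct) (auto simp: fps_const_map_mult fps_const_map_1)
 thus ?thesis by (simp add: qser_def fps_const_map_power fps_const_map_lf)
qed

text \<open>The coefficients are those in \<open>RR\<close> and \<open>rel_hom\<close>; this is the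
  link between polynomials and words.\<close>

lemma hpol_expo:
 assumes "finite S"
 shows "hpol J z m S s = (\<Sum>e\<in>expo S s. single e (fps_nth (qser J z m (card S)) (s - sum e S)))"
proof -
 let ?q = "\<lambda>t. fps_nth (qser J z m (card S)) t"
 have "hpol J z m S s = fps_nth ((\<Prod>i\<in>S. geo (pvar i)) * fps_const_map (qser J z m (card S))) s"
  by (simp add: hpol_def qser_pconst mult.commute)
 also have "... = (\<Sum>t\<in>{0..s}. \<Sum>e\<in>expo_eq S t. single e (?q (s - t)))"
  unfolding fps_mult_nth geo_prod_nth[OF assms] by (simp add: sum_distrib_right fps_const_map_def pconst_def mult_single)
 also have "... = (\<Sum>t\<in>{0..s}. \<Sum>e\<in>{e\<in>expo S s. sum e S = t}. single e (?q (s - sum e S)))"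
  by (intro sum.cong) (auto simp: expo_eq_def expo_def)
 also have "... = (\<Sum>e\<in>expo S s. single e (?q (s - sum e S)))"
  by (rule sum.group) (use finite_expo[OF assms] in \<open>auto simp: expo_def\<close>)
 finally show ?thesis .
qed

context fusion_core
begin

text \<open>Each variable becomes a letter whose power of \<open>t\<close> is its exponent. The
  sorted order of \<open>S\<close> is a choice that matters only up to shorter words.\<close>

definition Vec :: "nat set => (nat => nat) => nat => pol => 'm" where
 "Vec S ka d = lin_ext (\<lambda>a. wd d (yw (map (\<lambda>v. (ka v, a v)) (sorted_list_of_set S))))"

lemma Vec_simps: "Vec S ka d (f + g) = Vec S ka d f + Vec S ka d g" "Vec S ka d 0 = 0"
 "Vec S ka d (single a c) = sc c (wd d (yw (map (\<lambda>v. (ka v, a v)) (sorted_list_of_set S))))"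
 "Vec S ka d (\<Sum>i\<in>I. F i) = (\<Sum>i\<in>I. Vec S ka d (F i))" by (simp_all add: Vec_def lin_ext_add lin_ext_sum)

lemma prefix_sum_B:
 assumes "ok us" "deg us <= d" "(\<Sum>i\<in>I. sc (c i) (wd (d - deg us) (ws i))) : B (d - deg us) r"
 shows "(\<Sum>i\<in>I. sc (c i) (wd d (us @ ws i))) : B d (r + length us)"
 using assms
proof (induction us arbitrary: d)
 case (Cons x us)
 obtain X s where x: "x = (X, s)" by force
 have X: "X : spc n" using Cons.prems by (simp add: x)
 have "(\<Sum>i\<in>I. sc (c i) (wd (d - s) (us @ ws i))) : B (d - s) (r + length us)"
  using Cons.prems by (intro Cons.IH) (auto simp: x)
 from sp_B[OF X this, of s] show ?case using Cons.prems by (simp add: x wd_Cons ac_sum[OF X] ac_sc[OF X])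
qed simp

text \<open>In a generator times a monomial, the variables outside \<open>S\<close> carry only the
  monomial; once their letters are moved to the front, the remaining letters form a relation
  \<open>RR\<close>.\<close>

lemma Vec_hideal:
 assumes "f : hideal J z m r 0 d" and ka: "\<And>v. v < r ==> 0 < ka v \<and> ka v < 2 * n"
 shows "Vec {..<r} ka d f : B d r"
 using assms(1)
proof induction
 case hideal_zero
 thus ?case by (simp add: Vec_simps subsp_zero[OF B_subsp])
next
 case (hideal_add f g)
 thus ?case by (simp add: Vec_simps subsp_add[OF B_subsp])
next
 case (hideal_gen S s a c)
 have finS: "finite S" using hideal_gen(1) finite_subset by blast
 let ?q = "\<lambda>e. fps_nth (qser J z m (card S)) (s - sum e S)"
 define vs where "vs = sorted_list_of_set S"
 define us where "us = sorted_list_of_set ({..<r} - S)"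
 have vs: "set vs = S" "distinct vs" "length vs = card S" using finS by (auto simp: vs_def)
 have us: "set us = {..<r} - S" "distinct us" by (auto simp: us_def)
 have lr: "sorted_list_of_set {..<r} = [0..<r]" by (simp add: lessThan_atLeast0)
 have mus: "mset [0..<r] = mset (us @ vs)" by (rule set_eq_iff_mset_eq_distinct[THEN iffD1]) (use us vs hideal_gen(1) in auto)
 have len: "length us + card S = r" using arg_cong[OF mus, of size] vs by simp
 let ?L = "\<lambda>e ws. yw (map (\<lambda>v. (ka v, a v + e v)) ws)"
 have deg_vs: "deg (map (\<lambda>v. (ka v, a v + e v)) ws) = sum a (set ws) + sum e (set ws)" if "distinct ws" for e ws
  using that by (simp add: deg_map sum.distrib)
 have suma: "sum a {..<r} = sum a (set us) + sum a S" using hideal_gen(1) us by (metis finite_lessThan sum.subset_diff)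
 have "single a c * hpol J z m S s = (\<Sum>e\<in>expo S s. single (a + e) (c * ?q e))"
  by (simp add: hpol_expo[OF finS] sum_distrib_left mult_single)
 hence VE: "Vec {..<r} ka d (single a c * hpol J z m S s) = sc c (\<Sum>e\<in>expo S s. sc (?q e) (wd d (?L e [0..<r])))"
  by (simp add: Vec_simps lr sc_sum sc_sc)
 have SB: "(\<Sum>e\<in>expo S s. sc (?q e) (wd d (?L e [0..<r]))) : B d r"
 proof -
  have "(\<Sum>e\<in>expo S s. sc (?q e) (wd d (?L e [0..<r]) - wd d (?L e (us @ vs)))) : B d r"
  proof (intro subsp_sum[OF B_subsp] subsp_sc[OF B_subsp])
   fix e assume e: "e : expo S s"
   have ms: "mset (?L e [0..<r]) = mset (?L e (us @ vs))" using mus by (simp only: yw_def mset_map)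
   have y: "yok (map (\<lambda>v. (ka v, a v + e v)) [0..<r])" using ka by (auto simp: yok_map)
   have "sum e {..<r} = sum e S" by (rule sum.mono_neutral_right) (use hideal_gen(1) e in \<open>auto simp: expo_def\<close>)
   hence "deg (?L e [0..<r]) <= d" using e hideal_gen(5) deg_vs[of "[0..<r]" e] by (auto simp: expo_def atLeast0LessThan)
   from permute_B[OF ms ok_yw[OF y] this]
   show "wd d (?L e [0..<r]) - wd d (?L e (us @ vs)) : B d r" by simp
  qed
  moreover have "(\<Sum>e\<in>expo S s. sc (?q e) (wd d (?L e (us @ vs)))) : B d r"
  proof -
   let ?us = "?L (\<lambda>_. 0) us"
   have yus: "yok (map (\<lambda>v. (ka v, a v + 0)) us)" using ka us by (auto simp: yok_map)
   have dus: "deg ?us = sum a (set us)" using deg_vs[OF us(2), of "\<lambda>_. 0"] by simp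
   have "RR ka a s (d - deg ?us) vs : B (d - deg ?us) (length vs)"
    by (rule RR_B) (use vs ka hideal_gen suma dus finS in \<open>auto simp: card_gt_0_iff Suc_le_eq\<close>)
   hence "(\<Sum>e\<in>expo S s. sc (?q e) (wd (d - deg ?us) (?L e vs))) : B (d - deg ?us) (card S)" by (simp add: RR_def vs)
   from prefix_sum_B[OF ok_yw[OF yus] _ this]
   have "(\<Sum>e\<in>expo S s. sc (?q e) (wd d (?us @ ?L e vs))) : B d (card S + length us)" using hideal_gen(5) suma dus by simp
   moreover have "(\<Sum>e\<in>expo S s. sc (?q e) (wd d (?us @ ?L e vs))) = (\<Sum>e\<in>expo S s. sc (?q e) (wd d (?L e (us @ vs))))"
   proof (intro sum.cong refl arg_cong2[of _ _ _ _ sc] arg_cong[of _ _ "wd d"])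
    fix e assume e: "e : expo S s"
    have "map (\<lambda>v. (ka v, a v + 0)) us = map (\<lambda>v. (ka v, a v + e v)) us" using e us by (auto simp: expo_def)
    hence "?us = ?L e us" by (rule arg_cong)
    thus "?us @ ?L e vs = ?L e (us @ vs)" by (simp only: map_append yw_simps)
   qed
   ultimately show ?thesis using len by (simp add: add.commute)
  qed
  ultimately have "(\<Sum>e\<in>expo S s. sc (?q e) (wd d (?L e [0..<r]) - wd d (?L e (us @ vs)))) +
   (\<Sum>e\<in>expo S s. sc (?q e) (wd d (?L e (us @ vs)))) : B d r" by (rule subsp_add[OF B_subsp])
  thus ?thesis by (simp add: sc_diff sum_subtractf)
 qed
 show ?case unfolding VE by (rule subsp_sc[OF B_subsp SB])
qed

text \<open>When \<open>w\<close> has \<open>card S\<close> letters, this is the sum over the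
  bijections from letters to variables with matching colours of the corresponding monomials: a
  multisymmetric analogue of a monomial symmetric function.\<close>

fun sympol :: "(nat => nat) => (nat \<times> nat) list => nat set => pol" where
 "sympol ka [] S = 1"
| "sympol ka ((k, e) # w) S = (\<Sum>v\<in>{v\<in>S. ka v = k}. single (\<lambda>i. if i = v then e else 0) 1 * sympol ka w (S - {v}))"

lemma sympol_keys:
 assumes "finite S" "a : keys (sympol ka w S)"
 shows "(\<forall>v. v \<notin> S \<longrightarrow> a v = 0) \<and> sum a S <= deg w"
 using assms
proof (induction w arbitrary: S a)
 case (Cons ke w)
 obtain k e where ke: "ke = (k, e)" by force
 let ?u = "\<lambda>v i. if i = v then e else 0"
 have "a : (\<Union>v\<in>{v\<in>S. ka v = k}. keys (single (?u v) 1 * sympol ka w (S - {v})))"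
  by (rule subsetD[OF Poly_Mapping.keys_sum Cons.prems(2)[unfolded ke sympol.simps]])
 then obtain v where v: "v : S" "a : keys (single (?u v) 1 * sympol ka w (S - {v}))" by auto
 then obtain a' where a': "a' : keys (sympol ka w (S - {v}))" "a = ?u v + a'"
  using keys_mult[of "single (?u v) (1::complex)" "sympol ka w (S - {v})"] by auto
 have IH: "(\<forall>x. x \<notin> S - {v} \<longrightarrow> a' x = 0) \<and> sum a' (S - {v}) <= deg w"
  using Cons.IH[OF _ a'(1)] Cons.prems(1) by simp
 have "sum a' S = sum a' (S - {v})" using IH Cons.prems(1) by (intro sum.mono_neutral_right) auto
 moreover have "sum (?u v) S = e" using v(1) Cons.prems(1) by simp
 ultimately have "sum a S <= e + deg w" using IH by (simp add: a'(2) sum.distrib)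
 thus ?case using IH v(1) by (auto simp: a'(2) ke)
qed (simp add: deg_def)

lemma sympol_cong: "(\<And>v. v : S ==> ka v = ka' v) ==> sympol ka w S = sympol ka' w S"
proof (induction w arbitrary: S)
 case (Cons ke w)
 obtain k e where ke: "ke = (k, e)" by force
 have "{v\<in>S. ka v = k} = {v\<in>S. ka' v = k}" using Cons.prems by auto
 moreover have "sympol ka w (S - {v}) = sympol ka' w (S - {v})" for v by (rule Cons.IH) (use Cons.prems in auto)
 ultimately show ?case by (simp add: ke)
qed simp

lemma sympol_le: "S <= {..<r} ==> deg w <= d ==> sympol ka w S : pol_le r 0 d"
proof -
 assume S: "S <= {..<r}" and d: "deg w <= d"
 have fin: "finite S" using S finite_subset by blast
 have "(\<forall>i\<ge>r. a i = 0) \<and> (\<Sum>i<r. a i) + 0 <= d" if a: "a : keys (sympol ka w S)" for a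
 proof -
  note k = sympol_keys[OF fin a]
  have "sum a {..<r} = sum a S" by (rule sum.mono_neutral_right) (use S k in auto)
  moreover have "i \<notin> S" if "i \<ge> r" for i using S that by auto
  ultimately show ?thesis using k d by simp
 qed
 thus ?thesis by (simp add: pol_le_def)
qed

lemma Vec_cong: "finite S ==> (\<And>v. v : S ==> ka v = ka' v) ==> Vec S ka d f = Vec S ka' d f"
 unfolding Vec_def by (rule lin_ext_cong, rule arg_cong[of _ _ "\<lambda>l. wd d (yw l)"]) auto

text \<open>Bringing the letter of \<open>v\<close> to the front is a permutation of letters, hence
  harmless up to shorter words.\<close>

lemma Vec_extract:
 assumes S: "finite S" "v : S" and ka: "\<And>v. v : S ==> 0 < ka v \<and> ka v < 2 * n" and d: "e + d' <= d"
  and f: "\<And>a. a : keys f ==> (\<forall>x. x \<notin> S - {v} \<longrightarrow> a x = 0) \<and> sum a (S - {v}) <= d'"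
 shows "Vec S ka d (single (\<lambda>i. if i = v then e else 0) 1 * f) - ac (ym n (ka v)) e (Vec (S - {v}) ka (d - e) f) : B d (card S)"
proof -
 let ?y = "ym n (ka v)" and ?u = "\<lambda>i. if i = v then e else (0::nat)"
 have y: "?y : spc n" using ka[OF S(2)] ym_sp by blast
 let ?vs = "sorted_list_of_set S" and ?ws = "sorted_list_of_set (S - {v})"
 have ms: "mset ?vs = mset (v # ?ws)" by (rule set_eq_iff_mset_eq_distinct[THEN iffD1]) (use S in auto)
 have one_term: "Vec S ka d (single ?u 1 * single a c) - ac ?y e (Vec (S - {v}) ka (d - e) (single a c)) : B d (card S)"
  if a: "(\<forall>x. x \<notin> S - {v} \<longrightarrow> a x = 0) \<and> sum a (S - {v}) <= d'" for a c
 proof -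
  let ?g = "\<lambda>x. (ka x, (?u + a) x)"
  have yk: "yok (map ?g ?vs)" using ka S by (auto simp: yok_map)
  have ms': "mset (yw (map ?g ?vs)) = mset (yw (map ?g (v # ?ws)))" using ms by (simp only: yw_def mset_map)
  have "sum (?u + a) S = sum ?u S + sum a S" by (simp add: sum.distrib)
  also have "sum a S = sum a (S - {v})" using a S by (intro sum.mono_neutral_right) auto
  finally have "deg (yw (map ?g ?vs)) <= d" using S a d by (simp add: deg_map)
  from permute_B[OF ms' ok_yw[OF yk] this] S
  have 1: "wd d (yw (map ?g ?vs)) - wd d (yw (map ?g (v # ?ws))) : B d (card S)" by simp
  have "map ?g ?ws = map (\<lambda>x. (ka x, a x)) ?ws" using S by auto
  moreover have "?g v = (ka v, e)" using a by simp
  ultimately have "yw (map ?g (v # ?ws)) = (?y, e) # yw (map (\<lambda>x. (ka x, a x)) ?ws)" by (simp only: list.map yw_simps)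
  hence "wd d (yw (map ?g (v # ?ws))) = ac ?y e (wd (d - e) (yw (map (\<lambda>x. (ka x, a x)) ?ws)))" by (simp only: wd_Cons)
  hence "Vec S ka d (single ?u 1 * single a c) - ac ?y e (Vec (S - {v}) ka (d - e) (single a c)) =
    sc c (wd d (yw (map ?g ?vs)) - wd d (yw (map ?g (v # ?ws))))" by (simp only: mult_single Vec_simps ac_sc[OF y] sc_diff mult_1)
  thus ?thesis using subsp_sc[OF B_subsp 1] by simp
 qed
 show ?thesis
 proof (induction f rule: single_induct)
  case zero
  thus ?case by (simp add: Vec_simps ac_zero[OF y] subsp_zero[OF B_subsp])
 next
  case (add a c g)
  from subsp_add[OF B_subsp one_term[OF f[OF add(1)], of c] add(2)] show ?case
   by (simp add: distrib_left Vec_simps ac_add[OF y] algebra_simps)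
 qed
qed

text \<open>Each of the \<open>fact (card S)\<close> bijections between letters and variables fits
  exactly one colouring and yields a rearrangement of \<open>w\<close>.\<close>

lemma sum_sympol:
 assumes "finite S" "length w = card S" "yok w" "deg w <= d"
 shows "(\<Sum>ka\<in>PiE S (\<lambda>_. {1..<2 * n}). Vec S ka d (sympol ka w S)) - sc (fact (card S)) (wd d (yw w)) : B d (card S)"
 using assms
proof (induction w arbitrary: S d)
 case Nil
 hence S: "S = {}" by simp
 have "Vec {} ka d 1 = wd d []" for ka using Vec_simps(3)[of "{}" ka d 0 1] by (simp add: sc_one)
 thus ?case by (simp add: S sc_one subsp_zero[OF B_subsp])
next
 case (Cons ke w)
 obtain k e where ke: "ke = (k, e)" by force
 let ?A = "{1..<2 * n}" and ?u = "\<lambda>v i. if i = v then e else (0::nat)"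
 let ?h = "\<lambda>ka v. single (?u v) 1 * sympol ka w (S - {v})" and ?V = "\<lambda>ka v. Vec (S - {v}) ka (d - e) (sympol ka w (S - {v}))"
 have S: "finite S" "card S = Suc (length w)" using Cons.prems by auto
 have k: "0 < k" "k < 2 * n" "yok w" "e + deg w <= d" using Cons.prems by (auto simp: ke)
 have y: "ym n k : spc n" using k ym_sp by blast
 let ?P = "\<lambda>S. PiE S (\<lambda>_. ?A)"
 have finP: "finite (?P T)" if "finite T" for T :: "nat set" using that by (intro finite_PiE) auto
 have cS: "card (S - {v}) = length w" if "v : S" for v using that S by simp
 have A: "(\<Sum>ka\<in>?P S. Vec S ka d (sympol ka (ke # w) S)) =
  (\<Sum>v\<in>S. \<Sum>ka\<in>{ka\<in>?P S. ka v = k}. Vec S ka d (?h ka v))"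
 proof -
  have "(\<Sum>ka\<in>?P S. Vec S ka d (sympol ka (ke # w) S)) =
    (\<Sum>ka\<in>?P S. \<Sum>v\<in>{v\<in>S. ka v = k}. Vec S ka d (?h ka v))" by (simp add: ke Vec_simps)
  also have "... = (\<Sum>v\<in>S. \<Sum>ka\<in>{ka\<in>?P S. ka v = k}. Vec S ka d (?h ka v))"
   by (rule sum.swap_restrict) (use S finP in auto)
  finally show ?thesis .
 qed
 have each: "(\<Sum>ka\<in>{ka\<in>?P S. ka v = k}. Vec S ka d (?h ka v))
   - sc (fact (length w)) (wd d (yw (ke # w))) : B d (card S)" if v: "v : S" for v
 proof -
  let ?K = "{ka\<in>?P S. ka v = k}"
  have "(\<Sum>ka\<in>?K. Vec S ka d (?h ka v) - ac (ym n k) e (?V ka v)) : B d (card S)"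
  proof (rule subsp_sum[OF B_subsp])
   fix ka assume ka: "ka : ?K"
   have kr: "0 < ka x \<and> ka x < 2 * n" if "x : S" for x using PiE_mem[of ka S "\<lambda>_. ?A" x] ka that by auto
   have "Vec S ka d (?h ka v) - ac (ym n (ka v)) e (?V ka v) : B d (card S)"
    by (rule Vec_extract[OF S(1) v kr, where e = e and d' = "deg w" and d = d]) (use k sympol_keys[of "S - {v}"] S in auto)
   thus "Vec S ka d (?h ka v) - ac (ym n k) e (?V ka v) : B d (card S)" using ka by simp
  qed
  moreover have "(\<Sum>ka\<in>?K. ac (ym n k) e (?V ka v)) =
    ac (ym n k) e (\<Sum>ka\<in>?P (S - {v}). ?V ka v)" unfolding ac_sum[OF y]
  proof (rule sum.reindex_bij_witness[of _ "\<lambda>ka. ka(v := k)" "\<lambda>ka. ka(v := undefined)"])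
   fix ka assume ka: "ka : ?K"
   show "(ka(v := undefined))(v := k) = ka" using ka by auto
   show "ka(v := undefined) : ?P (S - {v})" using ka by (auto simp: PiE_def Pi_def extensional_def)
   have "sympol (ka(v := undefined)) w (S - {v}) = sympol ka w (S - {v})" by (rule sympol_cong) auto
   moreover have "Vec (S - {v}) (ka(v := undefined)) (d - e) f = Vec (S - {v}) ka (d - e) f" for f
    by (rule Vec_cong) (use S in auto)
   ultimately show "ac (ym n k) e (Vec (S - {v}) (ka(v := undefined)) (d - e) (sympol (ka(v := undefined)) w (S - {v}))) =
     ac (ym n k) e (?V ka v)" by simp
  next
   fix ka assume ka: "ka : ?P (S - {v})"
   have "ka v = undefined" using ka by (auto simp: PiE_def extensional_def)
   thus "(ka(v := k))(v := undefined) = ka" by auto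
   show "ka(v := k) : ?K" using ka k v by (auto simp: PiE_def Pi_def extensional_def)
  qed
  ultimately have 1: "(\<Sum>ka\<in>?K. Vec S ka d (?h ka v)) -
   ac (ym n k) e (\<Sum>ka\<in>?P (S - {v}). ?V ka v) : B d (card S)" by (simp add: sum_subtractf)
  have "(\<Sum>ka\<in>?P (S - {v}). ?V ka v) - sc (fact (length w)) (wd (d - e) (yw w)) : B (d - e) (length w)"
   using Cons.IH[of "S - {v}" "d - e"] cS[OF v] k S by simp
  from ym_B[OF k(1,2) this, of e]
  have "ac (ym n k) e (\<Sum>ka\<in>?P (S - {v}). ?V ka v) - sc (fact (length w)) (wd d (yw (ke # w))) : B d (card S)"
   using k S by (simp add: ac_diff[OF y] ac_sc[OF y] ke wd_Cons)
  from subsp_add[OF B_subsp 1 this] show ?thesis by simp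
 qed
 have "(\<Sum>v\<in>S. (\<Sum>ka\<in>{ka\<in>?P S. ka v = k}. Vec S ka d (?h ka v))
   - sc (fact (length w)) (wd d (yw (ke # w)))) : B d (card S)" by (rule subsp_sum[OF B_subsp each])
 moreover have "(\<Sum>v\<in>S. sc (fact (length w)) (wd d (yw (ke # w)))) = sc (fact (card S)) (wd d (yw (ke # w)))"
  using sc_sum_left[of "\<lambda>_. fact (length w)" S "wd d (yw (ke # w))"] S by (simp add: mult.commute)
 ultimately show ?case unfolding A by (simp only: sum_subtractf)
qed

lemma B_Suc_split:
 assumes "u : B d (Suc r)"
 shows "\<exists>U. (\<forall>w\<in>keys U. length w = r \<and> yok w \<and> deg w <= d) \<and> u - lin_ext (\<lambda>w. wd d (yw w)) U : B d r"
proof -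
 let ?Q = "\<lambda>u U. (\<forall>w\<in>keys U. length w = r \<and> yok w \<and> deg w <= d) \<and> u - lin_ext (\<lambda>w. wd d (yw w)) U : B d r"
 have "B d (Suc r) <= {u. \<exists>U. ?Q u U}"
 proof (rule B_least)
  show "subsp {u. \<exists>U. ?Q u U}"
  proof (rule subspI)
   show "0 : {u. \<exists>U. ?Q u U}" by (auto intro!: exI[of _ 0] simp: subsp_zero[OF B_subsp])
  next
   fix x y assume "x : {u. \<exists>U. ?Q u U}" "y : {u. \<exists>U. ?Q u U}"
   then obtain U W where U: "?Q x U" and W: "?Q y W" by blast
   have "x + y - lin_ext (\<lambda>w. wd d (yw w)) (U + W) : B d r"
    using subsp_add[OF B_subsp conjunct2[OF U] conjunct2[OF W]] by (simp add: lin_ext_add algebra_simps)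
   moreover have "\<forall>w\<in>keys (U + W). length w = r \<and> yok w \<and> deg w <= d"
    using U W Poly_Mapping.keys_add[of U W] by blast
   ultimately show "x + y : {u. \<exists>U. ?Q u U}" by blast
  next
   fix c x assume "x : {u. \<exists>U. ?Q u U}"
   then obtain U where U: "?Q x U" by blast
   have "sc c x - lin_ext (\<lambda>w. wd d (yw w)) (scale_pm c U) : B d r"
    using subsp_sc[OF B_subsp conjunct2[OF U], of c] by (simp add: lin_ext_scale sc_diff)
   moreover have "\<forall>w\<in>keys (scale_pm c U). length w = r \<and> yok w \<and> deg w <= d"
    using U keys_scale_pm[of c U] by blast
   ultimately show "sc c x : {u. \<exists>U. ?Q u U}" by blast
  qed
  show "N <= {u. \<exists>U. ?Q u U}" by (auto intro!: exI[of _ 0] N_B)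
  fix w assume w: "length w < Suc r" "yok w" "deg w <= d"
  show "wd d (yw w) : {u. \<exists>U. ?Q u U}"
  proof (cases "length w = r")
   case True
   thus ?thesis using w by (auto intro!: exI[of _ "single w 1"] simp: sc_one subsp_zero[OF B_subsp])
  next
   case False
   hence "wd d (yw w) : B d r" using w by (intro word_B) auto
   thus ?thesis by (auto intro!: exI[of _ 0])
  qed
 qed
 thus ?thesis using assms by blast
qed

lemma B_0: "B d 0 = N"
proof
 show "B d 0 <= N" by (rule B_least[OF N]) auto
qed (use N_B in auto)

end

text \<open>The pairs \<open>(j, i)\<close> with \<open>i < m j\<close> are the slots of the tensor
  product, and \<open>Lam c\<close> is the coordinate with basis vector \<open>c p\<close> in slot
  \<open>p\<close>. The power of \<open>z (fst p)\<close> comes from evaluating \<open>t^s\<close>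
  at the parameter of the factor.\<close>

locale fusion_functionals = fusion_core sc n J z m N ac v0 wd
 for sc :: "complex => 'm::ab_group_add => 'm" and n J z m N ac v0 wd +
 fixes Lam :: "(nat \<times> nat => nat) => 'm => complex"
 assumes inj_z: "inj_on z J"
  and Lam_add: "Lam c (u + w) = Lam c u + Lam c w"
  and Lam_sc: "Lam c (sc a u) = a * Lam c u"
  and Lam_N: "u : N ==> Lam c u = 0"
  and Lam_v0: "Lam c (v0 d) = (if \<forall>p\<in>Sigma J (\<lambda>j. {..<m j}). c p = 0 then 1 else 0)"
  and Lam_ac: "X : spc n ==> ok_word n ws ==>
   (\<forall>p\<in>Sigma J (\<lambda>j. {..<m j}). c p < 2 * n) ==>
   Lam c (ac X s (wd d ws)) = (\<Sum>p\<in>Sigma J (\<lambda>j. {..<m j}). z (fst p) ^ s *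
    (\<Sum>b<2 * n. X $$ (c p, b) * Lam (c(p := b)) (wd d ws)))"
begin

abbreviation "Pos \<equiv> Sigma J (\<lambda>j. {..<m j})"

lemma finite_Pos: "finite Pos"
 using J by (intro finite_SigmaI) auto

lemma Lam_zero [simp]: "Lam c 0 = 0"
 using Lam_sc[of c 0 0] by simp
lemma Lam_diff: "Lam c (u - w) = Lam c u - Lam c w"
 using Lam_add[of c u "- w"] Lam_sc[of c "- 1" w] by (simp add: sc_m1)
lemma Lam_sum: "Lam c (\<Sum>i\<in>I. f i) = (\<Sum>i\<in>I. Lam c (f i))"
 by (induction I rule: infinite_finite_induct) (auto simp: Lam_add)

text \<open>The generator has 0 in all slots and each letter changes one slot, so fewer letters than
  excited slots cannot suffice.\<close>

lemma Lam_short: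
 assumes "yok w" "\<forall>p\<in>Pos. c p < 2 * n" "length w < card {p\<in>Pos. c p ~= 0}"
 shows "Lam c (wd d (yw w)) = 0"
 using assms
proof (induction w arbitrary: c d)
 case Nil
 hence "{p\<in>Pos. c p ~= 0} ~= {}" by (metis card.empty less_irrefl list.size(3))
 thus ?case by (auto simp: wd_Nil Lam_v0)
next
 case (Cons ke w)
 obtain k e where ke: "ke = (k, e)" by force
 have k: "k < 2 * n" "yok w" using Cons.prems by (auto simp: ke)
 have "Lam (c(p := b)) (wd (d - e) (yw w)) = 0" if p: "p : Pos" "b < 2 * n" for p b
 proof (rule Cons.IH[OF k(2)])
  have "{q\<in>Pos. c q ~= 0} - {p} <= {q\<in>Pos. (c(p := b)) q ~= 0}" by auto
  hence "card ({q\<in>Pos. c q ~= 0} - {p}) <= card {q\<in>Pos. (c(p := b)) q ~= 0}"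
   by (rule card_mono[rotated]) (use finite_Pos in auto)
  moreover have "card {q\<in>Pos. c q ~= 0} - 1 <= card ({q\<in>Pos. c q ~= 0} - {p})"
   by (cases "p : {q\<in>Pos. c q ~= 0}") (use finite_Pos in auto)
  ultimately show "length w < card {q\<in>Pos. (c(p := b)) q ~= 0}" using Cons.prems(3) by simp
 qed (use Cons.prems p in auto)
 thus ?case using Lam_ac[OF ym_sp[OF k(1)], of "yw w" c e "d - e"] ok_yw[OF k(2)] Cons.prems(2) by (simp add: ke wd_Cons ok_def)
qed

lemma Lam_B:
 assumes "u : B d r" "\<forall>p\<in>Pos. c p < 2 * n" "card {p\<in>Pos. c p ~= 0} \<ge> r"
 shows "Lam c u = 0"
proof -
 have "B d r <= {u. Lam c u = 0}"
  by (rule B_least) (auto simp: Lam_add Lam_sc Lam_N intro!: subspI Lam_short assms(2) order_less_le_trans[OF _ assms(3)])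
 thus ?thesis using assms(1) by auto
qed

text \<open>The coordinates with colour \<open>ka v\<close> in slot \<open>p v\<close> and 0
  elsewhere; the choice of \<open>v\<close> is unique where \<open>p\<close> is injective.\<close>

definition place :: "(nat => nat \<times> nat) => (nat => nat) => nat set => nat \<times> nat => nat" where
 "place p ka S x = (if \<exists>v\<in>S. x = p v then ka (SOME v. v : S \<and> x = p v) else 0)"

lemma place_in: "inj_on p S ==> v : S ==> place p ka S (p v) = ka v"
proof -
 assume i: "inj_on p S" and v: "v : S"
 have "(SOME w. w : S \<and> p v = p w) = v" by (rule some_equality) (use i v in \<open>auto simp: inj_on_def\<close>)
 thus ?thesis using v by (auto simp: place_def)
qed

lemma place_remove: "inj_on p S ==> v : S ==> (place p ka S)(p v := 0) = place p ka (S - {v})"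
proof
 fix x assume i: "inj_on p S" and v: "v : S"
 have i': "inj_on p (S - {v})" using i by (rule inj_on_subset) auto
 show "((place p ka S)(p v := 0)) x = place p ka (S - {v}) x"
 proof (cases "\<exists>w\<in>S - {v}. x = p w")
  case True
  then obtain w where w: "w : S - {v}" "x = p w" by auto
  hence "p w ~= p v" using i v by (auto simp: inj_on_def)
  thus ?thesis using w place_in[OF i, of w ka] place_in[OF i' w(1), of ka] by simp
 next
  case False
  hence "place p ka (S - {v}) x = 0" by (auto simp: place_def)
  moreover have "x ~= p v ==> place p ka S x = 0" using False by (auto simp: place_def)
  ultimately show ?thesis by auto
 qed
qed

text \<open>With as many letters as excited slots, every letter excites a slot of its own and must
  match its colour; a letter of degree \<open>e\<close> in slot \<open>p v\<close> contributes
  \<open>z (fst (p v)) ^ e\<close>. The sum over these assignments is \<open>sympol\<close> at the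
  parameters.\<close>

lemma Lam_place:
 assumes "yok w" "length w = card S" "S <= {..<r}" "inj_on p S" "p ` S <= Pos" "\<And>v. v : S ==> 0 < ka v \<and> ka v < 2 * n"
 shows "Lam (place p ka S) (wd d (yw w)) = pol_eval r (\<lambda>v. z (fst (p v))) (sympol ka w S)"
 using assms
proof (induction w arbitrary: S d)
 case Nil
 hence "S = {}" using finite_subset[OF Nil(3)] by simp
 thus ?case by (simp add: wd_Nil Lam_v0 place_def pol_eval_1)
next
 case (Cons ke w)
 obtain k e where ke: "ke = (k, e)" by force
 have k: "0 < k" "k < 2 * n" "yok w" using Cons.prems by (auto simp: ke)
 have finS: "finite S" using Cons.prems(3) finite_subset by blast
 let ?c = "place p ka S"
 have cv: "?c x < 2 * n" for x
 proof (cases "\<exists>v\<in>S. x = p v")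
  case True
  thus ?thesis using place_in[OF Cons.prems(4)] Cons.prems(6) by auto
 next
  case False thus ?thesis using n by (simp add: place_def)
 qed
 have cnz: "{x\<in>Pos. ?c x ~= 0} = p ` S"
 proof
  show "{x\<in>Pos. ?c x ~= 0} <= p ` S" by (auto simp: place_def split: if_splits)
  show "p ` S <= {x\<in>Pos. ?c x ~= 0}"
  proof (intro image_subsetI CollectI conjI)
   fix v assume v: "v : S"
   thus "p v : Pos" using Cons.prems(5) by blast
   show "?c (p v) ~= 0" using place_in[OF Cons.prems(4) v, of ka] Cons.prems(6)[OF v] by simp
  qed
 qed
 have cardS: "card (p ` S) = Suc (length w)" using Cons.prems(2) card_image[OF Cons.prems(4)] by simp
 let ?u = "wd (d - e) (yw w)"
 \<comment> \<open>Unless the letter accounts for an excited slot by changing it from 0, the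
   remaining letters are too few for \<open>Lam_short\<close>.\<close>
 have inner: "(\<Sum>b<2 * n. ym n k $$ (?c x, b) * Lam (?c(x := b)) ?u) =
   (if x : p ` S then ym n k $$ (?c x, 0) * Lam (?c(x := 0)) ?u else 0)" if x: "x : Pos" for x
 proof -
  have "Lam (?c(x := b)) ?u = 0" if b: "b < 2 * n" "\<not> (x : p ` S \<and> b = 0)" for b
  proof (rule Lam_short[OF k(3)])
   show "\<forall>p\<in>Pos. (?c(x := b)) p < 2 * n" using cv b by auto
   have "p ` S <= {q\<in>Pos. (?c(x := b)) q ~= 0}" using cnz b(2) by auto
   hence "card (p ` S) <= card {q\<in>Pos. (?c(x := b)) q ~= 0}" by (rule card_mono[rotated]) (use finite_Pos in auto)
   thus "length w < card {q\<in>Pos. (?c(x := b)) q ~= 0}" using cardS by simp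
  qed
  hence "(\<Sum>b<2 * n. ym n k $$ (?c x, b) * Lam (?c(x := b)) ?u) =
   (\<Sum>b<2 * n. if b = 0 then if x : p ` S then ym n k $$ (?c x, 0) * Lam (?c(x := 0)) ?u else 0 else 0)"
   by (intro sum.cong) auto
  thus ?thesis using n by simp
 qed
 have "Lam ?c (wd d (yw (ke # w))) = (\<Sum>x\<in>Pos. z (fst x) ^ e * (\<Sum>b<2 * n. ym n k $$ (?c x, b) * Lam (?c(x := b)) ?u))"
  using Lam_ac[OF ym_sp[OF k(2)], of "yw w" ?c e "d - e"] ok_yw[OF k(3)] cv by (simp add: ke wd_Cons ok_def)
 also have "... = (\<Sum>x\<in>Pos. if x : p ` S then z (fst x) ^ e * (ym n k $$ (?c x, 0) * Lam (?c(x := 0)) ?u) else 0)"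
  by (rule sum.cong) (use inner in auto)
 also have "... = (\<Sum>x\<in>p ` S. z (fst x) ^ e * (ym n k $$ (?c x, 0) * Lam (?c(x := 0)) ?u))"
  using Cons.prems(5) finite_Pos by (simp add: sum.inter_restrict[symmetric] Int_absorb1)
 also have "... = (\<Sum>v\<in>S. z (fst (p v)) ^ e * (ym n k $$ (?c (p v), 0) * Lam (?c(p v := 0)) ?u))"
  by (simp add: sum.reindex[OF Cons.prems(4)])
 also have "... = (\<Sum>v\<in>S. if ka v = k then z (fst (p v)) ^ e * pol_eval r (\<lambda>v. z (fst (p v))) (sympol ka w (S - {v})) else 0)"
 proof (rule sum.cong)
  fix v assume v: "v : S"
  have "Lam (?c(p v := 0)) ?u = pol_eval r (\<lambda>v. z (fst (p v))) (sympol ka w (S - {v}))"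
   unfolding place_remove[OF Cons.prems(4) v]
   by (rule Cons.IH[OF k(3)]) (use Cons.prems v finS in \<open>auto simp: inj_on_def\<close>)
  moreover have "ym n k $$ (?c (p v), 0) = (if ka v = k then 1 else 0)"
   using place_in[OF Cons.prems(4) v, of ka] ym_col0[OF k(1,2)] Cons.prems(6)[OF v] by simp
  ultimately show "z (fst (p v)) ^ e * (ym n k $$ (?c (p v), 0) * Lam (?c(p v := 0)) ?u) =
   (if ka v = k then z (fst (p v)) ^ e * pol_eval r (\<lambda>v. z (fst (p v))) (sympol ka w (S - {v})) else 0)" by simp
 qed simp
 also have "... = (\<Sum>v\<in>{v\<in>S. ka v = k}. z (fst (p v)) ^ e * pol_eval r (\<lambda>v. z (fst (p v))) (sympol ka w (S - {v})))"
  using finS by (simp add: sum.inter_filter)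
 also have "... = pol_eval r (\<lambda>v. z (fst (p v))) (sympol ka (ke # w) S)"
  unfolding ke sympol.simps pol_eval_sum pol_eval_mult
 proof (rule sum.cong)
  fix v assume "v : {v\<in>S. ka v = k}"
  hence "v < r" using Cons.prems(3) by auto
  thus "z (fst (p v)) ^ e * pol_eval r (\<lambda>v. z (fst (p v))) (sympol ka w (S - {v})) =
    pol_eval r (\<lambda>v. z (fst (p v))) (single (\<lambda>i. if i = v then e else 0) 1) * pol_eval r (\<lambda>v. z (fst (p v))) (sympol ka w (S - {v}))"
   by (simp add: pvar_power[symmetric] pol_eval_power pol_eval_pvar)
 qed simp
 finally show ?case .
qed

text \<open>The words of length \<open>r\<close> in \<open>u\<close> are collected, for each
  colouring, into a polynomial \<open>F ka\<close>. Its value at an admissible point is a coordinate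
  of \<open>u\<close>, because shorter words are invisible there, hence 0; so \<open>F ka\<close>
  lies in \<open>hideal\<close> and gives shorter words. The sum over colourings is
  \<open>fact r\<close> times the leading part.\<close>

lemma B_descend:
 assumes u: "u : B d (Suc r)" and L: "\<And>c. \<forall>p\<in>Pos. c p < 2 * n ==> Lam c u = 0"
 shows "u : B d r"
proof -
 obtain U where U: "\<And>w. w : keys U ==> length w = r \<and> yok w \<and> deg w <= d"
  and uU: "u - lin_ext (\<lambda>w. wd d (yw w)) U : B d r" using B_Suc_split[OF u] by blast
 let ?K = "PiE {..<r} (\<lambda>_. {1..<2 * n})"
 let ?s = "\<lambda>w. \<Sum>ka\<in>?K. Vec {..<r} ka d (sympol ka w {..<r})"
 define F where "F ka = (\<Sum>w\<in>keys U. pconst (lookup U w) * sympol ka w {..<r})" for ka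
 have pconst_mult: "pconst c * f = pm.lin_ext (\<lambda>a. single a c) f" for c f
 proof (induction f rule: single_induct)
  case (add a c g) thus ?case by (simp add: distrib_left pm.lin_ext_add pconst_def mult_single mult.commute)
 qed simp
 have VecF: "Vec {..<r} ka d (pconst c * f) = sc c (Vec {..<r} ka d f)" for ka c f
 proof (induction f rule: single_induct)
  case (add a c g) thus ?case by (simp add: distrib_left Vec_simps pconst_def mult_single sc_add sc_sc)
 qed (simp add: Vec_simps)
 have VB: "Vec {..<r} ka d (F ka) : B d r" if ka: "ka : ?K" for ka
 proof -
  have kr: "0 < ka v \<and> ka v < 2 * n" if "v < r" for v using PiE_mem[OF ka, of v] that by auto
  have "F ka : hideal J z m r 0 d"
  proof (rule vanishing_in_hideal[OF J inj_z])
   show "F ka : pol_le r 0 d" unfolding F_def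
   proof (rule pol_le_sum)
    fix w assume "w : keys U"
    hence "sympol ka w {..<r} : pol_le r 0 d" using U by (intro sympol_le) auto
    thus "pconst (lookup U w) * sympol ka w {..<r} : pol_le r 0 d"
     using pol_le_mult[OF pol_le_pconst[of 0 0 "lookup U w" r]] by fastforce
   qed
   fix p0 assume p0: "admissible J m r p0"
   \<comment> \<open>Numbering the letters that share a factor turns an admissible assignment into
     an injective choice of slots.\<close>
   define p where "p v = (p0 v, card {i\<in>{..<v}. p0 i = p0 v})" for v
   have pPos: "p v : Pos" if v: "v < r" for v
   proof -
    have "{i\<in>{..<v}. p0 i = p0 v} \<subset> {i\<in>{..<r}. p0 i = p0 v}" using v by auto
    hence "card {i\<in>{..<v}. p0 i = p0 v} < card {i\<in>{..<r}. p0 i = p0 v}" by (intro psubset_card_mono) auto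
    thus ?thesis using p0 v by (auto simp: p_def admissible_def intro: order_less_le_trans)
   qed
   have lt: "p v ~= p w" if "v < w" for v w
   proof
    assume "p v = p w"
    hence e: "p0 v = p0 w" "card {i\<in>{..<v}. p0 i = p0 v} = card {i\<in>{..<w}. p0 i = p0 w}" by (auto simp: p_def)
    have "{i\<in>{..<v}. p0 i = p0 v} \<subset> {i\<in>{..<w}. p0 i = p0 w}" using that e by auto
    hence "card {i\<in>{..<v}. p0 i = p0 v} < card {i\<in>{..<w}. p0 i = p0 w}" by (intro psubset_card_mono) auto
    thus False using e by simp
   qed
   have inj: "inj_on p {..<r}" by (rule inj_onI) (metis lt nat_neq_iff)
   let ?c = "place p ka {..<r}"
   have pl: "Lam ?c (wd d (yw w)) = pol_eval r (\<lambda>v. z (p0 v)) (sympol ka w {..<r})" if "w : keys U" for w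
    using Lam_place[of w "{..<r}" r p ka d] U[OF that] inj pPos kr by (auto simp: p_def)
   have cv: "?c x < 2 * n" for x
   proof (cases "\<exists>v\<in>{..<r}. x = p v")
    case True thus ?thesis using place_in[OF inj] kr by auto
   next
    case False thus ?thesis using n by (simp add: place_def)
   qed
   have "p ` {..<r} <= {x\<in>Pos. ?c x ~= 0}"
   proof (intro image_subsetI CollectI conjI)
    fix v assume v: "v : {..<r}"
    thus "p v : Pos" using pPos by blast
    show "?c (p v) ~= 0" using place_in[OF inj v, of ka] kr v by auto
   qed
   hence "card (p ` {..<r}) <= card {x\<in>Pos. ?c x ~= 0}" by (rule card_mono[rotated]) (use finite_Pos in auto)
   hence "r <= card {x\<in>Pos. ?c x ~= 0}" using card_image[OF inj] by simp
   from Lam_B[OF uU _ this] cv have "Lam ?c (u - lin_ext (\<lambda>w. wd d (yw w)) U) = 0" by blast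
   hence "Lam ?c (lin_ext (\<lambda>w. wd d (yw w)) U) = 0" using L[of ?c] cv by (simp add: Lam_diff)
   hence "(\<Sum>w\<in>keys U. lookup U w * Lam ?c (wd d (yw w))) = 0" by (simp add: lin_ext_def Lam_sum Lam_sc)
   thus "pol_eval r (\<lambda>v. z (p0 v)) (F ka) = 0"
    unfolding F_def pol_eval_sum pol_eval_mult pol_eval_simps using pl by (simp cong: sum.cong)
  qed
  thus ?thesis by (rule Vec_hideal) (rule kr)
 qed
 have "(\<Sum>ka\<in>?K. Vec {..<r} ka d (F ka)) : B d r" by (rule subsp_sum[OF B_subsp VB])
 also have "(\<Sum>ka\<in>?K. Vec {..<r} ka d (F ka)) = (\<Sum>w\<in>keys U. sc (lookup U w) (?s w))"
  unfolding F_def Vec_simps VecF sc_sum by (rule sum.swap)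
 finally have 1: "(\<Sum>w\<in>keys U. sc (lookup U w) (?s w)) : B d r" .
 have 2: "(\<Sum>w\<in>keys U. sc (lookup U w) ((?s w) - sc (fact r) (wd d (yw w)))) : B d r"
 proof (intro subsp_sum[OF B_subsp] subsp_sc[OF B_subsp])
  fix w assume "w : keys U"
  thus "(?s w) - sc (fact r) (wd d (yw w)) : B d r" using sum_sympol[of "{..<r}" w d] U by simp
 qed
 from subsp_diff[OF B_subsp 1 2] have "(\<Sum>w\<in>keys U. sc (lookup U w) (sc (fact r) (wd d (yw w)))) : B d r"
  by (simp add: sc_diff sum_subtractf)
 hence "sc (1 / fact r) (\<Sum>w\<in>keys U. sc (lookup U w) (sc (fact r) (wd d (yw w)))) : B d r" by (rule subsp_sc[OF B_subsp])
 hence "lin_ext (\<lambda>w. wd d (yw w)) U : B d r" by (simp add: lin_ext_def sc_sum sc_sc)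
 thus ?thesis using subsp_cong[OF B_subsp uU] by blast
qed

theorem core_injective:
 assumes "u : B d r" "\<And>c. \<forall>p\<in>Pos. c p < 2 * n ==> Lam c u = 0"
 shows "u : N"
 using assms(1)
proof (induction r)
 case 0 thus ?case by (simp add: B_0)
next
 case (Suc r) thus ?case using B_descend assms(2) by blast
qed

end



section \<open>The current algebra\<close>

lemma map_mat_coeff_index [simp]: "i < dim_row X ==> j < dim_col X ==> mat_coeff r X $$ (i, j) = coeff (X $$ (i, j)) r"
 "dim_row (mat_coeff r X) = dim_row X" "dim_col (mat_coeff r X) = dim_col X" by (simp_all add: mat_coeff_def)

lemma mat_coeff_carrier: "X : carrier_mat a b ==> mat_coeff r X : carrier_mat a b"
 by auto

definition cur :: "nat => complex poly mat set" where "cur n = currents n (spc n)"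

lemma cur_iff: "X : cur n \<longleftrightarrow> X : mats n \<and> (\<forall>r. mat_coeff r X : spc n)"
 by (auto simp: cur_def currents_def)

lemma current_algebra_record [simp]: "carrier (CA n) = cur n"
 "X \<oplus>\<^bsub>CA n\<^esub> Y = X + Y" "c \<odot>\<^bsub>CA n\<^esub> X = [:c:] \<cdot>\<^sub>m X"
 "bracket (CA n) X Y = X * Y - Y * X" by (simp_all add: current_algebra_def cur_def)

lemma cur_carrier: "X : cur n ==> X : mats n"
 and cur_coeff: "X : cur n ==> mat_coeff r X : spc n"
 and cur_dims: "X : cur n ==> dim_row X = 2 * n" "X : cur n ==> dim_col X = 2 * n"
 by (auto simp: cur_iff)

lemma mat_coeff_add: "X : carrier_mat a b ==> Y : carrier_mat a b ==> mat_coeff r (X + Y) = mat_coeff r X + mat_coeff r Y"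
 by (rule eq_matI) auto

lemma mat_coeff_smult: "mat_coeff r ([:c:] \<cdot>\<^sub>m X) = c \<cdot>\<^sub>m mat_coeff r X"
 by (rule eq_matI) auto

lemma poly_mat_mult_entry:
 fixes A B :: "complex poly mat"
 assumes "A : carrier_mat k l" "B : carrier_mat l m" "a < k" "b < m"
 shows "(A * B) $$ (a, b) = (\<Sum>i<l. A $$ (a, i) * B $$ (i, b))"
 using assms by (auto simp: scalar_prod_def atLeast0LessThan intro!: sum.cong)

lemma mat_coeff_mult_entry:
 assumes X: "X : carrier_mat k k" and Y: "Y : carrier_mat k k" and ab: "a < k" "b < k"
 shows "coeff ((X * Y) $$ (a, b)) r = (\<Sum>i\<le>r. (mat_coeff i X * mat_coeff (r - i) Y) $$ (a, b))"
proof -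
 have "coeff ((X * Y) $$ (a, b)) r = (\<Sum>j<k. \<Sum>i\<le>r. coeff (X $$ (a, j)) i * coeff (Y $$ (j, b)) (r - i))"
  unfolding poly_mat_mult_entry[OF X Y ab] by (simp add: coeff_sum coeff_mult)
 also have "... = (\<Sum>i\<le>r. \<Sum>j<k. coeff (X $$ (a, j)) i * coeff (Y $$ (j, b)) (r - i))" by (rule sum.swap)
 also have "... = (\<Sum>i\<le>r. (mat_coeff i X * mat_coeff (r - i) Y) $$ (a, b))"
 proof (rule sum.cong)
  fix i
  show "(\<Sum>j<k. coeff (X $$ (a, j)) i * coeff (Y $$ (j, b)) (r - i)) = (mat_coeff i X * mat_coeff (r - i) Y) $$ (a, b)"
   unfolding mat_mult_entry[OF mat_coeff_carrier[OF X] mat_coeff_carrier[OF Y] ab] by (rule sum.cong) (use X Y ab in auto)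
 qed simp
 finally show ?thesis .
qed

text \<open>Summation is entrywise because matrices of varying size have no common zero.\<close>

definition msum :: "nat => (nat => complex mat) => nat => complex mat" where
 "msum n A k = mat (2 * n) (2 * n) (\<lambda>ij. \<Sum>i<k. A i $$ ij)"

lemma msum_0: "msum n A 0 = 0\<^sub>m (2 * n) (2 * n)"
 by (rule eq_matI) (auto simp: msum_def)

lemma msum_Suc: "A k : spc n ==> msum n A (Suc k) = msum n A k + A k"
 by (rule eq_matI) (auto simp: msum_def sp_dims)

lemma msum_sp: "(\<And>i. i < k ==> A i : spc n) ==> msum n A k : spc n"
 by (induction k) (auto simp: msum_0 msum_Suc sp_zero intro: sp_add)

lemma mat_coeff_bracket:
 assumes X: "X : cur n" and Y: "Y : cur n"
 shows "mat_coeff r (X * Y - Y * X) = msum n (\<lambda>i. br (mat_coeff i X) (mat_coeff (r - i) Y)) (Suc r)"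
proof (rule eq_matI)
 note C = cur_carrier[OF X] cur_carrier[OF Y]
 fix a b assume "a < dim_row (msum n (\<lambda>i. br (mat_coeff i X) (mat_coeff (r - i) Y)) (Suc r))"
  "b < dim_col (msum n (\<lambda>i. br (mat_coeff i X) (mat_coeff (r - i) Y)) (Suc r))"
 hence ab: "a < 2 * n" "b < 2 * n" by (auto simp: msum_def)
 have e: "(X * Y - Y * X) $$ (a, b) = (X * Y) $$ (a, b) - (Y * X) $$ (a, b)" by (rule index_minus_mat(1)) (use C ab in auto)
 have "coeff ((Y * X) $$ (a, b)) r = (\<Sum>i\<le>r. (mat_coeff (r - i) Y * mat_coeff i X) $$ (a, b))"
  unfolding mat_coeff_mult_entry[OF C(2,1) ab]
  by (rule sum.reindex_bij_witness[of _ "\<lambda>i. r - i" "\<lambda>i. r - i"]) auto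
 hence "mat_coeff r (X * Y - Y * X) $$ (a, b) =
   (\<Sum>i\<le>r. (mat_coeff i X * mat_coeff (r - i) Y) $$ (a, b) - (mat_coeff (r - i) Y * mat_coeff i X) $$ (a, b))"
  using C ab by (simp add: e mat_coeff_mult_entry[OF C ab] sum_subtractf del: index_mult_mat(1))
 also have "... = (\<Sum>i\<le>r. br (mat_coeff i X) (mat_coeff (r - i) Y) $$ (a, b))"
 proof (rule sum.cong)
  fix i
  have "br (mat_coeff i X) (mat_coeff (r - i) Y) $$ (a, b) =
    (mat_coeff i X * mat_coeff (r - i) Y) $$ (a, b) - (mat_coeff (r - i) Y * mat_coeff i X) $$ (a, b)"
   by (rule index_minus_mat(1)) (use C ab in auto)
  thus "(mat_coeff i X * mat_coeff (r - i) Y) $$ (a, b) - (mat_coeff (r - i) Y * mat_coeff i X) $$ (a, b) =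
    br (mat_coeff i X) (mat_coeff (r - i) Y) $$ (a, b)" by simp
 qed simp
 finally show "mat_coeff r (X * Y - Y * X) $$ (a, b) =
   msum n (\<lambda>i. br (mat_coeff i X) (mat_coeff (r - i) Y)) (Suc r) $$ (a, b)"
  using ab by (simp add: msum_def lessThan_Suc_atMost)
qed (use cur_dims[OF X] cur_dims[OF Y] in \<open>auto simp: msum_def\<close>)

interpretation cur: closed_lie "CA n" for n
proof
 fix X Y :: "complex poly mat" and c
 assume X: "X : carrier (CA n)"
 hence X': "X : cur n" by simp
 show "c \<odot>\<^bsub>CA n\<^esub> X : carrier (CA n)" using X' by (auto simp: cur_iff mat_coeff_smult intro: sp_smult)
 assume Y: "Y : carrier (CA n)"
 hence Y': "Y : cur n" by simp
 show "X \<oplus>\<^bsub>CA n\<^esub> Y : carrier (CA n)"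
  using X' Y' cur_carrier[OF X'] cur_carrier[OF Y'] by (auto simp: cur_iff mat_coeff_add intro: sp_add)
 have "mat_coeff r (X * Y - Y * X) : spc n" for r
  unfolding mat_coeff_bracket[OF X' Y'] by (intro msum_sp sp_bracket cur_coeff X' Y')
 thus "bracket (CA n) X Y : carrier (CA n)" using cur_carrier[OF X'] cur_carrier[OF Y'] by (auto simp: cur_iff)
qed

lemmas cur_add = cur.L_add[simplified] and cur_smult = cur.L_smult[simplified] and cur_bracket = cur.L_bracket[simplified]

lemma tensor_t_index: "i < dim_row x ==> j < dim_col x ==> tt x r $$ (i, j) = monom (x $$ (i, j)) r"
 by (simp add: tensor_poly_def smult_monom)

lemma tensor_t_dims [simp]: "dim_row (tt x r) = dim_row x" "dim_col (tt x r) = dim_col x"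
 by (simp_all add: tensor_poly_def)

lemma mat_coeff_tensor_t: "x : mats n ==>
  mat_coeff r' (tt x r) = (if r' = r then x else 0\<^sub>m (2 * n) (2 * n))" by (rule eq_matI) (auto simp: tensor_t_index)

lemma tensor_t_cur: "x : spc n ==> tt x r : cur n"
 using sp_carrierD[of x n] by (auto simp: cur_iff mat_coeff_tensor_t sp_zero)

lemma tensor_t_add: "x : spc n ==> y : spc n ==> tt (x + y) r = tt x r + tt y r"
 by (rule eq_matI) (auto simp: tensor_t_index sp_dims add_monom)

lemma tensor_t_smult: "tt (c \<cdot>\<^sub>m x) r = [:c:] \<cdot>\<^sub>m tt x r"
 by (rule eq_matI) (auto simp: tensor_t_index smult_monom)

lemma tensor_t_bracket:
 assumes x: "x : spc n" and y: "y : spc n"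
 shows "tt (br x y) (r + s) = tt x r * tt y s - tt y s * tt x r"
proof (rule eq_matI)
 note d = sp_dims[OF x] sp_dims[OF y]
 have C: "tt x r : mats n" "tt y s : mats n" using d by auto
 note c = sp_carrierD[OF x] sp_carrierD[OF y]
 fix a b assume "a < dim_row (tt x r * tt y s - tt y s * tt x r)"
  "b < dim_col (tt x r * tt y s - tt y s * tt x r)"
 hence ab: "a < 2 * n" "b < 2 * n" using d by auto
 have p: "(tt u i * tt w j) $$ (a, b) = monom ((u * w) $$ (a, b)) (i + j)"
  if u: "u : spc n" and w: "w : spc n" for u w i j
 proof -
  have "(tt u i * tt w j) $$ (a, b) = (\<Sum>k<2*n. tt u i $$ (a, k) * tt w j $$ (k, b))"
   by (rule poly_mat_mult_entry) (use ab sp_dims[OF u] sp_dims[OF w] in auto)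
  also have "... = (\<Sum>k<2*n. monom (u $$ (a, k) * w $$ (k, b)) (i + j))"
   by (rule sum.cong) (use ab sp_dims[OF u] sp_dims[OF w] in \<open>auto simp: tensor_t_index mult_monom\<close>)
  also have "... = monom (\<Sum>k<2*n. u $$ (a, k) * w $$ (k, b)) (i + j)" by (simp add: monom_sum)
  also have "(\<Sum>k<2*n. u $$ (a, k) * w $$ (k, b)) = (u * w) $$ (a, b)"
   by (rule mat_mult_entry[symmetric]) (use ab sp_carrierD[OF u] sp_carrierD[OF w] in auto)
  finally show ?thesis .
 qed
 have "br x y $$ (a, b) = (x * y) $$ (a, b) - (y * x) $$ (a, b)" by (rule index_minus_mat(1)) (use ab d in auto)
 hence "tt (br x y) (r + s) $$ (a, b) = monom ((x * y) $$ (a, b) - (y * x) $$ (a, b)) (r + s)"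
  using ab d by (subst tensor_t_index) auto
 also have "... = (tt x r * tt y s) $$ (a, b) - (tt y s * tt x r) $$ (a, b)"
  using p[OF x y, of r s] p[OF y x, of s r] by (simp add: diff_monom add.commute)
 also have "... = (tt x r * tt y s - tt y s * tt x r) $$ (a, b)" by (rule index_minus_mat(1)[symmetric]) (use ab d in auto)
 finally show "tt (br x y) (r + s) $$ (a, b) = (tt x r * tt y s - tt y s * tt x r) $$ (a, b)" .
qed (use sp_dims[OF x] sp_dims[OF y] in auto)

text \<open>Partial sums of the expansion in powers of \<open>t\<close>; induction on
  \<open>D\<close> reduces statements on currents to elements \<open>tensor_t x r\<close>.\<close>

definition ptrunc :: "nat => complex poly mat => complex poly mat" where
 "ptrunc D X = map_mat (\<lambda>f. \<Sum>r<D. monom (coeff f r) r) X"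

lemma ptrunc_0: "X : cur n ==> ptrunc 0 X = 0\<^sub>m (2 * n) (2 * n)"
 by (rule eq_matI) (auto simp: ptrunc_def cur_dims)

lemma ptrunc_Suc: "X : cur n ==> ptrunc (Suc D) X = ptrunc D X + tt (mat_coeff D X) D"
 by (rule eq_matI) (auto simp: ptrunc_def cur_dims tensor_t_index)

lemma cur_zero: "0\<^sub>m (2 * n) (2 * n) : cur n"
proof -
 have "mat_coeff r (0\<^sub>m (2 * n) (2 * n)) = 0\<^sub>m (2 * n) (2 * n)" for r by (rule eq_matI) auto
 thus ?thesis by (auto simp: cur_iff sp_zero)
qed

lemma ptrunc_cur: "X : cur n ==> ptrunc D X : cur n"
 by (induction D) (auto simp: ptrunc_0 ptrunc_Suc cur_zero intro!: cur_add tensor_t_cur cur_coeff)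

definition cdeg :: "complex poly mat => nat" where
 "cdeg X = Max (insert 0 ((\<lambda>(i, j). degree (X $$ (i, j))) ` ({..<dim_row X} \<times> {..<dim_col X})))"

lemma cdeg: "i < dim_row X ==> j < dim_col X ==> degree (X $$ (i, j)) <= cdeg X"
 unfolding cdeg_def by (rule Max_ge) auto

lemma mat_coeff_above: "X : cur n ==> r > cdeg X ==> mat_coeff r X = 0\<^sub>m (2 * n) (2 * n)"
 by (rule eq_matI) (auto simp: cur_dims intro!: coeff_eq_0 order_le_less_trans[OF cdeg])

lemma ptrunc_all: "D > cdeg X ==> ptrunc D X = X"
proof (rule eq_matI)
 fix i j assume ij: "i < dim_row X" "j < dim_col X" and D: "D > cdeg X"
 have "(\<Sum>r<D. monom (coeff (X $$ (i, j)) r) r) = X $$ (i, j)"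
 proof (rule poly_eqI)
  fix k
  have "coeff (\<Sum>r<D. monom (coeff (X $$ (i, j)) r) r) k = (\<Sum>r<D. if r = k then coeff (X $$ (i, j)) k else 0)"
   by (simp add: coeff_sum)
  also have "... = coeff (X $$ (i, j)) k" using order_le_less_trans[OF cdeg[OF ij] D] by (auto intro!: coeff_eq_0)
  finally show "coeff (\<Sum>r<D. monom (coeff (X $$ (i, j)) r) r) k = coeff (X $$ (i, j)) k" .
 qed
 thus "ptrunc D X $$ (i, j) = X $$ (i, j)" using ij by (simp add: ptrunc_def)
qed (auto simp: ptrunc_def)

abbreviation ev :: "complex => complex poly mat => complex mat" where
 "ev z \<equiv> map_mat (\<lambda>f. poly f z)"

lemma ev_tensor_t: "ev z (tt x r) = z ^ r \<cdot>\<^sub>m x"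
 by (rule eq_matI) (auto simp: tensor_t_index poly_monom)

lemma ev_add: "X : cur n ==> Y : cur n ==> ev z (X + Y) = ev z X + ev z Y"
 by (rule eq_matI) (auto simp: cur_dims)

lemma ev_smult: "ev z ([:c:] \<cdot>\<^sub>m X) = c \<cdot>\<^sub>m ev z X"
 by (rule eq_matI) auto

lemma ev_sp:
 assumes X: "X : cur n"
 shows "ev z X : spc n"
proof -
 have "ev z (ptrunc D X) : spc n" for D
 proof (induction D)
  case 0
  have "ev z (ptrunc 0 X) = 0\<^sub>m (2 * n) (2 * n)" unfolding ptrunc_0[OF X] by (rule eq_matI) auto
  thus ?case using sp_zero by simp
 next
  case (Suc D)
  thus ?case using ev_add[OF ptrunc_cur[OF X] tensor_t_cur[OF cur_coeff[OF X]]] sp_smult[OF cur_coeff[OF X]]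
   by (simp add: ptrunc_Suc[OF X] ev_tensor_t sp_add)
 qed
 from this[of "Suc (cdeg X)"] show ?thesis by (simp add: ptrunc_all)
qed

lemma ev_bracket:
 assumes X: "X : cur n" and Y: "Y : cur n"
 shows "ev z (X * Y - Y * X) = br (ev z X) (ev z Y)"
proof (rule eq_matI)
 note d = cur_dims[OF X] cur_dims[OF Y]
 fix a b assume "a < dim_row (br (ev z X) (ev z Y))" "b < dim_col (br (ev z X) (ev z Y))"
 hence ab: "a < 2 * n" "b < 2 * n" using d by auto
 have p: "poly ((U * W) $$ (a, b)) z = (ev z U * ev z W) $$ (a, b)" if "U : cur n" "W : cur n" for U W
 proof -
  have "(ev z U * ev z W) $$ (a, b) = (\<Sum>k<2*n. ev z U $$ (a, k) * ev z W $$ (k, b))"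
   by (rule mat_mult_entry) (use ab cur_carrier[OF that(1)] cur_carrier[OF that(2)] in auto)
  also have "... = (\<Sum>k<2*n. poly (U $$ (a, k)) z * poly (W $$ (k, b)) z)"
   by (rule sum.cong) (use ab cur_dims[OF that(1)] cur_dims[OF that(2)] in auto)
  finally show ?thesis
   unfolding poly_mat_mult_entry[OF cur_carrier[OF that(1)] cur_carrier[OF that(2)] ab] by (simp add: poly_sum)
 qed
 have "(X * Y - Y * X) $$ (a, b) = (X * Y) $$ (a, b) - (Y * X) $$ (a, b)" by (rule index_minus_mat(1)) (use ab d in auto)
 moreover have "br (ev z X) (ev z Y) $$ (a, b) = (ev z X * ev z Y) $$ (a, b) - (ev z Y * ev z X) $$ (a, b)"
  by (rule index_minus_mat(1)) (use ab d in auto)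
 ultimately show "ev z (X * Y - Y * X) $$ (a, b) = br (ev z X) (ev z Y) $$ (a, b)" using ab d p[OF X Y] p[OF Y X] by simp
qed (use cur_dims[OF X] cur_dims[OF Y] in auto)

lemma evaluation_lie_module:
 assumes V: "lie_module (sp n) V"
 shows "lie_module (CA n) (evaluation_module z V)"
proof -
 interpret V: lie_module "sp n" V by fact
 let ?E = "evaluation_module z V"
 have r: "carrier ?E = carrier V" "\<And>x y. x \<oplus>\<^bsub>?E\<^esub> y = x \<oplus>\<^bsub>V\<^esub> y" "\<And>c x. c \<odot>\<^bsub>?E\<^esub> x = c \<odot>\<^bsub>V\<^esub> x"
  "\<And>X x. act ?E X x = act V (ev z X) x" "\<zero>\<^bsub>?E\<^esub> = \<zero>\<^bsub>V\<^esub>"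
  by (simp_all add: evaluation_module_def)
 have mi: "x \<ominus>\<^bsub>?E\<^esub> y = x \<ominus>\<^bsub>V\<^esub> y" for x y
  by (simp add: a_minus_def a_inv_def m_inv_def evaluation_module_def)
 have "vectorspace (class_ring :: complex ring) ?E"
 proof (rule vectorspaceI)
  show "\<exists>y\<in>carrier ?E. y \<oplus>\<^bsub>?E\<^esub> x = \<zero>\<^bsub>?E\<^esub>" if "x : carrier ?E" for x
   using that V.M.l_neg[of x] V.M.a_inv_closed[of x] by (auto simp: r)
 next
  fix x and a b :: complex assume "x : carrier ?E"
  hence x: "x : carrier V" by (simp add: r)
  show "(a + b) \<odot>\<^bsub>?E\<^esub> x = a \<odot>\<^bsub>?E\<^esub> x \<oplus>\<^bsub>?E\<^esub> b \<odot>\<^bsub>?E\<^esub> x" using V.smult_l_distr[of a b x] x by (simp add: r)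
  show "(a * b) \<odot>\<^bsub>?E\<^esub> x = a \<odot>\<^bsub>?E\<^esub> (b \<odot>\<^bsub>?E\<^esub> x)" using V.smult_assoc1[of a b x] x by (simp add: r)
  show "1 \<odot>\<^bsub>?E\<^esub> x = x" using V.smult_one[of x] x by (simp add: r)
  show "a \<odot>\<^bsub>?E\<^esub> x : carrier ?E" using V.smult_closed[of a x] x by (simp add: r)
  fix y assume "y : carrier ?E"
  thus "a \<odot>\<^bsub>?E\<^esub> (x \<oplus>\<^bsub>?E\<^esub> y) = a \<odot>\<^bsub>?E\<^esub> x \<oplus>\<^bsub>?E\<^esub> a \<odot>\<^bsub>?E\<^esub> y"
   using V.smult_r_distr[of a x y] x by (simp add: r)
 qed (auto simp: r V.M.a_ac V.M.l_zero)
 thus ?thesis unfolding lie_module_def lie_module_axioms_def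
  using V.act_add_left[simplified] V.act_smult_left[simplified] V.act_bracket[simplified]
  by (auto simp: r mi ev_sp ev_add ev_smult ev_bracket V.act_closed V.act_add_right V.act_smult_right)
qed



section \<open>Tensor products\<close>

definition ftc :: "'i set => ('i => ('g, 'v) rep) => (('i => 'v) \<Rightarrow>\<^sub>0 complex) set" where
 "ftc I V = {u. keys u <= (\<Pi>\<^sub>E i\<in>I. carrier (V i))}"

definition tact :: "'i set => ('i => ('g, 'v) rep) => 'g => (('i => 'v) \<Rightarrow>\<^sub>0 complex) => (('i => 'v) \<Rightarrow>\<^sub>0 complex)" where
 "tact I V x = pm.lin_ext (\<lambda>f. \<Sum>i\<in>I. single (f(i := act (V i) x (f i))) 1)"

lemma tact_single: "tact I V x (single f c) = (\<Sum>i\<in>I. single (f(i := act (V i) x (f i))) c)"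
 by (simp add: tact_def pm.sc_sum)
lemma tact_add: "tact I V x (u + w) = tact I V x u + tact I V x w"
 and tact_scale: "tact I V x (scale_pm c u) = scale_pm c (tact I V x u)"
 and tact_zero [simp]: "tact I V x 0 = 0"
 and tact_diff: "tact I V x (u - w) = tact I V x u - tact I V x w"
 and tact_sum: "tact I V x (\<Sum>i\<in>A. F i) = (\<Sum>i\<in>A. tact I V x (F i))"
 by (simp_all add: tact_def pm.lin_ext_add pm.lin_ext_scale pm.lin_ext_diff pm.lin_ext_sum)

lemma ftc_subsp: "pm.subsp (ftc I V)"
 by (rule pm.subspI)
  (auto simp: ftc_def dest!: subsetD[OF Poly_Mapping.keys_add] subsetD[OF keys_scale_pm])

lemma ftc_single: "f : (\<Pi>\<^sub>E i\<in>I. carrier (V i)) ==> single f c : ftc I V"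
 by (simp add: ftc_def)

lemma ftc_induct [consumes 1, case_names zero add]:
 assumes u: "u : ftc I V" and "P 0"
  and "\<And>f c w. f : (\<Pi>\<^sub>E i\<in>I. carrier (V i)) ==> w : ftc I V ==> P w ==> P (single f c + w)"
 shows "P u"
proof -
 have "u : ftc I V \<and> P u"
 proof (induction u rule: single_induct)
  case zero thus ?case using assms(2) pm.subsp_zero[OF ftc_subsp] by auto
 next
  case (add a c g)
  hence a: "a : (\<Pi>\<^sub>E i\<in>I. carrier (V i))" using u by (auto simp: ftc_def)
  show ?case using assms(3)[OF a, of g c] pm.subsp_add[OF ftc_subsp ftc_single[OF a, of c], of g] add(2) by blast
 qed
 thus ?thesis by simp
qed

lemma PiE_upd: "f : (\<Pi>\<^sub>E i\<in>I. C i) ==> i : I ==> a : C i ==> f(i := a) : (\<Pi>\<^sub>E i\<in>I. C i)"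
 by (auto simp: PiE_def Pi_def extensional_def)

locale tensor = closed_lie L for L :: "'g lie_algebra" +
 fixes I :: "'i set" and V :: "'i => ('g, 'v) rep"
 assumes finI: "finite I" and lie: "i : I ==> lie_module L (V i)"
begin

abbreviation "PV \<equiv> (\<Pi>\<^sub>E i\<in>I. carrier (V i))"
abbreviation "ta \<equiv> tact I V"

lemma act_V: "i : I ==> x : carrier L ==> a : carrier (V i) ==> act (V i) x a : carrier (V i)"
 by (rule lie_module.act_closed[OF lie])

lemma act_PV: "f : PV ==> i : I ==> x : carrier L ==> f(i := act (V i) x (f i)) : PV"
 by (rule PiE_upd) (auto intro: act_V dest: PiE_mem)

lemma ta_closed: "x : carrier L ==> u : ftc I V ==> ta x u : ftc I V"
 unfolding tact_def by (rule pm.lin_ext_in[OF ftc_subsp], rule pm.subsp_sum[OF ftc_subsp], rule ftc_single, rule act_PV)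
  (auto simp: ftc_def)

sublocale ft: lin_space scale_pm L "ftc I V" "tact I V" by unfold_locales (auto simp: ftc_subsp ta_closed tact_add tact_scale)

definition "Nul = pm.lspan (multilinear_relations I V)"

lemma Nul: "pm.subsp Nul"
 unfolding Nul_def by (rule pm.subsp_lspan)

lemma mul_add:
 assumes "f : PV" "i : I" "a : carrier (V i)" "b : carrier (V i)"
 shows "single (f(i := a \<oplus>\<^bsub>V i\<^esub> b)) c - (single (f(i := a)) c + single (f(i := b)) c) : Nul"
proof -
 have "single (f(i := a \<oplus>\<^bsub>V i\<^esub> b)) 1 - single (f(i := a)) 1 - single (f(i := b)) 1 : multilinear_relations I V"
  unfolding multilinear_relations_def
  by (rule UnI1, rule CollectI, rule exI[of _ f], rule exI[of _ i], rule exI[of _ a], rule exI[of _ b])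
   (use assms in simp)
 from pm.subsp_sc[OF Nul pm.lspan_base[OF this, folded Nul_def], of c]
 show ?thesis by (simp add: pm.sc_diff pm.sc_add diff_diff_eq)
qed

lemma mul_smult:
 assumes "f : PV" "i : I" "a : carrier (V i)"
 shows "single (f(i := d \<odot>\<^bsub>V i\<^esub> a)) c - single (f(i := a)) (d * c) : Nul"
proof -
 have "single (f(i := d \<odot>\<^bsub>V i\<^esub> a)) 1 - single (f(i := a)) d : multilinear_relations I V"
  unfolding multilinear_relations_def
  by (rule UnI2, rule CollectI, rule exI[of _ f], rule exI[of _ i], rule exI[of _ a], rule exI[of _ d])
   (use assms in simp)
 from pm.subsp_sc[OF Nul pm.lspan_base[OF this, folded Nul_def], of c]
 show ?thesis by (simp add: pm.sc_diff mult.commute)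
qed

lemma mul_zero:
 assumes "f : PV" "i : I"
 shows "single (f(i := \<zero>\<^bsub>V i\<^esub>)) c : Nul"
proof -
 interpret lie_module L "V i" by (rule lie[OF assms(2)])
 have "0 \<odot>\<^bsub>V i\<^esub> \<zero>\<^bsub>V i\<^esub> = \<zero>\<^bsub>V i\<^esub>" using smult_l_null[of "\<zero>\<^bsub>V i\<^esub>"] by simp
 thus ?thesis using mul_smult[OF assms, of "\<zero>\<^bsub>V i\<^esub>" 0 c] by simp
qed

lemma mul_diff:
 assumes "f : PV" "i : I" "a : carrier (V i)" "b : carrier (V i)"
 shows "single (f(i := a \<ominus>\<^bsub>V i\<^esub> b)) c - (single (f(i := a)) c - single (f(i := b)) c) : Nul"
proof -
 interpret lie_module L "V i" by (rule lie[OF assms(2)])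
 have ab: "a \<ominus>\<^bsub>V i\<^esub> b : carrier (V i)" using assms by simp
 have "(a \<ominus>\<^bsub>V i\<^esub> b) \<oplus>\<^bsub>V i\<^esub> b = a" using assms M.minus_closed M.a_assoc M.l_neg M.r_zero
  by (simp add: a_minus_def M.a_assoc)
 thus ?thesis using pm.subsp_minus[OF Nul mul_add[OF assms(1,2) ab assms(4), of c]] by (simp add: algebra_simps)
qed

lemma relations_ftc: "multilinear_relations I V <= ftc I V"
proof
 fix r assume "r : multilinear_relations I V"
 then consider f i a b where "f : PV" "i : I" "a : carrier (V i)" "b : carrier (V i)"
   "r = single (f(i := a \<oplus>\<^bsub>V i\<^esub> b)) 1 - single (f(i := a)) 1 - single (f(i := b)) 1"
  | f i a d where "f : PV" "i : I" "a : carrier (V i)"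
   "r = single (f(i := d \<odot>\<^bsub>V i\<^esub> a)) 1 - single (f(i := a)) d"
  unfolding multilinear_relations_def Un_iff mem_Collect_eq by blast
 thus "r : ftc I V"
 proof cases
  case 1
  interpret lie_module L "V i" by (rule lie[OF 1(2)])
  show ?thesis unfolding 1(5) by (intro pm.subsp_diff[OF ftc_subsp] ftc_single PiE_upd 1 M.a_closed)
 next
  case 2
  interpret lie_module L "V i" by (rule lie[OF 2(2)])
  have "d \<odot>\<^bsub>V i\<^esub> a : carrier (V i)" using smult_closed[of d a] 2 by simp
  thus ?thesis unfolding 2(4) by (intro pm.subsp_diff[OF ftc_subsp] ftc_single PiE_upd 2)
 qed
qed

lemma Nul_ftc: "Nul <= ftc I V"
 unfolding Nul_def by (rule pm.lspan_least[OF ftc_subsp relations_ftc])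

text \<open>Where the action meets the factor of the relation, linearity of the action gives a
  relation; elsewhere only the other entries of the tuple change.\<close>

lemma ta_relation:
 assumes x: "x : carrier L" and r: "r : multilinear_relations I V"
 shows "ta x r : Nul"
proof -
 from r consider f i a b where "f : PV" "i : I" "a : carrier (V i)" "b : carrier (V i)"
   "r = single (f(i := a \<oplus>\<^bsub>V i\<^esub> b)) 1 - (single (f(i := a)) 1 + single (f(i := b)) 1)"
  | f i a d where "f : PV" "i : I" "a : carrier (V i)"
   "r = single (f(i := d \<odot>\<^bsub>V i\<^esub> a)) 1 - single (f(i := a)) d"
  unfolding multilinear_relations_def Un_iff mem_Collect_eq diff_diff_eq by blast
 thus ?thesis
 proof cases
  case 1
  interpret lie_module L "V i" by (rule lie[OF 1(2)])
  let ?g = "\<lambda>c j. (f(i := c))(j := act (V j) x ((f(i := c)) j))"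
  have "single (?g (a \<oplus>\<^bsub>V i\<^esub> b) j) 1 - (single (?g a j) 1 + single (?g b j) 1) : Nul" if j: "j : I" for j
  proof (cases "j = i")
   case True
   thus ?thesis using mul_add[OF 1(1,2) act_closed[OF x 1(3)] act_closed[OF x 1(4)], of 1] act_add_right[OF x 1(3,4)] by simp
  next
   case False
   hence e: "?g c j = (f(j := act (V j) x (f j)))(i := c)" for c by (simp add: fun_upd_twist)
   show ?thesis unfolding e by (rule mul_add[OF act_PV[OF 1(1) j x] 1(2-4)])
  qed
  hence "(\<Sum>j\<in>I. single (?g (a \<oplus>\<^bsub>V i\<^esub> b) j) 1 - (single (?g a j) 1 + single (?g b j) 1)) : Nul"
   by (rule pm.subsp_sum[OF Nul])
  thus ?thesis unfolding 1(5) tact_diff tact_add tact_single by (simp only: sum_subtractf sum.distrib)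
 next
  case 2
  interpret lie_module L "V i" by (rule lie[OF 2(2)])
  let ?g = "\<lambda>c j. (f(i := c))(j := act (V j) x ((f(i := c)) j))"
  have "single (?g (d \<odot>\<^bsub>V i\<^esub> a) j) 1 - single (?g a j) d : Nul" if j: "j : I" for j
  proof (cases "j = i")
   case True
   thus ?thesis using mul_smult[OF 2(1,2) act_closed[OF x 2(3)], of d 1] act_smult_right[OF x 2(3)] by simp
  next
   case False
   hence e: "?g c j = (f(j := act (V j) x (f j)))(i := c)" for c by (simp add: fun_upd_twist)
   show ?thesis unfolding e using mul_smult[OF act_PV[OF 2(1) j x] 2(2,3), of d 1] by simp
  qed
  hence "(\<Sum>j\<in>I. single (?g (d \<odot>\<^bsub>V i\<^esub> a) j) 1 - single (?g a j) d) : Nul"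
   by (rule pm.subsp_sum[OF Nul])
  thus ?thesis unfolding 2(4) tact_diff tact_single by (simp only: sum_subtractf)
 qed
qed

lemma Nul_stable: "ft.stable Nul"
 unfolding ft.stable_def
proof (intro conjI ballI Nul Nul_ftc)
 fix x u assume x: "x : carrier L" and "u : Nul"
 from this(2) show "ta x u : Nul" unfolding Nul_def
 proof (induction u rule: pm.lspan.induct)
  case (lspan_step r y c)
  thus ?case using ta_relation[OF x, of r] Nul by (auto simp: tact_add tact_scale Nul_def intro!: pm.lspan_add pm.lspan_sc)
 qed (simp add: pm.lspan_zero)
qed

lemma ft_presents: "ft.presents (\<lambda>u. u) (free_tuple_module I V) {0}"
 unfolding ft.presents_def by (auto simp: free_tuple_module_def ftc_def tact_def pm.lin_ext_def pm.sc_sum)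

lemma multilinear_subspace_eq: "multilinear_subspace I V = Nul"
proof -
 let ?FT = "free_tuple_module I V"
 interpret FT: Module.module "class_ring :: complex ring" ?FT by (rule ft.pres_module[OF ft_presents])
 have rel: "multilinear_relations I V <= carrier ?FT" using relations_ftc ft.pres_carrier[OF ft_presents] by auto
 have sub: "LinearCombinations.submodule (class_ring :: complex ring) (multilinear_subspace I V) ?FT"
  unfolding multilinear_subspace_def by (rule FT.span_is_submodule[OF rel])
 have op: "x \<oplus>\<^bsub>?FT\<^esub> y = x + y" "c \<odot>\<^bsub>?FT\<^esub> x = scale_pm c x" "\<zero>\<^bsub>?FT\<^esub> = 0" for x y c
  by (simp_all add: free_tuple_module_def)
 have "pm.subsp (multilinear_subspace I V)"
  using submodule.m_closed[OF sub] submodule.zero_closed[OF sub] submodule.smult_closed[OF sub]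
  by (intro pm.subspI) (auto simp: op class_ring_simps)
 moreover have "multilinear_relations I V <= multilinear_subspace I V"
  unfolding multilinear_subspace_def by (rule FT.in_own_span[OF rel])
 ultimately have "Nul <= multilinear_subspace I V" unfolding Nul_def by (rule pm.lspan_least)
 moreover have "multilinear_subspace I V <= Nul" unfolding multilinear_subspace_def
 proof (rule FT.span_is_subset)
  show "multilinear_relations I V <= Nul" unfolding Nul_def using pm.lspan_base by blast
  show "LinearCombinations.submodule (class_ring :: complex ring) Nul ?FT"
   using ft.pres_stable_image[OF ft_presents Nul_stable] by (simp add: act_stable_def)
 qed
 ultimately show ?thesis by auto
qed

abbreviation "kaT u \<equiv> Nul +>\<^bsub>free_tuple_module I V\<^esub> u"

lemma T_presents: "ft.presents kaT (tensor_product I V) Nul"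
 unfolding tensor_product_def multilinear_subspace_eq
 by (rule ft.pres_quotient[OF ft_presents Nul_stable]) (use pm.subsp_zero[OF Nul] in auto)

lemma tens_add:
 assumes x: "x : carrier L" "y : carrier L" and u: "u : ftc I V"
 shows "ta (x \<oplus>\<^bsub>L\<^esub> y) u - (ta x u + ta y u) : Nul"
 using u
proof (induction u rule: ftc_induct)
 case zero thus ?case by (simp add: pm.subsp_zero[OF Nul])
next
 case (add f c w)
 have "(\<Sum>i\<in>I. single (f(i := act (V i) (x \<oplus>\<^bsub>L\<^esub> y) (f i))) c -
   (single (f(i := act (V i) x (f i))) c + single (f(i := act (V i) y (f i))) c)) : Nul"
 proof (rule pm.subsp_sum[OF Nul])
  fix i assume i: "i : I"
  interpret lie_module L "V i" by (rule lie[OF i])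
  have fi: "f i : carrier (V i)" using add(1) i by (auto dest: PiE_mem)
  show "single (f(i := act (V i) (x \<oplus>\<^bsub>L\<^esub> y) (f i))) c -
   (single (f(i := act (V i) x (f i))) c + single (f(i := act (V i) y (f i))) c) : Nul"
   unfolding act_add_left[OF x fi] by (rule mul_add[OF add(1) i act_closed[OF x(1) fi] act_closed[OF x(2) fi]])
 qed
 from pm.subsp_add[OF Nul this add(3)] show ?case by (simp add: tact_add tact_single sum_subtractf sum.distrib algebra_simps)
qed

lemma tens_smult:
 assumes x: "x : carrier L" and u: "u : ftc I V"
 shows "ta (d \<odot>\<^bsub>L\<^esub> x) u - scale_pm d (ta x u) : Nul"
 using u
proof (induction u rule: ftc_induct)
 case zero thus ?case by (simp add: pm.subsp_zero[OF Nul])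
next
 case (add f c w)
 have "(\<Sum>i\<in>I. single (f(i := act (V i) (d \<odot>\<^bsub>L\<^esub> x) (f i))) c - single (f(i := act (V i) x (f i))) (d * c)) : Nul"
 proof (rule pm.subsp_sum[OF Nul])
  fix i assume i: "i : I"
  interpret lie_module L "V i" by (rule lie[OF i])
  have fi: "f i : carrier (V i)" using add(1) i by (auto dest: PiE_mem)
  show "single (f(i := act (V i) (d \<odot>\<^bsub>L\<^esub> x) (f i))) c - single (f(i := act (V i) x (f i))) (d * c) : Nul"
   unfolding act_smult_left[OF x fi] by (rule mul_smult[OF add(1) i act_closed[OF x fi]])
 qed
 from pm.subsp_add[OF Nul this add(3)] show ?case
  by (simp add: tact_add tact_single sum_subtractf pm.sc_add pm.sc_sum algebra_simps)
qed

text \<open>Terms in which \<open>x\<close> and \<open>y\<close> act on different factors are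
  symmetric in the two and cancel; those on one factor give the bracket there.\<close>

lemma tens_bracket:
 assumes x: "x : carrier L" "y : carrier L" and u: "u : ftc I V"
 shows "ta (bracket L x y) u - (ta x (ta y u) - ta y (ta x u)) : Nul"
 using u
proof (induction u rule: ftc_induct)
 case zero thus ?case by (simp add: pm.subsp_zero[OF Nul])
next
 case (add f c w)
 define C where "C x y = (\<Sum>i\<in>I. \<Sum>j\<in>I. if j = i then 0 else single (f(i := act (V i) y (f i), j := act (V j) x (f j))) c)" for x y
 have tt: "ta x (ta y (single f c)) = (\<Sum>i\<in>I. single (f(i := act (V i) x (act (V i) y (f i)))) c) + C x y" for x y
 proof -
  have "ta x (ta y (single f c)) = (\<Sum>i\<in>I. \<Sum>j\<in>I. single (f(i := act (V i) y (f i), j := act (V j) x ((f(i := act (V i) y (f i))) j))) c)"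
   by (simp add: tact_single tact_sum)
  also have "... = (\<Sum>i\<in>I. \<Sum>j\<in>I. (if j = i then single (f(i := act (V i) x (act (V i) y (f i)))) c else 0) +
    (if j = i then 0 else single (f(i := act (V i) y (f i), j := act (V j) x (f j))) c))" by (intro sum.cong refl) auto
  also have "... = (\<Sum>i\<in>I. single (f(i := act (V i) x (act (V i) y (f i)))) c) + C x y"
   using finI by (simp add: sum.distrib C_def)
  finally show ?thesis .
 qed
 have "C x y = (\<Sum>j\<in>I. \<Sum>i\<in>I. if j = i then 0 else single (f(i := act (V i) y (f i), j := act (V j) x (f j))) c)"
  unfolding C_def by (rule sum.swap)
 also have "... = C y x" unfolding C_def
 proof (intro sum.cong refl)
  fix i j
  show "(if i = j then 0 else single (f(j := act (V j) y (f j), i := act (V i) x (f i))) c) =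
    (if j = i then 0 else single (f(i := act (V i) x (f i), j := act (V j) y (f j))) c)"
   by (cases "i = j") (auto simp: fun_upd_twist)
 qed
 finally have CC: "C x y = C y x" .
 have "(\<Sum>i\<in>I. single (f(i := act (V i) (bracket L x y) (f i))) c -
   (single (f(i := act (V i) x (act (V i) y (f i)))) c - single (f(i := act (V i) y (act (V i) x (f i)))) c)) : Nul"
 proof (rule pm.subsp_sum[OF Nul])
  fix i assume i: "i : I"
  interpret lie_module L "V i" by (rule lie[OF i])
  have fi: "f i : carrier (V i)" using add(1) i by (auto dest: PiE_mem)
  show "single (f(i := act (V i) (bracket L x y) (f i))) c -
   (single (f(i := act (V i) x (act (V i) y (f i)))) c - single (f(i := act (V i) y (act (V i) x (f i)))) c) : Nul"
   unfolding act_bracket[OF x fi]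
   by (rule mul_diff[OF add(1) i act_closed[OF x(1) act_closed[OF x(2) fi]] act_closed[OF x(2) act_closed[OF x(1) fi]]])
 qed
 hence "ta (bracket L x y) (single f c) - (ta x (ta y (single f c)) - ta y (ta x (single f c))) : Nul"
  unfolding tt CC tact_single[of I V "bracket L x y"] by (simp add: sum_subtractf sum.distrib algebra_simps)
 from pm.subsp_add[OF Nul this add(3)] show ?case by (simp add: tact_add algebra_simps)
qed

text \<open>A product of linear functionals, one for each factor, is multilinear.\<close>

lemma functional_Nul:
 assumes \<phi>: "\<And>i a b. i : I ==> a : carrier (V i) ==> b : carrier (V i) ==> \<phi> i (a \<oplus>\<^bsub>V i\<^esub> b) = \<phi> i a + \<phi> i b"
  "\<And>i a d. i : I ==> a : carrier (V i) ==> \<phi> i (d \<odot>\<^bsub>V i\<^esub> a) = d * \<phi> i a"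
  and u: "u : Nul"
 shows "cplx.lin_ext (\<lambda>f. \<Prod>i\<in>I. \<phi> i (f i)) u = (0::complex)"
 using u unfolding Nul_def
proof (induction u rule: pm.lspan.induct)
 case (lspan_step r y c)
 have P: "(\<Prod>j\<in>I. \<phi> j ((f(i := a)) j)) = \<phi> i a * (\<Prod>j\<in>I - {i}. \<phi> j (f j))" if "i : I" for f i a
  using that finI by (subst prod.remove[of I i]) (auto intro!: prod.cong)
 from lspan_step(1) consider f i a b where "f : PV" "i : I" "a : carrier (V i)" "b : carrier (V i)"
   "r = single (f(i := a \<oplus>\<^bsub>V i\<^esub> b)) 1 - single (f(i := a)) 1 - single (f(i := b)) 1"
  | f i a d where "f : PV" "i : I" "a : carrier (V i)"
   "r = single (f(i := d \<odot>\<^bsub>V i\<^esub> a)) 1 - single (f(i := a)) d"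
  unfolding multilinear_relations_def Un_iff mem_Collect_eq by blast
 hence "cplx.lin_ext (\<lambda>f. \<Prod>i\<in>I. \<phi> i (f i)) r = 0"
 proof cases
  case 1
  show ?thesis unfolding 1(5) cplx.lin_ext_diff cplx.lin_ext_single P[OF 1(2)] \<phi>(1)[OF 1(2-4)] by (simp add: algebra_simps)
 next
  case 2
  show ?thesis unfolding 2(4) cplx.lin_ext_diff cplx.lin_ext_single P[OF 2(2)] \<phi>(2)[OF 2(2,3)] by (simp add: algebra_simps)
 qed
 thus ?case using lspan_step(3) by (simp add: cplx.lin_ext_add cplx.lin_ext_scale)
qed simp

end



section \<open>Relations satisfied by the tensor product of evaluation modules\<close>

lemma ym_col_self:
 assumes "0 < a" "a < 2 * n" "i < 2 * n"
 shows "ym n a $$ (i, a) = 0"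
proof -
 have "cj n a ~= a" "cj n 0 = n" "0 < n" using assms by (auto simp: cj_def)
 moreover have "a = n ==> cj n a = 0" by (simp add: cj_def)
 ultimately show ?thesis using assms by (auto simp: ym_def gm_index index_smult_mat carrier_matD[OF gm_carrier])
qed

context hw_rep begin

lemma coord_eqI:
 assumes x: "x : carrier V" and y: "y : carrier V" and eq: "\<And>c. coord c x = coord c y"
 shows "x = y"
proof -
 have y': "(- 1) \<odot>\<^bsub>V\<^esub> y : carrier V" using V.smult_closed[of "- 1" y] y by simp
 have "x \<oplus>\<^bsub>V\<^esub> (- 1) \<odot>\<^bsub>V\<^esub> y = \<zero>\<^bsub>V\<^esub>" "y \<oplus>\<^bsub>V\<^esub> (- 1) \<odot>\<^bsub>V\<^esub> y = \<zero>\<^bsub>V\<^esub>"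
  using x y y' eq by (auto intro!: coord_inj simp: coord_add coord_smult)
 thus ?thesis using V.M.add.right_cancel[OF y' x y] by simp
qed

lemma act_sp: "X : spc n ==> x : carrier V ==> act V X x : carrier V"
 using V.act_closed by simp

lemma par_act_v:
 assumes X: "par n X"
 shows "act V X v = (of_nat m * X $$ (0, 0)) \<odot>\<^bsub>V\<^esub> v"
proof (rule coord_eqI)
 have Xs: "X : spc n" "\<And>a. 0 < a ==> a < 2 * n ==> X $$ (a, 0) = 0" using X by (auto simp: par_def)
 show "act V X v : carrier V" by (rule act_sp[OF Xs(1) v(1)])
 show "(of_nat m * X $$ (0, 0)) \<odot>\<^bsub>V\<^esub> v : carrier V" using v V.smult_closed by simp
 have cv: "(\<lambda>c. coord c v) = vac m" by (rule ext) (rule coord_v)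
 fix c
 show "coord c (act V X v) = coord c ((of_nat m * X $$ (0, 0)) \<odot>\<^bsub>V\<^esub> v)"
  unfolding coord_act[OF Xs(1) v(1)] coord_smult[OF v(1)] cv
  using fun_cong[OF sact_vac[of n X m], of c] Xs(2) n by (simp add: sc_fun_def coord_v)
qed

lemma ypow_closed: "a < 2 * n ==> (act V (ym n a) ^^ r) v : carrier V"
 by (induction r) (auto intro: act_sp ym_sp v)

text \<open>On sequences with entries 0 and \<open>a\<close> the letter can only turn a 0 into
  \<open>a\<close>, since its column \<open>a\<close> vanishes; so each application uses up a
  slot.\<close>

lemma coord_ypow:
 assumes a: "0 < a" "a < 2 * n"
 shows "coord c ((act V (ym n a) ^^ r) v) ~= 0 ==> (\<forall>p<m. c p = 0 \<or> c p = a) \<and> card {p. p < m \<and> c p = a} = r"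
proof (induction r arbitrary: c)
 case 0
 hence "\<forall>p<m. c p = 0" by (auto simp: coord_v vac_def split: if_splits)
 moreover have "{p. p < m \<and> c p = a} = {}" using calculation a by auto
 ultimately show ?case by simp
next
 case (Suc r)
 let ?x = "(act V (ym n a) ^^ r) v"
 have nz: "sact n m (ym n a) (\<lambda>c. coord c ?x) c ~= 0"
  using Suc.prems coord_act[OF ym_sp[OF a(2)] ypow_closed[OF a(2), of r]] by simp
 hence c: "\<forall>p<m. c p < 2 * n" using sact_invalid by blast
 with nz have "(\<Sum>p<m. \<Sum>b<2 * n. ym n a $$ (c p, b) * coord (c(p := b)) ?x) ~= 0" by (simp add: sact_def)
 then obtain p where p: "p < m" "(\<Sum>b<2 * n. ym n a $$ (c p, b) * coord (c(p := b)) ?x) ~= 0"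
  by (meson lessThan_iff sum.neutral)
 then obtain b where b: "b < 2 * n" "ym n a $$ (c p, b) * coord (c(p := b)) ?x ~= 0" by (meson lessThan_iff sum.neutral)
 have cp: "c p < 2 * n" using c p by auto
 have nz': "coord (c(p := b)) ?x ~= 0" using b(2) by simp
 have IH: "\<forall>q<m. (c(p := b)) q = 0 \<or> (c(p := b)) q = a" "card {q. q < m \<and> (c(p := b)) q = a} = r"
  using Suc.IH[OF nz'] by blast+
 have "b = 0 \<or> b = a" using IH(1) p(1) by force
 moreover have "b ~= a" using ym_col_self[OF a cp] b(2) by auto
 ultimately have b0: "b = 0" by simp
 hence ca: "c p = a" using ym_col0[OF a cp] b(2) by (auto split: if_splits)
 have "{q. q < m \<and> c q = a} = insert p {q. q < m \<and> (c(p := b)) q = a}" using ca p(1) by auto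
 moreover have "p \<notin> {q. q < m \<and> (c(p := b)) q = a}" using b0 a by auto
 ultimately have "card {q. q < m \<and> c q = a} = Suc r" using IH(2) by simp
 moreover have "c q = 0 \<or> c q = a" if "q < m" for q using IH(1) that ca by (cases "q = p") force+
 ultimately show ?case by blast
qed

lemma ypow_nilpotent:
 assumes a: "0 < a" "a < 2 * n" and r: "r > m"
 shows "(act V (ym n a) ^^ r) v = \<zero>\<^bsub>V\<^esub>"
proof (rule coord_inj[OF ypow_closed[OF a(2)]], rule ccontr)
 fix c assume "coord c ((act V (ym n a) ^^ r) v) ~= 0"
 hence "card {p. p < m \<and> c p = a} = r" using coord_ypow[OF a] by blast
 moreover have "card {p. p < m \<and> c p = a} <= card {..<m}" by (rule card_mono) auto
 ultimately show False using r by simp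
qed

end

lemma single_sum: "single a (\<Sum>i\<in>I. f i) = (\<Sum>i\<in>I. single a (f i))"
 by (induction I rule: infinite_finite_induct) (auto simp: single_add)

section \<open>The tensor product of the evaluation modules\<close>

locale fusion_setup =
 fixes n k :: nat and m :: "nat => nat" and z :: "nat => complex"
  and xp xm :: "root_label => complex mat" and V :: "nat => (complex mat, 'v) rep" and v :: "nat => 'v"
 assumes n: "n \<ge> 1" and ch: "chevalley_generators n xp xm"
  and mono: "\<And>i j. 1 <= i ==> i <= j ==> j <= k ==> m j <= m i"
  and irr: "\<And>j. j : {1..k} ==> irreducible_module (sp n) (V j)"
  and hw: "\<And>j. j : {1..k} ==> highest_weight_vector n xp (V j) (\<lambda>h. of_nat (m j) * \<delta> 1 h) (v j)"
  and inj_z: "inj_on z {1..k}"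
begin

definition "J = {1..k}"
abbreviation "L \<equiv> CA n"
definition "E j = evaluation_module (z j) (V j)"

lemma rep: "j : J ==> hw_rep n (m j) xp xm (V j) (v j)"
 using n ch irr hw by (simp add: hw_rep_def J_def)

lemma Vj: "j : J ==> lie_module (sp n) (V j)"
 using irr by (simp add: irreducible_module_def J_def)

sublocale tensor "CA n" J E
proof (rule tensor.intro[OF cur.closed_lie_axioms tensor_axioms.intro])
 show "finite J" by (simp add: J_def)
 show "lie_module L (E j)" if "j : J" for j unfolding E_def by (rule evaluation_lie_module[OF Vj[OF that]])
qed

lemma E_simps [simp]: "carrier (E j) = carrier (V j)" "\<zero>\<^bsub>E j\<^esub> = \<zero>\<^bsub>V j\<^esub>"
 "x \<oplus>\<^bsub>E j\<^esub> y = x \<oplus>\<^bsub>V j\<^esub> y" "c \<odot>\<^bsub>E j\<^esub> x = c \<odot>\<^bsub>V j\<^esub> x" "act (E j) X = act (V j) (ev (z j) X)"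
 by (simp_all add: E_def evaluation_module_def)

lemma act_tensor_t: "j : J ==> x : spc n ==> a : carrier (V j) ==>
  act (V j) (ev (z j) (tt x s)) a = z j ^ s \<odot>\<^bsub>V j\<^esub> act (V j) x a"
 unfolding ev_tensor_t using lie_module.act_smult_left[OF Vj, of j x a "z j ^ s"] by simp

definition "vI = restrict v J"
definition "T0 = single vI 1"

lemma v_carrier: "j : J ==> v j : carrier (V j)"
 using hw_rep.v(1)[OF rep] .

lemma vI: "vI : PV"
 using v_carrier by (auto simp: vI_def)

lemma T0: "T0 : ftc J E"
 unfolding T0_def by (rule ftc_single[OF vI])

definition tw :: "(complex mat \<times> nat) list => ((nat => 'v) \<Rightarrow>\<^sub>0 complex)" where
 "tw ws = foldr ta (map (\<lambda>(x, s). tt x s) ws) T0"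

lemma tw_simps [simp]: "tw [] = T0" "tw ((x, s) # ws) = ta (tt x s) (tw ws)"
 by (simp_all add: tw_def)

lemma tw_ftc: "ok_word n ws ==> tw ws : ftc J E"
proof (induction ws)
 case (Cons x ws)
 thus ?case using ta_closed[of "tt (fst x) (snd x)" "tw ws"] tensor_t_cur[of "fst x" n "snd x"] by (cases x) auto
qed (simp add: T0)

text \<open>Factor \<open>j\<close> contributes its eigenvalue scaled by \<open>z j ^ s\<close>,
  whence the weighted power sum.\<close>

lemma tens_eigen:
 assumes Xs: "X : spc n" and X: "\<And>j. j : J ==> act (V j) X (v j) = (of_nat (m j) * e) \<odot>\<^bsub>V j\<^esub> v j"
 shows "ta (tt X s) T0 - scale_pm ((\<Sum>j\<in>J. of_nat (m j) * z j ^ s) * e) T0 : Nul"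
proof -
 let ?d = "\<lambda>j. z j ^ s * (of_nat (m j) * e)"
 have "(\<Sum>j\<in>J. single (vI(j := act (E j) (tt X s) (vI j))) 1 - single vI (?d j)) : Nul"
 proof (rule pm.subsp_sum[OF Nul])
  fix j assume j: "j : J"
  interpret hw_rep n "m j" xp xm "V j" "v j" by (rule rep[OF j])
  have "act (E j) (tt X s) (vI j) = z j ^ s \<odot>\<^bsub>V j\<^esub> ((of_nat (m j) * e) \<odot>\<^bsub>V j\<^esub> v j)"
   using j act_tensor_t[OF j Xs v(1)] X[OF j] by (simp add: vI_def)
  also have "... = ?d j \<odot>\<^bsub>E j\<^esub> v j" using V.smult_assoc1[of "z j ^ s" "of_nat (m j) * e" "v j"] v by simp
  finally have "act (E j) (tt X s) (vI j) = ?d j \<odot>\<^bsub>E j\<^esub> v j" .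
  moreover have "vI(j := v j) = vI" using j by (auto simp: vI_def)
  ultimately show "single (vI(j := act (E j) (tt X s) (vI j))) 1 - single vI (?d j) : Nul"
   using mul_smult[OF vI j, of "v j" "?d j" 1] v(1) by simp
 qed
 moreover have "(\<Sum>j\<in>J. single vI (?d j)) = scale_pm ((\<Sum>j\<in>J. of_nat (m j) * z j ^ s) * e) T0"
  by (simp add: T0_def sum_distrib_left sum_distrib_right mult_ac flip: single_sum)
 ultimately show ?thesis by (simp add: T0_def tact_single sum_subtractf del: E_simps)
qed

lemma tens_par:
 assumes "par n X"
 shows "ta (tt X s) T0 - scale_pm ((\<Sum>j\<in>J. of_nat (m j) * z j ^ s) * X $$ (0, 0)) T0 : Nul"
 by (rule tens_eigen) (use assms hw_rep.par_act_v[OF rep] in \<open>auto simp: par_def\<close>)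

text \<open>\<open>pl\<close> lists the factors hit by successive letters. The letters share one
  colour, so up to scalars only the number of hits on each factor matters.\<close>

definition "FF a pl = (\<lambda>j\<in>J. (act (V j) (ym n a) ^^ count_list pl j) (v j))"

lemma FF_PV: "a < 2 * n ==> FF a pl : PV"
 using hw_rep.ypow_closed[OF rep] by (auto simp: FF_def)

lemma FF_Cons: "j : J ==> FF a (j # pl) = (FF a pl)(j := act (V j) (ym n a) (FF a pl j))"
 by (auto simp: FF_def fun_eq_iff)

lemma tw_ym:
 assumes a: "a < 2 * n"
 shows "tw (map (\<lambda>t. (ym n a, t)) l) -
  (\<Sum>pl\<in>{pl. set pl <= J \<and> length pl = length l}. single (FF a pl) (\<Prod>i<length l. z (pl ! i) ^ (l ! i))) : Nul"
proof (induction l)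
 case Nil
 have "{pl. set pl <= J \<and> length pl = 0} = {[]}" by auto
 moreover have "FF a [] = vI" by (auto simp: FF_def vI_def)
 ultimately show ?case using pm.subsp_zero[OF Nul] by (simp add: T0_def)
next
 case (Cons s l)
 let ?Q = "{pl. set pl <= J \<and> length pl = length l}"
 let ?p = "\<lambda>pl. \<Prod>i<length l. z (pl ! i) ^ (l ! i)"
 let ?y = "ym n a"
 let ?G = "\<lambda>pl j. (FF a pl)(j := act (E j) (tt ?y s) (FF a pl j))"
 let ?tot = "\<Sum>pl\<in>?Q. single (FF a pl) (?p pl)"
 have ys: "tt ?y s : carrier L" using tensor_t_cur[OF ym_sp[OF a]] by simp
 have "ta (tt ?y s) (tw (map (\<lambda>t. (?y, t)) l) - ?tot) : Nul" using Nul_stable Cons.IH ys unfolding ft.stable_def by blast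
 hence 1: "tw (map (\<lambda>t. (?y, t)) (s # l)) - (\<Sum>pl\<in>?Q. \<Sum>j\<in>J. single (?G pl j) (?p pl)) : Nul"
  by (simp add: tact_diff tact_sum tact_single del: E_simps)
 have "(\<Sum>pl\<in>?Q. \<Sum>j\<in>J. single (?G pl j) (?p pl) - single (FF a (j # pl)) (z j ^ s * ?p pl)) : Nul"
 proof (intro pm.subsp_sum[OF Nul])
  fix pl j assume pl: "pl : ?Q" and j: "j : J"
  interpret hw_rep n "m j" xp xm "V j" "v j" by (rule rep[OF j])
  have fc: "FF a pl j : carrier (V j)" using FF_PV[OF a, of pl] j by (auto dest: PiE_mem)
  have "act (E j) (tt ?y s) (FF a pl j) = z j ^ s \<odot>\<^bsub>E j\<^esub> act (V j) ?y (FF a pl j)"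
   using act_tensor_t[OF j ym_sp[OF a] fc] by simp
  moreover have "act (V j) ?y (FF a pl j) : carrier (E j)" using act_sp[OF ym_sp[OF a] fc] by simp
  ultimately show "single (?G pl j) (?p pl) - single (FF a (j # pl)) (z j ^ s * ?p pl) : Nul"
   unfolding FF_Cons[OF j] using mul_smult[OF FF_PV[OF a] j, of "act (V j) ?y (FF a pl j)" pl "z j ^ s" "?p pl"] by (simp only:)
 qed
 from pm.subsp_add[OF Nul 1 this]
 have 2: "tw (map (\<lambda>t. (?y, t)) (s # l)) - (\<Sum>pl\<in>?Q. \<Sum>j\<in>J. single (FF a (j # pl)) (z j ^ s * ?p pl)) : Nul"
  by (simp add: sum_subtractf del: E_simps)
 have fQ: "finite ?Q" by (rule finite_lists_length_eq[OF finI])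
 have "(\<Sum>pl\<in>?Q. \<Sum>j\<in>J. single (FF a (j # pl)) (z j ^ s * ?p pl)) =
   (\<Sum>x\<in>?Q \<times> J. single (FF a (snd x # fst x)) (z (snd x) ^ s * ?p (fst x)))"
  by (simp add: sum.cartesian_product case_prod_beta)
 also have "... = (\<Sum>pl\<in>{pl. set pl <= J \<and> length pl = length (s # l)}.
   single (FF a pl) (\<Prod>i<length (s # l). z (pl ! i) ^ ((s # l) ! i)))"
 proof (rule sum.reindex_cong[of "\<lambda>pl. (tl pl, hd pl)"])
  show "inj_on (\<lambda>pl. (tl pl, hd pl)) {pl. set pl <= J \<and> length pl = length (s # l)}"
   by (rule inj_onI) (auto simp: length_Suc_conv)
  show "?Q \<times> J = (\<lambda>pl. (tl pl, hd pl)) ` {pl. set pl <= J \<and> length pl = length (s # l)}"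
  proof (rule subset_antisym; rule subsetI)
   fix x assume "x : ?Q \<times> J"
   thus "x : (\<lambda>pl. (tl pl, hd pl)) ` {pl. set pl <= J \<and> length pl = length (s # l)}"
    by (intro image_eqI[of _ _ "snd x # fst x"]) auto
  next
   fix x assume "x : (\<lambda>pl. (tl pl, hd pl)) ` {pl. set pl <= J \<and> length pl = length (s # l)}"
   then obtain pl where pl: "x = (tl pl, hd pl)" "set pl <= J" "length pl = length (s # l)" by blast
   then obtain j pl' where "pl = j # pl'" by (cases pl) auto
   thus "x : ?Q \<times> J" using pl by auto
  qed
  fix pl assume "pl : {pl. set pl <= J \<and> length pl = length (s # l)}"
  then obtain j pl' where "pl = j # pl'" by (cases pl) auto
  thus "single (FF a (snd (tl pl, hd pl) # fst (tl pl, hd pl)))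
     (z (snd (tl pl, hd pl)) ^ s * (\<Prod>i<length l. z (fst (tl pl, hd pl) ! i) ^ (l ! i))) =
    single (FF a pl) (\<Prod>i<length (s # l). z (pl ! i) ^ ((s # l) ! i))"
   by (simp add: prod.lessThan_Suc_shift del: prod.lessThan_Suc)
 qed
 finally show ?case using 2 by simp
qed

text \<open>The sum is \<open>hpol\<close> evaluated at the point with coordinates
  \<open>z (pl ! i)\<close>.\<close>

lemma expo_lists_eval:
 assumes "length pl = q"
 shows "(\<Sum>l\<in>expo_lists q s. fps_nth (qser J z m q) (s - sum_list l) * (\<Prod>i<q. z (pl ! i) ^ (l ! i))) =
  fps_nth (qser J z m q * (\<Prod>i<q. geo (z (pl ! i)))) s"
proof -
 have bij: "bij_betw (\<lambda>e. map e [0..<q]) (expo {..<q} s) (expo_lists q s)"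
  using expo_lists_bij[of "[0..<q]" s] by (simp add: atLeast0LessThan)
 have "(\<Sum>l\<in>expo_lists q s. fps_nth (qser J z m q) (s - sum_list l) * (\<Prod>i<q. z (pl ! i) ^ (l ! i))) =
   (\<Sum>e\<in>expo {..<q} s. fps_nth (qser J z m q) (s - sum_list (map e [0..<q])) * (\<Prod>i<q. z (pl ! i) ^ (map e [0..<q] ! i)))"
  by (rule sum.reindex_bij_betw[OF bij, symmetric])
 also have "... = (\<Sum>e\<in>expo {..<q} s. fps_nth (qser J z m q) (s - sum e {..<q}) * (\<Prod>i<q. z (pl ! i) ^ e i))"
  by (intro sum.cong refl) (simp add: interv_sum_list_conv_sum_set_nat atLeast0LessThan)
 also have "... = pol_eval q (\<lambda>i. z (pl ! i)) (hpol J z m {..<q} s)" by (simp add: hpol_expo pol_eval_sum pol_eval_simps)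
 finally show ?thesis by (simp add: pol_eval_hpol)
qed

text \<open>An assignment \<open>pl\<close> that exceeds some \<open>m j\<close> gives the zero
  tensor by nilpotency; for every other one the scalar vanishes by
  \<open>qser_geo_vanish\<close>.\<close>

lemma tens_hom:
 assumes a: "0 < a" "a < 2 * n" and s: "(\<Sum>j\<in>J. min q (m j)) < q + s"
 shows "(\<Sum>l\<in>expo_lists q s. scale_pm (fps_nth (qser J z m q) (s - sum_list l)) (tw (map (\<lambda>t. (ym n a, t)) l))) : Nul"
proof -
 let ?Q = "{pl. set pl <= J \<and> length pl = q}"
 let ?c = "\<lambda>l. fps_nth (qser J z m q) (s - sum_list l)"
 let ?p = "\<lambda>pl l. \<Prod>i<q. z (pl ! i) ^ (l ! i)"
 have "(\<Sum>l\<in>expo_lists q s. scale_pm (?c l) (tw (map (\<lambda>t. (ym n a, t)) l) - (\<Sum>pl\<in>?Q. single (FF a pl) (?p pl l)))) : Nul"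
 proof (intro pm.subsp_sum[OF Nul] pm.subsp_sc[OF Nul])
  fix l assume "l : expo_lists q s"
  hence "length l = q" by (simp add: expo_lists_def)
  thus "tw (map (\<lambda>t. (ym n a, t)) l) - (\<Sum>pl\<in>?Q. single (FF a pl) (?p pl l)) : Nul"
   using tw_ym[OF a(2), of l] by simp
 qed
 hence 1: "(\<Sum>l\<in>expo_lists q s. scale_pm (?c l) (tw (map (\<lambda>t. (ym n a, t)) l))) -
   (\<Sum>l\<in>expo_lists q s. \<Sum>pl\<in>?Q. single (FF a pl) (?c l * ?p pl l)) : Nul"
  by (simp add: pm.sc_diff pm.sc_sum sum_subtractf)
 have "(\<Sum>l\<in>expo_lists q s. \<Sum>pl\<in>?Q. single (FF a pl) (?c l * ?p pl l)) =
   (\<Sum>pl\<in>?Q. single (FF a pl) (\<Sum>l\<in>expo_lists q s. ?c l * ?p pl l))" by (subst sum.swap) (simp add: single_sum)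
 also have "... : Nul"
 proof (rule pm.subsp_sum[OF Nul])
  fix pl assume pl: "pl : ?Q"
  show "single (FF a pl) (\<Sum>l\<in>expo_lists q s. ?c l * ?p pl l) : Nul"
  proof (cases "\<forall>j\<in>J. count_list pl j <= m j")
   case True
   have "card {i\<in>{..<q}. pl ! i = j} = count_list pl j" for j
    using pl by (auto simp: count_list_eq_length_filter length_filter_conv_card intro!: arg_cong[of _ _ card])
   hence "fps_nth (qser J z m (card {..<q}) * (\<Prod>i<q. geo (z (pl ! i)))) s = 0"
    by (intro qser_geo_vanish) (use True pl s finI in auto)
   thus ?thesis using expo_lists_eval[of pl q s] pl pm.subsp_zero[OF Nul] by simp
  next
   case False
   then obtain j where j: "j : J" "count_list pl j > m j" by force
   hence "FF a pl j = \<zero>\<^bsub>E j\<^esub>" using hw_rep.ypow_nilpotent[OF rep[OF j(1)] a j(2)] by (simp add: FF_def)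
   hence "(FF a pl)(j := \<zero>\<^bsub>E j\<^esub>) = FF a pl" by (rule fun_upd_idem)
   thus ?thesis using mul_zero[OF FF_PV[OF a(2), of pl] j(1), of "\<Sum>l\<in>expo_lists q s. ?c l * ?p pl l"] by (simp only:)
  qed
 qed
 finally show ?thesis by (rule iffD2[OF pm.subsp_cong[OF Nul 1]])
qed

end



section \<open>Homogeneous components of words over the current algebra\<close>

definition wl :: "(complex mat \<times> nat) list => complex poly mat list" where
 "wl xs = map (\<lambda>(x, r). tt x r) xs"

lemma wl_simps [simp]: "wl [] = []" "wl ((x, r) # xs) = tt x r # wl xs"
 by (simp_all add: wl_def)

lemma wl_cur: "ok_word n xs ==> wl xs : lists (cur n)"
 by (induction xs) (auto simp: wl_def intro!: tensor_t_cur)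

lemma fw_cur: "ws : lists (cur n) ==> single ws c : FW (CA n)"
 by (rule fw_single) simp

text \<open>Each letter is expanded in powers of \<open>t\<close>, and the terms of total degree
  \<open>j\<close> are kept. Compatibility with the enveloping relations is a separate matter,
  settled in \<open>bt_enveloping\<close>.\<close>

fun bw :: "complex poly mat list => nat => (cwords)" where
 "bw [] j = (if j = 0 then single [] 1 else 0)"
| "bw (X # ws) j = (\<Sum>r\<le>j. wact (tt (mat_coeff r X) r) (bw ws (j - r)))"

text \<open>The component of degree \<open>j\<close>, up to the relations of the enveloping algebra.\<close>

definition bt :: "nat => (cwords) => (cwords)" where
 "bt j = pm.lin_ext (\<lambda>ws. bw ws j)"

lemma bt_single: "bt j (single ws c) = scale_pm c (bw ws j)"
 and bt_zero [simp]: "bt j 0 = 0"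
 and bt_add: "bt j (u + w) = bt j u + bt j w"
 and bt_diff: "bt j (u - w) = bt j u - bt j w"
 and bt_scale: "bt j (scale_pm c u) = scale_pm c (bt j u)"
 and bt_sum: "bt j (\<Sum>i\<in>I. f i) = (\<Sum>i\<in>I. bt j (f i))"
 by (simp_all add: bt_def pm.lin_ext_add pm.lin_ext_diff pm.lin_ext_scale pm.lin_ext_sum)

lemma bt_wact: "bt j (wact X u) = (\<Sum>r\<le>j. wact (tt (mat_coeff r X) r) (bt (j - r) u))"
proof (induction u rule: single_induct)
 case (add ws c g)
 thus ?case by (simp add: wact_add bt_add bt_single pm.sc_sum sum.distrib wact_scale)
qed simp

lemma bw_closed: "ws : lists (cur n) ==> bw ws j : FW (CA n)"
proof (induction ws arbitrary: j)
 case Nil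
 thus ?case using fw_cur[of "[]" n 1] pm.subsp_zero[OF FW_subsp[of "CA n"]] by simp
next
 case (Cons X ws)
 have X: "X : cur n" and ws: "ws : lists (cur n)" using Cons.prems by auto
 show ?case unfolding bw.simps
 proof (rule pm.subsp_sum[OF FW_subsp])
  fix r show "wact (tt (mat_coeff r X) r) (bw ws (j - r)) : FW (CA n)"
   using wact_closed[of "tt (mat_coeff r X) r" "CA n"] tensor_t_cur[OF cur_coeff[OF X]]
    Cons.IH[OF ws] by simp
 qed
qed

lemma bt_closed: "u : FW (CA n) ==> bt j u : FW (CA n)"
 unfolding bt_def by (rule pm.lin_ext_in[OF FW_subsp], rule bw_closed) (auto simp: FW_def)

lemma sum_triangle:
 "(\<Sum>r\<le>j. \<Sum>i\<le>r. f i (r - i)) = (\<Sum>r\<le>j. \<Sum>s\<le>j - r. f r s)" for j :: nat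
proof -
 have "(\<Sum>r\<le>j. \<Sum>i\<le>r. f i (r - i)) = (\<Sum>(i, s)\<in>{(i, s). i + s <= j}. f i s)"
  by (rule sum.triangle_reindex_eq[symmetric])
 also have "{(i, s). i + s <= j} = Sigma {..j} (\<lambda>r. {..j - r})" by auto
 finally show ?thesis by (simp add: sum.Sigma)
qed

context
 fixes n :: nat and K :: "(cwords) set"
 assumes K: "fw.stable (CA n) K" "env_rel (CA n) <= K"
begin

abbreviation (input) "FC \<equiv> FW (CA n)"

lemma K_subsp: "pm.subsp K" and K_FC: "K <= FC"
 and K_wact: "X : cur n ==> u : K ==> wact X u : K"
 using K(1) by (auto simp: fw.stable_def)

lemma K_add: "X : cur n ==> Y : cur n ==> u : FC ==> wact (X + Y) u - (wact X u + wact Y u) : K"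
 and K_smult: "X : cur n ==> u : FC ==> wact ([:d:] \<cdot>\<^sub>m X) u - scale_pm d (wact X u) : K"
 and K_bracket: "X : cur n ==> Y : cur n ==> u : FC ==>
  wact (X * Y - Y * X) u - (wact X (wact Y u) - wact Y (wact X u)) : K"
 using cur.env_add[OF K, of X Y u] cur.env_smult[OF K, of X u d] cur.env_bracket[OF K, of X Y u] by simp_all

lemma K_zero: "u : FC ==> wact (0\<^sub>m (2 * n) (2 * n)) u : K"
 using K_smult[OF cur_zero, of u 0] by simp

lemma tensor_t_zero: "tt (0\<^sub>m (2 * n) (2 * n)) r = 0\<^sub>m (2 * n) (2 * n)"
 by (rule eq_matI) (auto simp: tensor_t_index)

lemma K_tensor_zero: "u : FC ==> wact (tt (0\<^sub>m (2 * n) (2 * n)) r) u : K"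
 unfolding tensor_t_zero by (rule K_zero)

lemma K_msum:
 assumes "\<And>i. i < k ==> A i : spc n" and u: "u : FC"
 shows "wact (tt (msum n A k) r) u - (\<Sum>i<k. wact (tt (A i) r) u) : K"
 using assms(1)
proof (induction k)
 case 0 thus ?case using K_tensor_zero[OF u] by (simp add: msum_0)
next
 case (Suc k)
 have A: "A k : spc n" and M: "msum n A k : spc n" using Suc.prems by (auto intro!: msum_sp)
 have "wact (tt (msum n A (Suc k)) r) u - (wact (tt (msum n A k) r) u + wact (tt (A k) r) u) : K"
  unfolding msum_Suc[of A k n, OF A] tensor_t_add[OF M A] by (rule K_add[OF tensor_t_cur[OF M] tensor_t_cur[OF A] u])
 from pm.subsp_add[OF K_subsp this Suc.IH] show ?case using Suc.prems by (simp add: algebra_simps)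
qed

lemma K_ptrunc:
 assumes X: "X : cur n" and u: "u : FC"
 shows "wact (ptrunc D X) u - (\<Sum>r<D. wact (tt (mat_coeff r X) r) u) : K"
proof (induction D)
 case 0 thus ?case using K_zero[OF u] by (simp add: ptrunc_0[OF X])
next
 case (Suc D)
 have "wact (ptrunc (Suc D) X) u - (wact (ptrunc D X) u + wact (tt (mat_coeff D X) D) u) : K"
  unfolding ptrunc_Suc[OF X] by (rule K_add[OF ptrunc_cur[OF X] tensor_t_cur[OF cur_coeff[OF X]] u])
 from pm.subsp_add[OF K_subsp this Suc.IH] show ?case by (simp add: algebra_simps)
qed

text \<open>The coefficients of a bracket are sums of brackets of coefficients, so a relation splits
  into homogeneous relations; the double sums for the two orders of \<open>x\<close> and
  \<open>y\<close> agree after reindexing.\<close>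

lemma bt_enveloping:
 assumes "r : env_rel (CA n)"
 shows "bt j r : K"
proof -
 let ?c = "\<lambda>r X. tt (mat_coeff r X) r"
 have cc: "?c r X : cur n" if "X : cur n" for r X by (rule tensor_t_cur[OF cur_coeff[OF that]])
 have 1: "bt j (wact (x + y) u - (wact x u + wact y u)) : K" if x: "x : cur n" "y : cur n" and u: "u : FC" for x y u
 proof -
  have "(\<Sum>r\<le>j. wact (?c r (x + y)) (bt (j - r) u) - (wact (?c r x) (bt (j - r) u) + wact (?c r y) (bt (j - r) u))) : K"
   unfolding mat_coeff_add[OF x[THEN cur_carrier]] tensor_t_add[OF x[THEN cur_coeff]]
   by (rule pm.subsp_sum[OF K_subsp K_add[OF x[THEN cc] bt_closed[OF u]]])
  thus ?thesis by (simp add: bt_diff bt_add bt_wact sum_subtractf sum.distrib)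
 qed
 have 2: "bt j (wact ([:c:] \<cdot>\<^sub>m x) u - scale_pm c (wact x u)) : K" if x: "x : cur n" and u: "u : FC" for c x u
 proof -
  have "(\<Sum>r\<le>j. wact (?c r ([:c:] \<cdot>\<^sub>m x)) (bt (j - r) u) - scale_pm c (wact (?c r x) (bt (j - r) u))) : K"
   unfolding mat_coeff_smult tensor_t_smult by (rule pm.subsp_sum[OF K_subsp K_smult[OF cc[OF x] bt_closed[OF u]]])
  thus ?thesis by (simp add: bt_diff bt_scale bt_wact sum_subtractf pm.sc_sum)
 qed
 have 3: "bt j (wact x (wact y u) - wact y (wact x u) - wact (x * y - y * x) u) : K"
  if x: "x : cur n" and y: "y : cur n" and u: "u : FC" for x y u
 proof -
  note B = bt_closed[OF u]
  let ?h = "\<lambda>x y i s w. wact (?c i x) (wact (?c s y) (bt w u))"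
  let ?g = "\<lambda>i s w. wact (tt (br (mat_coeff i x) (mat_coeff s y)) (i + s)) (bt w u)"
  have X: "br (mat_coeff i x) (mat_coeff s y) : spc n" for i s by (rule sp_bracket[OF cur_coeff[OF x] cur_coeff[OF y]])
  have 4: "?g i s w - (?h x y i s w - ?h y x s i w) : K" for i s w unfolding tensor_t_bracket[OF cur_coeff[OF x] cur_coeff[OF y]]
   by (rule K_bracket[OF cc[OF x] cc[OF y] B])
  have 5: "wact (?c r (x * y - y * x)) (bt (j - r) u) - (\<Sum>i\<le>r. ?h x y i (r - i) (j - r) - ?h y x (r - i) i (j - r)) : K" for r
  proof -
   have a: "wact (?c r (x * y - y * x)) (bt (j - r) u) - (\<Sum>i<Suc r. wact (tt (br (mat_coeff i x) (mat_coeff (r - i) y)) r) (bt (j - r) u)) : K"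
    unfolding mat_coeff_bracket[OF x y] by (rule K_msum[OF X B])
   have b: "(\<Sum>i<Suc r. wact (tt (br (mat_coeff i x) (mat_coeff (r - i) y)) r) (bt (j - r) u)) = (\<Sum>i\<le>r. ?g i (r - i) (j - r))"
    unfolding lessThan_Suc_atMost by (rule sum.cong) auto
   have c: "(\<Sum>i\<le>r. ?g i (r - i) (j - r) - (?h x y i (r - i) (j - r) - ?h y x (r - i) i (j - r))) : K"
    by (rule pm.subsp_sum[OF K_subsp 4])
   from pm.subsp_add[OF K_subsp a[unfolded b] c] show ?thesis by (simp add: sum_subtractf) (simp add: algebra_simps)
  qed
  \<comment> \<open>Both sides run over the triples of degrees with sum \<open>j\<close>.\<close>
  have h: "(\<Sum>r\<le>j. \<Sum>i\<le>r. H i (r - i) (j - r)) = (\<Sum>r\<le>j. \<Sum>s\<le>j - r. H r s (j - r - s))"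
   for H :: "nat => nat => nat => (cwords)"
  proof -
   have "(\<Sum>r\<le>j. \<Sum>i\<le>r. H i (r - i) (j - r)) = (\<Sum>r\<le>j. \<Sum>i\<le>r. H i (r - i) (j - (i + (r - i))))"
    by (intro sum.cong refl) auto
   also have "... = (\<Sum>r\<le>j. \<Sum>s\<le>j - r. H r s (j - (r + s)))" by (rule sum_triangle)
   finally show ?thesis by simp
  qed
  have f: "(\<Sum>r\<le>j. \<Sum>i\<le>r. H i (r - i) (j - r)) = (\<Sum>r\<le>j. \<Sum>i\<le>r. H (r - i) i (j - r))"
   for H :: "nat => nat => nat => (cwords)"
  proof (rule sum.cong[OF refl])
   fix r
   show "(\<Sum>i\<le>r. H i (r - i) (j - r)) = (\<Sum>i\<le>r. H (r - i) i (j - r))"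
    by (rule sum.reindex_bij_witness[of _ "\<lambda>i. r - i" "\<lambda>i. r - i"]) auto
  qed
  have xy: "bt j (wact x (wact y u)) = (\<Sum>r\<le>j. \<Sum>i\<le>r. ?h x y i (r - i) (j - r))" for x y
   unfolding h[of "?h x y"] by (simp add: bt_wact wact_sum)
  have "(\<Sum>r\<le>j. wact (?c r (x * y - y * x)) (bt (j - r) u) - (\<Sum>i\<le>r. ?h x y i (r - i) (j - r) - ?h y x (r - i) i (j - r))) : K"
   by (rule pm.subsp_sum[OF K_subsp 5])
  hence "bt j (wact (x * y - y * x) u) - (bt j (wact x (wact y u)) - bt j (wact y (wact x u))) : K"
   unfolding xy f[of "?h y x"] by (simp add: bt_wact sum_subtractf)
  from pm.subsp_minus[OF K_subsp this] show ?thesis by (simp add: bt_diff bt_add algebra_simps)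
 qed
 have "env_rel (CA n) <= {r. bt j r : K}" by (rule enveloping_subsetI) (simp_all add: 1 2 3)
 thus ?thesis using assms by blast
qed

text \<open>Every term of the triangle outside the rectangle lies in \<open>K\<close>.\<close>

lemma triangle_rectangle:
 fixes D' :: nat
 assumes f: "\<And>r i. r \<ge> R \<or> i \<ge> D ==> f r i : K" and D': "D' \<ge> R + D"
 shows "(\<Sum>j<D'. \<Sum>r\<le>j. f r (j - r)) - (\<Sum>r<R. \<Sum>i<D. f r i) : K"
proof -
 let ?T = "{(i, j). i + j < D'}"
 have fin: "finite ?T" by (rule finite_subset[of _ "{..D'} \<times> {..D'}"]) auto
 have "(\<Sum>j<D'. \<Sum>r\<le>j. f r (j - r)) = (\<Sum>(r, i)\<in>?T. f r i)" by (rule sum.triangle_reindex[symmetric])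
 also have "... = (\<Sum>(r, i)\<in>?T - {..<R} \<times> {..<D}. f r i) + (\<Sum>(r, i)\<in>{..<R} \<times> {..<D}. f r i)"
  by (rule sum.subset_diff[OF _ fin]) (use D' in auto)
 also have "(\<Sum>(r, i)\<in>{..<R} \<times> {..<D}. f r i) = (\<Sum>r<R. \<Sum>i<D. f r i)"
  by (rule sum.cartesian_product[symmetric])
 finally have "(\<Sum>j<D'. \<Sum>r\<le>j. f r (j - r)) - (\<Sum>r<R. \<Sum>i<D. f r i) = (\<Sum>(r, i)\<in>?T - {..<R} \<times> {..<D}. f r i)" by simp
 also have "... : K"
 proof (rule pm.subsp_sum[OF K_subsp])
  fix x assume "x : ?T - {..<R} \<times> {..<D}"
  hence "R <= fst x \<or> D <= snd x" by (cases x) auto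
  thus "(case x of (r, i) => f r i) : K" using f by (simp add: case_prod_beta)
 qed
 finally show ?thesis .
qed

text \<open>The letters are polynomials in \<open>t\<close>, so a bound exists. Beyond it the
  components need not vanish as words, but their words contain a zero letter and so lie in
  \<open>K\<close>.\<close>

lemma bt_decomp:
 assumes "u : FC"
 shows "\<exists>D. \<forall>D'\<ge>D. bt D' u : K \<and> u - (\<Sum>j<D'. bt j u) : K"
 using assms
proof (induction u rule: fw_induct)
 case zero
 thus ?case using pm.subsp_zero[OF K_subsp] by simp
next
 case (add ws c w)
 have "\<exists>D. \<forall>D'\<ge>D. bw ws D' : K \<and> single ws 1 - (\<Sum>j<D'. bw ws j) : K" using add(1)
 proof (induction ws)
  case Nil
  have "bw [] D' = 0" "(\<Sum>j<D'. bw [] j) = single [] 1" if "D' \<ge> 1" for D' using that by auto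
  thus ?case using pm.subsp_zero[OF K_subsp] by (intro exI[of _ 1]) auto
 next
  case (Cons X ws)
  hence X: "X : cur n" and ws: "ws : lists (cur n)" by auto
  obtain D where D: "\<And>D'. D' \<ge> D ==> bw ws D' : K \<and> single ws 1 - (\<Sum>j<D'. bw ws j) : K" using Cons.IH by blast
  define R where "R = Suc (cdeg X)"
  let ?f = "\<lambda>r i. wact (tt (mat_coeff r X) r) (bw ws i)"
  have f: "?f r i : K" if "r \<ge> R \<or> i \<ge> D" for r i using that
  proof
   assume "r \<ge> R"
   hence "mat_coeff r X = 0\<^sub>m (2 * n) (2 * n)" by (intro mat_coeff_above[OF X]) (simp add: R_def)
   thus ?thesis using K_tensor_zero[OF bw_closed[OF ws]] by simp
  next
   assume "i \<ge> D"
   thus ?thesis using D K_wact[OF tensor_t_cur[OF cur_coeff[OF X]]] by blast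
  qed
  have "bw (X # ws) D' : K \<and> single (X # ws) 1 - (\<Sum>j<D'. bw (X # ws) j) : K" if D': "D' \<ge> R + D" for D'
  proof
   show "bw (X # ws) D' : K" unfolding bw.simps by (rule pm.subsp_sum[OF K_subsp], rule f) (use D' in auto)
   have "wact X (single ws 1 - (\<Sum>j<D. bw ws j)) : K" using D K_wact[OF X] by blast
   hence 1: "single (X # ws) 1 - (\<Sum>i<D. wact X (bw ws i)) : K" by (simp add: wact_diff wact_sum)
   have 2: "(\<Sum>i<D. wact X (bw ws i) - (\<Sum>r<R. ?f r i)) : K"
   proof (rule pm.subsp_sum[OF K_subsp])
    fix i
    show "wact X (bw ws i) - (\<Sum>r<R. ?f r i) : K" using K_ptrunc[OF X bw_closed[OF ws], of R] by (simp add: R_def ptrunc_all)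
   qed
   have 3: "(\<Sum>j<D'. bw (X # ws) j) - (\<Sum>r<R. \<Sum>i<D. ?f r i) : K"
    unfolding bw.simps by (rule triangle_rectangle[OF f D'])
   have "(\<Sum>r<R. \<Sum>i<D. ?f r i) = (\<Sum>i<D. \<Sum>r<R. ?f r i)" by (rule sum.swap)
   with pm.subsp_diff[OF K_subsp pm.subsp_add[OF K_subsp 1 2] 3]
   show "single (X # ws) 1 - (\<Sum>j<D'. bw (X # ws) j) : K" by (simp add: sum_subtractf del: bw.simps)
  qed
  thus ?case by blast
 qed
 then obtain D1 where D1: "\<And>D'. D' \<ge> D1 ==> bw ws D' : K \<and> single ws 1 - (\<Sum>j<D'. bw ws j) : K" by blast
 obtain D2 where D2: "\<And>D'. D' \<ge> D2 ==> bt D' w : K \<and> w - (\<Sum>j<D'. bt j w) : K" using add(3) by blast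
 have "bt D' (single ws c + w) : K \<and> single ws c + w - (\<Sum>j<D'. bt j (single ws c + w)) : K" if D': "D' \<ge> D1 + D2" for D'
 proof
  show "bt D' (single ws c + w) : K"
   using D1[of D'] D2[of D'] D' by (auto simp: bt_add bt_single intro!: pm.subsp_add[OF K_subsp] pm.subsp_sc[OF K_subsp])
  have "scale_pm c (single ws 1 - (\<Sum>j<D'. bw ws j)) + (w - (\<Sum>j<D'. bt j w)) : K"
   using D1[of D'] D2[of D'] D' by (intro pm.subsp_add[OF K_subsp] pm.subsp_sc[OF K_subsp]) auto
  thus "single ws c + w - (\<Sum>j<D'. bt j (single ws c + w)) : K"
   by (simp add: bt_add bt_single pm.sc_diff pm.sc_sum sum.distrib algebra_simps)
 qed
 thus ?case by blast
qed

lemma bw_homog: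
 assumes "ok_word n xs"
 shows "bw (wl xs) j - (if j = degsum xs then single (wl xs) 1 else 0) : K"
 using assms
proof (induction xs arbitrary: j)
 case Nil
 thus ?case using pm.subsp_zero[OF K_subsp] by simp
next
 case (Cons a xs)
 obtain x s where a: "a = (x, s)" by force
 have x: "x : spc n" and xs: "ok_word n xs" using Cons.prems by (auto simp: a)
 let ?d = "degsum xs"
 let ?w = "wact (tt x s) (bw (wl xs) (j - s))"
 have "(\<Sum>r\<le>j. wact (tt (mat_coeff r (tt x s)) r) (bw (wl xs) (j - r)) - (if r = s then ?w else 0)) : K"
 proof (rule pm.subsp_sum[OF K_subsp])
  fix r
  show "wact (tt (mat_coeff r (tt x s)) r) (bw (wl xs) (j - r)) - (if r = s then ?w else 0) : K"
   using K_tensor_zero[OF bw_closed[OF wl_cur[OF xs]]] pm.subsp_zero[OF K_subsp]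
   by (simp add: mat_coeff_tensor_t[OF sp_carrierD[OF x]])
 qed
 hence 1: "bw (wl (a # xs)) j - (if s <= j then ?w else 0) : K" by (simp add: a sum_subtractf)
 have 2: "wact (tt x s) (bw (wl xs) (j - s) - (if j - s = ?d then single (wl xs) 1 else 0)) : K"
  by (rule K_wact[OF tensor_t_cur[OF x] Cons.IH[OF xs]])
 show ?case
 proof (cases "s <= j")
  case True
  hence "j - s = ?d \<longleftrightarrow> j = s + ?d" by auto
  thus ?thesis using pm.subsp_add[OF K_subsp 1 2] True by (simp add: a wact_diff split: if_splits)
 next
  case False
  thus ?thesis using 1 by (simp add: a)
 qed
qed

lemma bt_homog:
 assumes "u : ED n d"
 shows "bt j u - (if j = d then u else 0) : K"
proof -
 have "pm.lin_ext (\<lambda>ws. bw ws j - (if j = d then single ws 1 else 0)) u : K"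
 proof (rule pm.lin_ext_in[OF K_subsp])
  fix ws assume "ws : keys u"
  then obtain xs where "ws = wl xs" "ok_word n xs" "degsum xs = d" using assms unfolding enveloping_degree_def wl_def by blast
  thus "bw ws j - (if j = d then single ws 1 else 0) : K" using bw_homog[of xs j] by (cases "j = d") simp_all
 qed
 moreover have "pm.lin_ext (\<lambda>ws. bw ws j - (if j = d then single ws 1 else 0)) u = bt j u - (if j = d then u else 0)"
 proof (induction u rule: single_induct)
  case (add ws c g)
  thus ?case by (simp add: pm.lin_ext_add bt_add bt_single pm.sc_diff)
 qed simp
 ultimately show ?thesis by simp
qed

end



section \<open>The associated graded module\<close>

lemma (in tensor) wordmap_ghull:
 assumes u0: "u0 : ftc I V" and "u : fw.ghull L (env_rel L)"
 shows "ft.wordmap u0 u : Nul"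
proof -
 let ?S = "{u : FW L. ft.wordmap u0 u : Nul}"
 have "fw.stable L ?S" unfolding fw.stable_def
 proof (intro conjI ballI)
  show "pm.subsp ?S" using FW_subsp[of L] Nul
   by (intro pm.subspI) (auto simp: ft.wordmap_add ft.wordmap_scale intro: pm.subsp_zero pm.subsp_add pm.subsp_sc)
  fix x u assume x: "x : carrier L" and u: "u : ?S"
  hence "ta x (ft.wordmap u0 u) : Nul" using Nul_stable unfolding ft.stable_def by blast
  thus "wact x u : ?S" using u wact_closed[OF x] ft.wordmap_wact[OF x] by simp
 qed auto
 moreover have "env_rel L <= ?S"
 proof -
  note simps = ft.wordmap_diff ft.wordmap_add ft.wordmap_scale ft.wordmap_wact ft.wordmap_closed[OF _ u0] L_add L_smult L_bracket
  have "env_rel L <= {r. ft.wordmap u0 r : Nul}"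
  proof (rule enveloping_subsetI)
   fix x y s assume x: "x : carrier L" "y : carrier L" "s : FW L"
   show "wact x (wact y s) - wact y (wact x s) - wact (bracket L x y) s : {r. ft.wordmap u0 r : Nul}"
    using pm.subsp_minus[OF Nul tens_bracket[OF x(1,2) ft.wordmap_closed[OF x(3) u0]]] x by (simp add: simps)
  qed (simp_all add: simps tens_add tens_smult)
  thus ?thesis using enveloping_subset by blast
 qed
 ultimately show ?thesis using assms(2) fw.ghull_least[of L ?S] by blast
qed

lemma enveloping_degree_iff: "u : ED n d \<longleftrightarrow>
  keys u <= wl ` {xs. ok_word n xs \<and> degsum xs = d}" unfolding enveloping_degree_def wl_def by blast

lemma ED_subsp: "pm.subsp (ED n d)"
 by (rule pm.subspI)
  (auto simp: enveloping_degree_iff dest!: subsetD[OF Poly_Mapping.keys_add] subsetD[OF keys_scale_pm])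

lemma ED_wl: "ok_word n xs ==> degsum xs = d ==> single (wl xs) c : ED n d"
 by (auto simp: enveloping_degree_iff)

lemma ED_fw: "u : ED n d ==> u : FW (CA n)"
proof -
 assume u: "u : ED n d"
 have "ws : lists (cur n)" if ws: "ws : keys u" for ws
 proof -
  obtain xs where "ws = wl xs" "ok_word n xs" using ws u unfolding enveloping_degree_iff by blast
  thus ?thesis using wl_cur by blast
 qed
 thus ?thesis by (auto simp: FW_def)
qed

lemma ED_wact:
 assumes x: "x : spc n" and u: "u : ED n d"
 shows "wact (tt x r) u : ED n (r + d)"
 unfolding wact_def
proof (rule pm.lin_ext_in[OF ED_subsp])
 fix ws assume "ws : keys u"
 then obtain xs where xs: "ws = wl xs" "ok_word n xs" "degsum xs = d" using u unfolding enveloping_degree_iff by blast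
 thus "single (tt x r # ws) 1 : ED n (r + d)" using ED_wl[of "(x, r) # xs" n "r + d" 1] x by simp
qed

lemma bw_ED: "ws : lists (cur n) ==> bw ws j : ED n j"
proof (induction ws arbitrary: j)
 case Nil
 thus ?case using ED_wl[of "[]" n 0 1] pm.subsp_zero[OF ED_subsp[of n]] by simp
next
 case (Cons X ws)
 hence X: "X : cur n" and ws: "ws : lists (cur n)" by auto
 show ?case unfolding bw.simps
 proof (rule pm.subsp_sum[OF ED_subsp])
  fix r assume "r : {..j}"
  thus "wact (tt (mat_coeff r X) r) (bw ws (j - r)) : ED n j"
   using ED_wact[OF cur_coeff[OF X] Cons.IH[OF ws], of r r "j - r"] by simp
 qed
qed

lemma bt_ED: "u : FW (CA n) ==> bt j u : ED n j"
 unfolding bt_def by (rule pm.lin_ext_in[OF ED_subsp], rule bw_ED) (auto simp: FW_def)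

section \<open>The degree filtration and its graded pieces on representatives\<close>

context fusion_setup begin

definition "Kenv = fw.ghull L (env_rel L)"

lemma Kenv: "fw.stable L Kenv" "env_rel L <= Kenv"
 unfolding Kenv_def using fw.stable_ghull[OF cur.enveloping_subset] fw.ghull_subset by auto

text \<open>Application of a word to the cyclic tensor, at the level of representatives.\<close>

definition "\<tau> = ft.wordmap T0"

lemma tau_wl: "\<tau> (single (wl xs) c) = scale_pm c (tw xs)"
 by (simp add: \<tau>_def tw_def wl_def)

lemma tau_simps: "\<tau> 0 = 0" "\<tau> (u + w) = \<tau> u + \<tau> w" "\<tau> (u - w) = \<tau> u - \<tau> w" "\<tau> (scale_pm c u) = scale_pm c (\<tau> u)"
 "\<tau> (\<Sum>i\<in>A. f i) = (\<Sum>i\<in>A. \<tau> (f i))"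
 by (simp_all add: \<tau>_def ft.wordmap_add ft.wordmap_diff ft.wordmap_scale ft.wordmap_sum)

lemma tau_wact: "X : cur n ==> \<tau> (wact X u) = ta X (\<tau> u)"
 using ft.wordmap_wact[of X T0 u] by (simp add: \<tau>_def)

lemma tau_Kenv: "u : Kenv ==> \<tau> u : Nul"
 unfolding \<tau>_def Kenv_def by (rule wordmap_ghull[OF T0])

lemma tau_ftc: "u : FW L ==> \<tau> u : ftc J E"
 unfolding \<tau>_def by (rule ft.wordmap_closed[OF _ T0])

text \<open>The preimage of filtration step \<open>j\<close>, followed by that of the preceding
  step; including \<open>Nul\<close> makes them full preimages, and before step 0 only
  \<open>Nul\<close> remains.\<close>

definition "Ph j = pm.lspan (tw ` {xs. ok_word n xs \<and> degsum xs <= j} \<union> Nul)"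
definition "Pb j = (case j of 0 => Nul | Suc i => Ph i)"

lemma Ph: "pm.subsp (Ph j)"
 unfolding Ph_def by (rule pm.subsp_lspan)

lemma Pb: "pm.subsp (Pb j)"
 by (auto simp: Pb_def Ph Nul split: nat.split)

lemma Nul_Ph: "Nul <= Ph j"
 unfolding Ph_def using pm.lspan_base by blast

lemma Nul_Pb: "Nul <= Pb j"
 using Nul_Ph by (auto simp: Pb_def split: nat.split)

lemma tw_Ph: "ok_word n xs ==> degsum xs <= j ==> tw xs : Ph j"
 unfolding Ph_def by (rule pm.lspan_base) blast

lemma Ph_mono: "i <= j ==> Ph i <= Ph j"
 unfolding Ph_def by (rule pm.lspan_mono) force

lemma Pb_Ph: "Pb j <= Ph j"
 using Nul_Ph Ph_mono by (auto simp: Pb_def split: nat.split)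

lemma Ph_Pb: "i < j ==> Ph i <= Pb j"
 using Ph_mono by (auto simp: Pb_def split: nat.split)

lemma Ph_ftc: "Ph j <= ftc J E"
 unfolding Ph_def by (rule pm.lspan_least[OF ftc_subsp]) (use tw_ftc Nul_ftc in auto)

lemma ta_Nul: "x : spc n ==> w : Nul ==> ta (tt x r) w : Nul"
 using Nul_stable tensor_t_cur[of x n r] unfolding ft.stable_def by simp

lemma ta_Ph:
 assumes x: "x : spc n" and w: "w : Ph i"
 shows "ta (tt x r) w : Ph (i + r)"
proof -
 have "Ph i <= {w. ta (tt x r) w : Ph (i + r)}" unfolding Ph_def[of i]
 proof (rule pm.lspan_least)
  show "pm.subsp {w. ta (tt x r) w : Ph (i + r)}" using Ph[of "i + r"] by (intro pm.subspI)
    (auto simp: tact_add tact_scale intro: pm.subsp_zero pm.subsp_add pm.subsp_sc)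
  have "ta (tt x r) (tw xs) : Ph (i + r)" if "ok_word n xs" "degsum xs <= i" for xs
   using tw_Ph[of "(x, r) # xs" "i + r"] x that by simp
  thus "tw ` {xs. ok_word n xs \<and> degsum xs <= i} \<union> Nul <= {w. ta (tt x r) w : Ph (i + r)}"
   using ta_Nul[OF x] Nul_Ph[of "i + r"] by blast
 qed
 thus ?thesis using w by blast
qed

lemma ta_Pb:
 assumes x: "x : spc n" and w: "w : Pb i"
 shows "ta (tt x r) w : Pb (i + r)"
proof (cases i)
 case 0
 thus ?thesis using ta_Nul[OF x] w Nul_Pb by (auto simp: Pb_def)
next
 case (Suc i')
 thus ?thesis using ta_Ph[OF x, of w i' r] w by (simp add: Pb_def)
qed

lemma tau_ED:
 assumes "u : ED n d" "d <= j"
 shows "\<tau> u : Ph j"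
 unfolding \<tau>_def ft.wordmap_def
proof (rule pm.lin_ext_in[OF Ph])
 fix ws assume "ws : keys u"
 then obtain xs where "ws = wl xs" "ok_word n xs" "degsum xs = d" using assms unfolding enveloping_degree_iff by blast
 thus "foldr ta ws T0 : Ph j" using tw_Ph[of xs j] assms(2) by (simp add: tw_def wl_def)
qed

lemma tau_bt: "u : FW L ==> \<tau> (bt j u) : Ph j"
 by (rule tau_ED[OF bt_ED order_refl])

abbreviation "M \<equiv> tensor_product J E"
abbreviation "F \<equiv> degree_filtration n M (pure_tensor J E v)"

lemma filtration: "F j = kaT ` Ph j"
proof -
 interpret M: Module.module "class_ring :: complex ring" M by (rule ft.pres_module[OF T_presents])
 have pt: "pure_tensor J E v = kaT T0" by (simp add: pure_tensor_def multilinear_subspace_eq T0_def vI_def)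
 have s: "(\<Oplus>\<^bsub>M\<^esub>d\<in>{..j}. word_action M (u d) (pure_tensor J E v)) = kaT (\<Sum>d\<le>j. \<tau> (u d))"
  if u: "\<forall>d\<le>j. u d : ED n d" for u
 proof -
  have uf: "u d : FW L" if "d : {..j}" for d by (rule ED_fw[of _ n d]) (use u that in simp)
  have t: "\<tau> (u d) : ftc J E" if "d : {..j}" for d by (rule tau_ftc[OF uf[OF that]])
  have "(\<Oplus>\<^bsub>M\<^esub>d\<in>{..j}. word_action M (u d) (pure_tensor J E v)) = (\<Oplus>\<^bsub>M\<^esub>d\<in>{..j}. kaT (\<tau> (u d)))"
  proof (rule M.finsum_cong'[OF refl])
   show "(\<lambda>d. kaT (\<tau> (u d))) : {..j} \<rightarrow> carrier M" using t ft.pres_carrier[OF T_presents] by auto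
   show "word_action M (u d) (pure_tensor J E v) = kaT (\<tau> (u d))" if "d : {..j}" for d
    unfolding pt \<tau>_def by (rule ft.pres_word_action[OF T_presents uf[OF that] T0])
  qed
  also have "... = kaT (\<Sum>d\<le>j. \<tau> (u d))" by (rule ft.pres_finsum[OF T_presents _ t]) simp
  finally show ?thesis .
 qed
 let ?A = "{(\<Sum>d\<le>j. \<tau> (u d)) + k | u k. (\<forall>d\<le>j. u d : ED n d) \<and> k : Nul}"
 have sub: "pm.subsp ?A"
 proof (rule pm.subspI)
  show "0 : ?A" using pm.subsp_zero[OF Nul] pm.subsp_zero[OF ED_subsp[of n]]
   by (intro CollectI exI[of _ "\<lambda>_. 0"] exI[of _ 0]) (simp add: tau_simps)
 next
  fix x y assume "x : ?A" "y : ?A"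
  then obtain u k u' k' where "x = (\<Sum>d\<le>j. \<tau> (u d)) + k" "\<forall>d\<le>j. u d : ED n d" "k : Nul"
   "y = (\<Sum>d\<le>j. \<tau> (u' d)) + k'" "\<forall>d\<le>j. u' d : ED n d" "k' : Nul" by blast
  thus "x + y : ?A" using pm.subsp_add[OF Nul] pm.subsp_add[OF ED_subsp[of n]]
   by (intro CollectI exI[of _ "\<lambda>d. u d + u' d"] exI[of _ "k + k'"]) (simp add: tau_simps sum.distrib)
 next
  fix c x assume "x : ?A"
  then obtain u k where "x = (\<Sum>d\<le>j. \<tau> (u d)) + k" "\<forall>d\<le>j. u d : ED n d" "k : Nul" by blast
  thus "scale_pm c x : ?A" using pm.subsp_sc[OF Nul] pm.subsp_sc[OF ED_subsp[of n]]
   by (intro CollectI exI[of _ "\<lambda>d. scale_pm c (u d)"] exI[of _ "scale_pm c k"]) (simp add: tau_simps pm.sc_add pm.sc_sum)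
 qed
 have tw: "tw xs : ?A" if xs: "ok_word n xs" "degsum xs <= j" for xs
 proof -
  let ?u = "\<lambda>d. if d = degsum xs then single (wl xs) 1 else 0"
  have "(\<Sum>d\<le>j. \<tau> (?u d)) = (\<Sum>d\<le>j. if d = degsum xs then tw xs else 0)"
   by (rule sum.cong) (auto simp: tau_simps tau_wl pm.sc_one)
  hence "tw xs = (\<Sum>d\<le>j. \<tau> (?u d)) + 0" using xs(2) by simp
  moreover have "\<forall>d\<le>j. ?u d : ED n d" using ED_wl[OF xs(1)] pm.subsp_zero[OF ED_subsp[of n]] by simp
  ultimately show ?thesis using pm.subsp_zero[OF Nul] by (intro CollectI exI[of _ ?u] exI[of _ 0] conjI)
 qed
 have nul: "k : ?A" if "k : Nul" for k using that pm.subsp_zero[OF ED_subsp[of n]]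
  by (intro CollectI exI[of _ "\<lambda>_. 0"] exI[of _ k]) (simp add: tau_simps)
 have "Ph j <= ?A" unfolding Ph_def by (rule pm.lspan_least[OF sub]) (use tw nul in blast)
 show ?thesis
 proof (rule subset_antisym; rule subsetI)
  fix x assume "x : F j"
  then obtain u where u: "\<forall>d\<le>j. u d : ED n d"
   "x = (\<Oplus>\<^bsub>M\<^esub>d\<in>{..j}. word_action M (u d) (pure_tensor J E v))" unfolding degree_filtration_def by blast
  have "(\<Sum>d\<le>j. \<tau> (u d)) : Ph j" using u(1) by (intro pm.subsp_sum[OF Ph] tau_ED) auto
  thus "x : kaT ` Ph j" using s[OF u(1)] u(2) by blast
 next
  fix x assume "x : kaT ` Ph j"
  then obtain w where w: "w : Ph j" "x = kaT w" by blast
  then obtain u k where u: "w = (\<Sum>d\<le>j. \<tau> (u d)) + k" "\<forall>d\<le>j. u d : ED n d" "k : Nul"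
   using \<open>Ph j <= ?A\<close> by blast
  have "(\<Sum>d\<le>j. \<tau> (u d)) : ftc J E" using u(2) by (intro pm.subsp_sum[OF ftc_subsp] tau_ftc ED_fw) auto
  hence "kaT w = kaT (\<Sum>d\<le>j. \<tau> (u d))"
   using ft.pres_eq[OF T_presents, of w "\<Sum>d\<le>j. \<tau> (u d)"] w(1) Ph_ftc[of j] u(1,3) by auto
  thus "x : F j" unfolding degree_filtration_def w(2) s[OF u(2), symmetric] using u(2) by blast
 qed
qed

lemma filtration_below: "filtration_below M F j = kaT ` Pb j"
proof (cases j)
 case 0
 have "kaT ` Nul = {kaT 0}"
 proof (rule subset_antisym; rule subsetI)
  fix x assume "x : kaT ` Nul"
  then obtain w where "w : Nul" "x = kaT w" by blast
  thus "x : {kaT 0}" using ft.pres_ker[OF T_presents, of w] Nul_ftc by blast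
 qed (use pm.subsp_zero[OF Nul] in blast)
 thus ?thesis using 0 ft.pres_zero[OF T_presents] by (simp add: filtration_below_def Pb_def)
next
 case (Suc i) thus ?thesis by (simp add: filtration_below_def Pb_def filtration)
qed

definition "kap j u = filtration_below M F j +>\<^bsub>M\<^esub> kaT u"

text \<open>A graded piece is only a vector space; an empty acting algebra makes the presentation
  lemmas applicable to it.\<close>

abbreviation "trivial_L \<equiv> (CA n)\<lparr>carrier := {}\<rparr>"

lemma Ph_lin_space: "lin_space scale_pm trivial_L (Ph j) (\<lambda>_ u. u)"
 by (rule lin_space.intro[OF pm.cvs_axioms lin_space_axioms.intro]) (simp_all add: Ph)

lemma piece_presents: "lin_space.presents scale_pm trivial_L (Ph j) (\<lambda>_ u. u) (kap j) (graded_piece M F j) (Pb j)"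
proof -
 note ls = Ph_lin_space[of j]
 have 1: "lin_space.presents scale_pm trivial_L (Ph j) (\<lambda>_ u. u) kaT (M\<lparr>carrier := F j\<rparr>) Nul"
  unfolding lin_space.presents_def[OF ls]
  using ft.pres_zero[OF T_presents] ft.pres_add[OF T_presents] ft.pres_smult[OF T_presents] ft.pres_ker[OF T_presents]
   Ph_ftc[of j] Nul_Ph[of j] by (auto simp: filtration subset_iff)
 have st: "lin_space.stable scale_pm trivial_L (Ph j) (\<lambda>_ u. u) (Pb j)"
  unfolding lin_space.stable_def[OF ls] using Pb Pb_Ph by simp
 have "(\<lambda>u. filtration_below M F j +>\<^bsub>M\<lparr>carrier := F j\<rparr>\<^esub> kaT u) = kap j"
  by (rule ext) (simp add: kap_def a_r_coset_def r_coset_def)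
 with lin_space.pres_quotient[OF ls 1 st Nul_Pb filtration_below]
 show ?thesis by (simp add: graded_piece_def)
qed

lemmas piece_simps = lin_space.pres_carrier[OF Ph_lin_space piece_presents] lin_space.pres_zero[OF Ph_lin_space piece_presents]
 and piece_add = lin_space.pres_add[OF Ph_lin_space piece_presents]
 and piece_smult = lin_space.pres_smult[OF Ph_lin_space piece_presents]
 and piece_ker = lin_space.pres_ker[OF Ph_lin_space piece_presents]
 and piece_eq = lin_space.pres_eq[OF Ph_lin_space piece_presents]
 and piece_finsum = lin_space.pres_finsum[OF Ph_lin_space piece_presents]

lemma kap_act:
 assumes x: "x : spc n" and u: "u : Ph i"
 shows "(\<Union>y\<in>kap i u. filtration_below M F (i + r) +>\<^bsub>M\<^esub> act M (tt x r) y) = kap (i + r) (ta (tt x r) u)"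
proof -
 have X: "tt x r : carrier L" using tensor_t_cur[OF x] by simp
 have uf: "u : ftc J E" using u Ph_ftc by blast
 have Pf: "Pb i <= ftc J E" using Pb_Ph Ph_ftc by blast
 have k: "kap i u = kaT ` {k + u | k. k : Pb i}" unfolding kap_def filtration_below by (rule ft.pres_coset[OF T_presents Pf uf])
 have "filtration_below M F (i + r) +>\<^bsub>M\<^esub> act M (tt x r) (kaT (k + u)) = kap (i + r) (ta (tt x r) u)"
  if kk: "k : Pb i" for k
 proof -
  have ku: "k + u : Ph i" using pm.subsp_add[OF Ph _ u] kk Pb_Ph by blast
  hence "act M (tt x r) (kaT (k + u)) = kaT (ta (tt x r) (k + u))" using ft.pres_act[OF T_presents X] Ph_ftc by blast
  moreover have "kap (i + r) (ta (tt x r) (k + u)) = kap (i + r) (ta (tt x r) u)"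
   using piece_eq[OF ta_Ph[OF x ku] ta_Ph[OF x u]] ta_Pb[OF x kk] by (simp add: tact_add)
  ultimately show ?thesis by (simp add: kap_def)
 qed
 moreover have "0 : Pb i" by (rule pm.subsp_zero[OF Pb])
 ultimately show ?thesis unfolding k by auto
qed

abbreviation "gr \<equiv> associated_graded M F"
text \<open>The map from words to the associated graded module: the component of degree
  \<open>j\<close> is applied to the cyclic tensor and read modulo the preceding filtration step.
  Its kernel is \<open>K1\<close>.\<close>

definition "\<pi> u j = kap j (\<tau> (bt j u))"
definition "K1 = {u : FW L. \<forall>j. \<tau> (bt j u) : Pb j}"

lemma gr_act:
 assumes X: "X : cur n" and u: "u : FW L"
 shows "act gr X (\<pi> u) = \<pi> (wact X u)"
proof
 fix j
 have c: "mat_coeff r X : spc n" for r by (rule cur_coeff[OF X])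
 have t: "ta (tt (mat_coeff r X) r) (\<tau> (bt (j - r) u)) : Ph j" if "r : {..j}" for r
  using ta_Ph[OF c tau_bt[OF u], of r r "j - r"] that by simp
 have e: "(\<Union>y\<in>\<pi> u (j - r). filtration_below M F j +>\<^bsub>M\<^esub> act M (tt (mat_coeff r X) r) y) =
   kap j (ta (tt (mat_coeff r X) r) (\<tau> (bt (j - r) u)))" if "r : {..j}" for r
  using kap_act[OF c tau_bt[OF u, of "j - r"], of r r] that by (simp add: \<pi>_def)
 interpret P: Module.module "class_ring :: complex ring" "graded_piece M F j"
  by (rule lin_space.pres_module[OF Ph_lin_space piece_presents])
 have "act gr X (\<pi> u) j = (\<Oplus>\<^bsub>graded_piece M F j\<^esub>r\<in>{..j}. kap j (ta (tt (mat_coeff r X) r) (\<tau> (bt (j - r) u))))"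
  unfolding associated_graded_def rep.simps by (rule P.finsum_cong'[OF refl _ e]) (use t piece_simps(1)[of j] in auto)
 also have "... = kap j (\<Sum>r\<le>j. ta (tt (mat_coeff r X) r) (\<tau> (bt (j - r) u)))" by (rule piece_finsum[OF _ t]) simp
 also have "... = \<pi> (wact X u) j" by (simp add: \<pi>_def bt_wact tau_simps tau_wact tensor_t_cur[OF c])
 finally show "act gr X (\<pi> u) j = \<pi> (wact X u) j" .
qed

lemma pi_support:
 assumes u: "u : FW L"
 shows "finite {j. \<pi> u j ~= kap j 0}"
proof -
 obtain D where D: "\<forall>D'\<ge>D. bt D' u : Kenv" using bt_decomp[OF Kenv u] by blast
 have "{j. \<pi> u j ~= kap j 0} <= {..<D}"
 proof
  fix j assume j: "j : {j. \<pi> u j ~= kap j 0}"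
  have "\<tau> (bt j u) : Pb j" if "D <= j" using D that tau_Kenv Nul_Pb by blast
  thus "j : {..<D}" using j piece_ker[OF tau_bt[OF u], of j] by (auto simp: \<pi>_def not_le)
 qed
 thus ?thesis by (rule finite_subset) simp
qed

text \<open>Words of degree below \<open>j\<close> are zero in the piece, so those of degree exactly
  \<open>j\<close> suffice.\<close>

lemma piece_homog:
 assumes "x : carrier (graded_piece M F j)"
 shows "\<exists>u\<in>ED n j. x = kap j (\<tau> u)"
proof -
 have "Ph j <= {w. \<exists>u\<in>ED n j. w - \<tau> u : Pb j}" unfolding Ph_def
 proof (rule pm.lspan_least)
  note e = ED_subsp[of n j]
  show "pm.subsp {w. \<exists>u\<in>ED n j. w - \<tau> u : Pb j}"
  proof (rule pm.subspI)
   show "0 : {w. \<exists>u\<in>ED n j. w - \<tau> u : Pb j}"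
    using pm.subsp_zero[OF e] pm.subsp_zero[OF Pb] by (intro CollectI bexI[of _ 0]) (simp_all add: tau_simps)
  next
   fix x y assume "x : {w. \<exists>u\<in>ED n j. w - \<tau> u : Pb j}" "y : {w. \<exists>u\<in>ED n j. w - \<tau> u : Pb j}"
   then obtain u u' where "u : ED n j" "u' : ED n j" "x - \<tau> u : Pb j" "y - \<tau> u' : Pb j" by blast
   thus "x + y : {w. \<exists>u\<in>ED n j. w - \<tau> u : Pb j}"
    using pm.subsp_add[OF e, of u u'] pm.subsp_add[OF Pb, of "x - \<tau> u" j "y - \<tau> u'"]
    by (intro CollectI bexI[of _ "u + u'"]) (simp_all add: tau_simps algebra_simps)
  next
   fix c x assume "x : {w. \<exists>u\<in>ED n j. w - \<tau> u : Pb j}"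
   then obtain u where "u : ED n j" "x - \<tau> u : Pb j" by blast
   thus "scale_pm c x : {w. \<exists>u\<in>ED n j. w - \<tau> u : Pb j}"
    using pm.subsp_sc[OF e, of u c] pm.subsp_sc[OF Pb, of "x - \<tau> u" j c]
    by (intro CollectI bexI[of _ "scale_pm c u"]) (simp_all add: tau_simps pm.sc_diff)
  qed
  have 1: "\<exists>u\<in>ED n j. tw xs - \<tau> u : Pb j"
   if xs: "ok_word n xs" "degsum xs <= j" for xs
  proof (cases "degsum xs = j")
   case True
   thus ?thesis using ED_wl[OF xs(1) True, of 1] pm.subsp_zero[OF Pb]
    by (intro bexI[of _ "single (wl xs) 1"]) (simp_all add: tau_wl pm.sc_one)
  next
   case False
   hence "tw xs : Pb j" using tw_Ph[OF xs(1) order_refl] Ph_Pb[of "degsum xs" j] xs(2) by auto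
   thus ?thesis using pm.subsp_zero[OF e] by (intro bexI[of _ 0]) (simp_all add: tau_simps)
  qed
  have 2: "\<exists>u\<in>ED n j. w - \<tau> u : Pb j" if "w : Nul" for w
   using that Nul_Pb pm.subsp_zero[OF e] by (intro bexI[of _ 0]) (auto simp: tau_simps)
  show "tw ` {xs. ok_word n xs \<and> degsum xs <= j} \<union> Nul
    <= {w. \<exists>u\<in>ED n j. w - \<tau> u : Pb j}" using 1 2 by blast
 qed
 moreover obtain w where w: "w : Ph j" "x = kap j w" using assms piece_simps(1) by auto
 ultimately obtain u where u: "u : ED n j" "w - \<tau> u : Pb j" by blast
 hence "kap j w = kap j (\<tau> u)" using piece_eq[OF w(1) tau_ED[OF u(1) order_refl]] by blast
 thus ?thesis using w(2) u(1) by blast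
qed

lemma pi_homog:
 assumes "\<And>i. i : A ==> u i : ED n i" and A: "finite A"
 shows "\<pi> (\<Sum>i\<in>A. u i) j = (if j : A then kap j (\<tau> (u j)) else kap j 0)"
proof -
 have uf: "(\<Sum>i\<in>A. u i) : FW L" using assms by (intro pm.subsp_sum[OF FW_subsp] ED_fw)
 have "(\<Sum>i\<in>A. bt j (u i) - (if j = i then u i else 0)) : Kenv"
  by (rule pm.subsp_sum[OF K_subsp[OF Kenv]], rule bt_homog[OF Kenv]) (rule assms)
 hence "\<tau> (bt j (\<Sum>i\<in>A. u i)) - \<tau> (if j : A then u j else 0) : Nul"
  using tau_Kenv A by (simp add: bt_sum sum_subtractf flip: tau_simps(3))
 moreover have "\<tau> (if j : A then u j else 0) : Ph j"
  using tau_ED[OF assms(1) order_refl] pm.subsp_zero[OF Ph] by (simp add: tau_simps)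
 ultimately have "kap j (\<tau> (bt j (\<Sum>i\<in>A. u i))) = kap j (\<tau> (if j : A then u j else 0))"
  using piece_eq[OF tau_bt[OF uf]] Nul_Pb by blast
 thus ?thesis by (simp add: \<pi>_def tau_simps)
qed

text \<open>For surjectivity, the finitely many nonzero components of an element have homogeneous
  representatives, and their sum is a preimage because \<open>bt\<close> separates degrees.\<close>

theorem gr_presents: "fw.presents L \<pi> gr K1"
proof -
 have rec: "\<zero>\<^bsub>gr\<^esub> = (\<lambda>j. kap j 0)" "g \<oplus>\<^bsub>gr\<^esub> h = (\<lambda>j. g j \<oplus>\<^bsub>graded_piece M F j\<^esub> h j)"
  "c \<odot>\<^bsub>gr\<^esub> g = (\<lambda>j. c \<odot>\<^bsub>graded_piece M F j\<^esub> g j)" for g h c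
  by (simp_all add: associated_graded_def piece_simps)
 have car: "g : carrier gr \<longleftrightarrow> (\<forall>j. g j : kap j ` Ph j) \<and> finite {j. g j ~= kap j 0}" for g
  by (simp add: associated_graded_def piece_simps)
 have pi0: "\<pi> 0 = (\<lambda>j. kap j 0)" by (rule ext) (simp add: \<pi>_def tau_simps)
 have "carrier gr = \<pi> ` FW L"
 proof (rule subset_antisym; rule subsetI)
  fix g assume g: "g : carrier gr"
  let ?A = "{j. g j ~= kap j 0}"
  have "\<exists>u\<in>ED n j. g j = kap j (\<tau> u)" for j
   by (rule piece_homog) (use g in \<open>simp add: car piece_simps(1)\<close>)
  then obtain u where u: "\<And>j. u j : ED n j" "\<And>j. g j = kap j (\<tau> (u j))" by metis
  have fin: "finite ?A" using g car by blast
  have "g = \<pi> (\<Sum>i\<in>?A. u i)"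
  proof
   fix j show "g j = \<pi> (\<Sum>i\<in>?A. u i) j" unfolding pi_homog[OF u(1) fin] using u(2)[of j] by simp
  qed
  moreover have "(\<Sum>i\<in>?A. u i) : FW L" by (intro pm.subsp_sum[OF FW_subsp] ED_fw[OF u(1)])
  ultimately show "g : \<pi> ` FW L" by (rule image_eqI)
 next
  fix g assume "g : \<pi> ` FW L"
  then obtain u where u: "u : FW L" "g = \<pi> u" by blast
  thus "g : carrier gr" using tau_bt[OF u(1)] pi_support[OF u(1)] by (simp add: car) (simp add: \<pi>_def)
 qed
 moreover have "\<pi> u = \<pi> 0 \<longleftrightarrow> u : K1" if u: "u : FW L" for u
 proof -
  have "\<pi> u = \<pi> 0 \<longleftrightarrow> (\<forall>j. kap j (\<tau> (bt j u)) = kap j 0)" unfolding pi0 fun_eq_iff \<pi>_def ..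
  also have "... \<longleftrightarrow> u : K1" using u piece_ker[OF tau_bt[OF u]] by (simp add: K1_def)
  finally show ?thesis .
 qed
 moreover have "\<pi> u \<oplus>\<^bsub>gr\<^esub> \<pi> w = \<pi> (u + w)" if "u : FW L" "w : FW L" for u w
  unfolding rec by (rule ext) (simp add: \<pi>_def piece_add[OF tau_bt[OF that(1)] tau_bt[OF that(2)]] bt_add tau_simps)
 moreover have "c \<odot>\<^bsub>gr\<^esub> \<pi> u = \<pi> (scale_pm c u)" if "u : FW L" for u c
  unfolding rec by (rule ext) (simp add: \<pi>_def piece_smult[OF tau_bt[OF that]] bt_scale tau_simps)
 ultimately show ?thesis unfolding fw.presents_def using gr_act pi0 by (auto simp: rec(1) K1_def)
qed

lemma K1_env: "env_rel L <= K1"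
proof
 fix r assume r: "r : env_rel L"
 hence "\<tau> (bt j r) : Pb j" for j using tau_Kenv[OF bt_enveloping[OF Kenv r]] Nul_Pb by blast
 thus "r : K1" using r cur.enveloping_subset by (auto simp: K1_def)
qed

text \<open>The conditions in degrees other than \<open>d\<close> hold automatically, as those
  components of \<open>u\<close> are zero modulo the enveloping relations.\<close>

lemma K1_homog:
 assumes u: "u : ED n d" and "\<tau> u : Pb d"
 shows "u : K1"
proof -
 have "\<tau> (bt j u) : Pb j" for j
 proof -
  have "\<tau> (bt j u) - \<tau> (if j = d then u else 0) : Nul"
   using tau_Kenv[OF bt_homog[OF Kenv u, of j]] by (simp add: tau_simps)
  hence "\<tau> (bt j u) - \<tau> (if j = d then u else 0) : Pb j" using Nul_Pb by blast
  thus ?thesis using assms(2) pm.subsp_cong[OF Pb] by (cases "j = d") (auto simp: tau_simps)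
 qed
 thus ?thesis using ED_fw[OF u] by (simp add: K1_def)
qed

lemma fusion_product_gr: "fusion_product n {1..k} z V v = gr"
proof -
 have "E = (\<lambda>i. evaluation_module (z i) (V i))" by (rule ext) (simp add: E_def)
 thus ?thesis by (simp add: fusion_product_def Let_def J_def)
qed

end



section \<open>Divided power sums\<close>

abbreviation yl :: "'a => nat list => ('a \<times> nat) list" where
 "yl y l \<equiv> map (\<lambda>t. (y, t)) l"

definition sum_lists :: "nat => nat => nat list set" where
 "sum_lists q s = {l. length l = q \<and> sum_list l = s}"

text \<open>The increasing list with multiplicities \<open>b\<close>, which is the order of the
  factors in \<open>divided_power_sum\<close>.\<close>

definition sorted_word :: "(nat => nat) => nat => nat list" where
 "sorted_word b k = concat (map (\<lambda>i. replicate (b i) i) [0..<k])"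

lemma sorted_word:
 "length (sorted_word b k) = (\<Sum>i<k. b i)" "sum_list (sorted_word b k) = (\<Sum>i<k. i * b i)"
 "count_list (sorted_word b k) j = (if j < k then b j else 0)"
proof -
 have "count_list (replicate a i) j = (if i = j then a else 0)" for a i j :: nat by (induction a) auto
 thus "length (sorted_word b k) = (\<Sum>i<k. b i)" "sum_list (sorted_word b k) = (\<Sum>i<k. i * b i)"
  "count_list (sorted_word b k) j = (if j < k then b j else 0)" by (induction k) (auto simp: sorted_word_def sum_list_replicate)
qed

lemma S_set_sorted_word:
 assumes b: "b : S_set q s"
 shows "sorted_word b (Suc s) : sum_lists q s" "count_list (sorted_word b (Suc s)) = b"
proof -
 have fin: "finite {i. b i ~= 0}" and b1: "(\<Sum>i | b i ~= 0. b i) = q" and b2: "(\<Sum>i | b i ~= 0. i * b i) = s"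
  using b by (auto simp: S_set_def)
 have le: "i <= s" if "b i ~= 0" for i
 proof -
  have "i * b i <= s" unfolding b2[symmetric] by (rule member_le_sum) (use that fin in auto)
  moreover have "i * 1 <= i * b i" using that by (intro mult_le_mono2) auto
  ultimately show ?thesis by linarith
 qed
 have sub: "{i. b i ~= 0} <= {..<Suc s}" using le by (auto simp: less_Suc_eq_le)
 have "(\<Sum>i<Suc s. b i) = q" unfolding b1[symmetric] by (rule sum.mono_neutral_right[OF _ sub]) auto
 moreover have "(\<Sum>i<Suc s. i * b i) = s"
  using sum.mono_neutral_right[OF finite_lessThan sub, of "\<lambda>i. i * b i"] b2 by simp
 ultimately show "sorted_word b (Suc s) : sum_lists q s" by (simp add: sum_lists_def sorted_word)
 show "count_list (sorted_word b (Suc s)) = b" by (rule ext) (use le in \<open>force simp: sorted_word less_Suc_eq_le\<close>)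
qed

lemma count_list_S_set:
 assumes "l : sum_lists q s"
 shows "count_list l : S_set q s"
proof -
 have e: "{i. count_list l i ~= 0} = set l" by (auto simp: count_list_0_iff)
 show ?thesis using assms sum_count_set[of l "set l"] sum_list_map_eq_sum_count[of "\<lambda>i. i" l]
  by (simp add: S_set_def sum_lists_def e[unfolded neq0_conv] mult.commute)
qed

lemma finite_sum_lists: "finite (sum_lists q s)"
proof (rule finite_subset)
 show "sum_lists q s <= {l. set l <= {..s} \<and> length l = q}" by (auto simp: sum_lists_def dest: member_le_sum_list)
 show "finite {l. set l <= {..s} \<and> length l = q}" by (rule finite_lists_length_eq) simp
qed

lemma finite_S_set: "finite (S_set q s)"
proof (rule finite_subset[OF _ finite_imageI[OF finite_sum_lists[of q s], of count_list]])
 show "S_set q s <= count_list ` sum_lists q s" using S_set_sorted_word by (metis image_eqI subsetI)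
qed

text \<open>The lists in question are the rearrangements of one multiset, counted by a multinomial
  coefficient; its denominators are those of the divided powers.\<close>

lemma card_words:
 assumes b: "b : S_set q s"
 shows "of_nat (card {l : sum_lists q s. count_list l = b}) = (fact q * (\<Prod>i\<le>s. 1 / fact (b i)) :: complex)"
proof -
 let ?w = "sorted_word b (Suc s)"
 note w = S_set_sorted_word[OF b]
 have "{l : sum_lists q s. count_list l = b} = permutations_of_multiset (mset ?w)"
 proof -
  have "count_list l = b \<longleftrightarrow> mset l = mset ?w" for l unfolding multiset_eq_iff count_mset fun_eq_iff w(2) ..
  moreover have "l : sum_lists q s" if "mset l = mset ?w" for l
   using that w(1) mset_eq_length[OF that] sum_mset_sum_list[of l] sum_mset_sum_list[of ?w] by (simp add: sum_lists_def)
  ultimately show ?thesis by (auto simp: permutations_of_multiset_def)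
 qed
 moreover have "(\<Prod>x\<in>set_mset (mset ?w). fact (count (mset ?w) x)) = (\<Prod>i\<le>s. fact (b i) :: nat)"
 proof (rule prod.mono_neutral_cong_left)
  have "b x = 0" if "x \<notin> set ?w" for x using that w(2) count_list_0_iff[of ?w x] by simp
  thus "\<forall>i\<in>{..s} - set_mset (mset ?w). fact (b i) = (1 :: nat)" by simp
  have "x <= s" if "x : set ?w" for x
   using that sorted_word(3)[of b "Suc s" x] count_list_0_iff[of ?w x] by (auto split: if_splits)
  thus "set_mset (mset ?w) <= {..s}" by auto
 qed (simp_all add: count_mset w(2))
 ultimately have "card {l : sum_lists q s. count_list l = b} * (\<Prod>i\<le>s. fact (b i)) = fact q"
  using card_permutations_of_multiset_aux[of "mset ?w"] w(1) by (simp add: sum_lists_def)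
 hence "of_nat (card {l : sum_lists q s. count_list l = b}) * (\<Prod>i\<le>s. fact (b i)) = (fact q :: complex)"
  by (metis (mono_tags, lifting) of_nat_fact of_nat_mult of_nat_prod prod.cong)
 thus ?thesis by (simp add: prod_dividef field_simps)
qed

text \<open>A sum over ordered lists instead of multisets: modulo commutation of the letters it is
  \<open>fact q\<close> times the divided power sum.\<close>

definition word_sum :: "complex mat => nat => nat => (cwords)" where
 "word_sum y q s = (\<Sum>l\<in>sum_lists q s. single (wl (yl y l)) 1)"

lemma wl_append [simp]: "wl (us @ vs) = wl us @ wl vs"
 by (simp add: wl_def)

lemma divided_power_sum_words:
 "divided_power_sum y q s = (\<Sum>b\<in>S_set q s. single (wl (yl y (sorted_word b (Suc s)))) (\<Prod>i\<le>s. 1 / fact (b i)))"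
 by (simp add: divided_power_sum_def sorted_word_def wl_def map_concat comp_def)

lemma yl_sp: "y : spc n ==> fst ` set (yl y l) <= spc n"
 by auto

lemma word_sum_ED: "y : spc n ==> word_sum y q s : ED n s"
 unfolding word_sum_def by (rule pm.subsp_sum[OF ED_subsp], rule ED_wl[OF yl_sp]) (auto simp: sum_lists_def comp_def)

lemma divided_power_sum_ED:
 assumes y: "y : spc n"
 shows "divided_power_sum y q s : ED n s"
 unfolding divided_power_sum_words
proof (rule pm.subsp_sum[OF ED_subsp], rule ED_wl[OF yl_sp[OF y]])
 fix b assume "b : S_set q s"
 thus "sum_list (map snd (yl y (sorted_word b (Suc s)))) = s"
  using S_set_sorted_word(1)[of b q s] by (simp add: sum_lists_def comp_def)
qed

context
 fixes n :: nat and K :: "(cwords) set" and y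
 assumes K: "fw.stable (CA n) K" "env_rel (CA n) <= K" and y: "y : spc n"
begin

private lemma s: "pm.subsp K" by (rule K_subsp[OF K])

lemma yl_fw: "single (wl (yl y l)) c : FW (CA n)"
 by (rule fw_cur[OF wl_cur[OF yl_sp[OF y]]])

lemma letters_commute:
 "single (wl (yl y (us @ a # vs))) 1 - single (wl (yl y (a # us @ vs))) 1 : K"
proof (induction us)
 case Nil
 thus ?case using pm.subsp_zero[OF s] by simp
next
 case (Cons b us)
 let ?u = "single (wl (yl y (us @ vs))) 1"
 have "br y y = 0\<^sub>m (2 * n) (2 * n)" by (rule eq_matI) (use sp_dims[OF y] in auto)
 hence "wact (tt (br y y) (b + a)) ?u : K" using K_tensor_zero[OF K yl_fw[of "us @ vs" 1], of "b + a"] by simp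
 moreover have "wact (tt (br y y) (b + a)) ?u - (wact (tt y b) (wact (tt y a) ?u) - wact (tt y a) (wact (tt y b) ?u)) : K"
  unfolding tensor_t_bracket[OF y y] by (rule K_bracket[OF K tensor_t_cur[OF y] tensor_t_cur[OF y] yl_fw])
 ultimately have "wact (tt y b) (wact (tt y a) ?u) - wact (tt y a) (wact (tt y b) ?u) : K" using pm.subsp_cong[OF s] by blast
 from pm.subsp_add[OF s K_wact[OF K tensor_t_cur[OF y, of b] Cons.IH] this]
 show ?case by (simp add: wact_diff)
qed

lemma words_mset: "mset l = mset l' ==> single (wl (yl y l)) 1 - single (wl (yl y l')) 1 : K"
proof (induction l arbitrary: l')
 case Nil
 thus ?case using pm.subsp_zero[OF s] by simp
next
 case (Cons a l)
 have "a : set l'" using Cons.prems by (metis list.set_intros(1) set_mset_mset)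
 then obtain us vs where l': "l' = us @ a # vs" by (meson split_list)
 hence "mset l = mset (us @ vs)" using Cons.prems by simp
 from pm.subsp_diff[OF s K_wact[OF K tensor_t_cur[OF y, of a] Cons.IH[OF this]] letters_commute[of us a vs]]
 show ?case by (simp add: l' wact_diff)
qed

lemma word_sum_divided_power: "word_sum y q s - scale_pm (fact q) (divided_power_sum y q s) : K"
proof -
 let ?A = "\<lambda>b. {l : sum_lists q s. count_list l = b}"
 let ?w = "\<lambda>b c :: complex. single (wl (yl y (sorted_word b (Suc s)))) c"
 have "word_sum y q s = (\<Sum>b\<in>S_set q s. \<Sum>l\<in>?A b. single (wl (yl y l)) 1)" unfolding word_sum_def
  by (rule sum.group[symmetric, OF finite_sum_lists finite_S_set]) (use count_list_S_set in blast)
 moreover have "scale_pm (fact q) (divided_power_sum y q s) = (\<Sum>b\<in>S_set q s. \<Sum>l\<in>?A b. ?w b 1)"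
 proof -
  have "?w b (fact q * (\<Prod>i\<le>s. 1 / fact (b i))) = (\<Sum>l\<in>?A b. ?w b 1)" if "b : S_set q s" for b
   using card_words[OF that] by (simp flip: single_sum)
  thus ?thesis unfolding divided_power_sum_words pm.sc_sum scale_pm_single by (intro sum.cong refl)
 qed
 moreover have "(\<Sum>b\<in>S_set q s. \<Sum>l\<in>?A b. single (wl (yl y l)) 1 - ?w b 1) : K"
 proof (intro pm.subsp_sum[OF s] words_mset)
  fix b l assume b: "b : S_set q s" and l: "l : ?A b"
  thus "mset l = mset (sorted_word b (Suc s))" using S_set_sorted_word(2)[OF b] by (simp add: multiset_eq_iff count_mset)
 qed
 ultimately show ?thesis by (simp add: sum_subtractf)
qed

lemma words_smult:
 "single (wl (yl (c \<cdot>\<^sub>m y) l)) 1 - scale_pm (c ^ length l) (single (wl (yl y l)) 1) : K"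
proof (induction l)
 case Nil
 thus ?case using pm.subsp_zero[OF s] by (simp add: pm.sc_one)
next
 case (Cons t l)
 let ?u = "single (wl (yl (c \<cdot>\<^sub>m y) l)) 1" and ?w = "single (wl (yl y l)) 1"
 have u: "?u : FW (CA n)" by (rule fw_cur[OF wl_cur[OF yl_sp[OF sp_smult[OF y]]]])
 have "wact (tt (c \<cdot>\<^sub>m y) t) ?u - scale_pm c (wact (tt y t) ?u) : K"
  unfolding tensor_t_smult by (rule K_smult[OF K tensor_t_cur[OF y] u])
 from pm.subsp_add[OF s this pm.subsp_sc[OF s K_wact[OF K tensor_t_cur[OF y, of t] Cons.IH], of c]]
 show ?case by (simp add: wact_diff wact_scale pm.sc_diff pm.sc_sc)
qed

lemma word_sum_smult: "word_sum (c \<cdot>\<^sub>m y) q s - scale_pm (c ^ q) (word_sum y q s) : K"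
proof -
 have "(\<Sum>l\<in>sum_lists q s. single (wl (yl (c \<cdot>\<^sub>m y) l)) 1 - scale_pm (c ^ q) (single (wl (yl y l)) 1)) : K"
  by (rule pm.subsp_sum[OF s]) (use words_smult in \<open>auto simp: sum_lists_def\<close>)
 thus ?thesis by (simp add: word_sum_def sum_subtractf pm.sc_sum)
qed

end

section \<open>Lowering root vectors and the defining relations in the fusion product\<close>

lemma root_first_zero:
 assumes "\<alpha> : pos_roots n"
 shows "\<delta>1_coroot n \<alpha> = (if fst (root_pair n \<alpha>) = 0 then 1 else 0)"
 using assms by (auto simp: pos_roots_def \<delta>1_coroot_simps)

text \<open>If the coroot sees \<open>\<delta> 1\<close>, the root vector sits in the first column
  and is a multiple of a letter; otherwise it is parabolic and kills the highest weight
  vector.\<close>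

lemma xm_cases:
 assumes ch: "chevalley_generators n xp xm" and \<alpha>: "\<alpha> : pos_roots n"
 shows "(\<delta>1_coroot n \<alpha> = 1 \<and> (\<exists>a c. 0 < a \<and> a < 2 * n \<and> c ~= 0 \<and> xm \<alpha> = c \<cdot>\<^sub>m ym n a)) \<or>
  (\<delta>1_coroot n \<alpha> = 0 \<and> par n (xm \<alpha>) \<and> xm \<alpha> $$ (0, 0) = 0)"
proof -
 obtain a b where rp: "root_pair n \<alpha> = (a, b)" by force
 note ab = root_pair_less[OF \<alpha> rp]
 obtain c where c: "c ~= 0" "xm \<alpha> = c \<cdot>\<^sub>m gm n b a" using chevalley_gm(2)[OF ch \<alpha> rp] by blast
 show ?thesis
 proof (cases "a = 0")
  case True
  \<comment> \<open>The factor 2 compensates for the factor 1/2 in \<open>ym n n\<close>.\<close>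
  have "xm \<alpha> = (if b = n then 2 * c else c) \<cdot>\<^sub>m ym n b"
   by (rule eq_matI) (use c(2) True in \<open>auto simp: ym_def gm_def\<close>)
  thus ?thesis using c(1) ab True root_first_zero[OF \<alpha>] by (intro disjI1 conjI exI[of _ b] exI[of _ "if b = n then 2 * c else c"]) (auto simp: rp)
 next
  case False
  have "b ~= n" using \<alpha> rp False by (auto simp: pos_roots_def)
  hence "cj n b ~= 0" using ab by (auto simp: cj_def split: if_splits)
  hence "gm n b a $$ (i, 0) = 0" if "i < 2 * n" for i using that False by (simp add: gm_index)
  hence "xm \<alpha> $$ (i, 0) = 0" if "i < 2 * n" for i
   using that by (simp add: c(2) index_smult_mat carrier_matD[OF gm_carrier])
  thus ?thesis using xp_xm_sp(2)[OF ch \<alpha>] root_first_zero[OF \<alpha>] False ab by (auto simp: par_def rp)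
 qed
qed

context fusion_setup begin

definition "NN = (\<Sum>j\<in>J. m j)"

lemma K1_stable: "fw.stable L K1"
 by (rule fw.pres_K_stable[OF gr_presents])

lemma tau_single_tw: "\<tau> (single (wl (yl y l)) 1) = tw (yl y l)"
 by (simp add: tau_wl pm.sc_one)

lemma qser_0: "fps_nth (qser J z m q) 0 = 1"
proof -
 have "fps_nth (\<Prod>j\<in>A. lf (z j) ^ min q (m j)) 0 = 1" if "finite A" for A
  using that by (induction A rule: finite_induct) (simp_all add: fps_power_zeroth lf_nth)
 thus ?thesis using finI by (simp add: qser_def)
qed

text \<open>In the deformed relation the lists of sum \<open>s\<close> have coefficient 1, the
  constant term of \<open>qser\<close>; all other lists have smaller degree and vanish in the graded
  piece.\<close>

lemma tau_word_sum:
 assumes a: "0 < a" "a < 2 * n" and q: "(\<Sum>j\<in>J. min q (m j)) < q + s"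
 shows "\<tau> (word_sum (ym n a) q s) : Pb s"
proof -
 let ?w = "\<lambda>l. scale_pm (fps_nth (qser J z m q) (s - sum_list l)) (tw (yl (ym n a) l))"
 let ?B = "{l : expo_lists q s. sum_list l < s}"
 have "expo_lists q s = sum_lists q s \<union> ?B" by (auto simp: expo_lists_def sum_lists_def)
 moreover have "finite (expo_lists q s)"
 proof (rule finite_subset)
  show "expo_lists q s <= (\<Union>t\<le>s. sum_lists q t)" by (auto simp: expo_lists_def sum_lists_def)
 qed (simp add: finite_sum_lists)
 moreover have "sum_lists q s \<inter> ?B = {}" by (auto simp: sum_lists_def)
 ultimately have "(\<Sum>l\<in>expo_lists q s. ?w l) = (\<Sum>l\<in>sum_lists q s. ?w l) + (\<Sum>l\<in>?B. ?w l)"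
  using sum.union_disjoint[of "sum_lists q s" ?B ?w] finite_sum_lists by simp
 moreover have "(\<Sum>l\<in>sum_lists q s. ?w l) = \<tau> (word_sum (ym n a) q s)" unfolding word_sum_def tau_simps tau_single_tw
  by (rule sum.cong) (auto simp: sum_lists_def qser_0 pm.sc_one)
 moreover have B: "(\<Sum>l\<in>?B. ?w l) : Pb s"
 proof (intro pm.subsp_sum[OF Pb] pm.subsp_sc[OF Pb])
  fix l assume l: "l : ?B"
  have "tw (yl (ym n a) l) : Ph (sum_list l)" by (rule tw_Ph[OF yl_sp[OF ym_sp[OF a(2)]]]) (simp add: comp_def)
  thus "tw (yl (ym n a) l) : Pb s" using Ph_Pb[of "sum_list l" s] l by blast
 qed
 ultimately have "\<tau> (word_sum (ym n a) q s) = (\<Sum>l\<in>expo_lists q s. ?w l) - (\<Sum>l\<in>?B. ?w l)" by simp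
 moreover have "(\<Sum>l\<in>expo_lists q s. ?w l) : Pb s" using tens_hom[OF a q] Nul_Pb by blast
 ultimately show ?thesis using pm.subsp_diff[OF Pb _ B] by simp
qed

lemma tw_prefix: "ok_word n us ==> tw vs : Nul ==> tw (us @ vs) : Nul"
 by (induction us) (auto intro: ta_Nul)

lemma tw_par:
 assumes X: "par n X" "X $$ (0, 0) = 0" and l: "l ~= []"
 shows "tw (yl X l) : Nul"
proof -
 obtain us t where "l = us @ [t]" using l by (metis rev_exhaust)
 moreover have "tw [(X, t)] : Nul" using tens_par[OF X(1), of t] X(2) by simp
 moreover have "X : spc n" using X(1) by (simp add: par_def)
 ultimately show ?thesis using tw_prefix[OF yl_sp[of X n us], of "[(X, t)]"] by simp
qed

lemma tau_word_sum_xm: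
 assumes \<alpha>: "\<alpha> : pos_roots n" and q: "(\<Sum>j\<in>J. min q (m j * \<delta>1_coroot n \<alpha>)) < q + s" and q1: "1 <= q"
 shows "\<tau> (word_sum (xm \<alpha>) q s) : Pb s"
 using xm_cases[OF ch \<alpha>]
proof
 assume "\<delta>1_coroot n \<alpha> = 1 \<and> (\<exists>a c. 0 < a \<and> a < 2 * n \<and> c ~= 0 \<and> xm \<alpha> = c \<cdot>\<^sub>m ym n a)"
 then obtain a c where d: "\<delta>1_coroot n \<alpha> = 1" and a: "0 < a" "a < 2 * n" and c: "xm \<alpha> = c \<cdot>\<^sub>m ym n a" by blast
 have "\<tau> (word_sum (xm \<alpha>) q s) - scale_pm (c ^ q) (\<tau> (word_sum (ym n a) q s)) : Pb s"
  using tau_Kenv[OF word_sum_smult[OF Kenv ym_sp[OF a(2)], of c q s]] Nul_Pb by (auto simp: c tau_simps)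
 moreover have "scale_pm (c ^ q) (\<tau> (word_sum (ym n a) q s)) : Pb s"
  by (rule pm.subsp_sc[OF Pb tau_word_sum[OF a]]) (use q d in simp)
 ultimately show ?thesis using pm.subsp_cong[OF Pb] by blast
next
 assume a: "\<delta>1_coroot n \<alpha> = 0 \<and> par n (xm \<alpha>) \<and> xm \<alpha> $$ (0, 0) = 0"
 show ?thesis unfolding word_sum_def tau_simps tau_single_tw
 proof (rule pm.subsp_sum[OF Pb])
  fix l assume "l : sum_lists q s"
  hence "l ~= []" using q1 by (auto simp: sum_lists_def)
  thus "tw (yl (xm \<alpha>) l) : Pb s" using tw_par a Nul_Pb by blast
 qed
qed

lemma word_sum_0: "word_sum y q 0 = single (wl (yl y (replicate q 0))) 1"
proof -
 have "sum_lists q 0 = {replicate q 0}" by (auto simp: sum_lists_def intro!: replicate_eqI)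
 thus ?thesis by (simp add: word_sum_def)
qed

lemma dps_K1:
 assumes \<alpha>: "\<alpha> : pos_roots n" and q: "(\<Sum>j\<in>J. min q (m j * \<delta>1_coroot n \<alpha>)) < q + s" and q1: "1 <= q"
 shows "divided_power_sum (xm \<alpha>) q s : K1"
proof (rule K1_homog[OF divided_power_sum_ED])
 show x: "xm \<alpha> : spc n" by (rule xp_xm_sp[OF ch \<alpha>])
 have "\<tau> (word_sum (xm \<alpha>) q s) - scale_pm (fact q) (\<tau> (divided_power_sum (xm \<alpha>) q s)) : Pb s"
  using tau_Kenv[OF word_sum_divided_power[OF Kenv x, of q s]] Nul_Pb by (auto simp: tau_simps)
 from pm.subsp_diff[OF Pb tau_word_sum_xm[OF assms] this]
 have "scale_pm (fact q) (\<tau> (divided_power_sum (xm \<alpha>) q s)) : Pb s" by simp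
 from pm.subsp_sc[OF Pb this, of "1 / fact q"] show "\<tau> (divided_power_sum (xm \<alpha>) q s) : Pb s"
  by (simp add: pm.sc_sc pm.sc_one)
qed

lemma tens_cartan:
 assumes h: "h : cartan n"
 shows "ta (tt h s) T0 - scale_pm ((\<Sum>j\<in>J. of_nat (m j) * z j ^ s) * \<delta> 1 h) T0 : Nul"
 by (rule tens_eigen) (use h cartan_closed(2) hw in \<open>auto simp: highest_weight_vector_def J_def\<close>)

lemma tens_n_plus:
 assumes X: "X : n_plus n xp"
 shows "ta (tt X s) T0 : Nul"
proof -
 have "act (V j) X (v j) = (of_nat (m j) * 0) \<odot>\<^bsub>V j\<^esub> v j" if j: "j : J" for j
 proof -
  interpret hw_rep n "m j" xp xm "V j" "v j" by (rule rep[OF j])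
  show ?thesis using hw X V.smult_l_null[OF v(1)] by (auto simp: highest_weight_vector_def)
 qed
 thus ?thesis using tens_eigen[of X 0 s] X n_plus_closed(1)[OF ch] by auto
qed

lemma weyl_K1: "weyl_relations n xp xm NN <= K1"
proof -
 have "single [X] 1 : K1" if X: "X : currents n (n_plus n xp)" for X
 proof -
  have Xc: "X : cur n" using X n_plus_closed(1)[OF ch] by (auto simp: cur_iff currents_def)
  have "\<tau> (bt j (single [X] 1)) : Pb j" for j
  proof -
   have "(\<Sum>r\<le>j. wact (tt (mat_coeff r X) r) (bw [] (j - r))) = (\<Sum>r\<le>j. if r = j then single [tt (mat_coeff j X) j] 1 else 0)"
    by (rule sum.cong) auto
   hence "\<tau> (bt j (single [X] 1)) = ta (tt (mat_coeff j X) j) T0"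
    using tau_wl[of "[(mat_coeff j X, j)]" 1] by (simp add: bt_single pm.sc_one)
   thus ?thesis using tens_n_plus[of "mat_coeff j X" j] X Nul_Pb by (auto simp: currents_def)
  qed
  thus ?thesis using fw_cur[of "[X]" n] Xc by (simp add: K1_def)
 qed
 moreover have "single [tt h r] 1 - single [] (of_nat NN * \<delta> 1 h * (if r = 0 then 1 else 0)) : K1" if h: "h : cartan n" for h r
 proof (rule K1_homog)
  have hs: "h : spc n" using h cartan_closed(2) by blast
  show "single [tt h r] 1 - single [] (of_nat NN * \<delta> 1 h * (if r = 0 then 1 else 0)) : ED n r"
   using ED_wl[of "[(h, r)]" n r 1] ED_wl[of "[]" n 0] hs pm.subsp_zero[OF ED_subsp[of n]]
   by (intro pm.subsp_diff[OF ED_subsp]) auto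
  have t: "\<tau> (single [tt h r] 1) = ta (tt h r) T0" "\<tau> (single [] c) = scale_pm c T0" for c
   using tau_wl[of "[(h, r)]" 1] tau_wl[of "[]" c] by (simp_all add: pm.sc_one)
  have e: "\<tau> (single [tt h r] 1 - single [] (of_nat NN * \<delta> 1 h * (if r = 0 then 1 else 0))) =
    ta (tt h r) T0 - scale_pm (of_nat NN * \<delta> 1 h * (if r = 0 then 1 else 0)) T0" by (simp only: tau_simps t)
  show "\<tau> (single [tt h r] 1 - single [] (of_nat NN * \<delta> 1 h * (if r = 0 then 1 else 0))) : Pb r"
  proof (cases "r = 0")
   case True
   hence "of_nat NN * \<delta> 1 h * (if r = 0 then 1 else 0) = (\<Sum>j\<in>J. of_nat (m j) * z j ^ r) * \<delta> 1 h"
    by (simp add: NN_def)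
   thus ?thesis unfolding e using tens_cartan[OF h, of r] Nul_Pb by (simp only: subset_iff)
  next
   case False
   \<comment> \<open>The cyclic tensor has degree 0, so for positive \<open>r\<close> the eigenvalue
     of \<open>tensor_t h r\<close> is invisible in the graded piece.\<close>
   have "T0 : Ph 0" using tw_Ph[of "[]" 0] by simp
   hence "T0 : Pb r" using Ph_Pb[of 0 r] False by auto
   hence "scale_pm ((\<Sum>j\<in>J. of_nat (m j) * z j ^ r) * \<delta> 1 h) T0 : Pb r" by (rule pm.subsp_sc[OF Pb])
   moreover have "ta (tt h r) T0 - scale_pm ((\<Sum>j\<in>J. of_nat (m j) * z j ^ r) * \<delta> 1 h) T0 : Pb r"
    using tens_cartan[OF h] Nul_Pb by blast
   ultimately have "ta (tt h r) T0 : Pb r" using pm.subsp_cong[OF Pb] by blast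
   thus ?thesis unfolding e using False by simp
  qed
 qed
 moreover have "single (replicate (NN * \<delta>1_coroot n \<alpha> + 1) (tensor_poly (xm \<alpha>) 1)) 1 : K1" if \<alpha>: "\<alpha> : pos_roots n" for \<alpha>
 proof -
  let ?q = "NN * \<delta>1_coroot n \<alpha> + 1"
  \<comment> \<open>The power relation is a word sum with \<open>s = 0\<close>, and its exponent
    exceeds the sum of the minima.\<close>
  have "single (replicate ?q (tensor_poly (xm \<alpha>) 1)) 1 = word_sum (xm \<alpha>) ?q 0"
   by (simp add: word_sum_0 wl_def map_replicate_const del: replicate_Suc)
  moreover have "(\<Sum>j\<in>J. min ?q (m j * \<delta>1_coroot n \<alpha>)) <= (\<Sum>j\<in>J. m j * \<delta>1_coroot n \<alpha>)" by (rule sum_mono) simp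
  hence "(\<Sum>j\<in>J. min ?q (m j * \<delta>1_coroot n \<alpha>)) < ?q + 0" by (simp add: NN_def sum_distrib_right)
  hence "word_sum (xm \<alpha>) ?q 0 : K1"
   by (intro K1_homog[OF word_sum_ED] tau_word_sum_xm \<alpha> xp_xm_sp[OF ch \<alpha>]) simp_all
  ultimately show ?thesis by simp
 qed
 ultimately show ?thesis unfolding weyl_relations_def by blast
qed

end



section \<open>Relations in the quotient of the local Weyl module\<close>

context fusion_setup begin

definition "dps_relations = {divided_power_sum (xm \<alpha>) r s | \<alpha> r s. \<alpha> : pos_roots n \<and> 1 <= r \<and> 1 <= s \<and>
 (\<exists>p. s + r \<ge> 1 + r * p + (\<Sum>j = p + 1..k. m j * \<delta>1_coroot n \<alpha>))}"

text \<open>The inner hull is the kernel for the local Weyl module, and the outer one adds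
  \<open>fusion_ideal\<close>; the nesting mirrors the iterated quotient.\<close>

definition "K2 = fw.ghull L (fw.ghull L (env_rel L \<union> weyl_relations n xp xm NN) \<union> dps_relations)"

lemma weyl_fw: "weyl_relations n xp xm NN <= FW L"
 using weyl_K1 by (auto simp: K1_def)

lemma sum_J_split:
 fixes f :: "nat => nat"
 assumes "p <= k"
 shows "sum f J = sum f {1..p} + sum f {p + 1..k}"
 using sum.ub_add_nat[of 1 p f "k - p"] assms by (simp add: J_def)

text \<open>Each minimum is at most \<open>r\<close> for \<open>j\<close> up to \<open>p\<close> and
  at most \<open>M j\<close> beyond; if \<open>p > k\<close>, the bound by \<open>r\<close> alone is
  enough.\<close>

lemma fusion_bound:
 fixes M :: "nat => nat"
 assumes "s + r \<ge> 1 + r * p + (\<Sum>j = p + 1..k. M j)"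
 shows "(\<Sum>j\<in>J. min r (M j)) < r + s"
proof (cases "p <= k")
 case True
 have "(\<Sum>j\<in>{1..p}. min r (M j)) <= (\<Sum>j\<in>{1..p}. r)" by (rule sum_mono) simp
 moreover have "(\<Sum>j = p + 1..k. min r (M j)) <= (\<Sum>j = p + 1..k. M j)" by (rule sum_mono) simp
 ultimately show ?thesis using assms sum_J_split[OF True, of "\<lambda>j. min r (M j)"] by (simp add: mult.commute)
next
 case False
 have "(\<Sum>j\<in>J. min r (M j)) <= (\<Sum>j\<in>J. r)" by (rule sum_mono) simp
 also have "... = k * r" by (simp add: J_def)
 also have "... <= r * p" using False by simp
 finally show ?thesis using assms by simp
qed

lemma dps_relations_K1: "dps_relations <= K1"
proof
 fix u assume "u : dps_relations"
 then obtain \<alpha> r s p where u: "u = divided_power_sum (xm \<alpha>) r s" and \<alpha>: "\<alpha> : pos_roots n" and r: "1 <= r"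
  and p: "s + r \<ge> 1 + r * p + (\<Sum>j = p + 1..k. m j * \<delta>1_coroot n \<alpha>)"
  unfolding dps_relations_def by blast
 show "u : K1" unfolding u by (rule dps_K1[OF \<alpha> fusion_bound[OF p] r])
qed

lemma dps_fw: "dps_relations <= FW L"
 using dps_relations_K1 by (auto simp: K1_def)

lemma KW_fw: "env_rel L \<union> weyl_relations n xp xm NN <= FW L"
 using cur.enveloping_subset weyl_fw by blast

lemma KW_stable: "fw.stable L (fw.ghull L (env_rel L \<union> weyl_relations n xp xm NN))"
 by (rule fw.stable_ghull[OF KW_fw])

lemma K2_fw: "fw.ghull L (env_rel L \<union> weyl_relations n xp xm NN) \<union> dps_relations <= FW L"
 using KW_stable dps_fw by (auto simp: fw.stable_def)

lemma K2: "fw.stable L K2" "env_rel L <= K2"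
 and weyl_K2: "weyl_relations n xp xm NN <= K2" and dps_K2: "dps_relations <= K2"
proof -
 show "fw.stable L K2" unfolding K2_def by (rule fw.stable_ghull[OF K2_fw])
 have "fw.ghull L (env_rel L \<union> weyl_relations n xp xm NN) \<union> dps_relations <= K2"
  unfolding K2_def by (rule fw.ghull_subset)
 moreover have "env_rel L \<union> weyl_relations n xp xm NN <= fw.ghull L (env_rel L \<union> weyl_relations n xp xm NN)"
  by (rule fw.ghull_subset)
 ultimately show "env_rel L <= K2" "weyl_relations n xp xm NN <= K2" "dps_relations <= K2" by blast+
qed

lemma K2_K1: "K2 <= K1"
 unfolding K2_def by (intro fw.ghull_least[OF K1_stable] Un_least fw.ghull_least[OF K1_stable] K1_env weyl_K1 dps_relations_K1)

lemma K2_subsp: "pm.subsp K2"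
 by (rule K_subsp[OF K2])

lemma K2_n_plus:
 assumes X: "X : n_plus n xp"
 shows "single [tt X s] 1 : K2"
proof -
 have Xs: "X : mats n" using X n_plus_closed(1)[OF ch] sp_carrierD by blast
 have "tt X s : currents n (n_plus n xp)"
  using X Xs n_plus_closed(2)[OF ch] by (auto simp: currents_def mat_coeff_tensor_t[OF Xs])
 thus ?thesis using weyl_K2 unfolding weyl_relations_def by blast
qed

lemma K2_cartan: "h : cartan n ==>
  single [tt h s] 1 - single [] (of_nat NN * \<delta> 1 h * (if s = 0 then 1 else 0)) : K2"
 using weyl_K2 unfolding weyl_relations_def by blast

lemma coroot_cartan:
 assumes "\<alpha> : pos_roots n"
 shows "coroot n \<alpha> : cartan n" "root_functional \<alpha> (coroot n \<alpha>) = 2"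
proof -
 have m: "H' n i - H' n j = H' n i + (- 1) \<cdot>\<^sub>m H' n j" for i j by (rule eq_matI) auto
 show "coroot n \<alpha> : cartan n" using assms cartan_closed(4,5,6) by (auto simp: pos_roots_def m)
 show "root_functional \<alpha> (coroot n \<alpha>) = 2" using assms by (auto simp: pos_roots_def \<delta>_def H'_index)
qed

text \<open>Here the Weyl power relation has exponent 1, so \<open>xm \<alpha>\<close> kills the
  generator; bracketing with the coroot times \<open>t^s\<close>, whose eigenvalue is -2, produces
  the higher powers of \<open>t\<close>.\<close>

lemma K2_low:
 assumes \<alpha>: "\<alpha> : pos_roots n" and d: "\<delta>1_coroot n \<alpha> = 0"
 shows "single [tt (xm \<alpha>) s] 1 : K2"
proof -
 let ?x = "xm \<alpha>" and ?h = "coroot n \<alpha>" and ?w = "single [] 1 :: cwords"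
 have x: "?x : spc n" by (rule xp_xm_sp(2)[OF ch \<alpha>])
 note h = coroot_cartan[OF \<alpha>]
 have hs: "?h : spc n" using h(1) cartan_closed(2) by blast
 have w: "?w : FW L" by (rule fw_cur) simp
 have "single (replicate (NN * \<delta>1_coroot n \<alpha> + 1) (tensor_poly ?x 1)) 1 : K2"
  using weyl_K2 \<alpha> unfolding weyl_relations_def by blast
 hence x0: "wact (tt ?x 0) ?w : K2" by (simp add: d)
 let ?c = "of_nat NN * \<delta> 1 ?h * (if s = 0 then 1 else 0)"
 have "wact (tt ?x 0) (wact (tt ?h s) ?w - single [] ?c) : K2"
  unfolding wact_single by (rule K_wact[OF K2 tensor_t_cur[OF x] K2_cartan[OF h(1)]])
 moreover have "wact (tt ?x 0) (single [] ?c) : K2" using pm.subsp_sc[OF K2_subsp x0, of ?c] by simp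
 ultimately have 1: "wact (tt ?x 0) (wact (tt ?h s) ?w) : K2" using pm.subsp_cong[OF K2_subsp] by (metis wact_diff)
 have "br ?h ?x = (- 2) \<cdot>\<^sub>m ?x" using ch \<alpha> h by (auto simp: chevalley_generators_def weight_space_def)
 hence "wact (tt ((- 2) \<cdot>\<^sub>m ?x) (s + 0)) ?w - (wact (tt ?h s) (wact (tt ?x 0) ?w) - wact (tt ?x 0) (wact (tt ?h s) ?w)) : K2"
  using K_bracket[OF K2 tensor_t_cur[OF hs, of s] tensor_t_cur[OF x, of 0] w] tensor_t_bracket[OF hs x, of s 0] by metis
 moreover have "wact (tt ?h s) (wact (tt ?x 0) ?w) - wact (tt ?x 0) (wact (tt ?h s) ?w) : K2"
  by (rule pm.subsp_diff[OF K2_subsp K_wact[OF K2 tensor_t_cur[OF hs] x0] 1])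
 ultimately have "wact (tt ((- 2) \<cdot>\<^sub>m ?x) (s + 0)) ?w : K2" using pm.subsp_cong[OF K2_subsp] by blast
 moreover have "wact (tt ((- 2) \<cdot>\<^sub>m ?x) (s + 0)) ?w - scale_pm (- 2) (wact (tt ?x s) ?w) : K2"
  unfolding tensor_t_smult using K_smult[OF K2 tensor_t_cur[OF x, of s] w, of "- 2"] by (simp only: add_0_right)
 ultimately have "scale_pm (- 2) (wact (tt ?x s) ?w) : K2" using pm.subsp_cong[OF K2_subsp] by blast
 from pm.subsp_sc[OF K2_subsp this, of "- 1 / 2"] show ?thesis by simp
qed

text \<open>The counterpart of \<open>tens_par\<close> for vanishing parameters: the weighted power
  sum is then \<open>NN\<close> in degree 0 and zero in positive degree.\<close>

definition "PK X s \<longleftrightarrow> single [tt X s] 1 - single [] (of_nat NN * X $$ (0, 0) * (if s = 0 then 1 else 0)) : K2"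

lemma PK_smult:
 assumes X: "X : spc n" and "PK X s"
 shows "PK (c \<cdot>\<^sub>m X) s"
proof -
 let ?w = "single [] 1 :: cwords"
 have "wact (tt (c \<cdot>\<^sub>m X) s) ?w - scale_pm c (wact (tt X s) ?w) : K2"
  unfolding tensor_t_smult by (rule K_smult[OF K2 tensor_t_cur[OF X] fw_cur]) simp
 define v where "v = of_nat NN * X $$ (0, 0) * (if s = 0 then 1 else 0)"
 from pm.subsp_add[OF K2_subsp \<open>wact _ _ - _ : K2\<close> pm.subsp_sc[OF K2_subsp assms(2)[unfolded PK_def, folded v_def], of c]]
 have "single [tt (c \<cdot>\<^sub>m X) s] 1 - single [] (c * v) : K2" by (simp add: pm.sc_diff v_def[symmetric])
 moreover have "of_nat NN * (c \<cdot>\<^sub>m X) $$ (0, 0) * (if s = 0 then 1 else 0) = c * v"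
  using sp_dims[OF X] n by (simp add: v_def)
 ultimately show ?thesis unfolding PK_def by (simp only:)
qed

lemma PK_add:
 assumes X: "X : spc n" "Y : spc n" and "PK X s" "PK Y s"
 shows "PK (X + Y) s"
proof -
 let ?w = "single [] 1 :: cwords"
 have "wact (tt (X + Y) s) ?w - (wact (tt X s) ?w + wact (tt Y s) ?w) : K2"
  unfolding tensor_t_add[OF X] by (rule K_add[OF K2 tensor_t_cur[OF X(1)] tensor_t_cur[OF X(2)] fw_cur]) simp
 from pm.subsp_add[OF K2_subsp this pm.subsp_add[OF K2_subsp assms(3,4)[unfolded PK_def]]]
 have "single [tt (X + Y) s] 1 - (single [] (of_nat NN * X $$ (0, 0) * (if s = 0 then 1 else 0))
   + single [] (of_nat NN * Y $$ (0, 0) * (if s = 0 then 1 else 0))) : K2" by (simp add: algebra_simps)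
 thus ?thesis using sp_dims[OF X(1)] sp_dims[OF X(2)] n
  unfolding PK_def by (simp only: single_add[symmetric] index_add_mat(1) distrib_left distrib_right)
qed

text \<open>A nonzero entry of a parabolic matrix sits on the diagonal, at a positive root, or at a
  negative root whose coroot does not see \<open>\<delta> 1\<close>; each case is governed by one
  kind of Weyl relation.\<close>

lemma PK_gm:
 assumes X: "par n X" and ab: "a < 2 * n" "b < 2 * n" and ne: "X $$ (a, b) ~= 0"
 shows "PK (gm n a b) s"
proof -
 have Xs: "X : spc n" using X by (simp add: par_def)
 have g: "gm n a b : spc n" by (rule gm_sp[OF ab])
 have hinj: "a = b" if "hgt n a = hgt n b" using that ab by (auto simp: hgt_def split: if_splits)
 have g0: "gm n a b $$ (0, 0) = 0" if "a ~= b" using that n ab by (auto simp: gm_index cj_def split: if_splits)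
 consider "hgt n a = hgt n b" | "hgt n a > hgt n b" | "hgt n b > hgt n a" by linarith
 thus ?thesis
 proof cases
  case 1
  hence "gm n a b : cartan n" using hinj by (intro diagonal_in_cartan[OF g]) (auto simp: gm_index)
  thus ?thesis using K2_cartan[of "gm n a b" s] by (simp add: PK_def \<delta>_def)
 next
  case 2
  obtain \<alpha> c where "\<alpha> : pos_roots n" "gm n a b = c \<cdot>\<^sub>m xp \<alpha>" using gm_upper_chevalley(1)[OF ch ab 2] by blast
  hence "gm n a b : n_plus n xp" using n_plus_closed(4,5)[OF ch] by metis
  moreover have "gm n a b $$ (0, 0) = 0" using g0 2 by auto
  ultimately show ?thesis using K2_n_plus[of "gm n a b" s]
   by (simp only: PK_def mult_zero_right mult_zero_left single_zero diff_zero)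
 next
  case 3
  obtain \<alpha> c where \<alpha>: "\<alpha> : pos_roots n" "gm n a b = c \<cdot>\<^sub>m xm \<alpha>" "root_pair n \<alpha> = (b, a) \<or> root_pair n \<alpha> = (cj n a, cj n b)"
   using gm_upper_chevalley(2)[OF ch ab(2,1) 3] by blast
  have "a ~= b" using 3 by auto
  have "b ~= 0"
  proof
   assume "b = 0"
   hence "0 < a" using \<open>a ~= b\<close> by simp
   thus False using X ab ne \<open>b = 0\<close> by (simp add: par_def)
  qed
  moreover have "cj n a ~= 0"
  proof
   assume c: "cj n a = 0"
   hence "a = n" using n ab by (auto simp: cj_def split: if_splits)
   hence "b ~= n" using \<open>a ~= b\<close> by simp
   hence "0 < cj n b" "cj n b < 2 * n" using ab by (auto simp: cj_def)
   hence "X $$ (cj n b, cj n a) = 0" using X c by (simp add: par_def)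
   thus False using sp_sym[OF Xs ab] ne by simp
  qed
  ultimately have "fst (root_pair n \<alpha>) ~= 0" using \<alpha>(3) by auto
  hence d: "\<delta>1_coroot n \<alpha> = 0" by (simp add: root_first_zero[OF \<alpha>(1)])
  have x: "xm \<alpha> : spc n" by (rule xp_xm_sp(2)[OF ch \<alpha>(1)])
  have "xm \<alpha> $$ (0, 0) = 0" using xm_cases[OF ch \<alpha>(1)] d by simp
  hence "PK (xm \<alpha>) s" using K2_low[OF \<alpha>(1) d] by (simp add: PK_def)
  thus ?thesis unfolding \<alpha>(2) by (rule PK_smult[OF x])
 qed
qed

lemma PK_par:
 assumes X: "par n X"
 shows "PK X s"
proof -
 have "X : spc n" using X by (simp add: par_def)
 thus ?thesis
 proof (induction X rule: sp_gm_induct)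
  case zero
  have "single [tt (0\<^sub>m (2 * n) (2 * n)) s] 1 : K2" using K_tensor_zero[OF K2 fw_cur[of "[]" n 1], of s] by simp
  thus ?case using n by (simp add: PK_def)
 next
  case (add a b c Y)
  show ?case
   by (rule PK_add[OF sp_smult[OF gm_sp[OF add(1,2)]] add(4) PK_smult[OF gm_sp[OF add(1,2)] PK_gm[OF X add(1-3)]] add(5)])
 qed
qed

text \<open>As \<open>m\<close> decreases, the \<open>j\<close> with \<open>q <= m j\<close> form an
  initial segment; its length \<open>p\<close> attains the minimum in the defining
  inequality.\<close>

lemma threshold: "\<exists>p. (\<Sum>j\<in>J. min q (m j)) = q * p + (\<Sum>j = p + 1..k. m j)"
proof -
 define p where "p = (LEAST p. \<forall>j. p < j \<and> j <= k \<longrightarrow> m j < q)"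
 have P: "\<forall>j. k < j \<and> j <= k \<longrightarrow> m j < q" by simp
 have pk: "p <= k" unfolding p_def by (rule Least_le) (rule P)
 have low: "m j < q" if "p < j" "j <= k" for j
  using LeastI[of "\<lambda>p. \<forall>j. p < j \<and> j <= k \<longrightarrow> m j < q" k, OF P] that unfolding p_def[symmetric] by blast
 have high: "q <= m j" if j: "1 <= j" "j <= p" for j
 proof -
  have "p - 1 < (LEAST p. \<forall>j. p < j \<and> j <= k \<longrightarrow> m j < q)" unfolding p_def[symmetric] using j by simp
  then obtain i where i: "p - 1 < i" "i <= k" "\<not> m i < q" using not_less_Least by blast
  hence "i = p" using low[of i] by force
  hence "q <= m p" using i by simp
  also have "m p <= m j" by (rule mono[OF j pk])
  finally show ?thesis .
 qed
 have "(\<Sum>j\<in>{1..p}. min q (m j)) = (\<Sum>j\<in>{1..p}. q)" by (rule sum.cong) (use high in auto)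
 moreover have "(\<Sum>j = p + 1..k. min q (m j)) = (\<Sum>j = p + 1..k. m j)" by (rule sum.cong) (use low in auto)
 ultimately have "(\<Sum>j\<in>J. min q (m j)) = q * p + (\<Sum>j = p + 1..k. m j)"
  using sum_J_split[OF pk, of "\<lambda>j. min q (m j)"] by simp
 thus ?thesis ..
qed

lemma K2_prefix: "us : lists (cur n) ==> single vs 1 : K2 ==> single (us @ vs) 1 : K2"
proof (induction us)
 case (Cons X us)
 hence "wact X (single (us @ vs) 1) : K2" by (intro K_wact[OF K2]) auto
 thus ?case by simp
qed simp

text \<open>For positive \<open>s\<close> this is a divided power relation of \<open>Long 1\<close>,
  with \<open>p\<close> from \<open>threshold\<close>. The ideal has no generators with
  \<open>s = 0\<close>; in that case the bound forces \<open>m j < q\<close> for every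
  \<open>j\<close>, hence \<open>NN < q\<close>, and the Weyl power relation applies.\<close>

lemma word_sum_K2:
 assumes q: "1 <= q" and s: "(\<Sum>j\<in>J. min q (m j)) < q + s"
 shows "word_sum (ym n n) q s : K2"
proof -
 have \<alpha>: "Long 1 : pos_roots n" using n by (simp add: pos_roots_def)
 have d: "\<delta>1_coroot n (Long 1) = 1" using root_first_zero[OF \<alpha>] by simp
 let ?x = "xm (Long 1)"
 have x: "?x : spc n" by (rule xp_xm_sp(2)[OF ch \<alpha>])
 obtain c where c: "c ~= 0" "?x = c \<cdot>\<^sub>m gm n n 0" using chevalley_gm(2)[OF ch \<alpha>, of 0 n] by auto
 have y: "ym n n = (1 / (2 * c)) \<cdot>\<^sub>m ?x" by (rule eq_matI) (use c in \<open>auto simp: ym_def gm_def\<close>)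
 have "word_sum ?x q s : K2"
 proof (cases "s = 0")
  case True
  have m1: "tt ?x 0 = tensor_poly ?x 1" by simp
  have mq: "m j < q" if j: "j : J" for j
  proof -
   have "min q (m j) <= (\<Sum>j\<in>J. min q (m j))" by (rule member_le_sum) (use j finI in auto)
   thus ?thesis using s True by simp
  qed
  hence "(\<Sum>j\<in>J. min q (m j)) = NN" unfolding NN_def by (intro sum.cong) (auto simp: less_imp_le min_absorb2)
  hence "NN + 1 <= q" using s True by simp
  hence "replicate q (tt ?x 0) = replicate (q - (NN + 1)) (tt ?x 0) @ replicate (NN + 1) (tt ?x 0)"
   by (metis le_add_diff_inverse2 replicate_add)
  moreover have "single (replicate (NN * \<delta>1_coroot n (Long 1) + 1) (tensor_poly ?x 1)) 1 : K2"
   using weyl_K2 \<alpha> unfolding weyl_relations_def by blast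
  hence "single (replicate (NN + 1) (tt ?x 0)) 1 : K2" by (simp only: d mult_1_right m1)
  ultimately have "single (replicate q (tt ?x 0)) 1 : K2"
   using K2_prefix[of "replicate (q - (NN + 1)) (tt ?x 0)"] tensor_t_cur[OF x, of 0] by (simp only:) force
  thus ?thesis using True by (simp add: word_sum_0 wl_def map_replicate_const)
 next
  case False
  obtain p where "(\<Sum>j\<in>J. min q (m j)) = q * p + (\<Sum>j = p + 1..k. m j)" using threshold by blast
  hence "s + q \<ge> 1 + q * p + (\<Sum>j = p + 1..k. m j * \<delta>1_coroot n (Long 1))" using s d by simp
  hence "divided_power_sum ?x q s : dps_relations" unfolding dps_relations_def
   using \<alpha> q False by (intro CollectI exI[of _ "Long 1"] exI[of _ q] exI[of _ s] conjI exI[of _ p]) simp_all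
  hence "scale_pm (fact q) (divided_power_sum ?x q s) : K2" using dps_K2 pm.subsp_sc[OF K2_subsp] by blast
  thus ?thesis using word_sum_divided_power[OF K2 x, of q s] pm.subsp_cong[OF K2_subsp] by blast
 qed
 hence "scale_pm ((1 / (2 * c)) ^ q) (word_sum ?x q s) : K2" by (rule pm.subsp_sc[OF K2_subsp])
 thus ?thesis unfolding y using word_sum_smult[OF K2 x, of "1 / (2 * c)" q s] pm.subsp_cong[OF K2_subsp] by blast
qed

end



section \<open>Comparison of the two modules\<close>

definition psc :: "complex => ('a \<Rightarrow>\<^sub>0 complex) \<times> ('b \<Rightarrow>\<^sub>0 complex) => ('a \<Rightarrow>\<^sub>0 complex) \<times> ('b \<Rightarrow>\<^sub>0 complex)" where
 "psc c p = (scale_pm c (fst p), scale_pm c (snd p))"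

interpretation psp: cvs psc by unfold_locales (auto simp: psc_def pm.sc_add pm.sc_left pm.sc_sc pm.sc_one prod_eq_iff)

context fusion_setup begin

definition "pac x s p = (wact (tt x s) (fst p), ta (tt x s) (snd p))"
text \<open>The homogenising parameter is set to 0 in the word entry, which therefore survives only
  in exact degree, and to 1 in the tensor entry.\<close>

definition "pv0 d = (if d = (0::nat) then single [] 1 else 0 :: cwords, T0)"

fun pwd :: "nat => (complex mat \<times> nat) list => (cwords) \<times> ((nat => 'v) \<Rightarrow>\<^sub>0 complex)" where
 "pwd d [] = pv0 d"
| "pwd d ((X, s) # ws) = pac X s (pwd (d - s) ws)"

lemma snd_pwd: "snd (pwd d ws) = tw ws"
 by (induction d ws rule: pwd.induct) (auto simp: pv0_def pac_def)

lemma fst_pwd_fw: "ok_word n ws ==> fst (pwd d ws) : FW L"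
proof (induction d ws rule: pwd.induct)
 case (1 d)
 thus ?case using fw_cur[of "[]" n 1] pm.subsp_zero[OF FW_subsp[of L]] by (simp add: pv0_def)
next
 case (2 d X s ws)
 thus ?case using wact_closed[of "tt X s" L] tensor_t_cur[of X n s] by (simp add: pac_def)
qed

lemma fst_pwd: "degsum ws <= d ==>
  fst (pwd d ws) = (if degsum ws = d then single (wl ws) 1 else 0)"
proof (induction d ws rule: pwd.induct)
 case (2 d X s ws)
 hence "s + degsum ws = d \<longleftrightarrow> degsum ws = d - s" by auto
 thus ?case using 2 by (simp add: pac_def)
qed (auto simp: pv0_def)

abbreviation "NP \<equiv> {p. fst p : K2 \<and> snd p : Nul}"

lemma NP: "psp.subsp NP"
 using K2_subsp Nul by (intro psp.subspI) (auto simp: psc_def intro: pm.subsp_zero pm.subsp_add pm.subsp_sc)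

text \<open>The corrections of lower degree in \<open>rel_hom\<close> have zero word entry. One
  formula thus gives the graded relation in the word entry and the deformed relation in the tensor
  entry.\<close>

lemma core: "fusion_core psc n J z m NP pac pv0 pwd"
proof (rule fusion_core.intro[OF psp.cvs_axioms fusion_core_axioms.intro])
 show "n \<ge> 1" "finite J" by (rule n finI)+
 show "psp.subsp NP" by (rule NP)
 fix X :: "complex mat" and s :: nat
 show "pac X s (u + w) = pac X s u + pac X s w" for u w by (simp add: pac_def wact_add tact_add)
 show "pac X s (psc c u) = psc c (pac X s u)" for c u by (simp add: pac_def psc_def wact_scale tact_scale)
 show "pwd d [] = pv0 d" "pwd d ((X, s) # ws) = pac X s (pwd (d - s) ws)" for d ws by simp_all
 fix d :: nat and ws :: "(complex mat \<times> nat) list"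
 show "pac X s (pv0 d) - psc ((\<Sum>j\<in>J. of_nat (m j) * z j ^ s) * X $$ (0, 0)) (pv0 (d + s)) : NP" if X: "par n X"
 proof -
  let ?c = "(\<Sum>j\<in>J. of_nat (m j) * z j ^ s) * X $$ (0, 0)"
  have "wact (tt X s) (fst (pv0 d)) - scale_pm ?c (fst (pv0 (d + s))) : K2"
  proof (cases "d = 0")
   case True
   have "scale_pm ?c (fst (pv0 (d + s))) = single [] (of_nat NN * X $$ (0, 0) * (if s = 0 then 1 else 0))"
    using True by (simp add: pv0_def NN_def)
   thus ?thesis using PK_par[OF X, of s] True by (simp only: PK_def pv0_def fst_conv if_True wact_single simp_thms)
  qed (use pm.subsp_zero[OF K2_subsp] in \<open>simp add: pv0_def\<close>)
  thus ?thesis using tens_par[OF X, of s] by (simp add: pac_def psc_def) (simp add: pv0_def)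
 qed
 show "(\<Sum>l\<in>expo_lists q s. psc (fps_nth (qser J z m q) (s - sum_list l)) (pwd d (yl (ym n n) l))) : NP"
  if q: "1 <= q" "(\<Sum>j\<in>J. min q (m j)) < q + s" and sd: "s <= d" for q
 proof -
  let ?c = "\<lambda>l. fps_nth (qser J z m q) (s - sum_list l)"
  have a: "0 < n" "n < 2 * n" using n by auto
  have fst_sum: "fst (\<Sum>i\<in>A. f i) = (\<Sum>i\<in>A. fst (f i))" "snd (\<Sum>i\<in>A. f i) = (\<Sum>i\<in>A. snd (f i))"
   for A :: "nat list set" and f :: "nat list => (cwords) \<times> ((nat => 'v) \<Rightarrow>\<^sub>0 complex)"
   by (induction A rule: infinite_finite_induct) auto
  have "(\<Sum>l\<in>expo_lists q s. scale_pm (?c l) (fst (pwd d (yl (ym n n) l)))) =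
    (\<Sum>l\<in>expo_lists q s. if sum_list l = d then single (wl (yl (ym n n) l)) 1 else 0)"
   using sd by (intro sum.cong refl) (auto simp: fst_pwd comp_def expo_lists_def qser_0 pm.sc_one)
  also have "... : K2"
  proof (cases "s = d")
   case True
   have "finite (expo_lists q s)"
   proof (rule finite_subset)
    show "expo_lists q s <= (\<Union>t\<le>s. sum_lists q t)" by (auto simp: expo_lists_def sum_lists_def)
   qed (simp add: finite_sum_lists)
   moreover have "{l : expo_lists q s. sum_list l = d} = sum_lists q s" using True by (auto simp: expo_lists_def sum_lists_def)
   ultimately have "(\<Sum>l\<in>expo_lists q s. if sum_list l = d then single (wl (yl (ym n n) l)) 1 else 0) = word_sum (ym n n) q s"
    by (simp add: word_sum_def flip: sum.inter_filter)
   thus ?thesis using word_sum_K2[OF q] by simp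
  next
   case False
   have "(\<Sum>l\<in>expo_lists q s. if sum_list l = d then single (wl (yl (ym n n) l)) (1::complex) else 0) = 0"
    by (rule sum.neutral) (use False sd in \<open>auto simp: expo_lists_def\<close>)
   thus ?thesis using pm.subsp_zero[OF K2_subsp] by simp
  qed
  finally show ?thesis using tens_hom[OF a q(2)] by (simp add: fst_sum psc_def snd_pwd)
 qed
 have w: "fst (pwd d ws) : FW L" "snd (pwd d ws) : ftc J E" if "ok_word n ws"
  using fst_pwd_fw tw_ftc that by (simp_all add: snd_pwd)
 assume X: "X : spc n"
 note tX = tensor_t_cur[OF X, of s]
 have tXL: "tt X s : carrier L" using tX by simp
 show "pac X s u : NP" if "u : NP" for u using that K_wact[OF K2 tX] ta_Nul[OF X] by (simp add: pac_def)
 show "pac (c \<cdot>\<^sub>m X) s (pwd d ws) - psc c (pac X s (pwd d ws)) : NP" if ws: "ok_word n ws" for c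
  using K_smult[OF K2 tX w(1)[OF ws], of c] tens_smult[OF tXL w(2)[OF ws], of c] by (simp add: pac_def psc_def tensor_t_smult)
 fix Y assume Y: "Y : spc n" and ws: "ok_word n ws"
 have tYL: "tt Y t : carrier L" for t using tensor_t_cur[OF Y] by simp
 show "pac (X + Y) s (pwd d ws) - (pac X s (pwd d ws) + pac Y s (pwd d ws)) : NP"
  using K_add[OF K2 tX tensor_t_cur[OF Y, of s] w(1)[OF ws]] tens_add[OF tXL tYL w(2)[OF ws], of s]
  by (simp add: pac_def tensor_t_add[OF X Y])
 show "pac (br X Y) (s + t) (pwd d ws) - (pac X s (pac Y t (pwd d ws)) - pac Y t (pac X s (pwd d ws))) : NP" for t
  using K_bracket[OF K2 tX tensor_t_cur[OF Y, of t] w(1)[OF ws]] tens_bracket[OF tXL tYL w(2)[OF ws], of t]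
  by (simp add: pac_def tensor_t_bracket[OF X Y])
qed

section \<open>Coordinate functionals of the tensor product\<close>

definition "cf c j = hw_rep.coord n (m j) (V j) (v j) (\<lambda>i. c (j, i :: nat))"
text \<open>Only the tensor entry is seen, so pairs with tensor entry 0 are killed by every
  functional.\<close>

definition "Lam c p = cplx.lin_ext (\<lambda>f. \<Prod>j\<in>J. cf c j (f j)) (snd p)"

lemma cf_simps:
 assumes j: "j : J"
 shows "a : carrier (V j) ==> b : carrier (V j) ==> cf c j (a \<oplus>\<^bsub>V j\<^esub> b) = cf c j a + cf c j b"
  "a : carrier (V j) ==> cf c j (d \<odot>\<^bsub>V j\<^esub> a) = d * cf c j a"
  "cf c j (v j) = (if \<forall>i<m j. c (j, i) = 0 then 1 else 0)"
proof -
 interpret hw_rep n "m j" xp xm "V j" "v j" by (rule rep[OF j])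
 show "a : carrier (V j) ==> b : carrier (V j) ==> cf c j (a \<oplus>\<^bsub>V j\<^esub> b) = cf c j a + cf c j b"
  "a : carrier (V j) ==> cf c j (d \<odot>\<^bsub>V j\<^esub> a) = d * cf c j a"
  "cf c j (v j) = (if \<forall>i<m j. c (j, i) = 0 then 1 else 0)" by (simp_all add: cf_def coord_add coord_smult coord_v vac_def)
qed

lemma cf_act:
 assumes j: "j : J" and X: "X : spc n" and a: "a : carrier (V j)" and c: "\<forall>i<m j. c (j, i) < 2 * n"
 shows "cf c j (act (V j) X a) = (\<Sum>i<m j. \<Sum>b<2 * n. X $$ (c (j, i), b) * cf (c((j, i) := b)) j a)"
proof -
 interpret hw_rep n "m j" xp xm "V j" "v j" by (rule rep[OF j])
 have "(\<lambda>i'. (c((j, i) := b)) (j, i')) = (\<lambda>i'. c (j, i'))(i := b)" for i b by (rule ext) simp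
 thus ?thesis using c unfolding cf_def coord_act[OF X a] sact_def by simp
qed

text \<open>The Leibniz rule selects a factor and the action on that factor selects a slot; together
  they give the sum over all slots.\<close>

lemma Lam_tact:
 assumes X: "X : spc n" and c: "\<forall>p\<in>Sigma J (\<lambda>j. {..<m j}). c p < 2 * n" and u: "u : ftc J E"
 shows "cplx.lin_ext (\<lambda>f. \<Prod>j\<in>J. cf c j (f j)) (ta (tt X s) u) =
  (\<Sum>p\<in>Sigma J (\<lambda>j. {..<m j}). z (fst p) ^ s * (\<Sum>b<2 * n. X $$ (c p, b) * cplx.lin_ext (\<lambda>f. \<Prod>j\<in>J. cf (c(p := b)) j (f j)) u))"
 using u
proof (induction u rule: ftc_induct)
 case zero thus ?case by simp
next
 case (add f d w)
 let ?P = "\<lambda>c f. \<Prod>j\<in>J. cf c j (f j)"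
 have fin: "finite J" by (rule finI)
 have 1: "?P c (f(j := act (E j) (tt X s) (f j))) =
   (\<Sum>i<m j. z j ^ s * (\<Sum>b<2 * n. X $$ (c (j, i), b) * ?P (c((j, i) := b)) f))" if j: "j : J" for j
 proof -
  interpret hw_rep n "m j" xp xm "V j" "v j" by (rule rep[OF j])
  have fj: "f j : carrier (V j)" using add(1) j by (auto dest: PiE_mem)
  have cj: "\<forall>i<m j. c (j, i) < 2 * n" using c j by auto
  let ?R = "\<Prod>j\<in>J - {j}. cf c j (f j)"
  have R: "(\<Prod>j'\<in>J - {j}. cf (c((j, i) := b)) j' (f j')) = ?R" for i b by (rule prod.cong) (auto simp: cf_def)
  have P: "?P c' f = cf c' j (f j) * (\<Prod>j'\<in>J - {j}. cf c' j' (f j'))" for c' by (rule prod.remove[OF fin j])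
  have Q: "cf (c((j, i) := b)) j (f j) * ?R = ?P (c((j, i) := b)) f" for i b unfolding P R ..
  have R': "(\<Prod>j'\<in>J - {j}. cf c j' ((f(j := a)) j')) = ?R" for a by (rule prod.cong) auto
  have "?P c (f(j := act (E j) (tt X s) (f j))) = cf c j (act (E j) (tt X s) (f j)) * ?R"
   by (simp add: prod.remove[OF fin j] R' del: E_simps)
  also have "cf c j (act (E j) (tt X s) (f j)) = z j ^ s * cf c j (act (V j) X (f j))"
   using act_tensor_t[OF j X fj] cf_simps(2)[OF j act_sp[OF X fj]] by simp
  also have "z j ^ s * cf c j (act (V j) X (f j)) * ?R =
    (\<Sum>i<m j. z j ^ s * (\<Sum>b<2 * n. X $$ (c (j, i), b) * (cf (c((j, i) := b)) j (f j) * ?R)))"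
   unfolding cf_act[OF j X fj cj] by (simp add: sum_distrib_left sum_distrib_right mult_ac)
  finally show ?thesis unfolding Q .
 qed
 have "cplx.lin_ext (?P c) (ta (tt X s) (single f d)) = (\<Sum>j\<in>J. d * ?P c (f(j := act (E j) (tt X s) (f j))))"
  unfolding tact_single cplx.lin_ext_sum cplx.lin_ext_single ..
 also have "... = (\<Sum>j\<in>J. \<Sum>i<m j. d * (z j ^ s * (\<Sum>b<2 * n. X $$ (c (j, i), b) * ?P (c((j, i) := b)) f)))"
  by (rule sum.cong[OF refl]) (simp only: 1 sum_distrib_left)
 also have "... = (\<Sum>p\<in>Sigma J (\<lambda>j. {..<m j}). d * (z (fst p) ^ s * (\<Sum>b<2 * n. X $$ (c p, b) * ?P (c(p := b)) f)))"
  using fin by (simp add: sum.Sigma case_prod_beta)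
 also have "... = (\<Sum>p\<in>Sigma J (\<lambda>j. {..<m j}). z (fst p) ^ s * (\<Sum>b<2 * n. X $$ (c p, b) * cplx.lin_ext (?P (c(p := b))) (single f d)))"
  unfolding cplx.lin_ext_single by (simp add: sum_distrib_left mult_ac)
 finally show ?case using add(3) by (simp only: tact_add cplx.lin_ext_add distrib_left sum.distrib)
qed

lemma functionals: "fusion_functionals psc n J z m NP pac pv0 pwd Lam"
proof (rule fusion_functionals.intro[OF core fusion_functionals_axioms.intro])
 show "inj_on z J" using inj_z by (simp add: J_def)
 fix c :: "nat \<times> nat => nat"
 show "Lam c (u + w) = Lam c u + Lam c w" for u w by (simp add: Lam_def cplx.lin_ext_add)
 show "Lam c (psc a u) = a * Lam c u" for a u by (simp add: Lam_def psc_def cplx.lin_ext_scale)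
 show "Lam c u = 0" if "u : NP" for u unfolding Lam_def by (rule functional_Nul) (use cf_simps that in auto)
 show "Lam c (pv0 d) = (if \<forall>p\<in>Sigma J (\<lambda>j. {..<m j}). c p = 0 then 1 else 0)" for d
 proof -
  have "Lam c (pv0 d) = (\<Prod>j\<in>J. if \<forall>i<m j. c (j, i) = 0 then 1 else 0)"
   by (simp add: Lam_def pv0_def T0_def vI_def) (intro prod.cong refl, auto simp: cf_simps)
  also have "... = (if \<forall>p\<in>Sigma J (\<lambda>j. {..<m j}). c p = 0 then 1 else 0)" using finI by auto
  finally show ?thesis .
 qed
 show "Lam c (pac X s (pwd d ws)) = (\<Sum>p\<in>Sigma J (\<lambda>j. {..<m j}). z (fst p) ^ s *
    (\<Sum>b<2 * n. X $$ (c p, b) * Lam (c(p := b)) (pwd d ws)))"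
  if "X : spc n" "ok_word n ws" "\<forall>p\<in>Sigma J (\<lambda>j. {..<m j}). c p < 2 * n" for X ws s d
  using Lam_tact[OF that(1,3) tw_ftc[OF that(2)], of s] by (simp add: Lam_def pac_def snd_pwd)
qed

text \<open>The pair \<open>(w, \<tau> w)\<close> is a combination of words of degree
  \<open>d\<close>, while \<open>(0, \<tau> w)\<close> comes, up to \<open>Nul\<close>, from words
  of smaller degree, whose word entry is zero. Their difference \<open>(w, 0)\<close> is spanned by
  words and relations and killed by all functionals, so \<open>core_injective\<close> makes it a
  relation.\<close>

lemma component_K2:
 assumes w: "w : ED n d" and "\<tau> w : Pb d"
 shows "w : K2"
proof -
 interpret C: fusion_functionals psc n J z m NP pac pv0 pwd Lam by (rule functionals)
 let ?S = "{p. \<exists>r. p : C.B d r}"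
 have S: "psp.subsp ?S"
 proof (rule psp.subspI)
  show "0 : ?S" using psp.subsp_zero[OF C.B_subsp] by blast
 next
  fix x y assume "x : ?S" "y : ?S"
  then obtain r r' where "x : C.B d r" "y : C.B d r'" by blast
  hence "x : C.B d (r + r')" "y : C.B d (r + r')" using C.B_mono[of r "r + r'" d] C.B_mono[of r' "r + r'" d] by auto
  thus "x + y : ?S" using psp.subsp_add[OF C.B_subsp] by blast
 next
  fix c x assume "x : ?S" thus "psc c x : ?S" using psp.subsp_sc[OF C.B_subsp] by blast
 qed
 have wS: "pwd d xs : ?S" if "ok_word n xs" "degsum xs <= d" for xs
  using C.word_in_B[of xs d] that by (auto simp: C.ok_def C.deg_def)
 have "psp.lin_ext (\<lambda>ws. (single ws 1, foldr ta ws T0)) w : ?S"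
 proof (rule psp.lin_ext_in[OF S])
  fix ws assume "ws : keys w"
  then obtain xs where xs: "ws = wl xs" "ok_word n xs" "degsum xs = d" using w unfolding enveloping_degree_iff by blast
  hence "pwd d xs = (single ws 1, foldr ta ws T0)"
   using fst_pwd[of xs d] snd_pwd[of d xs] by (simp add: prod_eq_iff tw_def wl_def)
  thus "(single ws 1, foldr ta ws T0) : ?S" using wS[of xs] xs by simp
 qed
 moreover have "psp.lin_ext (\<lambda>ws. (single ws 1, foldr ta ws T0)) w = (w, \<tau> w)"
 proof (induction w rule: single_induct)
  case zero thus ?case by (simp add: tau_simps zero_prod_def)
 next
  case (add a c g)
  thus ?case by (simp add: psp.lin_ext_add tau_simps) (simp add: psc_def \<tau>_def)
 qed
 ultimately have 1: "(w, \<tau> w) : ?S" by simp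
 have nul: "(0, e) : ?S" if "e : Nul" for e using C.N_B[of "(0, e)" d] that pm.subsp_zero[OF K2_subsp] by auto
 have 2: "(0, \<tau> w) : ?S"
 proof (cases d)
  case 0
  thus ?thesis using assms(2) nul by (simp add: Pb_def)
 next
  case (Suc i)
  have "Ph i <= {e. (0, e) : ?S}" unfolding Ph_def
  proof (rule pm.lspan_least)
   show "pm.subsp {e. (0, e) : ?S}"
   proof (rule pm.subspI)
    show "0 : {e. (0, e) : ?S}" using psp.subsp_zero[OF S] by (simp add: zero_prod_def)
    show "x + y : {e. (0, e) : ?S}" if "x : {e. (0, e) : ?S}" "y : {e. (0, e) : ?S}" for x y
     using psp.subsp_add[OF S, of "(0, x)" "(0, y)"] that by simp
    show "scale_pm c x : {e. (0, e) : ?S}" if "x : {e. (0, e) : ?S}" for c x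
     using psp.subsp_sc[OF S, of "(0, x)" c] that by (simp add: psc_def)
   qed
   have "(0, tw xs) : ?S" if xs: "ok_word n xs" "degsum xs <= i" for xs
   proof -
    have "pwd d xs = (0, tw xs)" using fst_pwd[of xs d] snd_pwd[of d xs] xs Suc by (simp add: prod_eq_iff)
    thus ?thesis using wS[OF xs(1)] xs(2) Suc by simp
   qed
   thus "tw ` {xs. ok_word n xs \<and> degsum xs <= i} \<union> Nul <= {e. (0, e) : ?S}" using nul by blast
  qed
  thus ?thesis using assms(2) Suc by (auto simp: Pb_def)
 qed
 from psp.subsp_diff[OF S 1 2] obtain r where "(w, 0) : C.B d r" by auto
 hence "(w, 0) : NP" by (rule C.core_injective) (simp add: Lam_def)
 thus ?thesis by simp
qed

text \<open>Modulo \<open>K2\<close> an element is the sum of its homogeneous components, so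
  \<open>component_K2\<close> can be applied in each degree separately.\<close>

theorem K1_eq_K2: "K1 = K2"
proof
 show "K2 <= K1" by (rule K2_K1)
 show "K1 <= K2"
 proof
  fix u assume u: "u : K1"
  hence uf: "u : FW L" and "\<And>j. \<tau> (bt j u) : Pb j" by (auto simp: K1_def)
  hence "bt j u : K2" for j using component_K2[OF bt_ED[OF uf]] by blast
  hence s: "(\<Sum>j<D. bt j u) : K2" for D by (rule pm.subsp_sum[OF K2_subsp])
  obtain D where "u - (\<Sum>j<D. bt j u) : K2" using bt_decomp[OF K2 uf] by blast
  thus "u : K2" using pm.subsp_cong[OF K2_subsp] s by blast
 qed
qed

theorem fusion_isomorphic:
 "lie_module_isomorphic L (fusion_product n {1..k} z V v)
  (quotient_module (local_weyl n xp xm (\<Sum>j = 1..k. m j)) (fusion_ideal n xp xm k m))"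
proof -
 have NN: "(\<Sum>j = 1..k. m j) = NN" by (simp add: NN_def J_def)
 let ?W = "local_weyl n xp xm NN" and ?KW = "fw.ghull L (env_rel L \<union> weyl_relations n xp xm NN)"
 let ?ka = "\<lambda>u. relation_submodule L (weyl_relations n xp xm NN) +>\<^bsub>free_word_module L\<^esub> u"
 have W: "fw.presents L ?ka ?W ?KW" unfolding local_weyl_def by (rule cur.presented_module_presents(2)[OF weyl_fw])
 have nil: "single [] 1 : FW L" by (rule fw_cur) simp
 \<comment> \<open>Started at the empty word, evaluation of words is the identity, so the generators
   of \<open>fusion_ideal\<close> are the classes of the divided power sums themselves.\<close>
 have wm: "fw.wordmap (single [] 1) u = u" for u :: "cwords"
 proof (induction u rule: single_induct)
  case (add ws c g)
  have "foldr wact ws (single [] 1) = single ws (1 :: complex)" by (induction ws) auto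
  thus ?case using add by (simp add: fw.wordmap_add)
 qed simp
 have act: "word_action ?W (divided_power_sum (xm \<alpha>) r s) (weyl_generator n xp xm NN) = ?ka (divided_power_sum (xm \<alpha>) r s)"
  if "\<alpha> : pos_roots n" for \<alpha> r s
 proof -
  have "divided_power_sum (xm \<alpha>) r s : FW L" by (rule ED_fw[OF divided_power_sum_ED[OF xp_xm_sp(2)[OF ch that]]])
  from fw.pres_word_action[OF W this nil] show ?thesis unfolding weyl_generator_def presented_generator_def wm .
 qed
 have "{word_action ?W (divided_power_sum (xm \<alpha>) r s) (weyl_generator n xp xm NN) | \<alpha> r s.
   \<alpha> : pos_roots n \<and> 1 <= r \<and> 1 <= s \<and> (\<exists>p. s + r \<ge> 1 + r * p + (\<Sum>j = p + 1..k. m j * \<delta>1_coroot n \<alpha>))} = ?ka ` dps_relations"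
 proof (rule subset_antisym; rule subsetI)
  fix x assume "x : {word_action ?W (divided_power_sum (xm \<alpha>) r s) (weyl_generator n xp xm NN) | \<alpha> r s.
   \<alpha> : pos_roots n \<and> 1 <= r \<and> 1 <= s \<and> (\<exists>p. s + r \<ge> 1 + r * p + (\<Sum>j = p + 1..k. m j * \<delta>1_coroot n \<alpha>))}"
  thus "x : ?ka ` dps_relations" unfolding dps_relations_def using act by blast
 next
  fix x assume "x : ?ka ` dps_relations"
  thus "x : {word_action ?W (divided_power_sum (xm \<alpha>) r s) (weyl_generator n xp xm NN) | \<alpha> r s.
   \<alpha> : pos_roots n \<and> 1 <= r \<and> 1 <= s \<and> (\<exists>p. s + r \<ge> 1 + r * p + (\<Sum>j = p + 1..k. m j * \<delta>1_coroot n \<alpha>))}"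
   unfolding dps_relations_def using act[symmetric] by blast
 qed
 hence I: "fusion_ideal n xp xm k m = ?ka ` K2"
  unfolding fusion_ideal_def Let_def NN K2_def by (simp only: fw.pres_generated[OF W dps_fw])
 have "?KW <= K2" unfolding K2_def using fw.ghull_subset by blast
 from fw.pres_quotient[OF W K2(1) this I]
 have Q: "fw.presents L (\<lambda>u. fusion_ideal n xp xm k m +>\<^bsub>?W\<^esub> ?ka u) (quotient_module ?W (fusion_ideal n xp xm k m)) K2" .
 have G: "fw.presents L \<pi> (fusion_product n {1..k} z V v) K2"
  unfolding fusion_product_gr K1_eq_K2[symmetric] by (rule gr_presents)
 show ?thesis unfolding NN by (rule fw.presents_isomorphic[OF G Q cur.fw_lie_module[OF G K2(2)] cur.fw_lie_module[OF Q K2(2)]])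
qed

end

theorem theorem2:
  fixes n k :: nat
    and m :: "nat \<Rightarrow> nat"
    and z :: "nat \<Rightarrow> complex"
    and xp xm :: "root_label \<Rightarrow> complex mat"
    and V :: "nat \<Rightarrow> (complex mat, 'v) rep"
    and v :: "nat \<Rightarrow> 'v"
  assumes "n \<ge> 1"
    and "chevalley_generators n xp xm"
    and "\<And>i j. 1 \<le> i \<Longrightarrow> i \<le> j \<Longrightarrow> j \<le> k \<Longrightarrow> m j \<le> m i"
    and "\<And>j. 1 \<le> j \<Longrightarrow> j \<le> k \<Longrightarrow> m j > 0"
    and "\<And>j. 1 \<le> j \<Longrightarrow> j \<le> k \<Longrightarrow> irreducible_module (sp n) (V j)"
    and "\<And>j. 1 \<le> j \<Longrightarrow> j \<le> k \<Longrightarrow>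
      highest_weight_vector n xp (V j) (\<lambda>h. of_nat (m j) * \<delta> 1 h) (v j)"
    and "inj_on z {1..k}"
  shows "lie_module_isomorphic (current_algebra n)
    (fusion_product n {1..k} z V v)
    (quotient_module (local_weyl n xp xm (\<Sum>j = 1..k. m j)) (fusion_ideal n xp xm k m))"
proof -
  interpret fusion_setup n k m z xp xm V v
    by (rule fusion_setup.intro) (use assms in auto)
  show ?thesis by (rule fusion_isomorphic)
qed


end
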